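(* Let $T>0$, $L>0$, $N\ge2$ and $\lambda>0$ with $\lambda\notin\mathcal N_{mixt}$. Consider system (II) described in the context. (1) For every $i\in\{1,\dots,N\}$ and every initial state $y_0=(y_0^k)_{k=1}^N\in L^2(\Gamma)$ there exist controls $a=(a^k)_{k=1}^N,\ b=(b^k)_{k=1}^N\in (H^1(0,T))^N$ with $a^i(t)=b^i(t)=0$ for all $t\in(0,T)$ such that the solution of system (II) satisfies $y^k(T,x)=0$ for all $x\in(0,L)$ and all $k\in\{1,\dots,N\}$. (2) If $\lambda\in\mathcal N_{odd}$, then for every two distinct indices $i_0,j_0\in\{1,\dots,N\}$ there exists an initial state $y_0\in L^2(\Gamma)$ such that for all controls $a,b\in (H^1(0,T))^N$ satisfying either $a^{i_0}(t)=a^{j_0}(t)=b^{i_0}(t)=0$ for all $t\in(0,T)$ or $b^{i_0}(t)=b^{j_0}(t)=a^{i_0}(t)=0$ for all $t\in(0,T)$, the solution of system (II) satisfies $y^{k_0}(T,\cdot)\not\equiv0$ for some $k_0\in\{1,\dots,N\}$. (3) If $\lambda\notin\mathcal N_{odd}$ and $N\ge3$, then for every two distinct indices $i_0,j_0\in\{1,\dots,N\}$ and every initial state $y_0\in L^2(\Gamma)$ there exist controls $a,b\in (H^1(0,T))^N$ with either $a^{i_0}(t)=a^{j_0}(t)=b^{i_0}(t)=0$ for all $t\in(0,T)$ or $b^{i_0}(t)=b^{j_0}(t)=a^{i_0}(t)=0$ for all $t\in(0,T)$, such that the solution of system (II) satisfies $y^k(T,x)=0$ for all $x\in(0,L)$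 and all $k\in\{1,\dots,N\}$.
   Context: All functions are real-valued. $L^2(\Gamma)=\prod_{k=1}^N L^2(0,L)$ and $H^m(\Gamma)=\prod_{k=1}^N H^m(0,L)$ with product norms ($\Gamma$ is a star-shaped tree with $N$ edges of length $L$, all meeting at the common vertex $x=0$). Sets: $\mathcal N_3=\{\frac{\pi^2}{4L^2}(2n+1)^2: n\in\mathbb N,\ n\ge0\}$, $\mathcal N_4=\{\frac{\pi^2}{4L^2}((2m)^2+(2n+1)^2): m,n\in\mathbb N,\ m\ge1,\ n\ge0\}$, $\mathcal N_{mixt}=\mathcal N_3\cup\mathcal N_4$, and $\mathcal N_{odd}=\{\frac{\pi^2}{4L^2}((2m+1)^2+(2n+1)^2): m,n\in\mathbb N,\ 0\le m<n\}$. System (II): for $k\in\{1,\dots,N\}$, $y^k_t+\lambda y^k_{xx}+y^k_{xxxx}=0$ on $(0,T)\times(0,L)$; at $x=0$, for $t\in(0,T)$: $y^i(t,0)=y^j(t,0)$ and $y^i_{xx}(t,0)=y^j_{xx}(t,0)$ for all $i,j$, $\sum_{k=1}^N y^k_x(t,0)=0$, $\sum_{k=1}^N y^k_{xxx}(t,0)=0$; at $x=L$: $y^k_x(t,L)=a^k(t)$, $y^k_{xxx}(t,L)=b^k(t)$ for all $k$; initial condition $y^k(0,x)=y_0^k(x)$. Notion of solution: let $A\phi=(\lambda\phi^k_{xx}+\phi^k_{xxxx})_{k}$ on $L^2(\Gamma)$ with domain $D(A)=\{\phi\in H^4(\Gamma): \phi^k_x(L)=\phi^k_{xxx}(L)=0\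 \forall k,\ \phi^i(0)=\phi^j(0),\ \phi^i_{xx}(0)=\phi^j_{xx}(0)\ \forall i,j,\ \sum_k\phi^k_x(0)=0,\ \sum_k\phi^k_{xxx}(0)=0\}$; $-A$ generates a strongly continuous semigroup on $L^2(\Gamma)$. Fix polynomials $P_1,P_2$ vanishing at $x=0$ together with their first three derivatives and with $P_1'(L)=1$, $P_1'''(L)=0$, $P_2'(L)=0$, $P_2'''(L)=1$. For $y_0\in L^2(\Gamma)$ and $a,b\in(H^1(0,T))^N$ the solution is $y=(z^k+P_1a^k+P_2b^k)_k\in C([0,T];L^2(\Gamma))$, where $z$ is the mild solution of $z_t+Az=F$, $z(0)=(y_0^k-P_1a^k(0)-P_2b^k(0))_k$, with $F^k=-P_1a^k_t-P_2b^k_t-(\lambda P_1''+P_1'''')a^k-(\lambda P_2''+P_2'''')b^k$ (independent of the choice of $P_1,P_2$). *)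

theory Defs
  imports "HOL-Analysis.Analysis" "HOL-Computational_Algebra.Polynomial"
begin

section \<open>The Hilbert space of square-integrable functions on the real line\<close>

instance vec :: ("{metric_space, second_countable_topology}", finite) second_countable_topology
proof
  obtain B :: "'a set set" where B: "countable B" "topological_basis B"
    using ex_countable_basis by blast
  define C where "C = (\<lambda>(i, b). {x :: 'a ^ 'b. x $ i \<in> b}) ` (UNIV \<times> B)"
  have bo: "open b" if "b \<in> B" for b using B that topological_basis_open by blast
  have cC: "countable C" unfolding C_def using B by auto
  have 1: "generate_topology C S" if S: "open S" for S :: "('a ^ 'b) set"
  proof -
    have "\<exists>U. generate_topology C U \<and> x \<in> U \<and> U \<subseteq> S" if x: "x \<in> S" for x
    proof -
      obtain A where A: "\<And>i. open (A i)" "\<And>i. x $ i \<in> A i"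
        "\<And>y. (\<forall>i. y $ i \<in> A i) \<Longrightarrow> y \<in> S"
        using S[unfolded open_vec_def, THEN bspec, OF x] by blast
      have "\<forall>i. \<exists>b. b \<in> B \<and> x $ i \<in> b \<and> b \<subseteq> A i"
      proof
        fix i
        obtain b where "b \<in> B" "x $ i \<in> b" "b \<subseteq> A i"
          using topological_basisE[OF B(2) A(1) A(2)] .
        then show "\<exists>b. b \<in> B \<and> x $ i \<in> b \<and> b \<subseteq> A i" by blast
      qed
      from choice[OF this] obtain b
        where b: "\<And>i. b i \<in> B" "\<And>i. x $ i \<in> b i" "\<And>i. b i \<subseteq> A i" by blast
      have "generate_topology C (\<Inter>i\<in>I. {x. x $ i \<in> b i})" if "finite I" for I :: "'b set"
        using that
      proof induction
        case empty
        then show ?case by (simp add: generate_topology.UNIV)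
      next
        case (insert i I)
        have "generate_topology C {x. x $ i \<in> b i}"
          by (rule generate_topology.Basis) (auto simp: C_def b intro!: image_eqI[of _ _ "(i, b i)"])
        with insert show ?case by (simp add: generate_topology.Int)
      qed
      from this[OF finite_class.finite_UNIV] show ?thesis
        using A(3) b(2,3) by (intro exI[of _ "\<Inter>i. {x. x $ i \<in> b i}"] conjI) (assumption, blast, blast)
    qed
    then have "\<forall>x\<in>S. \<exists>U. generate_topology C U \<and> x \<in> U \<and> U \<subseteq> S" by blast
    from bchoice[OF this] obtain U where
      U: "\<forall>x\<in>S. generate_topology C (U x) \<and> x \<in> U x \<and> U x \<subseteq> S" ..
    have S_eq: "\<Union>(U ` S) = S" using U by blast
    have "generate_topology C (\<Union>(U ` S))" by (rule generate_topology.UN) (use U in blast)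
    then show ?thesis by (simp only: S_eq)
  qed
  have 2: "open S" if "generate_topology C S" for S
    using that
  proof induction
    case (Basis s)
    then obtain i b where s: "s = {x. x $ i \<in> b}" "b \<in> B" by (auto simp: C_def)
    then show ?case using open_vimage_vec_nth[OF bo, of b i] by (simp add: vimage_def)
  qed (simp_all add: open_Int open_Union)
  have "open = generate_topology C" using 1 2 by (intro ext iffI) blast+
  with cC show "\<exists>B :: ('a ^ 'b) set set. countable B \<and> open = generate_topology B"
    by blast
qed

definition sqint :: "(real \<Rightarrow> real) \<Rightarrow> bool" where
  "sqint f \<longleftrightarrow> f \<in> borel_measurable lborel \<and> integrable lborel (\<lambda>x. (f x)\<^sup>2)"

lemma sqint_mult:
  assumes "sqint f" "sqint g" shows "integrable lborel (\<lambda>x. f x * g x)"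
proof (rule Bochner_Integration.integrable_bound)
  show "integrable lborel (\<lambda>x. (f x)\<^sup>2 + (g x)\<^sup>2)" using assms by (auto simp: sqint_def)
  show "(\<lambda>x. f x * g x) \<in> borel_measurable lborel" using assms by (auto simp: sqint_def)
  have "\<bar>a * b\<bar> \<le> a\<^sup>2 + b\<^sup>2" for a b :: real
  proof -
    have "2 * \<bar>a * b\<bar> \<le> a\<^sup>2 + b\<^sup>2"
      using sum_squares_bound[of "\<bar>a\<bar>" "\<bar>b\<bar>"] by (simp add: abs_mult mult.assoc)
    then show ?thesis using abs_ge_zero[of "a * b"] by linarith
  qed
  then show "AE x in lborel. norm (f x * g x) \<le> norm ((f x)\<^sup>2 + (g x)\<^sup>2)" by auto
qed

lemma sqint_add: "sqint f \<Longrightarrow> sqint g \<Longrightarrow> sqint (\<lambda>x. f x + g x)"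
  using sqint_mult[of f g] unfolding sqint_def
  by (auto simp: power2_sum mult.assoc intro!: Bochner_Integration.integrable_add)

lemma sqint_scale: "sqint f \<Longrightarrow> sqint (\<lambda>x. c * f x)"
  unfolding sqint_def by (auto simp: power_mult_distrib)

lemma sqint_zero: "sqint (\<lambda>x. 0)" by (simp add: sqint_def)

text \<open>\<open>L\<^sup>2\<close> with respect to Lebesgue measure; every class has Borel representatives, so
  \<^term>\<open>lborel\<close> loses nothing against \<^term>\<open>lebesgue\<close>.\<close>

quotient_type l2 = "real \<Rightarrow> real" / partial:
  "\<lambda>f g. sqint f \<and> sqint g \<and> (AE x in lborel. f x = g x)"
proof (rule part_equivpI)
  show "\<exists>f. sqint f \<and> sqint f \<and> (AE x in lborel. f x = f x)"
    using sqint_zero by blast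
qed (auto simp: symp_def transp_def elim: AE_mp)

instantiation l2 :: real_inner
begin

lift_definition zero_l2 :: l2 is "\<lambda>x. 0" by (simp add: sqint_zero)
lift_definition plus_l2 :: "l2 \<Rightarrow> l2 \<Rightarrow> l2" is "\<lambda>f g x. f x + g x"
  by (auto simp: sqint_add)
lift_definition scaleR_l2 :: "real \<Rightarrow> l2 \<Rightarrow> l2" is "\<lambda>c f x. c * f x"
  by (auto simp: sqint_scale)
definition uminus_l2 :: "l2 \<Rightarrow> l2" where "uminus_l2 u = (-1) *\<^sub>R u"
definition minus_l2 :: "l2 \<Rightarrow> l2 \<Rightarrow> l2" where "minus_l2 u v = u + (- v)"
lift_definition inner_l2 :: "l2 \<Rightarrow> l2 \<Rightarrow> real" is "\<lambda>f g. LINT x|lborel. f x * g x"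
  by (rule integral_cong_AE) (auto simp: sqint_def)
definition norm_l2 :: "l2 \<Rightarrow> real" where "norm_l2 u = sqrt (inner u u)"
definition sgn_l2 :: "l2 \<Rightarrow> l2" where "sgn_l2 u = inverse (norm u) *\<^sub>R u"
definition dist_l2 :: "l2 \<Rightarrow> l2 \<Rightarrow> real" where "dist_l2 u v = norm (u - v)"
definition uniformity_l2 :: "(l2 \<times> l2) filter" where
  "uniformity_l2 = (INF e\<in>{0<..}. principal {(x, y). dist x y < e})"
definition open_l2 :: "l2 set \<Rightarrow> bool" where
  "open_l2 S = (\<forall>x\<in>S. \<forall>\<^sub>F (x', y) in uniformity. x' = x \<longrightarrow> y \<in> S)"

instance
proof
  fix u v w :: l2 and c d :: real
  show "u + v + w = u + (v + w)" by transfer (auto simp: sqint_add add.assoc)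
  show "u + v = v + u" by transfer (auto simp: sqint_add add.commute)
  show "0 + u = u" by transfer auto
  show "- u + u = 0" unfolding uminus_l2_def
    by transfer (auto simp: sqint_add sqint_scale sqint_zero)
  show "u - v = u + (- v)" by (rule minus_l2_def)
  show "c *\<^sub>R (u + v) = c *\<^sub>R u + c *\<^sub>R v"
    by transfer (auto simp: sqint_add sqint_scale distrib_left)
  show "(c + d) *\<^sub>R u = c *\<^sub>R u + d *\<^sub>R u"
    by transfer (auto simp: sqint_add sqint_scale distrib_right)
  show "c *\<^sub>R d *\<^sub>R u = (c * d) *\<^sub>R u"
    by transfer (auto simp: sqint_scale mult.assoc)
  show "1 *\<^sub>R u = u" by transfer auto
  show "dist u v = norm (u - v)" by (rule dist_l2_def)
  show "sgn u = inverse (norm u) *\<^sub>R u" by (rule sgn_l2_def)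
  show "uniformity = (INF e\<in>{0<..}. principal {(x::l2, y). dist x y < e})" by (rule uniformity_l2_def)
  show "open U = (\<forall>x\<in>U. \<forall>\<^sub>F (x', y) in uniformity. x' = x \<longrightarrow> y \<in> U)" for U :: "l2 set"
    by (rule open_l2_def)
  show "inner u v = inner v u" by transfer (simp add: mult.commute)
  show "inner (u + v) w = inner u w + inner v w"
    by transfer (simp add: distrib_right sqint_mult)
  show "inner (c *\<^sub>R u) v = c * inner u v" by transfer (simp add: mult.assoc)
  show "0 \<le> inner u u" by transfer simp
  show "inner u u = 0 \<longleftrightarrow> u = 0"
  proof transfer
    fix f assume "sqint f \<and> sqint f \<and> (AE x in lborel. f x = f x)"
    then have "sqint f" by simp
    then have "integrable lborel (\<lambda>x. f x * f x)" by (rule sqint_mult[OF _ \<open>sqint f\<close>])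
    then have "(LINT x|lborel. f x * f x) = 0 \<longleftrightarrow> (AE x in lborel. f x * f x = 0)"
      by (rule integral_nonneg_eq_0_iff_AE) simp
    then show "((LINT x|lborel. f x * f x) = 0) =
        (sqint f \<and> sqint (\<lambda>x. 0) \<and> (AE x in lborel. f x = 0))"
      using \<open>sqint f\<close> sqint_zero by simp
  qed
  show "norm u = sqrt (inner u u)" by (rule norm_l2_def)
qed

end

text \<open>\<open>fun_of u\<close> is an arbitrary representative of \<open>u\<close>, determined only almost everywhere.\<close>

definition l2_of :: "(real \<Rightarrow> real) \<Rightarrow> l2" where "l2_of = abs_l2"
definition fun_of :: "l2 \<Rightarrow> real \<Rightarrow> real" where "fun_of = rep_l2"

lemma sqint_fun_of [simp]: "sqint (fun_of u)"
  unfolding fun_of_def using Quotient_rep_reflp[OF Quotient_l2, of u] by simp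

lemma l2_of_fun_of [simp]: "l2_of (fun_of u) = u"
  unfolding fun_of_def l2_of_def using Quotient_abs_rep[OF Quotient_l2] by simp

lemma l2_of_eq_iff: "sqint f \<Longrightarrow> sqint g \<Longrightarrow> l2_of f = l2_of g \<longleftrightarrow> (AE x in lborel. f x = g x)"
  unfolding l2_of_def using Quotient_rel[OF Quotient_l2, of f g] by simp

lemma fun_of_l2_of: "sqint f \<Longrightarrow> AE x in lborel. fun_of (l2_of f) x = f x"
  using l2_of_eq_iff[of "fun_of (l2_of f)" f] by simp

lemma l2_of_add: "sqint f \<Longrightarrow> sqint g \<Longrightarrow> l2_of f + l2_of g = l2_of (\<lambda>x. f x + g x)"
  unfolding l2_of_def by (simp add: plus_l2.abs_eq)

lemma l2_of_scaleR: "sqint f \<Longrightarrow> c *\<^sub>R l2_of f = l2_of (\<lambda>x. c * f x)"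
  unfolding l2_of_def by (simp add: scaleR_l2.abs_eq)

lemma sqint_diff: "sqint f \<Longrightarrow> sqint g \<Longrightarrow> sqint (\<lambda>x. f x - g x)"
  using sqint_add[of f "\<lambda>x. - 1 * g x"] sqint_scale[of g "-1"] by simp

lemma l2_of_diff: "sqint f \<Longrightarrow> sqint g \<Longrightarrow> l2_of f - l2_of g = l2_of (\<lambda>x. f x - g x)"
  using l2_of_add[of f "\<lambda>x. - 1 * g x"] sqint_scale[of g "-1"] l2_of_scaleR[of g "-1"]
  by (simp add: diff_conv_add_uminus del: add_uminus_conv_diff)

lemma inner_l2_of: "sqint f \<Longrightarrow> sqint g \<Longrightarrow> inner (l2_of f) (l2_of g) = (LINT x|lborel. f x * g x)"
  unfolding l2_of_def by (simp add: inner_l2.abs_eq)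

lemma norm_l2_of: "sqint f \<Longrightarrow> norm (l2_of f) = sqrt (LINT x|lborel. (f x)\<^sup>2)"
  by (simp add: norm_eq_sqrt_inner inner_l2_of power2_eq_square)

lemma nn_norm_l2_of: "sqint f \<Longrightarrow> (\<integral>\<^sup>+x. ennreal ((f x)\<^sup>2) \<partial>lborel) = ennreal ((norm (l2_of f))\<^sup>2)"
  by (subst nn_integral_eq_integral) (auto simp: sqint_def norm_l2_of)

lemma sqintI:
  assumes "f \<in> borel_measurable lborel" "(\<integral>\<^sup>+x. ennreal ((f x)\<^sup>2) \<partial>lborel) < \<infinity>"
  shows "sqint f"
  unfolding sqint_def using assms by (auto intro!: integrableI_nonneg)

instance l2 :: complete_space
proof
  fix X :: "nat \<Rightarrow> l2" assume X: "Cauchy X"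
  then have "\<forall>k. \<exists>M. \<forall>m\<ge>M. \<forall>n\<ge>M. dist (X m) (X n) < (1/2)^k"
    unfolding Cauchy_def by simp
  then obtain M where M: "\<And>k m n. m \<ge> M k \<Longrightarrow> n \<ge> M k \<Longrightarrow> dist (X m) (X n) < (1/2)^k" by metis
  define r where "r k = (\<Sum>i\<le>k. M i) + k" for k
  have r: "strict_mono r" by (rule strict_monoI_Suc) (simp add: r_def)
  have rM: "r k \<ge> M k" for k unfolding r_def
    using member_le_sum[of k "{..k}" M] by simp
  have r': "r (Suc k) \<ge> M k" for k using rM[of k] strict_mono_less_eq[OF r, of k "Suc k"] by linarith
  define f where "f k = fun_of (X (r k))" for k
  have f: "sqint (f k)" "l2_of (f k) = X (r k)" for k by (auto simp: f_def)
  have fm [measurable]: "f k \<in> borel_measurable lborel" for k using f unfolding sqint_def by auto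
  have fn: "(\<integral>\<^sup>+x. ennreal ((f m x - f n x)\<^sup>2) \<partial>lborel) = ennreal ((dist (X (r m)) (X (r n)))\<^sup>2)" for m n
    using nn_norm_l2_of[OF sqint_diff[OF f(1) f(1)]] l2_of_diff[OF f(1) f(1)]
    by (simp add: dist_norm f(2))
  have "(\<integral>\<^sup>+x. (\<Sum>k. ennreal (2^k * (f (Suc k) x - f k x)\<^sup>2)) \<partial>lborel)
      = (\<Sum>k. \<integral>\<^sup>+x. ennreal (2^k * (f (Suc k) x - f k x)\<^sup>2) \<partial>lborel)"
    by (rule nn_integral_suminf) measurable
  also have "\<dots> \<le> (\<Sum>k. ennreal ((1/2)^k))"
  proof (rule suminf_le)
    fix k
    have "(\<integral>\<^sup>+x. ennreal (2^k * (f (Suc k) x - f k x)\<^sup>2) \<partial>lborel)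
        = ennreal (2^k) * ennreal ((dist (X (r (Suc k))) (X (r k)))\<^sup>2)"
      by (simp add: ennreal_mult' nn_integral_cmult fn)
    also have "\<dots> = ennreal (2^k * (dist (X (r (Suc k))) (X (r k)))\<^sup>2)"
      by (simp add: ennreal_mult')
    also have "\<dots> \<le> ennreal ((1/2)^k)"
    proof (rule ennreal_leI)
      have "(dist (X (r (Suc k))) (X (r k)))\<^sup>2 \<le> ((1/2)^k)\<^sup>2"
        using M[of k, OF r' rM] by (intro power_mono) auto
      then have "2^k * (dist (X (r (Suc k))) (X (r k)))\<^sup>2 \<le> 2^k * ((1/2)^k)\<^sup>2" by simp
      also have "\<dots> = (1/2)^k" by (simp add: power2_eq_square power_one_over field_simps)
      finally show "2^k * (dist (X (r (Suc k))) (X (r k)))\<^sup>2 \<le> (1/2)^k" .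
    qed
    finally show "(\<integral>\<^sup>+x. ennreal (2^k * (f (Suc k) x - f k x)\<^sup>2) \<partial>lborel) \<le> ennreal ((1/2)^k)" .
  qed auto
  also have "\<dots> = ennreal (\<Sum>k. (1/2)^k)"
    by (rule suminf_ennreal2) (auto intro!: summable_geometric)
  also have "\<dots> < \<infinity>" by simp
  finally have fin: "(\<integral>\<^sup>+x. (\<Sum>k. ennreal (2^k * (f (Suc k) x - f k x)\<^sup>2)) \<partial>lborel) \<noteq> \<infinity>" by simp
  have "AE x in lborel. (\<Sum>k. ennreal (2^k * (f (Suc k) x - f k x)\<^sup>2)) \<noteq> \<infinity>"
    by (rule nn_integral_PInf_AE[OF _ fin]) measurable
  then have conv: "AE x in lborel. (\<lambda>k. f k x) \<longlonglongrightarrow> lim (\<lambda>k. f k x)"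
  proof eventually_elim
    case (elim x)
    define F where "F k = ennreal (2^k * (f (Suc k) x - f k x)\<^sup>2)" for k
    define C where "C = enn2real (\<Sum>k. F k)"
    have C0: "C \<ge> 0" by (simp add: C_def)
    have FC: "(\<Sum>k. F k) = ennreal C"
      unfolding C_def using elim by (simp add: less_top F_def[abs_def])
    have "2^k * (f (Suc k) x - f k x)\<^sup>2 \<le> C" for k
    proof -
      have "(\<Sum>i\<in>{k}. F i) \<le> (\<Sum>k. F k)" by (rule sum_le_suminf) auto
      then have "ennreal (2^k * (f (Suc k) x - f k x)\<^sup>2) \<le> ennreal C"
        unfolding FC by (simp only: F_def sum.insert finite.emptyI empty_iff not_False_eq_True sum.empty add_0_right)
      then show ?thesis by (subst (asm) ennreal_le_iff) (rule C0)
    qed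
    then have "(f (Suc k) x - f k x)\<^sup>2 \<le> C * (1/2)^k" for k
      by (simp add: field_simps power_one_over)
    then have "sqrt ((f (Suc k) x - f k x)\<^sup>2) \<le> sqrt (C * (1/2)^k)" for k
      by (rule real_sqrt_le_mono)
    then have nb: "norm (f (Suc k) x - f k x) \<le> sqrt C * (sqrt (1/2))^k" for k
      by (simp only: real_sqrt_mult real_sqrt_power[symmetric] real_sqrt_abs real_norm_def)
    have sm: "summable (\<lambda>k. sqrt C * (sqrt (1/2))^k)"
      by (intro summable_mult summable_geometric) simp
    have "summable (\<lambda>k. f (Suc k) x - f k x)"
      by (rule summable_comparison_test'[OF sm nb])
    then have "convergent (\<lambda>n. \<Sum>k<n. f (Suc k) x - f k x)"
      by (simp add: summable_iff_convergent)
    then have "convergent (\<lambda>n. f n x - f 0 x)" by (simp only: sum_lessThan_telescope[of "\<lambda>n. f n x"])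
    then obtain l where "(\<lambda>n. f n x - f 0 x) \<longlonglongrightarrow> l" by (auto simp: convergent_def)
    then have "(\<lambda>n. (f n x - f 0 x) + f 0 x) \<longlonglongrightarrow> l + f 0 x" by (intro tendsto_add tendsto_const)
    then have "convergent (\<lambda>n. f n x)" by (auto simp: convergent_def)
    then show ?case by (simp add: convergent_LIMSEQ_iff)
  qed
  define g where "g x = lim (\<lambda>k. f k x)" for x
  have gm [measurable]: "g \<in> borel_measurable lborel" unfolding g_def by measurable
  have est: "(\<integral>\<^sup>+x. ennreal ((g x - f k x)\<^sup>2) \<partial>lborel) \<le> ennreal (((1/2)^k)\<^sup>2)" for k
  proof -
    have "(\<integral>\<^sup>+x. ennreal ((g x - f k x)\<^sup>2) \<partial>lborel) = (\<integral>\<^sup>+x. liminf (\<lambda>j. ennreal ((f j x - f k x)\<^sup>2)) \<partial>lborel)"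
    proof (rule nn_integral_cong_AE)
      show "AE x in lborel. ennreal ((g x - f k x)\<^sup>2) = liminf (\<lambda>j. ennreal ((f j x - f k x)\<^sup>2))"
        using conv
      proof eventually_elim
        case (elim x)
        then have "(\<lambda>j. ennreal ((f j x - f k x)\<^sup>2)) \<longlonglongrightarrow> ennreal ((g x - f k x)\<^sup>2)"
          unfolding g_def by (intro tendsto_intros)
        then show ?case by (metis lim_imp_Liminf sequentially_bot)
      qed
    qed
    also have "\<dots> \<le> liminf (\<lambda>j. \<integral>\<^sup>+x. ennreal ((f j x - f k x)\<^sup>2) \<partial>lborel)"
      by (rule nn_integral_liminf) measurable
    also have "\<dots> \<le> ennreal (((1/2)^k)\<^sup>2)"
    proof (rule Liminf_le)
      have "(\<integral>\<^sup>+x. ennreal ((f j x - f k x)\<^sup>2) \<partial>lborel) \<le> ennreal (((1/2)^k)\<^sup>2)" if "j \<ge> k" for j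
      proof -
        have "dist (X (r j)) (X (r k)) < (1/2)^k"
          using rM[of k] strict_mono_less_eq[OF r, of k j] that by (intro M) linarith+
        then show ?thesis unfolding fn by (intro ennreal_leI power_mono) auto
      qed
      then show "\<forall>\<^sub>F j in sequentially. (\<integral>\<^sup>+x. ennreal ((f j x - f k x)\<^sup>2) \<partial>lborel) \<le> ennreal (((1/2)^k)\<^sup>2)"
        by (auto simp: eventually_sequentially)
    qed simp
    finally show ?thesis .
  qed
  have dg: "sqint (\<lambda>x. g x - f k x)" for k
  proof (rule sqintI)
    show "(\<integral>\<^sup>+x. ennreal ((g x - f k x)\<^sup>2) \<partial>lborel) < \<infinity>"
      using le_less_trans[OF est[of k] ennreal_less_top] by simp
  qed measurable
  have g: "sqint g" using sqint_add[OF dg[of 0] f(1)[of 0]] by simp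
  have "norm (l2_of g - X (r k)) \<le> (1/2)^k" for k
  proof -
    have "ennreal ((norm (l2_of (\<lambda>x. g x - f k x)))\<^sup>2) \<le> ennreal (((1/2)^k)\<^sup>2)"
      using est[of k] unfolding nn_norm_l2_of[OF dg] .
    then have "(norm (l2_of (\<lambda>x. g x - f k x)))\<^sup>2 \<le> ((1/2)^k)\<^sup>2"
      by (subst (asm) ennreal_le_iff) (rule zero_le_power2)
    then have "norm (l2_of (\<lambda>x. g x - f k x)) \<le> (1/2)^k"
      by (rule power2_le_imp_le) simp
    then show ?thesis unfolding l2_of_diff[OF g f(1)[of k], symmetric] f(2) .
  qed
  then have "\<forall>\<^sub>F k in sequentially. norm (X (r k) - l2_of g) \<le> (1/2)^k"
    by (simp add: norm_minus_commute)
  moreover have "(\<lambda>k. (1/2::real)^k) \<longlonglongrightarrow> 0" by (intro LIMSEQ_power_zero) simp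
  ultimately have "(\<lambda>k. X (r k) - l2_of g) \<longlonglongrightarrow> 0" by (rule Lim_null_comparison)
  then have "(X \<circ> r) \<longlonglongrightarrow> l2_of g" by (simp add: LIM_zero_iff o_def)
  then have "X \<longlonglongrightarrow> l2_of g" by (rule Cauchy_converges_subseq[OF X r, unfolded o_def[symmetric]])
  then show "convergent X" by (auto simp: convergent_def)
qed

instance l2 :: banach ..

lemma sqint_continuous:
  assumes "continuous_on {-n..n} g" shows "sqint (\<lambda>x. indicator {-n..n} x * g x)"
proof -
  have 1: "integrable lborel (\<lambda>x. indicator {-n..n} x *\<^sub>R g x)"
    using assms by (intro borel_integrable_compact) auto
  have 2: "integrable lborel (\<lambda>x. indicator {-n..n} x *\<^sub>R (g x)\<^sup>2)"
    using assms by (intro borel_integrable_compact continuous_intros) auto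
  have "(\<lambda>x. indicator {-n..n} x *\<^sub>R (g x)\<^sup>2) = (\<lambda>x. (indicator {-n..n} x * g x)\<^sup>2)"
    by (auto simp: fun_eq_iff indicator_def)
  with 1 2 show ?thesis unfolding sqint_def by (auto dest: borel_measurable_integrable)
qed

lemma l2_dominated_convergence:
  assumes f: "sqint f" and s: "\<And>k. sqint (s k)" and w: "sqint w"
    and lim: "AE x in lborel. (\<lambda>k. s k x) \<longlonglongrightarrow> f x"
    and bound: "\<And>k x. \<bar>s k x - f x\<bar> \<le> w x"
  shows "(\<lambda>k. l2_of (s k)) \<longlonglongrightarrow> l2_of f"
proof -
  have "(\<lambda>k. LINT x|lborel. (s k x - f x)\<^sup>2) \<longlonglongrightarrow> (LINT x::real|lborel. (0::real))"
  proof (rule integral_dominated_convergence[where w = "\<lambda>x. (w x)\<^sup>2"])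
    show "integrable lborel (\<lambda>x. (w x)\<^sup>2)" using w by (simp add: sqint_def)
    show "AE x in lborel. (\<lambda>k. (s k x - f x)\<^sup>2) \<longlonglongrightarrow> 0"
      using lim
    proof eventually_elim
      case (elim x)
      then have "(\<lambda>k. (s k x - f x)\<^sup>2) \<longlonglongrightarrow> (f x - f x)\<^sup>2" by (intro tendsto_intros)
      then show ?case by simp
    qed
    show "(\<lambda>x. (s k x - f x)\<^sup>2) \<in> borel_measurable lborel" for k
      using sqint_diff[OF s[of k] f] by (auto simp: sqint_def dest: borel_measurable_integrable)
    show "AE x in lborel. norm ((s k x - f x)\<^sup>2) \<le> (w x)\<^sup>2" for k
    proof (rule AE_I2)
      fix x
      show "norm ((s k x - f x)\<^sup>2) \<le> (w x)\<^sup>2"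
        using power_mono[OF bound[of k x], of 2] by simp
    qed
  qed simp
  then have "(\<lambda>k. sqrt (LINT x|lborel. (s k x - f x)\<^sup>2)) \<longlonglongrightarrow> 0"
    using tendsto_real_sqrt by fastforce
  then have "(\<lambda>k. norm (l2_of (s k) - l2_of f)) \<longlonglongrightarrow> 0"
    by (simp add: l2_of_diff s f norm_l2_of sqint_diff)
  then show ?thesis by (simp add: LIM_zero_iff tendsto_norm_zero_iff)
qed

lemma l2_of_sum:
  assumes "\<And>i. i \<in> A \<Longrightarrow> sqint (f i)" "finite A"
  shows "sqint (\<lambda>x. \<Sum>i\<in>A. f i x) \<and> (\<Sum>i\<in>A. l2_of (f i)) = l2_of (\<lambda>x. \<Sum>i\<in>A. f i x)"
  using assms(2,1)
proof (induction A rule: finite_induct)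
  case empty
  show ?case by (simp add: sqint_zero zero_l2_def l2_of_def)
next
  case (insert i A)
  then show ?case by (simp add: l2_of_add sqint_add)
qed

lemma closed_subspace_l2_UNIV:
  assumes V: "closed V" "subspace V"
    and E: "\<And>n j :: nat. l2_of (\<lambda>x. indicator {-real n..real n} x * x ^ j) \<in> V"
  shows "V = UNIV"
proof -
  have mono: "sqint (\<lambda>x. indicator {-n..n} x * x ^ j)" for n :: real and j :: nat
    by (intro sqint_continuous continuous_intros)
  have cont: "l2_of (\<lambda>x. indicator {-real n..real n} x * g x) \<in> V"
    if g: "continuous_on {-real n..real n} g" for n :: nat and g
  proof -
    have "\<exists>p. real_polynomial_function p \<and> (\<forall>x\<in>{-real n..real n}. \<bar>g x - p x\<bar> < inverse (real (Suc k)))" for k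
      using Stone_Weierstrass_real_polynomial_function[OF _ g, of "inverse (real (Suc k))"]
      by (metis compact_Icc inverse_positive_iff_positive of_nat_0_less_iff zero_less_Suc)
    then obtain p where p: "\<And>k. real_polynomial_function (p k)"
      "\<And>k x. x \<in> {-real n..real n} \<Longrightarrow> \<bar>g x - p k x\<bar> < inverse (real (Suc k))" by metis
    have *: "sqint (\<lambda>x. indicator {-real n..real n} x * p k x) \<and>
        l2_of (\<lambda>x. indicator {-real n..real n} x * p k x) \<in> V" for k
    proof -
      obtain a m where pk: "p k = (\<lambda>x. \<Sum>i\<le>m::nat. a i * x ^ i)"
        using p(1)[of k] unfolding real_polynomial_function_iff_sum by blast
      let ?f = "\<lambda>i x. a i * (indicator {-real n..real n} x * x ^ i)"
      have eq: "(\<lambda>x. indicator {-real n..real n} x * p k x) = (\<lambda>x. \<Sum>i\<le>m. ?f i x)"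
        unfolding pk by (auto simp: sum_distrib_left mult_ac)
      have f: "sqint (?f i)" for i by (rule sqint_scale[OF mono])
      have "(\<Sum>i\<le>m. l2_of (?f i)) \<in> V"
        using E[of n] by (intro subspace_sum[OF V(2)])
          (auto simp flip: l2_of_scaleR[OF mono] intro!: subspace_scale[OF V(2)])
      then show ?thesis using l2_of_sum[of "{..m}" ?f] f unfolding eq by simp
    qed
    have "(\<lambda>k. l2_of (\<lambda>x. indicator {-real n..real n} x * p k x))
        \<longlonglongrightarrow> l2_of (\<lambda>x. indicator {-real n..real n} x * g x)"
    proof (rule l2_dominated_convergence[where w = "\<lambda>x. indicator {-real n..real n} x * 1"])
      show "sqint (\<lambda>x. indicator {-real n..real n} x * g x)" by (rule sqint_continuous[OF g])
      show "sqint (\<lambda>x. indicator {-real n..real n} x * p k x)" for k using * by blast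
      show "sqint (\<lambda>x. indicator {-real n..real n} x * 1)"
        by (intro sqint_continuous continuous_intros)
      have le: "\<bar>indicator {-real n..real n} x * p k x - indicator {-real n..real n} x * g x\<bar>
          \<le> inverse (real (Suc k))" for k x
        using p(2)[of x k] by (cases "x \<in> {-real n..real n}") (auto simp: abs_minus_commute)
      show "AE x in lborel. (\<lambda>k. indicator {-real n..real n} x * p k x)
          \<longlonglongrightarrow> indicator {-real n..real n} x * g x"
      proof (rule AE_I2)
        fix x
        have "(\<lambda>k. indicator {-real n..real n} x * p k x - indicator {-real n..real n} x * g x) \<longlonglongrightarrow> 0"
          by (rule Lim_null_comparison[OF _ LIMSEQ_inverse_real_of_nat]) (use le in simp)
        then show "(\<lambda>k. indicator {-real n..real n} x * p k x) \<longlonglongrightarrow> indicator {-real n..real n} x * g x"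
          by (simp add: LIM_zero_iff)
      qed
      fix k x
      have "inverse (real (Suc k)) \<le> 1" by (simp add: field_simps)
      then show "\<bar>indicator {-real n..real n} x * p k x - indicator {-real n..real n} x * g x\<bar>
          \<le> indicator {-real n..real n} x * 1"
        using le[where k = k and x = x] by (cases "x \<in> {-real n..real n}") auto
    qed
    then show ?thesis using * V(1) by (meson closed_sequentially)
  qed
  have "l2_of f \<in> V" if f: "sqint f" for f
  proof -
    have fm: "f \<in> borel_measurable borel" using f by (simp add: sqint_def)
    then have "f measurable_on UNIV"
      by (intro lebesgue_measurable_imp_measurable_on_real) (auto intro: measurable_completion)
    then obtain N g where N: "negligible N" and g: "\<And>k. continuous_on UNIV (g k)"
      and glim: "\<And>x. x \<notin> N \<Longrightarrow> (\<lambda>k. g k x) \<longlonglongrightarrow> f x"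
      unfolding measurable_on_def by auto
    have AEN: "AE x in lborel. x \<notin> N"
      using N AE_not_in[of N lebesgue] by (simp add: AE_completion_iff negligible_iff_null_sets)
    define c :: "nat \<Rightarrow> real \<Rightarrow> real" where "c n y = max (- real n) (min (real n) y)" for n y
    have c_abs: "\<bar>c n y\<bar> \<le> real n" for n y by (auto simp: c_def)
    have c_le: "\<bar>c n y\<bar> \<le> \<bar>y\<bar>" for n y by (auto simp: c_def)
    have c_diff: "\<bar>c n y - y\<bar> \<le> \<bar>y\<bar>" for n y by (auto simp: c_def)
    have c_eq: "c n y = y" if "\<bar>y\<bar> \<le> real n" for n y using that by (auto simp: c_def)
    let ?t = "\<lambda>n x. indicator {-real n..real n} x * c n (f x)"
    have t: "sqint (?t n)" for n
    proof (rule sqintI)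
      show "?t n \<in> borel_measurable lborel" unfolding c_def using fm by simp
      have "(\<integral>\<^sup>+x. ennreal ((?t n x)\<^sup>2) \<partial>lborel) \<le> (\<integral>\<^sup>+x. ennreal ((f x)\<^sup>2) \<partial>lborel)"
        by (intro nn_integral_mono ennreal_leI)
          (use c_le in \<open>auto simp: indicator_def abs_le_square_iff[symmetric]\<close>)
      also have "\<dots> < \<infinity>" unfolding nn_norm_l2_of[OF f] by simp
      finally show "(\<integral>\<^sup>+x. ennreal ((?t n x)\<^sup>2) \<partial>lborel) < \<infinity>" .
    qed
    have tV: "l2_of (?t n) \<in> V" for n
    proof -
      let ?s = "\<lambda>k x. indicator {-real n..real n} x * c n (g k x)"
      have cg: "continuous_on {-real n..real n} (\<lambda>x. c n (g k x))" for k
        unfolding c_def by (intro continuous_intros continuous_on_subset[OF g]) auto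
      have "(\<lambda>k. l2_of (?s k)) \<longlonglongrightarrow> l2_of (?t n)"
      proof (rule l2_dominated_convergence[where w = "\<lambda>x. indicator {-real n..real n} x * (2 * real n)"])
        show "sqint (?s k)" for k by (rule sqint_continuous[OF cg])
        show "sqint (\<lambda>x. indicator {-real n..real n} x * (2 * real n))"
          by (intro sqint_continuous continuous_intros)
        show "AE x in lborel. (\<lambda>k. ?s k x) \<longlonglongrightarrow> ?t n x"
          using AEN
        proof eventually_elim
          case (elim x)
          then show ?case unfolding c_def by (intro tendsto_intros glim)
        qed
        show "\<bar>?s k x - ?t n x\<bar> \<le> indicator {-real n..real n} x * (2 * real n)" for k x
          using c_abs[of n "g k x"] c_abs[of n "f x"] by (cases "x \<in> {-real n..real n}") auto
      qed (rule t)
      then show ?thesis using cont[OF cg] V(1) by (meson closed_sequentially)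
    qed
    have "(\<lambda>n. l2_of (?t n)) \<longlonglongrightarrow> l2_of f"
    proof (rule l2_dominated_convergence[where w = "\<lambda>x. \<bar>f x\<bar>"])
      show "sqint (\<lambda>x. \<bar>f x\<bar>)" using f by (auto simp: sqint_def intro!: borel_measurable_abs)
      show "AE x in lborel. (\<lambda>n. ?t n x) \<longlonglongrightarrow> f x"
      proof (rule AE_I2)
        fix x
        obtain M :: nat where M: "\<bar>x\<bar> + \<bar>f x\<bar> \<le> real M" using real_arch_simple by blast
        have "?t n x = f x" if "n \<ge> M" for n
        proof -
          have "\<bar>x\<bar> + \<bar>f x\<bar> \<le> real n" using that M by linarith
          then show ?thesis using c_eq[of "f x" n] by (auto simp: indicator_def)
        qed
        then show "(\<lambda>n. ?t n x) \<longlonglongrightarrow> f x"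
          by (intro tendsto_eventually) (auto simp: eventually_sequentially)
      qed
      show "\<bar>?t n x - f x\<bar> \<le> \<bar>f x\<bar>" for n x
        using c_diff[of n "f x"] by (cases "x \<in> {-real n..real n}") auto
    qed (use f t in auto)
    then show ?thesis using tV V(1) by (meson closed_sequentially)
  qed
  from this[OF sqint_fun_of] show ?thesis by auto
qed

lemma separable_l2: "\<exists>D :: l2 set. countable D \<and> closure D = UNIV"
proof -
  define e where "e nj = l2_of (\<lambda>x. indicator {-real (fst nj)..real (fst nj)} x * x ^ snd nj)"
    for nj :: "nat \<times> nat"
  define S where "S qs = (\<Sum>(q, nj)\<leftarrow>qs. real_of_rat q *\<^sub>R e nj)" for qs
  define D where "D = range S"
  have "countable D" unfolding D_def by simp
  have S_append: "S (xs @ ys) = S xs + S ys" for xs ys by (simp add: S_def)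
  have S_scale: "real_of_rat c *\<^sub>R S xs = S (map (\<lambda>(q, nj). (c * q, nj)) xs)" for c xs
    by (induction xs) (auto simp: S_def scaleR_add_right of_rat_mult)
  have D_add: "u + v \<in> D" if "u \<in> D" "v \<in> D" for u v
    using that S_append unfolding D_def by (metis rangeE rangeI)
  have D_scale: "real_of_rat c *\<^sub>R u \<in> D" if "u \<in> D" for c u
    using that S_scale unfolding D_def by (metis rangeE rangeI)
  have add: "u + v \<in> closure D" if uv: "u \<in> closure D" "v \<in> closure D" for u v
  proof -
    obtain x y where "\<And>n. x n \<in> D" "x \<longlonglongrightarrow> u" "\<And>n. y n \<in> D" "y \<longlonglongrightarrow> v"
      using uv unfolding closure_sequential by metis
    then show ?thesis
      unfolding closure_sequential
      by (intro exI[of _ "\<lambda>n. x n + y n"]) (auto intro: D_add tendsto_add)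
  qed
  have rat: "real_of_rat c *\<^sub>R u \<in> closure D" if u: "u \<in> closure D" for c u
  proof -
    obtain x where "\<And>n. x n \<in> D" "x \<longlonglongrightarrow> u"
      using u unfolding closure_sequential by metis
    then show ?thesis
      unfolding closure_sequential
      by (intro exI[of _ "\<lambda>n. real_of_rat c *\<^sub>R x n"]) (auto intro: D_scale tendsto_intros)
  qed
  have scale: "c *\<^sub>R u \<in> closure D" if u: "u \<in> closure D" for c u
  proof -
    have "closed ((\<lambda>c. c *\<^sub>R u) -` closure D)"
      by (intro closed_vimage closed_closure continuous_intros)
    moreover have "\<rat> \<subseteq> (\<lambda>c. c *\<^sub>R u) -` closure D" using rat[OF u] by (auto elim: Rats_cases)
    ultimately have "closure \<rat> \<subseteq> (\<lambda>c. c *\<^sub>R u) -` closure D" by (simp add: closure_minimal)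
    then show ?thesis by (auto simp: Rats_closure_real)
  qed
  have "0 = S []" by (simp add: S_def)
  then have "0 \<in> D" unfolding D_def by (metis rangeI)
  then have sub: "subspace (closure D)"
    unfolding subspace_def using add scale closure_subset by blast
  have "e nj = S [(1, nj)]" for nj by (simp add: S_def)
  then have "e nj \<in> D" for nj unfolding D_def by (metis rangeI)
  then have "e nj \<in> closure D" for nj using closure_subset by blast
  from this[of "(n, j)" for n j] have "closure D = UNIV"
    by (intro closed_subspace_l2_UNIV[OF closed_closure sub]) (simp add: e_def)
  with \<open>countable D\<close> show ?thesis by blast
qed

instance l2 :: second_countable_topology
proof
  obtain D :: "l2 set" where D: "countable D" "closure D = UNIV" using separable_l2 by blast
  define B where "B = (\<lambda>(x, n). ball x (inverse (real (Suc n)))) ` (D \<times> UNIV)"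
  have "countable B" unfolding B_def using D(1) by simp
  have "open S \<Longrightarrow> generate_topology B S" for S
  proof -
    assume S: "open S"
    have "\<forall>x\<in>S. \<exists>b. b \<in> B \<and> x \<in> b \<and> b \<subseteq> S"
    proof
      fix x assume "x \<in> S"
      then obtain r where r: "r > 0" "ball x r \<subseteq> S" using S open_contains_ball by blast
      obtain n where n: "inverse (real (Suc n)) < r / 2"
        using reals_Archimedean[of "r / 2"] r(1) by auto
      have "x \<in> closure D" using D(2) by simp
      then obtain y where y: "y \<in> D" "dist y x < inverse (real (Suc n))"
        unfolding closure_approachable by (metis inverse_positive_iff_positive of_nat_0_less_iff zero_less_Suc)
      have "ball y (inverse (real (Suc n))) \<subseteq> ball x r"
      proof
        fix z assume "z \<in> ball y (inverse (real (Suc n)))"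
        then have "dist x z < r"
          using y(2) n dist_triangle[of x z y] by (simp add: dist_commute)
        then show "z \<in> ball x r" by simp
      qed
      moreover have "ball y (inverse (real (Suc n))) \<in> B"
        unfolding B_def using y(1) by (intro image_eqI[of _ _ "(y, n)"]) auto
      moreover have "x \<in> ball y (inverse (real (Suc n)))" using y(2) by simp
      ultimately show "\<exists>b. b \<in> B \<and> x \<in> b \<and> b \<subseteq> S" using r(2) by (meson order_trans)
    qed
    from bchoice[OF this] obtain b where b: "\<forall>x\<in>S. b x \<in> B \<and> x \<in> b x \<and> b x \<subseteq> S" ..
    have S_eq: "\<Union>(b ` S) = S" using b by blast
    have "generate_topology B (\<Union>(b ` S))"
      by (rule generate_topology.UN) (use b in \<open>auto intro: generate_topology.Basis\<close>)
    then show "generate_topology B S" by (simp only: S_eq)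
  qed
  moreover have "generate_topology B S \<Longrightarrow> open S" for S
  proof (induction rule: generate_topology.induct)
    case (Basis s)
    then show ?case by (auto simp: B_def)
  qed (simp_all add: open_Int open_Union)
  ultimately have "open = generate_topology B" by (intro ext iffI) blast+
  with \<open>countable B\<close> show "\<exists>B :: l2 set set. countable B \<and> open = generate_topology B" by blast
qed

section \<open>Sobolev spaces on an interval\<close>

text \<open>Elements of \<open>L\<^sup>2(0,L)\<close> are identified with the classes in \<^typ>\<open>l2\<close> that vanish outside \<open>(0,L)\<close>.\<close>

definition L2_interval :: "real \<Rightarrow> l2 set" where
  "L2_interval L = {u. AE x in lborel. x \<notin> {0<..<L} \<longrightarrow> fun_of u x = 0}"

definition l2_on :: "real \<Rightarrow> (real \<Rightarrow> real) \<Rightarrow> l2" where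
  "l2_on L f = l2_of (\<lambda>x. indicator {0<..<L} x * f x)"

text \<open>\<open>H\<^sup>m\<close> is defined by iterated weak derivatives, tested against \<open>C\<^sup>1\<close> functions with compact
  support in \<open>(0,L)\<close>.\<close>

definition test_function :: "real \<Rightarrow> (real \<Rightarrow> real) \<Rightarrow> bool" where
  "test_function L \<phi> \<longleftrightarrow> \<phi> C1_differentiable_on UNIV \<and>
     (\<exists>a b. 0 < a \<and> b < L \<and> (\<forall>x. x \<notin> {a..b} \<longrightarrow> \<phi> x = 0))"

definition has_weak_deriv :: "real \<Rightarrow> l2 \<Rightarrow> l2 \<Rightarrow> bool" where
  "has_weak_deriv L u v \<longleftrightarrow> (\<forall>\<phi>. test_function L \<phi> \<longrightarrow>
     (LINT x:{0<..<L}|lborel. fun_of u x * deriv \<phi> x) =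
     - (LINT x:{0<..<L}|lborel. fun_of v x * \<phi> x))"

primrec sobolev :: "nat \<Rightarrow> real \<Rightarrow> l2 set" where
  "sobolev 0 L = L2_interval L"
| "sobolev (Suc m) L = {u \<in> L2_interval L. \<exists>v \<in> sobolev m L. has_weak_deriv L u v}"

definition weak_deriv :: "real \<Rightarrow> l2 \<Rightarrow> l2" where
  "weak_deriv L u = (THE v. v \<in> L2_interval L \<and> has_weak_deriv L u v)"

text \<open>For \<open>u \<in> H\<^sup>1(0,L)\<close> and \<open>p \<in> [0,L]\<close>: the value at \<open>p\<close> of the representative of \<open>u\<close>
  that is continuous on \<open>[0,L]\<close>.\<close>

definition pt_value :: "real \<Rightarrow> l2 \<Rightarrow> real \<Rightarrow> real" where
  "pt_value L u p = (THE c. \<exists>g. continuous_on {0..L} g \<and>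
     (AE x in lborel. x \<in> {0<..<L} \<longrightarrow> fun_of u x = g x) \<and> g p = c)"

section \<open>Semigroups and mild solutions\<close>

text \<open>The state space is a closed subspace \<open>X\<close> of an ambient normed space; the values of \<open>S\<close>
  outside \<open>X\<close> (and at negative times) are irrelevant.\<close>

definition C0_semigroup :: "'a::real_normed_vector set \<Rightarrow> (real \<Rightarrow> 'a \<Rightarrow> 'a) \<Rightarrow> bool" where
  "C0_semigroup X S \<longleftrightarrow>
     (\<forall>t\<ge>0. (\<forall>u\<in>X. S t u \<in> X) \<and>
        (\<forall>u\<in>X. \<forall>v\<in>X. \<forall>c d. S t (c *\<^sub>R u + d *\<^sub>R v) = c *\<^sub>R S t u + d *\<^sub>R S t v) \<and>
        (\<exists>K. \<forall>u\<in>X. norm (S t u) \<le> K * norm u)) \<and>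
     (\<forall>u\<in>X. S 0 u = u) \<and>
     (\<forall>s\<ge>0. \<forall>t\<ge>0. \<forall>u\<in>X. S (s + t) u = S s (S t u)) \<and>
     (\<forall>u\<in>X. ((\<lambda>t. S t u) \<longlongrightarrow> u) (at_right 0))"

definition generates ::
  "'a::real_normed_vector set \<Rightarrow> 'a set \<Rightarrow> ('a \<Rightarrow> 'a) \<Rightarrow> (real \<Rightarrow> 'a \<Rightarrow> 'a) \<Rightarrow> bool" where
  "generates X D G S \<longleftrightarrow> C0_semigroup X S \<and> D \<subseteq> X \<and>
     (\<forall>u\<in>X. \<forall>v. ((\<lambda>h. (1 / h) *\<^sub>R (S h u - u)) \<longlongrightarrow> v) (at_right 0) \<longleftrightarrow> u \<in> D \<and> v = G u)"

text \<open>Mild solution on \<open>[0,T]\<close> of \<open>z' = G z + F\<close>, \<open>z(0) = z0\<close>, with \<open>S\<close> the semigroup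
  generated by \<open>G\<close>; the integral is the Bochner integral.\<close>

definition mild_solution ::
  "(real \<Rightarrow> 'a::{banach, second_countable_topology} \<Rightarrow> 'a) \<Rightarrow> real \<Rightarrow> 'a \<Rightarrow>
    (real \<Rightarrow> 'a) \<Rightarrow> (real \<Rightarrow> 'a) \<Rightarrow> bool" where
  "mild_solution S T z0 F z \<longleftrightarrow> (\<forall>t\<in>{0..T}.
     set_integrable lborel {0..t} (\<lambda>s. S (t - s) (F s)) \<and>
     z t = S t z0 + (LINT s:{0..t}|lborel. S (t - s) (F s)))"

section \<open>The linear Kuramoto--Sivashinsky system on a star-shaped tree\<close>

text \<open>The \<open>N\<close> edges, each parametrized by \<open>(0,L)\<close>, are indexed by a finite type \<^typ>\<open>'n\<close>
  with \<open>N = CARD('n)\<close>; \<open>0\<close> is the common vertex.\<close>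

definition L2_tree :: "real \<Rightarrow> (l2 ^ 'n) set" where
  "L2_tree L = {u. \<forall>k. u $ k \<in> L2_interval L}"

definition sobolev_tree :: "nat \<Rightarrow> real \<Rightarrow> (l2 ^ 'n) set" where
  "sobolev_tree m L = {u. \<forall>k. u $ k \<in> sobolev m L}"

definition KS_op :: "real \<Rightarrow> real \<Rightarrow> l2 ^ 'n \<Rightarrow> l2 ^ 'n" where
  "KS_op lam L \<phi> = (\<chi> k. lam *\<^sub>R (weak_deriv L ^^ 2) (\<phi> $ k) + (weak_deriv L ^^ 4) (\<phi> $ k))"

definition KS_dom :: "real \<Rightarrow> (l2 ^ 'n) set" where
  "KS_dom L = {\<phi> \<in> sobolev_tree 4 L.
     (\<forall>k. pt_value L (weak_deriv L (\<phi> $ k)) L = 0 \<and>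
          pt_value L ((weak_deriv L ^^ 3) (\<phi> $ k)) L = 0) \<and>
     (\<forall>i j. pt_value L (\<phi> $ i) 0 = pt_value L (\<phi> $ j) 0 \<and>
            pt_value L ((weak_deriv L ^^ 2) (\<phi> $ i)) 0 = pt_value L ((weak_deriv L ^^ 2) (\<phi> $ j)) 0) \<and>
     (\<Sum>k\<in>UNIV. pt_value L (weak_deriv L (\<phi> $ k)) 0) = 0 \<and>
     (\<Sum>k\<in>UNIV. pt_value L ((weak_deriv L ^^ 3) (\<phi> $ k)) 0) = 0}"

definition lifting_polys :: "real \<Rightarrow> real poly \<Rightarrow> real poly \<Rightarrow> bool" where
  "lifting_polys L P1 P2 \<longleftrightarrow>
     (\<forall>j\<le>3. poly ((pderiv ^^ j) P1) 0 = 0 \<and> poly ((pderiv ^^ j) P2) 0 = 0) \<and>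
     poly (pderiv P1) L = 1 \<and> poly ((pderiv ^^ 3) P1) L = 0 \<and>
     poly (pderiv P2) L = 0 \<and> poly ((pderiv ^^ 3) P2) L = 1"

definition lift_state :: "real \<Rightarrow> real \<Rightarrow> real poly \<Rightarrow> real poly \<Rightarrow> l2 ^ 'n \<Rightarrow> l2 ^ 'n \<Rightarrow> real \<Rightarrow> l2 ^ 'n" where
  "lift_state L T P1 P2 a b t = (\<chi> k. l2_on L (\<lambda>x.
     poly P1 x * pt_value T (a $ k) t + poly P2 x * pt_value T (b $ k) t))"

definition lift_source ::
  "real \<Rightarrow> real \<Rightarrow> real \<Rightarrow> real poly \<Rightarrow> real poly \<Rightarrow> l2 ^ 'n \<Rightarrow> l2 ^ 'n \<Rightarrow> real \<Rightarrow> l2 ^ 'n" where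
  "lift_source lam L T P1 P2 a b t = (\<chi> k. l2_on L (\<lambda>x.
     - poly P1 x * fun_of (weak_deriv T (a $ k)) t
     - poly P2 x * fun_of (weak_deriv T (b $ k)) t
     - (lam * poly ((pderiv ^^ 2) P1) x + poly ((pderiv ^^ 4) P1) x) * pt_value T (a $ k) t
     - (lam * poly ((pderiv ^^ 2) P2) x + poly ((pderiv ^^ 4) P2) x) * pt_value T (b $ k) t))"

text \<open>The pair \<open>P1, P2\<close> and the semigroup are existentially quantified: the solution does not
  depend on the pair, and the semigroup is unique on \<open>L2_tree L\<close>.\<close>

definition KS_solution ::
  "real \<Rightarrow> real \<Rightarrow> real \<Rightarrow> l2 ^ 'n \<Rightarrow> l2 ^ 'n \<Rightarrow> l2 ^ 'n \<Rightarrow> (real \<Rightarrow> l2 ^ 'n) \<Rightarrow> bool" where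
  "KS_solution lam L T y0 a b y \<longleftrightarrow> continuous_on {0..T} y \<and>
     (\<exists>P1 P2 S z. lifting_polys L P1 P2 \<and>
        generates (L2_tree L) (KS_dom L) (\<lambda>\<phi>. - KS_op lam L \<phi>) S \<and>
        mild_solution S T (y0 - lift_state L T P1 P2 a b 0) (lift_source lam L T P1 P2 a b) z \<and>
        (\<forall>t\<in>{0..T}. y t = z t + lift_state L T P1 P2 a b t))"

definition N3 :: "real \<Rightarrow> real set" where
  "N3 L = {pi\<^sup>2 / (4 * L\<^sup>2) * (2 * real n + 1)\<^sup>2 | n. True}"

definition N4 :: "real \<Rightarrow> real set" where
  "N4 L = {pi\<^sup>2 / (4 * L\<^sup>2) * ((2 * real m)\<^sup>2 + (2 * real n + 1)\<^sup>2) | m n. m \<ge> 1}"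

definition Nmixt :: "real \<Rightarrow> real set" where
  "Nmixt L = N3 L \<union> N4 L"

definition Nodd :: "real \<Rightarrow> real set" where
  "Nodd L = {pi\<^sup>2 / (4 * L\<^sup>2) * ((2 * real m + 1)\<^sup>2 + (2 * real n + 1)\<^sup>2) | m n. m < n}"

end

theory Submission
  imports Defs "HOL-Real_Asymp.Real_Asymp"
begin

text \<open>
  The operator \<open>A\<close> is self-adjoint with explicit eigenvectors. With \<open>\<omega>\<^sub>j = j\<pi>/(2L)\<close> they are of two kinds: for
  even \<open>j\<close> the function \<open>cos (\<omega>\<^sub>j x)\<close>, the same on all edges; for odd \<open>j\<close> the function \<open>sin (\<omega>\<^sub>j x)\<close>,
  multiplied on edge \<open>k\<close> by a weight \<open>v\<^sub>k\<close>, where the weights sum to zero. Both kinds satisfy the vertex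
  conditions and belong to the eigenvalue \<open>\<sigma>\<^sub>j = \<omega>\<^sub>j\<^sup>4 - \<lambda>\<omega>\<^sub>j\<^sup>2\<close>. Pairing a solution with such an eigenvector
  \<open>V = (v\<^sub>k \<phi>\<^sub>j)\<^sub>k\<close> and integrating by parts in \<open>x\<close> and in \<open>t\<close> gives (lemma \<open>KS_solution_final_mode\<close>)
  \<open>\<langle>y(T), V\<rangle> = exp (- \<sigma>\<^sub>j T) (\<langle>y\<^sub>0, V\<rangle> - \<phi>\<^sub>j(L) \<Sum>\<^sub>k v\<^sub>k \<integral> exp (\<sigma>\<^sub>j t) (b\<^sup>k(t) + (\<lambda> - \<omega>\<^sub>j\<^sup>2) a\<^sup>k(t)) dt)\<close>.
  Since \<open>\<phi>\<^sub>j(L) = \<plusminus> 1\<close>, every mode is seen by the controls, and null controllability is a problem of moments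
  against the functions \<open>exp (\<sigma>\<^sub>j t)\<close>.

  Suppose that the \<open>\<sigma>\<^sub>j\<close> grow like \<open>j\<^sup>4\<close>, with distinct values at least a fixed distance apart. Then for every bounded target that
  respects coincidences \<open>\<sigma>\<^sub>i = \<sigma>\<^sub>j\<close> there is a \<open>C\<^sup>1\<close> function supported in \<open>[0,T]\<close> with these moments
  (\<open>exponential_moment_problem\<close>). The operator \<open>1 + \<sigma>\<^sub>j\<^sup>-\<^sup>1 d/dt\<close> multiplies the moment against
  \<open>exp (s t)\<close> by \<open>1 - s/\<sigma>\<^sub>j\<close>; so the product of these operators over all \<open>j\<close> with \<open>\<sigma>\<^sub>j \<noteq> \<sigma>\<^sub>n\<close>, applied to a bump
  function, yields a function whose moments vanish except at \<open>\<sigma>\<^sub>n\<close>. The infinite product converges because the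
  \<open>k\<close>-th derivative of the bump is at most \<open>C\<^sup>k (k!)\<^sup>2\<close>. The remaining moment is at least
  a constant times \<open>exp (\<sigma>\<^sub>n T/2 - C \<surd>\<sigma>\<^sub>n log \<sigma>\<^sub>n)\<close>, so the normalised functions
  decay fast enough to be summed.

  Now let edge \<open>i\<close> be uncontrolled. The weights \<open>+1\<close> on \<open>k\<close> and \<open>-1\<close> on \<open>i\<close>, for \<open>k \<noteq> i\<close>, span all
  admissible weights of an odd mode, so every edge \<open>k \<noteq> i\<close> has its own separate moment problem; one of these edges, \<open>k0\<close>,
  also takes care of the even modes. A coincidence \<open>\<sigma>\<^sub>i = \<sigma>\<^sub>j\<close> with \<open>i \<noteq> j\<close> means \<open>\<omega>\<^sub>i\<^sup>2 + \<omega>\<^sub>j\<^sup>2 = \<lambda>\<close>. Then two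
  conditions fall on the same exponential, but with the coefficients \<open>\<lambda> - \<omega>\<^sub>i\<^sup>2 = \<omega>\<^sub>j\<^sup>2\<close> and \<open>\<omega>\<^sub>i\<^sup>2\<close> of \<open>a\<^sup>k\<close>,
  which differ; hence the moments of \<open>a\<^sup>k\<close> and \<open>b\<^sup>k\<close> can be chosen to satisfy both (\<open>pair_control\<close>). If in
  addition \<open>a\<^sup>j = 0\<close> on a second edge, \<open>b\<^sup>j\<close> alone has to do: this works when no odd mode takes
  part in a coincidence, which is what \<open>\<lambda> \<notin> \<N>\<^sub>m\<^sub>i\<^sub>x\<^sub>t\<close> and \<open>\<lambda> \<notin> \<N>\<^sub>o\<^sub>d\<^sub>d\<close> say, and when the even modes are left to a third edge. If
  \<open>\<lambda> \<in> \<N>\<^sub>o\<^sub>d\<^sub>d\<close>, two odd modes coincide. For the weights \<open>\<plusminus>1\<close> on the edges \<open>i0\<close> and \<open>j0\<close> only one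
  control remains, so the two conditions are proportional, and an initial state in just one of the two modes violates them.

  A solution refers to any semigroup generated by \<open>-A\<close>. It is identified with
  \<open>u \<mapsto> \<Sum>\<^sub>j exp (- \<sigma>\<^sub>j t) E\<^sub>j u\<close>, where \<open>E\<^sub>j\<close> are the spectral projections: this series is generated by \<open>-A\<close>
  (\<open>KS_generates\<close>), and a semigroup is determined by its generator on eigenvectors (\<open>semigroup_unique\<close>).
\<close>

section \<open>A compactly supported function of Gevrey class two\<close>

text \<open>The \<open>n\<close>-th derivative of \<open>exp (- 1/t)\<close> for \<open>t > 0\<close> is \<open>P\<^sub>n(1/t) exp (- 1/t)\<close>; the chain rule at \<open>x = 1/t\<close> gives
  \<open>P\<^sub>n\<^sub>+\<^sub>1 = x\<^sup>2 (P\<^sub>n - P\<^sub>n')\<close>. The extension by zero to \<open>t \<le> 0\<close> is smooth.\<close>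

primrec flat_poly :: "nat \<Rightarrow> real poly" where
  "flat_poly 0 = 1"
| "flat_poly (Suc n) = pCons 0 (pCons 0 (flat_poly n - pderiv (flat_poly n)))"

definition flat :: "nat \<Rightarrow> real \<Rightarrow> real" where
  "flat n t = (if 0 < t then poly (flat_poly n) (1 / t) * exp (- (1 / t)) else 0)"

text \<open>Since \<open>x\<^sup>k exp (- x) \<le> k!\<close>, weighting the \<open>k\<close>-th coefficient with \<open>k!\<close> gives a norm that dominates
  \<open>P(x) exp (- x)\<close> on \<open>x \<ge> 0\<close> and that the recursion for \<open>flat_poly\<close> enlarges only by \<open>8 (n+1)\<^sup>2\<close>.\<close>

definition fact_norm :: "nat \<Rightarrow> real poly \<Rightarrow> real" where
  "fact_norm d P = (\<Sum>k\<le>d. \<bar>coeff P k\<bar> * fact k)"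

lemma power_le_fact_mult_exp:
  assumes "0 \<le> (x::real)" shows "x ^ k \<le> fact k * exp x"
proof -
  have "(\<Sum>n\<in>{k}. x ^ n /\<^sub>R fact n) \<le> (\<Sum>n. x ^ n /\<^sub>R fact n)"
    using assms by (intro sum_le_suminf summable_exp_generic) auto
  then have "x ^ k /\<^sub>R fact k \<le> exp x" by (simp add: exp_def)
  then show ?thesis by (simp add: field_simps)
qed

lemma poly_exp_le_fact_norm:
  assumes "degree P \<le> d" "0 \<le> x"
  shows "\<bar>poly P x\<bar> * exp (- x) \<le> fact_norm d P"
proof -
  have "poly P x = (\<Sum>k\<le>d. coeff P k * x ^ k)"
    unfolding poly_altdef using assms(1)
    by (intro sum.mono_neutral_left) (auto simp: coeff_eq_0)
  then have "\<bar>poly P x\<bar> \<le> (\<Sum>k\<le>d. \<bar>coeff P k\<bar> * x ^ k)"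
    using assms(2) by (auto simp: abs_mult intro!: order.trans[OF sum_abs])
  also have "\<dots> \<le> (\<Sum>k\<le>d. \<bar>coeff P k\<bar> * (fact k * exp x))"
    using assms(2) by (intro sum_mono mult_left_mono power_le_fact_mult_exp) auto
  also have "\<dots> = fact_norm d P * exp x"
    by (simp add: fact_norm_def sum_distrib_right mult.assoc)
  finally show ?thesis by (simp add: exp_minus field_simps)
qed

lemma degree_flat_poly: "degree (flat_poly n) \<le> 2 * n"
proof (induction n)
  case (Suc n)
  have "degree (flat_poly n - pderiv (flat_poly n)) \<le> 2 * n"
    using Suc by (intro degree_diff_le) (auto simp: degree_pderiv)
  then show ?case using degree_pCons_le[of 0 "flat_poly n - pderiv (flat_poly n)"]
      degree_pCons_le[of 0 "pCons 0 (flat_poly n - pderiv (flat_poly n))"] by simp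
qed simp

lemma fact_norm_pCons2: "fact_norm (Suc (Suc d)) (pCons 0 (pCons 0 Q)) = (\<Sum>k\<le>d. \<bar>coeff Q k\<bar> * fact (k + 2))"
  unfolding fact_norm_def by (subst sum.atMost_Suc_shift, subst sum.atMost_Suc_shift) simp

text \<open>The Gevrey estimate: multiplication by \<open>x\<^sup>2\<close> replaces \<open>k!\<close> by \<open>(k+2)!\<close>, and differentiation costs a factor
  \<open>k\<close>. As \<open>k \<le> 2n\<close>, one step of the recursion costs at most \<open>(2k+2)(k+1) \<le> 8 (n+1)\<^sup>2\<close>.\<close>

lemma fact_norm_flat_poly: "fact_norm (2 * n) (flat_poly n) \<le> 8 ^ n * (fact n)\<^sup>2"
proof (induction n)
  case 0
  then show ?case by (simp add: fact_norm_def)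
next
  case (Suc n)
  define P where "P = flat_poly n"
  have P: "degree P \<le> 2 * n" using degree_flat_poly P_def by simp
  have fac2: "fact (k + 2) = (real k + 2) * (real k + 1) * fact k" for k
    by (simp add: numeral_2_eq_2 field_simps)
  have "fact_norm (2 * Suc n) (flat_poly (Suc n))
      = (\<Sum>k\<le>2*n. \<bar>coeff P k - (real k + 1) * coeff P (Suc k)\<bar> * fact (k + 2))"
    unfolding P_def by (simp add: fact_norm_pCons2 coeff_pderiv add.commute)
  also have "\<dots> \<le> (\<Sum>k\<le>2*n. \<bar>coeff P k\<bar> * fact (k + 2) + (real k + 1) * \<bar>coeff P (Suc k)\<bar> * fact (k + 2))"
  proof (intro sum_mono)
    fix k
    have "\<bar>coeff P k - (real k + 1) * coeff P (Suc k)\<bar> \<le> \<bar>coeff P k\<bar> + (real k + 1) * \<bar>coeff P (Suc k)\<bar>"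
      using abs_triangle_ineq4[of "coeff P k" "(real k + 1) * coeff P (Suc k)"] by (simp add: abs_mult)
    then show "\<bar>coeff P k - (real k + 1) * coeff P (Suc k)\<bar> * fact (k + 2)
       \<le> \<bar>coeff P k\<bar> * fact (k + 2) + (real k + 1) * \<bar>coeff P (Suc k)\<bar> * fact (k + 2)"
      by (metis distrib_right fact_ge_zero mult_right_mono)
  qed
  also have "\<dots> = (\<Sum>k\<le>2*n. \<bar>coeff P k\<bar> * fact (k + 2))
      + (\<Sum>k\<le>2*n. real (Suc k) * \<bar>coeff P (Suc k)\<bar> * fact (Suc k + 1))"
    by (simp add: sum.distrib add.commute)
  also have "(\<Sum>k\<le>2*n. real (Suc k) * \<bar>coeff P (Suc k)\<bar> * fact (Suc k + 1))
      = (\<Sum>k\<le>Suc (2*n). real k * \<bar>coeff P k\<bar> * fact (k + 1))"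
    by (subst sum.atMost_Suc_shift) simp
  also have "\<dots> = (\<Sum>k\<le>2*n. real k * \<bar>coeff P k\<bar> * fact (k + 1))"
    using P by (simp add: coeff_eq_0)
  also have "(\<Sum>k\<le>2*n. \<bar>coeff P k\<bar> * fact (k + 2)) + \<dots>
      = (\<Sum>k\<le>2*n. (\<bar>coeff P k\<bar> * fact k) * ((2 * real k + 2) * (real k + 1)))"
    unfolding sum.distrib[symmetric] by (intro sum.cong) (auto simp: fac2 algebra_simps)
  also have "\<dots> \<le> (\<Sum>k\<le>2*n. (\<bar>coeff P k\<bar> * fact k) * (8 * (real n + 1)\<^sup>2))"
  proof (intro sum_mono mult_left_mono)
    fix k assume "k \<in> {..2*n}"
    then have "2 * real k + 2 \<le> 4 * (real n + 1)" "real k + 1 \<le> 2 * (real n + 1)" by auto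
    then have "(2 * real k + 2) * (real k + 1) \<le> (4 * (real n + 1)) * (2 * (real n + 1))"
      by (intro mult_mono) auto
    then show "(2 * real k + 2) * (real k + 1) \<le> 8 * (real n + 1)\<^sup>2"
      by (simp add: power2_eq_square algebra_simps)
  qed auto
  also have "\<dots> = fact_norm (2*n) P * (8 * (real n + 1)\<^sup>2)"
    by (simp add: fact_norm_def sum_distrib_right)
  also have "\<dots> \<le> (8 ^ n * (fact n)\<^sup>2) * (8 * (real n + 1)\<^sup>2)"
    using Suc unfolding P_def by (intro mult_right_mono) auto
  also have "\<dots> = 8 ^ Suc n * (fact (Suc n))\<^sup>2"
    by (simp add: power_mult_distrib[symmetric] mult_ac add.commute)
  finally show ?case .
qed

lemma flat_bound: "\<bar>flat n t\<bar> \<le> 8 ^ n * (fact n)\<^sup>2"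
proof (cases "0 < t")
  case True
  then have "\<bar>flat n t\<bar> = \<bar>poly (flat_poly n) (1 / t)\<bar> * exp (- (1 / t))"
    by (simp add: flat_def abs_mult)
  also have "\<dots> \<le> fact_norm (2 * n) (flat_poly n)"
    using True by (intro poly_exp_le_fact_norm degree_flat_poly) auto
  finally show ?thesis using fact_norm_flat_poly[of n] by linarith
qed (simp add: flat_def)

text \<open>Only the origin needs an argument: there \<open>flat n h / h\<close> is \<open>h\<close> times \<open>x\<^sup>2 P\<^sub>n(x) exp (- x)\<close> at \<open>x = 1/h\<close>, which is
  bounded.\<close>

lemma flat_deriv: "(flat n has_real_derivative flat (Suc n) t) (at t)"
proof (cases t "0::real" rule: linorder_cases)
  case less
  have "((\<lambda>x. 0::real) has_real_derivative 0) (at t)" by simp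
  then have "(flat n has_real_derivative 0) (at t)"
    by (rule has_field_derivative_transform_within_open[of _ _ _ "{..<0}"]) (use less in \<open>auto simp: flat_def\<close>)
  then show ?thesis using less by (simp add: flat_def)
next
  case greater
  let ?P = "flat_poly n"
  have "((\<lambda>x. poly ?P (1 / x) * exp (- (1 / x))) has_real_derivative
      (poly (pderiv ?P) (1 / t) * (- (1 / t\<^sup>2))) * exp (- (1 / t))
        + poly ?P (1 / t) * (exp (- (1 / t)) * (1 / t\<^sup>2))) (at t)"
    using greater
    by (auto intro!: derivative_eq_intros DERIV_chain2[OF poly_DERIV] simp: power2_eq_square field_simps)
  also have "(poly (pderiv ?P) (1 / t) * (- (1 / t\<^sup>2))) * exp (- (1 / t))
        + poly ?P (1 / t) * (exp (- (1 / t)) * (1 / t\<^sup>2)) = flat (Suc n) t"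
    using greater by (simp add: flat_def field_simps power2_eq_square)
  finally show ?thesis
    by (rule has_field_derivative_transform_within_open[of _ _ _ "{0<..}"]) (use greater in \<open>auto simp: flat_def\<close>)
next
  case equal
  \<comment> \<open>\<open>Q(x) = x\<^sup>2 P\<^sub>n(x)\<close>, so that \<open>flat n h / h = h \<cdot> Q(1/h) exp (- 1/h)\<close>.\<close>
  define Q where "Q = pCons 0 (pCons 0 (flat_poly n))"
  define K where "K = fact_norm (degree Q) Q"
  have b: "\<bar>flat n h / h\<bar> \<le> \<bar>h\<bar> * K" for h
  proof (cases "0 < h")
    case True
    have "\<bar>poly Q (1/h)\<bar> * exp (-(1/h)) \<le> K"
      unfolding K_def using True by (intro poly_exp_le_fact_norm) auto
    moreover have "poly Q (1/h) = poly (flat_poly n) (1/h) / h\<^sup>2"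
      by (simp add: Q_def power2_eq_square)
    ultimately have "\<bar>poly (flat_poly n) (1/h)\<bar> / h\<^sup>2 * exp (-(1/h)) \<le> K"
      by (simp add: abs_divide)
    then have "\<bar>flat n h\<bar> / h\<^sup>2 \<le> K" using True by (simp add: flat_def abs_mult)
    then have "\<bar>flat n h\<bar> / h\<^sup>2 * h \<le> K * h" using True by (intro mult_right_mono) auto
    then show ?thesis using True by (simp add: power2_eq_square mult.commute abs_divide)
  next
    case False
    have "0 \<le> K" unfolding K_def fact_norm_def by (intro sum_nonneg) auto
    then have "0 \<le> \<bar>h\<bar> * K" by (intro mult_nonneg_nonneg) auto
    moreover have "flat n h = 0" using False by (simp add: flat_def)
    ultimately show ?thesis by (simp only: div_0 abs_zero)
  qed
  have "((\<lambda>h. \<bar>h\<bar> * K) \<longlongrightarrow> \<bar>0\<bar> * K) (at (0::real))" by (intro tendsto_intros)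
  moreover have "\<forall>\<^sub>F h in at 0. norm (flat n h / h) \<le> \<bar>h\<bar> * K"
    by (intro always_eventually allI) (simp only: real_norm_def b)
  ultimately have "((\<lambda>h. flat n h / h) \<longlongrightarrow> 0) (at 0)"
    using Lim_null_comparison[of "\<lambda>h. flat n h / h" "\<lambda>h. \<bar>h\<bar> * K"] by simp
  then have "((\<lambda>h. (flat n (0 + h) - flat n 0) / h) \<longlongrightarrow> flat (Suc n) 0) (at 0)"
    by (simp add: flat_def[of _ 0])
  then show ?thesis unfolding equal DERIV_def .
qed

text \<open>Sequences of functions in which each is the derivative of its predecessor stand for the derivatives of one smooth
  function; in this form the Leibniz rule needs no iterated derivative operator.\<close>

lemma Leibniz_family:
  fixes f g :: "nat \<Rightarrow> real \<Rightarrow> real"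
  assumes "\<And>n t. (f n has_real_derivative f (Suc n) t) (at t)"
    and "\<And>n t. (g n has_real_derivative g (Suc n) t) (at t)"
  shows "((\<lambda>t. \<Sum>k\<le>n. real (n choose k) * f k t * g (n - k) t) has_real_derivative
    (\<Sum>k\<le>Suc n. real (Suc n choose k) * f k t * g (Suc n - k) t)) (at t)"
proof -
  have "((\<lambda>t. \<Sum>k\<le>n. real (n choose k) * f k t * g (n - k) t) has_real_derivative
    (\<Sum>k\<le>n. real (n choose k) * (f (Suc k) t * g (n - k) t + f k t * g (Suc n - k) t))) (at t)"
    by (auto intro!: derivative_eq_intros assms sum.cong simp: Suc_diff_le algebra_simps)
  also have "(\<Sum>k\<le>n. real (n choose k) * (f (Suc k) t * g (n - k) t + f k t * g (Suc n - k) t))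
     = (\<Sum>k\<le>n. real (n choose k) * f (Suc k) t * g (n - k) t)
       + (\<Sum>k\<le>n. real (n choose k) * f k t * g (Suc n - k) t)"
    by (simp add: sum.distrib algebra_simps)
  also have "(\<Sum>k\<le>n. real (n choose k) * f k t * g (Suc n - k) t)
     = (\<Sum>k\<le>Suc n. real (n choose k) * f k t * g (Suc n - k) t)" by simp
  also have "\<dots> = f 0 t * g (Suc n) t + (\<Sum>k\<le>n. real (n choose Suc k) * f (Suc k) t * g (n - k) t)"
    by (subst sum.atMost_Suc_shift) simp
  also have "(\<Sum>k\<le>n. real (n choose k) * f (Suc k) t * g (n - k) t)
       + (f 0 t * g (Suc n) t + (\<Sum>k\<le>n. real (n choose Suc k) * f (Suc k) t * g (n - k) t))
     = (\<Sum>k\<le>Suc n. real (Suc n choose k) * f k t * g (Suc n - k) t)"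
    by (subst sum.atMost_Suc_shift) (simp add: sum.distrib algebra_simps)
  finally show ?thesis .
qed

text \<open>The \<open>n\<close>-th derivative of \<open>exp (- 1/t) exp (- 1/(T-t))\<close> on \<open>(0,T)\<close>, extended by zero.\<close>

definition bump :: "real \<Rightarrow> nat \<Rightarrow> real \<Rightarrow> real" where
  "bump T n t = (\<Sum>k\<le>n. real (n choose k) * flat k t * ((-1) ^ (n - k) * flat (n - k) (T - t)))"

lemma bump_deriv: "(bump T n has_real_derivative bump T (Suc n) t) (at t)"
  unfolding bump_def
proof (rule Leibniz_family[where f = flat and g = "\<lambda>n t. (-1) ^ n * flat n (T - t)", OF flat_deriv])
  fix n t
  show "((\<lambda>t. (- 1) ^ n * flat n (T - t)) has_real_derivative (- 1) ^ Suc n * flat (Suc n) (T - t)) (at t)"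
  proof -
    have "((\<lambda>t. flat n (T - t)) has_real_derivative flat (Suc n) (T - t) * (-1)) (at t)"
      by (rule DERIV_chain2[OF flat_deriv]) (auto intro!: derivative_eq_intros)
    from DERIV_cmult[OF this, of "(-1) ^ n"] show ?thesis by (simp only: power_Suc mult_ac)
  qed
qed

lemma bump_bound: "\<bar>bump T n t\<bar> \<le> 16 ^ n * (fact n)\<^sup>2"
proof -
  have "\<bar>bump T n t\<bar> \<le> (\<Sum>k\<le>n. \<bar>real (n choose k) * flat k t * ((-1) ^ (n - k) * flat (n - k) (T - t))\<bar>)"
    unfolding bump_def by (rule sum_abs)
  also have "\<dots> \<le> (\<Sum>k\<le>n. 8 ^ n * (fact n)\<^sup>2)"
  proof (rule sum_mono)
    fix k assume "k \<in> {..n}"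
    then have k: "k \<le> n" by simp
    have bf: "real (n choose k) * (fact k * fact (n - k)) = fact n"
      using binomial_fact_lemma[OF k] by (metis mult.commute of_nat_fact of_nat_mult)
    have ff: "fact k * fact (n - k) \<le> (fact n :: real)"
      using bf mult_right_mono[of 1 "real (n choose k)" "fact k * fact (n - k)"] k
      by (simp add: Suc_leI)
    have "\<bar>real (n choose k) * flat k t * ((-1) ^ (n - k) * flat (n - k) (T - t))\<bar>
        = real (n choose k) * (\<bar>flat k t\<bar> * \<bar>flat (n - k) (T - t)\<bar>)"
      by (simp add: abs_mult power_abs)
    also have "\<dots> \<le> real (n choose k) * ((8 ^ k * (fact k)\<^sup>2) * (8 ^ (n - k) * (fact (n - k))\<^sup>2))"
      by (intro mult_left_mono mult_mono flat_bound) auto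
    also have "\<dots> = 8 ^ n * (real (n choose k) * (fact k * fact (n - k))) * (fact k * fact (n - k))"
      using k by (simp add: power2_eq_square mult_ac flip: power_add)
    also have "\<dots> \<le> 8 ^ n * fact n * fact n" unfolding bf by (intro mult_left_mono ff) auto
    finally show "\<bar>real (n choose k) * flat k t * ((-1) ^ (n - k) * flat (n - k) (T - t))\<bar> \<le> 8 ^ n * (fact n)\<^sup>2"
      by (simp add: power2_eq_square)
  qed
  also have "\<dots> = real (n + 1) * (8 ^ n * (fact n)\<^sup>2)" by simp
  also have "\<dots> \<le> 2 ^ n * (8 ^ n * (fact n)\<^sup>2)"
  proof (intro mult_right_mono)
    have "n + 1 \<le> 2 ^ n" by (induction n) auto
    then show "real (n + 1) \<le> 2 ^ n" by (metis of_nat_le_iff of_nat_numeral of_nat_power)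
  qed auto
  also have "\<dots> = 16 ^ n * (fact n)\<^sup>2" by (simp flip: power_mult_distrib)
  finally show ?thesis .
qed

lemma bump_support: "t \<notin> {0<..<T} \<Longrightarrow> bump T n t = 0"
  unfolding bump_def by (intro sum.neutral) (auto simp: flat_def)

lemma bump_nonneg: "0 \<le> bump T 0 t" by (simp add: bump_def flat_def)
lemma bump_pos: "0 < t \<Longrightarrow> t < T \<Longrightarrow> 0 < bump T 0 t" by (simp add: bump_def flat_def)

section \<open>Infinite products of differential operators\<close>

text \<open>The product of the operators \<open>1 + x\<^sub>j d/dt\<close> for \<open>j < M\<close>. The argument \<open>D\<close> lists all derivatives of a function, and so
  does the result.\<close>

primrec diff_op :: "(nat \<Rightarrow> real) \<Rightarrow> nat \<Rightarrow> (nat \<Rightarrow> real \<Rightarrow> real) \<Rightarrow> nat \<Rightarrow> real \<Rightarrow> real" where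
  "diff_op x 0 D = D"
| "diff_op x (Suc M) D = (\<lambda>n t. diff_op x M D n t + x M * diff_op x M D (Suc n) t)"

lemma diff_op_linear:
  "diff_op x M (\<lambda>n t. D n t + c * D' n t) n t = diff_op x M D n t + c * diff_op x M D' n t"
  by (induction M arbitrary: n) (auto simp: algebra_simps)

lemma diff_op_shift: "diff_op x M (\<lambda>n. D (Suc n)) n t = diff_op x M D (Suc n) t"
  by (induction M arbitrary: n) auto

lemma diff_op_Suc: "diff_op x (Suc M) D n t = diff_op x M (\<lambda>n t. D n t + x M * D (Suc n) t) n t"
  by (simp only: diff_op_linear diff_op_shift[of x M D]) simp

lemma diff_op_deriv:
  assumes "\<And>n t. (D n has_real_derivative D (Suc n) t) (at t)"
  shows "(diff_op x M D n has_real_derivative diff_op x M D (Suc n) t) (at t)"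
  by (induction M arbitrary: n) (auto intro!: derivative_eq_intros assms)

lemma diff_op_support: "(\<And>n. D n t = 0) \<Longrightarrow> diff_op x M D n t = 0"
  by (induction M arbitrary: n) auto

text \<open>Expanding the product naively loses too much. Peeling off one factor at a time turns a bound \<open>B C\<^sup>k (k!)\<^sup>2\<close> for
  \<open>k \<le> M+1\<close> derivatives into the same bound for \<open>k \<le> M\<close> derivatives, with \<open>B\<close> enlarged by \<open>1 + C \<bar>x\<^sub>M\<bar> (M+1)\<^sup>2\<close>: the square
  of the factorials is paid by \<open>(k+1)\<^sup>2 \<le> (M+1)\<^sup>2\<close>. The resulting product converges when \<open>x\<^sub>j = O(j\<^sup>-\<^sup>4)\<close>.\<close>

lemma diff_op_bound:
  assumes "\<And>k. k \<le> M \<Longrightarrow> \<bar>D (n + k) t\<bar> \<le> B * C ^ k * (fact k)\<^sup>2" "0 \<le> C"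
  shows "\<bar>diff_op x M D n t\<bar> \<le> B * (\<Prod>j<M. 1 + C * \<bar>x j\<bar> * (real j + 1)\<^sup>2)"
  using assms(1)
proof (induction M arbitrary: D B)
  case 0
  then show ?case using 0[of 0] by simp
next
  case (Suc M)
  have B: "0 \<le> B" using Suc.prems[of 0] by simp
  have "\<bar>D (n + k) t + x M * D (Suc (n + k)) t\<bar>
      \<le> (B * (1 + C * \<bar>x M\<bar> * (real M + 1)\<^sup>2)) * C ^ k * (fact k)\<^sup>2" if k: "k \<le> M" for k
  proof -
    have "\<bar>D (n + k) t + x M * D (Suc (n + k)) t\<bar> \<le> \<bar>D (n + k) t\<bar> + \<bar>x M\<bar> * \<bar>D (n + Suc k) t\<bar>"
      using abs_triangle_ineq[of "D (n + k) t" "x M * D (Suc (n + k)) t"] by (simp add: abs_mult)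
    also have "\<dots> \<le> B * C ^ k * (fact k)\<^sup>2 + \<bar>x M\<bar> * (B * C ^ Suc k * (fact (Suc k))\<^sup>2)"
      using k by (intro add_mono mult_left_mono Suc.prems) auto
    also have "\<dots> = B * C ^ k * (fact k)\<^sup>2 * (1 + C * \<bar>x M\<bar> * (real k + 1)\<^sup>2)"
      by (simp add: power2_eq_square algebra_simps)
    also have "\<dots> \<le> B * C ^ k * (fact k)\<^sup>2 * (1 + C * \<bar>x M\<bar> * (real M + 1)\<^sup>2)"
      using k B assms(2) by (intro mult_left_mono add_left_mono power_mono mult_nonneg_nonneg) auto
    finally show ?thesis by (simp add: mult_ac)
  qed
  from Suc.IH[of "\<lambda>n t. D n t + x M * D (Suc n) t", OF this]
  show ?case unfolding diff_op_Suc by (simp add: mult_ac)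
qed

lemma sum_inverse_squares_le: "(\<Sum>j<M. 1 / (real j + 1)\<^sup>2) \<le> 2"
proof -
  have *: "(\<Sum>j<Suc M. 1 / (real j + 1)\<^sup>2) \<le> 2 - 1 / (real M + 1)" for M
  proof (induction M)
    case (Suc M)
    have "1 / (real M + 2)\<^sup>2 \<le> 1 / (real M + 1) - 1 / (real M + 2)"
    proof -
      have "1 / (real M + 2)\<^sup>2 \<le> 1 / ((real M + 1) * (real M + 2))"
        unfolding power2_eq_square by (intro divide_left_mono mult_right_mono) auto
      also have "\<dots> = 1 / (real M + 1) - 1 / (real M + 2)" by (simp add: divide_simps)
      finally show ?thesis .
    qed
    then show ?case using Suc by (simp add: add.commute)
  qed simp
  show ?thesis
  proof (cases M)
    case (Suc N)
    have "0 \<le> 1 / (real N + 1)" by simp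
    then show ?thesis using *[of N] unfolding Suc by linarith
  qed simp
qed

lemma prod_one_plus_le:
  assumes "\<And>j. 0 \<le> a j" "\<And>j. a j \<le> c / (real j + 1)\<^sup>2" "0 \<le> c"
  shows "(\<Prod>j<M. 1 + a j) \<le> exp (2 * c)"
proof -
  have "(\<Prod>j<M. 1 + a j) \<le> (\<Prod>j<M. exp (c * (1 / (real j + 1)\<^sup>2)))"
  proof (intro prod_mono conjI)
    fix j
    show "0 \<le> 1 + a j" using assms(1)[of j] by simp
    have "1 + a j \<le> exp (a j)" by simp
    also have "\<dots> \<le> exp (c * (1 / (real j + 1)\<^sup>2))" using assms(2)[of j] by simp
    finally show "1 + a j \<le> exp (c * (1 / (real j + 1)\<^sup>2))" .
  qed
  also have "\<dots> = exp (c * (\<Sum>j<M. 1 / (real j + 1)\<^sup>2))" by (simp add: exp_sum sum_distrib_left)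
  also have "\<dots> \<le> exp (2 * c)" using mult_left_mono[OF sum_inverse_squares_le[of M] assms(3)] by (simp add: mult.commute)
  finally show ?thesis .
qed

lemma fact_add_le: "fact (n + k) \<le> (2 ^ (n + k) * fact n * fact k :: real)"
proof -
  have "real ((n + k) choose k) = fact (n + k) / (fact k * fact n)"
    using binomial_fact[of k "n + k"] by simp
  then have "fact (n + k) = real ((n + k) choose k) * (fact k * fact n)" by (simp add: field_simps)
  also have "\<dots> \<le> 2 ^ (n + k) * (fact k * fact n)"
  proof (rule mult_right_mono)
    show "real ((n + k) choose k) \<le> 2 ^ (n + k)"
      by (metis binomial_le_pow2 of_nat_le_iff of_nat_numeral of_nat_power)
  qed auto
  finally show ?thesis by (simp add: mult_ac)
qed

text \<open>The constants come from \<open>bump_bound\<close>: the derivatives of order \<open>n + k\<close> with \<open>n \<le> 2\<close> obey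
  \<open>16\<^sup>n\<^sup>+\<^sup>k ((n+k)!)\<^sup>2 \<le> 64\<^sup>2 (2!)\<^sup>2 \<cdot> 64\<^sup>k (k!)\<^sup>2\<close>, and \<open>64\<^sup>2 (2!)\<^sup>2 = 16384\<close>.\<close>

definition op_bound :: "real \<Rightarrow> real" where "op_bound d = 16384 * exp (128 * d)"

lemma diff_op_bump_bound:
  assumes x: "\<And>j. \<bar>x j\<bar> \<le> d / (real j + 1) ^ 4" and n: "n \<le> 2"
  shows "\<bar>diff_op x M (bump T) n t\<bar> \<le> op_bound d"
proof -
  have d: "0 \<le> d" using x[of 0] by simp
  have "\<bar>bump T (n + k) t\<bar> \<le> 16384 * 64 ^ k * (fact k)\<^sup>2" for k
  proof -
    have "\<bar>bump T (n + k) t\<bar> \<le> 16 ^ (n + k) * (fact (n + k))\<^sup>2" by (rule bump_bound)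
    also have "\<dots> \<le> 16 ^ (n + k) * (2 ^ (n + k) * fact n * fact k)\<^sup>2"
      by (intro mult_left_mono power_mono fact_add_le) auto
    also have "\<dots> = (16 * 4) ^ (n + k) * (fact n)\<^sup>2 * (fact k)\<^sup>2"
    proof -
      have "(2 ^ (n + k) :: real)\<^sup>2 = 4 ^ (n + k)" by (simp add: power2_eq_square flip: power_mult_distrib)
      then show ?thesis by (simp only: power_mult_distrib mult.assoc)
    qed
    also have "\<dots> = (64 ^ n * (fact n)\<^sup>2) * (64 ^ k * (fact k)\<^sup>2)"
      by (simp add: power_add mult_ac)
    also have "\<dots> \<le> 16384 * (64 ^ k * (fact k)\<^sup>2)"
    proof (rule mult_right_mono)
      have "n = 0 \<or> n = 1 \<or> n = 2" using n by auto
      then show "64 ^ n * (fact n)\<^sup>2 \<le> (16384::real)" by (auto simp: fact_2)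
    qed auto
    finally show ?thesis by (simp add: mult_ac)
  qed
  from diff_op_bound[of M "bump T" n t 16384 64 x, OF this]
  have "\<bar>diff_op x M (bump T) n t\<bar> \<le> 16384 * (\<Prod>j<M. 1 + 64 * \<bar>x j\<bar> * (real j + 1)\<^sup>2)" by simp
  also have "\<dots> \<le> 16384 * exp (2 * (64 * d))"
  proof (intro mult_left_mono prod_one_plus_le)
    fix j
    have "64 * \<bar>x j\<bar> * (real j + 1)\<^sup>2 \<le> 64 * (d / (real j + 1) ^ 4) * (real j + 1)\<^sup>2"
      by (intro mult_right_mono mult_left_mono x) auto
    also have "\<dots> = 64 * d / (real j + 1)\<^sup>2"
    proof -
      have "64 * (d / q ^ 4) * q\<^sup>2 = 64 * d / q\<^sup>2" if "q > 0" for q :: real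
        using that by (simp add: field_simps power2_eq_square power4_eq_xxxx)
      from this[of "real j + 1"] show ?thesis by simp
    qed
    finally show "64 * \<bar>x j\<bar> * (real j + 1)\<^sup>2 \<le> 64 * d / (real j + 1)\<^sup>2" .
  qed (use d in auto)
  finally show ?thesis by (simp add: op_bound_def)
qed

text \<open>The derivative and a common bound of both functions are part of the notion, so that series of such functions can be
  summed by the Weierstrass test.\<close>

definition C1_bump :: "real \<Rightarrow> real \<Rightarrow> (real \<Rightarrow> real) \<Rightarrow> (real \<Rightarrow> real) \<Rightarrow> bool" where
  "C1_bump T K g g' \<longleftrightarrow> (\<forall>t. (g has_real_derivative g' t) (at t)) \<and> continuous_on UNIV g' \<and>
     (\<forall>t. t \<notin> {0<..<T} \<longrightarrow> g t = 0 \<and> g' t = 0) \<and> (\<forall>t. \<bar>g t\<bar> \<le> K \<and> \<bar>g' t\<bar> \<le> K)"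

lemma C1_bump_continuous: "C1_bump T K g g' \<Longrightarrow> continuous_on A g"
  unfolding C1_bump_def by (meson DERIV_continuous continuous_at_imp_continuous_on)

lemma C1_bump_scale: "C1_bump T K g g' \<Longrightarrow> C1_bump T (\<bar>c\<bar> * K) (\<lambda>t. c * g t) (\<lambda>t. c * g' t)"
  unfolding C1_bump_def by (auto intro!: derivative_eq_intros continuous_intros mult_left_mono simp: abs_mult)

lemma C1_bump_suminf:
  assumes g: "\<And>n. C1_bump T (K n) (g n) (g' n)" and K: "summable K"
  shows "C1_bump T (suminf K) (\<lambda>t. \<Sum>n. g n t) (\<lambda>t. \<Sum>n. g' n t)"
    and "(\<lambda>n. integral {0..T} (\<lambda>s. exp (\<sigma> * s) * g n s)) sums
      integral {0..T} (\<lambda>s. exp (\<sigma> * s) * (\<Sum>n. g n s))"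
proof -
  have bg: "norm (g n t) \<le> K n" and bg': "norm (g' n t) \<le> K n" for n t
    using g unfolding C1_bump_def by auto
  have u: "uniform_limit UNIV (\<lambda>n t. \<Sum>i<n. g i t) (\<lambda>t. \<Sum>n. g n t) sequentially"
    by (rule Weierstrass_m_test[OF bg K])
  have u': "uniform_limit UNIV (\<lambda>n t. \<Sum>i<n. g' i t) (\<lambda>t. \<Sum>n. g' n t) sequentially"
    by (rule Weierstrass_m_test[OF bg' K])
  have sg: "summable (\<lambda>n. g n t)" for t
    using summable_comparison_test'[OF K bg] by auto
  have cg': "continuous_on UNIV (\<lambda>t. \<Sum>n. g' n t)"
    by (rule uniform_limit_theorem[OF _ u']) (use g in \<open>auto simp: C1_bump_def intro!: always_eventually continuous_on_sum\<close>)
  have "((\<lambda>t. \<Sum>n. g n t) has_real_derivative (\<Sum>n. g' n t)) (at t)" for t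
  proof -
    have d: "(g n has_real_derivative g' n x) (at x within UNIV)" for n x
      using g by (auto simp: C1_bump_def)
    have uc: "uniformly_convergent_on UNIV (\<lambda>n x. \<Sum>i<n. g' i x)"
      using u' by (auto simp: uniformly_convergent_on_def)
    show ?thesis
      by (rule has_field_derivative_series'(2)[of UNIV g g' 0 t, OF convex_UNIV d uc UNIV_I sg]) simp
  qed
  moreover have "\<bar>\<Sum>n. g n t\<bar> \<le> suminf K" "\<bar>\<Sum>n. g' n t\<bar> \<le> suminf K" for t
    using norm_suminf_le[of "\<lambda>n. g n t" K, OF bg K] norm_suminf_le[of "\<lambda>n. g' n t" K, OF bg' K] by auto
  ultimately show "C1_bump T (suminf K) (\<lambda>t. \<Sum>n. g n t) (\<lambda>t. \<Sum>n. g' n t)"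
    using g cg' unfolding C1_bump_def by auto
  have "uniform_limit {0..T} (\<lambda>n s. exp (\<sigma> * s) * (\<Sum>i<n. g i s)) (\<lambda>s. exp (\<sigma> * s) * (\<Sum>n. g n s)) sequentially"
  proof (rule uniform_lim_mult)
    show "uniform_limit {0..T} (\<lambda>n s. exp (\<sigma> * s)) (\<lambda>s. exp (\<sigma> * s)) sequentially"
      by (rule uniform_limit_const)
    show "uniform_limit {0..T} (\<lambda>n t. \<Sum>i<n. g i t) (\<lambda>t. \<Sum>n. g n t) sequentially"
      by (rule uniform_limit_on_subset[OF u]) auto
    show "bounded ((\<lambda>s. exp (\<sigma> * s)) ` {0..T})"
      by (intro compact_imp_bounded compact_continuous_image continuous_intros compact_Icc)
    show "bounded ((\<lambda>t. \<Sum>n. g n t) ` {0..T})"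
      using \<open>\<And>t. \<bar>\<Sum>n. g n t\<bar> \<le> suminf K\<close> unfolding bounded_iff by auto
  qed
  moreover have "continuous_on {0..T} (\<lambda>s. exp (\<sigma> * s) * (\<Sum>i<n. g i s))" for n
    by (intro continuous_intros C1_bump_continuous[OF g])
  ultimately obtain I J where
    IJ: "\<And>n. ((\<lambda>s. exp (\<sigma> * s) * (\<Sum>i<n. g i s)) has_integral I n) {0..T}"
      "((\<lambda>s. exp (\<sigma> * s) * (\<Sum>n. g n s)) has_integral J) {0..T}" "(I \<longlongrightarrow> J) sequentially"
    by (rule uniform_limit_integral) auto
  have int: "(\<lambda>s. exp (\<sigma> * s) * g n s) integrable_on {0..T}" for n
    by (intro integrable_continuous_real continuous_intros C1_bump_continuous[OF g])
  have "I = (\<lambda>n. \<Sum>i<n. integral {0..T} (\<lambda>s. exp (\<sigma> * s) * g i s))"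
    using integral_unique[OF IJ(1)] int by (auto simp: sum_distrib_left integral_sum fun_eq_iff)
  then show "(\<lambda>n. integral {0..T} (\<lambda>s. exp (\<sigma> * s) * g n s)) sums
      integral {0..T} (\<lambda>s. exp (\<sigma> * s) * (\<Sum>n. g n s))"
    using IJ(2,3) by (simp add: sums_def integral_unique)
qed

lemma C1_bump_deriv_moment:
  assumes "0 \<le> T" "C1_bump T K g g'"
  shows "integral {0..T} (\<lambda>s. exp (\<sigma> * s) * g' s) = - \<sigma> * integral {0..T} (\<lambda>s. exp (\<sigma> * s) * g s)"
proof -
  have c: "continuous_on {0..T} g" "continuous_on {0..T} g'"
    using C1_bump_continuous[OF assms(2)] assms(2) by (auto simp: C1_bump_def intro: continuous_on_subset)
  have "((\<lambda>s. \<sigma> * (exp (\<sigma> * s) * g s) + exp (\<sigma> * s) * g' s) has_integral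
      (exp (\<sigma> * T) * g T - exp (\<sigma> * 0) * g 0)) {0..T}"
  proof (rule fundamental_theorem_of_calculus[OF assms(1)])
    fix s
    have "((\<lambda>s. exp (\<sigma> * s) * g s) has_real_derivative \<sigma> * (exp (\<sigma> * s) * g s) + exp (\<sigma> * s) * g' s) (at s)"
      using assms(2) by (auto simp: C1_bump_def intro!: derivative_eq_intros)
    then show "((\<lambda>s. exp (\<sigma> * s) * g s) has_vector_derivative \<sigma> * (exp (\<sigma> * s) * g s) + exp (\<sigma> * s) * g' s) (at s within {0..T})"
      by (simp add: has_real_derivative_iff_has_vector_derivative has_vector_derivative_at_within)
  qed
  moreover have "g T = 0" "g 0 = 0" using assms(2) by (auto simp: C1_bump_def)
  moreover have "(\<lambda>s. exp (\<sigma> * s) * g s) integrable_on {0..T}" "(\<lambda>s. exp (\<sigma> * s) * g' s) integrable_on {0..T}"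
    by (intro integrable_continuous_real continuous_intros c)+
  ultimately show ?thesis
    by (simp add: has_integral_iff integral_add integrable_on_mult_right)
qed

lemma diff_op_bump_C1:
  assumes "\<And>j. \<bar>x j\<bar> \<le> d / (real j + 1) ^ 4" "n \<le> 1"
  shows "C1_bump T (op_bound d) (diff_op x M (bump T) n) (diff_op x M (bump T) (Suc n))"
  unfolding C1_bump_def
  using diff_op_deriv[of "bump T", OF bump_deriv] assms
    DERIV_continuous[OF diff_op_deriv[of "bump T", OF bump_deriv]]
  by (auto intro!: diff_op_support diff_op_bump_bound bump_support continuous_at_imp_continuous_on)

text \<open>Integration by parts turns \<open>1 + x\<^sub>j d/dt\<close> into multiplication of the moment by \<open>1 - x\<^sub>j \<sigma>\<close>.\<close>

lemma diff_op_moment: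
  assumes "\<And>j. \<bar>x j\<bar> \<le> d / (real j + 1) ^ 4" "0 \<le> T"
  shows "integral {0..T} (\<lambda>s. exp (\<sigma> * s) * diff_op x M (bump T) 0 s)
    = (\<Prod>j<M. 1 - x j * \<sigma>) * integral {0..T} (\<lambda>s. exp (\<sigma> * s) * bump T 0 s)"
proof (induction M)
  case (Suc M)
  have int: "(\<lambda>s. exp (\<sigma> * s) * diff_op x M (bump T) n s) integrable_on {0..T}" if "n \<le> 1" for n
    by (intro integrable_continuous_real continuous_intros C1_bump_continuous[OF diff_op_bump_C1[OF assms(1) that]])
  have "integral {0..T} (\<lambda>s. exp (\<sigma> * s) * diff_op x (Suc M) (bump T) 0 s)
     = integral {0..T} (\<lambda>s. exp (\<sigma> * s) * diff_op x M (bump T) 0 s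
        + x M * (exp (\<sigma> * s) * diff_op x M (bump T) (Suc 0) s))"
    by (simp add: algebra_simps)
  also have "\<dots> = integral {0..T} (\<lambda>s. exp (\<sigma> * s) * diff_op x M (bump T) 0 s)
        + x M * integral {0..T} (\<lambda>s. exp (\<sigma> * s) * diff_op x M (bump T) (Suc 0) s)"
    using int[of 0] int[of 1] by (simp add: integral_add integrable_on_mult_right)
  also have "\<dots> = (1 - x M * \<sigma>) * integral {0..T} (\<lambda>s. exp (\<sigma> * s) * diff_op x M (bump T) 0 s)"
    using C1_bump_deriv_moment[OF assms(2) diff_op_bump_C1[OF assms(1), of 0 T M], of \<sigma>] by (simp add: algebra_simps)
  finally show ?case using Suc by simp
qed simp

text \<open>The partial products applied to the bump form a series: the step from \<open>M\<close> to \<open>M+1\<close> adds \<open>x\<^sub>M\<close> times a function bounded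
  uniformly in \<open>M\<close>, and \<open>\<Sum> \<bar>x\<^sub>M\<bar>\<close> converges. So the limit exists in \<open>C\<^sup>1\<close>, and its moments are the limits of the
  moments.\<close>

lemma infinite_order_operator_on_bump:
  assumes x: "\<And>j. \<bar>x j\<bar> \<le> d / (real j + 1) ^ 4" and T: "0 \<le> T"
  obtains g g' where "C1_bump T (op_bound d * (1 + 2 * d)) g g'"
    "\<And>\<sigma>. (\<lambda>M. (\<Prod>j<M. 1 - x j * \<sigma>) * integral {0..T} (\<lambda>s. exp (\<sigma> * s) * bump T 0 s))
        \<longlonglongrightarrow> integral {0..T} (\<lambda>s. exp (\<sigma> * s) * g s)"
proof -
  \<comment> \<open>The increments of the sequence of partial products: \<open>h 0\<close> is the bump itself, so that the partial sum up to \<open>M\<close> is the product of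
    the first \<open>M\<close> operators.\<close>
  define h where "h M = (case M of 0 \<Rightarrow> bump T 0 | Suc M \<Rightarrow> \<lambda>t. x M * diff_op x M (bump T) 1 t)" for M
  define h' where "h' M = (case M of 0 \<Rightarrow> bump T 1 | Suc M \<Rightarrow> \<lambda>t. x M * diff_op x M (bump T) 2 t)" for M
  define K where "K M = (case M of 0 \<Rightarrow> op_bound d | Suc M \<Rightarrow> \<bar>x M\<bar> * op_bound d)" for M
  have d: "0 \<le> d" using x[of 0] by simp
  have C: "C1_bump T (K M) (h M) (h' M)" for M
  proof (cases M)
    case 0
    then show ?thesis using diff_op_bump_C1[of x d 0 T 0, OF x] by (simp add: h_def h'_def K_def)
  next
    case (Suc N)
    then show ?thesis using C1_bump_scale[OF diff_op_bump_C1[of x d 1 T N, OF x], of "x N"]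
      by (simp add: h_def h'_def K_def numeral_2_eq_2)
  qed
  have partial: "(\<Sum>i<Suc M. h i t) = diff_op x M (bump T) 0 t" for M t
    by (induction M) (simp_all add: h_def)
  have x2: "\<bar>x j\<bar> \<le> d * (1 / (real j + 1)\<^sup>2)" for j
  proof -
    have "(real j + 1)\<^sup>2 \<le> (real j + 1) ^ 4" by (intro power_increasing) auto
    then have "d / (real j + 1) ^ 4 \<le> d / (real j + 1)\<^sup>2" using d by (intro divide_left_mono) auto
    then show ?thesis using x[of j] by simp
  qed
  have op0: "0 \<le> op_bound d" by (simp add: op_bound_def)
  have sumx: "(\<Sum>j<M. \<bar>x j\<bar>) \<le> 2 * d" for M
  proof -
    have "(\<Sum>j<M. \<bar>x j\<bar>) \<le> d * (\<Sum>j<M. 1 / (real j + 1)\<^sup>2)"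
      unfolding sum_distrib_left by (intro sum_mono x2)
    then show ?thesis using mult_left_mono[OF sum_inverse_squares_le[of M] d] by simp
  qed
  have sx: "summable (\<lambda>j. \<bar>x j\<bar>)" by (rule summableI_nonneg_bounded[OF _ sumx]) auto
  have "summable (\<lambda>M. K (Suc M))" unfolding K_def by (simp add: summable_mult2 sx)
  then have sK: "summable K" by (simp add: summable_Suc_iff)
  have "suminf K = op_bound d + (\<Sum>M. \<bar>x M\<bar> * op_bound d)"
    using suminf_split_head[OF sK] by (simp add: K_def)
  also have "\<dots> = op_bound d + (\<Sum>M. \<bar>x M\<bar>) * op_bound d" using sx by (simp add: suminf_mult2)
  also have "\<dots> \<le> op_bound d + 2 * d * op_bound d"
    using suminf_le_const[OF sx sumx] op0 by (intro add_left_mono mult_right_mono)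
  finally have sKle: "suminf K \<le> op_bound d * (1 + 2 * d)" by (simp add: algebra_simps)
  let ?g = "\<lambda>t. \<Sum>n. h n t" and ?g' = "\<lambda>t. \<Sum>n. h' n t"
  have 1: "C1_bump T (op_bound d * (1 + 2 * d)) ?g ?g'"
    using C1_bump_suminf(1)[OF C sK] sKle unfolding C1_bump_def by (meson order_trans)
  have 2: "(\<lambda>M. (\<Prod>j<M. 1 - x j * \<sigma>) * integral {0..T} (\<lambda>s. exp (\<sigma> * s) * bump T 0 s))
        \<longlonglongrightarrow> integral {0..T} (\<lambda>s. exp (\<sigma> * s) * ?g s)" for \<sigma>
  proof -
    have "(\<lambda>M. \<Sum>i<Suc M. integral {0..T} (\<lambda>s. exp (\<sigma> * s) * h i s))
        \<longlonglongrightarrow> integral {0..T} (\<lambda>s. exp (\<sigma> * s) * ?g s)"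
      using C1_bump_suminf(2)[OF C sK, of \<sigma>] unfolding sums_def by (rule LIMSEQ_Suc)
    moreover have "(\<Sum>i<Suc M. integral {0..T} (\<lambda>s. exp (\<sigma> * s) * h i s))
        = (\<Prod>j<M. 1 - x j * \<sigma>) * integral {0..T} (\<lambda>s. exp (\<sigma> * s) * bump T 0 s)" for M
    proof -
      have "(\<Sum>i<Suc M. integral {0..T} (\<lambda>s. exp (\<sigma> * s) * h i s))
          = integral {0..T} (\<lambda>s. \<Sum>i<Suc M. exp (\<sigma> * s) * h i s)"
        by (subst integral_sum) (auto intro!: integrable_continuous_real continuous_intros C1_bump_continuous[OF C])
      also have "\<dots> = integral {0..T} (\<lambda>s. exp (\<sigma> * s) * diff_op x M (bump T) 0 s)"
        unfolding partial[symmetric] sum_distrib_left ..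
      finally show ?thesis using diff_op_moment[OF x T] by simp
    qed
    ultimately show ?thesis by simp
  qed
  show ?thesis by (rule that[OF 1 2])
qed

section \<open>The moment problem for real exponentials\<close>

lemma one_minus_ge_exp: "0 \<le> u \<Longrightarrow> u \<le> 1/2 \<Longrightarrow> exp (- 2 * u) \<le> 1 - (u::real)"
proof -
  assume u: "0 \<le> u" "u \<le> 1/2"
  have "2 * (u * u) \<le> u" using mult_left_mono[OF u(2) u(1)] by simp
  then have "- 2 * u \<le> - u - 2 * u\<^sup>2" by (simp add: power2_eq_square)
  also have "\<dots> \<le> ln (1 - u)" by (rule ln_one_minus_pos_lower_bound[OF u])
  finally have "exp (- 2 * u) \<le> exp (ln (1 - u))" by (simp only: exp_le_cancel_iff)
  then show ?thesis using u by simp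
qed

text \<open>Each factor is bounded below by \<open>exp (- B (2 + l) / (j+1)\<^sup>2)\<close>, where \<open>B = \<surd>(2s/c0)\<close>. If \<open>\<sigma>\<^sub>j \<le> 2s\<close>, then \<open>(j+1)\<^sup>2 \<le> B\<close>, so this bound is
  at most \<open>exp (- l)\<close>, which the gap guarantees. If \<open>\<sigma>\<^sub>j > 2s\<close>, then \<open>s/\<sigma>\<^sub>j\<close> lies in \<open>[0, 1/2]\<close> and is at most \<open>B/(j+1)\<^sup>2\<close>.\<close>

lemma canonical_product_lower_bound:
  fixes \<sigma> :: "nat \<Rightarrow> real" and s c0 \<delta> :: real
  assumes c0: "c0 > 0" and \<delta>: "\<delta> > 0" and s: "s > 0"
    and growth: "\<And>j. c0 * (real j + 1) ^ 4 \<le> \<sigma> j"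
    and gap: "\<And>j. j \<in> J \<Longrightarrow> \<delta> \<le> \<bar>\<sigma> j - s\<bar>"
  shows "exp (- 2 * sqrt (2 * s / c0) * (2 + ln (1 + 2 * s / \<delta>)))
    \<le> \<bar>\<Prod>j<M. 1 - (if j \<in> J then 1 / \<sigma> j else 0) * s\<bar>"
proof -
  define B where "B = sqrt (2 * s / c0)"
  define l where "l = ln (1 + 2 * s / \<delta>)"
  have B: "0 \<le> B" "B\<^sup>2 = 2 * s / c0" using c0 s by (auto simp: B_def)
  have l: "0 \<le> l" using s \<delta> by (simp add: l_def)
  have each: "exp (- (B * (2 + l)) * (1 / (real j + 1)\<^sup>2)) \<le> \<bar>1 - (if j \<in> J then 1 / \<sigma> j else 0) * s\<bar>" for j
  proof (cases "j \<in> J")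
    case False
    then show ?thesis using B l by simp
  next
    case True
    define q where "q = (real j + 1)\<^sup>2"
    have q: "q > 0" "c0 * q\<^sup>2 \<le> \<sigma> j" using growth[of j] by (auto simp: q_def power2_eq_square power4_eq_xxxx mult_ac)
    have \<sigma>: "\<sigma> j > 0" using q c0 by (smt (verit) mult_pos_pos zero_less_power)
    have eq: "\<bar>1 - (if j \<in> J then 1 / \<sigma> j else 0) * s\<bar> = \<bar>\<sigma> j - s\<bar> / \<sigma> j"
      using True \<sigma> by (simp add: field_simps abs_divide flip: diff_divide_distrib)
    show ?thesis
    proof (cases "\<sigma> j \<le> 2 * s")
      case le: True
      have "q\<^sup>2 \<le> B\<^sup>2" using q le c0 unfolding B by (simp add: field_simps)
      then have qB: "1 \<le> B / q" using q(1) B(1) by (simp add: power2_le_iff_abs_le)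
      have "exp (- (B * (2 + l)) * (1 / q)) \<le> exp (- l)"
      proof -
        have "l \<le> (2 + l) * (B / q)" using mult_mono[of l "2 + l" 1 "B / q"] l qB by simp
        then show ?thesis by (simp add: mult_ac)
      qed
      also have "\<dots> = 1 / (1 + 2 * s / \<delta>)"
      proof -
        have "0 < 1 + 2 * s / \<delta>" using s \<delta> by (smt (verit) divide_pos_pos)
        then show ?thesis by (simp add: l_def exp_minus inverse_eq_divide)
      qed
      also have "\<dots> \<le> \<delta> / (2 * s)" using s \<delta> by (simp add: field_simps)
      also have "\<dots> \<le> \<delta> / \<sigma> j" using le \<sigma> \<delta> by (intro divide_left_mono) auto
      also have "\<dots> \<le> \<bar>\<sigma> j - s\<bar> / \<sigma> j" using gap[OF True] \<sigma> by (intro divide_right_mono) auto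
      finally show ?thesis unfolding eq q_def .
    next
      case gt: False
      have u: "0 \<le> s / \<sigma> j" "s / \<sigma> j \<le> 1/2" using gt \<sigma> s by (auto simp: field_simps)
      have "(s / \<sigma> j)\<^sup>2 \<le> (B / q)\<^sup>2"
      proof -
        have "(s / \<sigma> j)\<^sup>2 \<le> s / \<sigma> j * 1" unfolding power2_eq_square by (rule mult_left_mono) (use u in linarith)+
        also have "\<dots> \<le> s / (c0 * q\<^sup>2)" using q c0 s \<sigma> by (simp, intro divide_left_mono mult_pos_pos) auto
        also have "\<dots> \<le> 2 * s / (c0 * q\<^sup>2)" using q c0 s by (intro divide_right_mono) auto
        also have "\<dots> = (B / q)\<^sup>2" unfolding power_divide B by simp
        finally show ?thesis .
      qed
      then have "s / \<sigma> j \<le> B / q" by (rule power2_le_imp_le) (use B q in simp)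
      then have "- (B * (2 + l)) * (1 / q) \<le> - 2 * (s / \<sigma> j)"
      proof -
        have "B / q * 2 \<le> B / q * (2 + l)" using B q l by (intro mult_left_mono) auto
        moreover have "- (B * (2 + l)) * (1 / q) = - (B / q * (2 + l))" by simp
        ultimately show ?thesis using \<open>s / \<sigma> j \<le> B / q\<close> by linarith
      qed
      then have "exp (- (B * (2 + l)) * (1 / q)) \<le> exp (- 2 * (s / \<sigma> j))" by (simp only: exp_le_cancel_iff)
      also have "\<dots> \<le> 1 - s / \<sigma> j" by (rule one_minus_ge_exp[OF u])
      also have "\<dots> = (\<sigma> j - s) / \<sigma> j" using \<sigma> by (simp add: field_simps)
      also have "\<dots> \<le> \<bar>\<sigma> j - s\<bar> / \<sigma> j" using \<sigma> by (intro divide_right_mono) auto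
      finally show ?thesis unfolding eq q_def .
    qed
  qed
  have Bl: "0 \<le> B * (2 + l)" using B l by simp
  have "exp (- 2 * B * (2 + l)) \<le> exp (- (B * (2 + l)) * (\<Sum>j<M. 1 / (real j + 1)\<^sup>2))"
    using mult_left_mono[OF sum_inverse_squares_le[of M] Bl] by (simp add: mult_ac)
  also have "\<dots> = (\<Prod>j<M. exp (- (B * (2 + l)) * (1 / (real j + 1)\<^sup>2)))"
    by (simp only: exp_sum[OF finite_lessThan, symmetric] sum_distrib_left)
  also have "\<dots> \<le> (\<Prod>j<M. \<bar>1 - (if j \<in> J then 1 / \<sigma> j else 0) * s\<bar>)"
    by (intro prod_mono conjI each) auto
  finally show ?thesis unfolding B_def l_def by (simp only: abs_prod)
qed

text \<open>On \<open>[T/2, 3T/4]\<close> the bump is bounded below by a positive constant and \<open>exp (s t) \<ge> exp (s T/2)\<close>.\<close>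

lemma bump_laplace_lower_bound:
  assumes "T > 0"
  obtains b where "b > 0" "\<And>s. s \<ge> 0 \<Longrightarrow> b * exp (s * T / 2) \<le> integral {0..T} (\<lambda>t. exp (s * t) * bump T 0 t)"
proof -
  have cb: "continuous_on A (bump T 0)" for A
    using DERIV_continuous[OF bump_deriv] by (intro continuous_at_imp_continuous_on) blast
  define I where "I = {T/2..3*T/4}"
  have "\<exists>x\<in>I. \<forall>y\<in>I. bump T 0 x \<le> bump T 0 y"
    unfolding I_def using assms by (intro continuous_attains_inf cb) auto
  then obtain x where x: "x \<in> I" "\<And>y. y \<in> I \<Longrightarrow> bump T 0 x \<le> bump T 0 y" by blast
  have pos: "0 < bump T 0 x" using x(1) assms by (intro bump_pos) (auto simp: I_def)
  have int: "(\<lambda>t. exp (s * t) * bump T 0 t) integrable_on {a..b}" for s a b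
    by (intro integrable_continuous_real continuous_intros cb)
  have "T / 4 * bump T 0 x * exp (s * T / 2) \<le> integral {0..T} (\<lambda>t. exp (s * t) * bump T 0 t)" if "s \<ge> 0" for s
  proof -
    have "T / 4 * bump T 0 x * exp (s * T / 2) = integral I (\<lambda>t. exp (s * T / 2) * bump T 0 x)"
      unfolding I_def using assms by simp
    also have "\<dots> \<le> integral I (\<lambda>t. exp (s * t) * bump T 0 t)"
      unfolding I_def
    proof (rule integral_le[OF _ int])
      fix t assume t: "t \<in> {T/2..3*T/4}"
      have "s * T / 2 \<le> s * t" using t that mult_left_mono[of "T/2" t s] by simp
      then show "exp (s * T / 2) * bump T 0 x \<le> exp (s * t) * bump T 0 t"
        using t x pos by (intro mult_mono) (auto simp: I_def)
    qed auto
    also have "\<dots> \<le> integral {0..T} (\<lambda>t. exp (s * t) * bump T 0 t)"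
      using assms by (intro integral_subset_le) (auto simp: I_def bump_nonneg intro: int)
    finally show ?thesis .
  qed
  then show ?thesis using that[of "T / 4 * bump T 0 x"] pos assms by auto
qed

text \<open>The loss in the canonical product is of order \<open>\<surd>\<sigma> log \<sigma> = o(\<sigma>)\<close>, so it is absorbed by half of the gain
  \<open>\<sigma> T/2\<close>; the other half is at least linear in \<open>n\<close>.\<close>

lemma summable_moment_weights:
  fixes \<sigma> :: "nat \<Rightarrow> real"
  assumes "c0 > 0" "\<delta> > 0" "T > 0" and growth: "\<And>j. c0 * (real j + 1) ^ 4 \<le> \<sigma> j"
  shows "summable (\<lambda>n. exp (2 * sqrt (2 * \<sigma> n / c0) * (2 + ln (1 + 2 * \<sigma> n / \<delta>)) - \<sigma> n * T / 2))"
proof -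
  have "((\<lambda>s. 2 * sqrt (2 * s / c0) * (2 + ln (1 + 2 * s / \<delta>)) / s) \<longlongrightarrow> 0) at_top"
    using assms(1,2) by real_asymp
  then have "\<forall>\<^sub>F s in at_top. 2 * sqrt (2 * s / c0) * (2 + ln (1 + 2 * s / \<delta>)) / s < T / 4"
    using assms(3) by (intro order_tendstoD) auto
  then have ev: "\<forall>\<^sub>F s in at_top. 2 * sqrt (2 * s / c0) * (2 + ln (1 + 2 * s / \<delta>)) \<le> s * T / 4"
    using eventually_gt_at_top[of 0] by eventually_elim (simp add: field_simps)
  have lin: "c0 * (real n + 1) \<le> \<sigma> n" for n
  proof -
    have "(real n + 1) ^ 1 \<le> (real n + 1) ^ 4" by (intro power_increasing) auto
    then have "c0 * (real n + 1) \<le> c0 * (real n + 1) ^ 4" using assms(1) by simp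
    then show ?thesis using growth[of n] by linarith
  qed
  have "filterlim (\<lambda>n. c0 * (real n + 1)) at_top sequentially" using assms(1) by real_asymp
  then have "filterlim \<sigma> at_top sequentially"
    by (rule filterlim_at_top_mono) (simp add: lin)
  from eventually_compose_filterlim[OF ev this]
  have ev2: "\<forall>\<^sub>F n in sequentially. norm (exp (2 * sqrt (2 * \<sigma> n / c0) * (2 + ln (1 + 2 * \<sigma> n / \<delta>)) - \<sigma> n * T / 2))
      \<le> exp (- (c0 * T / 4)) ^ n"
  proof eventually_elim
    case (elim n)
    have "2 * sqrt (2 * \<sigma> n / c0) * (2 + ln (1 + 2 * \<sigma> n / \<delta>)) - \<sigma> n * T / 2 \<le> - (\<sigma> n * (T / 4))"
      using elim by simp
    also have "\<dots> \<le> - (c0 * real n * (T / 4))"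
    proof -
      have "c0 * real n \<le> \<sigma> n" using lin[of n] assms(1) by (simp add: algebra_simps)
      then show ?thesis using assms(3) by (simp add: mult_right_mono)
    qed
    also have "\<dots> = real n * - (c0 * T / 4)" by simp
    finally have "exp (2 * sqrt (2 * \<sigma> n / c0) * (2 + ln (1 + 2 * \<sigma> n / \<delta>)) - \<sigma> n * T / 2)
       \<le> exp (real n * - (c0 * T / 4))" by (simp only: exp_le_cancel_iff)
    then show ?case by (simp only: exp_of_nat_mult real_norm_def abs_exp_cancel)
  qed
  show ?thesis
    by (rule summable_comparison_test_ev[OF ev2 summable_geometric]) (use assms in simp)
qed

text \<open>A coincidence \<open>\<sigma>\<^sub>i = \<sigma>\<^sub>j\<close> makes one exponential out of two indices. So \<open>rep\<close> selects the least index of each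
  class, and the biorthogonal functions are built for these representatives only.\<close>

theorem exponential_moment_problem_pos:
  fixes \<sigma> R :: "nat \<Rightarrow> real"
  assumes T: "T > 0" and c0: "c0 > 0" and \<delta>: "\<delta> > 0"
    and growth: "\<And>j. c0 * (real j + 1) ^ 4 \<le> \<sigma> j"
    and gap: "\<And>i j. \<sigma> i \<noteq> \<sigma> j \<Longrightarrow> \<delta> \<le> \<bar>\<sigma> i - \<sigma> j\<bar>"
    and R: "\<And>j. \<bar>R j\<bar> \<le> K" "\<And>i j. \<sigma> i = \<sigma> j \<Longrightarrow> R i = R j"
  shows "\<exists>g g' K'. C1_bump T K' g g' \<and> (\<forall>j. integral {0..T} (\<lambda>s. exp (\<sigma> j * s) * g s) = R j)"
proof -
  define rep where "rep n = (\<forall>i<n. \<sigma> i \<noteq> \<sigma> n)" for n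
  define r where "r j = (LEAST i. \<sigma> i = \<sigma> j)" for j
  have r: "\<sigma> (r j) = \<sigma> j" "rep (r j)" for j
  proof -
    show *: "\<sigma> (r j) = \<sigma> j" unfolding r_def by (rule LeastI[of _ j]) simp
    show "rep (r j)" unfolding rep_def using * not_less_Least[of _ "\<lambda>i. \<sigma> i = \<sigma> j"] unfolding r_def by metis
  qed
  have rep_inj: "m = n" if "rep m" "rep n" "\<sigma> m = \<sigma> n" for m n
    using that unfolding rep_def by (metis linorder_neqE_nat)
  \<comment> \<open>Omitted factors are encoded by \<open>x n j = 0\<close>, which makes them equal to one.\<close>
  define J where "J n = {j. rep j \<and> j \<noteq> n}" for n
  define x where "x n j = (if j \<in> J n then 1 / \<sigma> j else 0)" for n j
  have \<sigma>pos: "\<sigma> j > 0" for j using growth[of j] c0 by (smt (verit) mult_pos_pos of_nat_0_le_iff zero_less_power)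
  have x: "\<bar>x n j\<bar> \<le> (1 / c0) / (real j + 1) ^ 4" for n j
  proof -
    have "1 / \<sigma> j \<le> 1 / (c0 * (real j + 1) ^ 4)"
      using growth[of j] c0 \<sigma>pos[of j] by (intro divide_left_mono) auto
    then show ?thesis using c0 \<sigma>pos[of j] by (auto simp: x_def)
  qed
  define \<psi> where "\<psi> s = integral {0..T} (\<lambda>t. exp (s * t) * bump T 0 t)" for s
  define B where "B = op_bound (1 / c0) * (1 + 2 * (1 / c0))"
  have "\<exists>g g'. C1_bump T B g g' \<and> (\<forall>s. (\<lambda>M. (\<Prod>j<M. 1 - x n j * s) * \<psi> s)
      \<longlonglongrightarrow> integral {0..T} (\<lambda>t. exp (s * t) * g t))" for n
    unfolding B_def \<psi>_def
    by (rule infinite_order_operator_on_bump[of "x n" "1 / c0" T, OF x less_imp_le[OF T]]) blast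
  then have "\<forall>n. \<exists>g. (\<exists>g'. C1_bump T B g g') \<and> (\<forall>s. (\<lambda>M. (\<Prod>j<M. 1 - x n j * s) * \<psi> s)
      \<longlonglongrightarrow> integral {0..T} (\<lambda>t. exp (s * t) * g t))" by blast
  from choice[OF this] obtain g where ex: "\<And>n. \<exists>g'. C1_bump T B (g n) g'"
    and lim: "\<And>n s. (\<lambda>M. (\<Prod>j<M. 1 - x n j * s) * \<psi> s) \<longlonglongrightarrow> integral {0..T} (\<lambda>t. exp (s * t) * g n t)"
    by blast
  have "\<forall>n. \<exists>g'. C1_bump T B (g n) g'" using ex by blast
  from choice[OF this] obtain g' where g: "\<And>n. C1_bump T B (g n) (g' n)" by blast
  define Q where "Q n m = integral {0..T} (\<lambda>t. exp (\<sigma> m * t) * g n t)" for n m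
  have Q0: "Q n m = 0" if "rep n" "\<sigma> m \<noteq> \<sigma> n" for n m
  proof -
    have rJ: "r m \<in> J n" using r[of m] that by (auto simp: J_def)
    have prod0: "(\<Prod>j<M. 1 - x n j * \<sigma> m) = 0" if "M > r m" for M
    proof (rule prod_zero)
      show "\<exists>j\<in>{..<M}. 1 - x n j * \<sigma> m = 0"
        using that rJ r(1)[of m] \<sigma>pos[of m] by (intro bexI[of _ "r m"]) (auto simp: x_def)
    qed simp
    have "\<forall>\<^sub>F M in sequentially. (\<Prod>j<M. 1 - x n j * \<sigma> m) * \<psi> (\<sigma> m) = 0"
      by (rule eventually_mono[OF eventually_gt_at_top[of "r m"]]) (simp only: prod0 mult_zero_left)
    then have "(\<lambda>M. (\<Prod>j<M. 1 - x n j * \<sigma> m) * \<psi> (\<sigma> m)) \<longlonglongrightarrow> 0" by (rule tendsto_eventually)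
    then show ?thesis unfolding Q_def by (rule LIMSEQ_unique[OF lim])
  qed
  obtain b where b: "b > 0" "\<And>s. s \<ge> 0 \<Longrightarrow> b * exp (s * T / 2) \<le> \<psi> s"
    using bump_laplace_lower_bound[OF T] unfolding \<psi>_def by metis
  define w where "w n = 2 * sqrt (2 * \<sigma> n / c0) * (2 + ln (1 + 2 * \<sigma> n / \<delta>))" for n
  have Qlow: "b * exp (\<sigma> n * T / 2 - w n) \<le> \<bar>Q n n\<bar>" if "rep n" for n
  proof -
    have "(\<lambda>M. \<bar>(\<Prod>j<M. 1 - x n j * \<sigma> n) * \<psi> (\<sigma> n)\<bar>) \<longlonglongrightarrow> \<bar>Q n n\<bar>"
      unfolding Q_def by (intro tendsto_rabs lim)
    moreover have "b * exp (\<sigma> n * T / 2 - w n) \<le> \<bar>(\<Prod>j<M. 1 - x n j * \<sigma> n) * \<psi> (\<sigma> n)\<bar>" for M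
    proof -
      have gp: "\<delta> \<le> \<bar>\<sigma> j - \<sigma> n\<bar>" if "j \<in> J n" for j
        using that gap[of j n] rep_inj[of j n] \<open>rep n\<close> by (auto simp: J_def)
      have "exp (- w n) \<le> \<bar>\<Prod>j<M. 1 - x n j * \<sigma> n\<bar>"
        using canonical_product_lower_bound[where M = M, OF c0 \<delta> \<sigma>pos growth gp] unfolding w_def x_def by simp
      moreover have "b * exp (\<sigma> n * T / 2) \<le> \<psi> (\<sigma> n)" using b \<sigma>pos[of n] by simp
      moreover have "0 < b * exp (\<sigma> n * T / 2)" using b by simp
      ultimately have "exp (- w n) * (b * exp (\<sigma> n * T / 2)) \<le> \<bar>\<Prod>j<M. 1 - x n j * \<sigma> n\<bar> * \<psi> (\<sigma> n)"
        by (intro mult_mono) auto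
      moreover have "0 \<le> \<psi> (\<sigma> n)" using \<open>b * exp (\<sigma> n * T / 2) \<le> \<psi> (\<sigma> n)\<close> \<open>0 < b * exp (\<sigma> n * T / 2)\<close> by linarith
      moreover have "b * exp (\<sigma> n * T / 2 - w n) = exp (- w n) * (b * exp (\<sigma> n * T / 2))"
        by (simp only: exp_diff exp_minus divide_inverse mult_ac)
      ultimately show ?thesis by (simp only: abs_mult abs_of_nonneg)
    qed
    ultimately show ?thesis by (intro LIMSEQ_le_const) auto
  qed
  \<comment> \<open>The function \<open>g n / Q n n\<close> has moment one at \<open>\<sigma>\<^sub>n\<close> and zero at all other frequencies.\<close>
  define c where "c n = (if rep n then R n / Q n n else 0)" for n
  have cb: "\<bar>c n\<bar> \<le> K / b * exp (w n - \<sigma> n * T / 2)" for n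
  proof (cases "rep n")
    case True
    have K: "0 \<le> K" using R(1)[of 0] by linarith
    have p: "0 < b * exp (\<sigma> n * T / 2 - w n)" using b by simp
    have "\<bar>c n\<bar> = \<bar>R n\<bar> / \<bar>Q n n\<bar>" using True by (simp add: c_def)
    also have "\<dots> \<le> K / (b * exp (\<sigma> n * T / 2 - w n))"
      using Qlow[OF True] R(1)[of n] K p by (intro frac_le) auto
    also have "\<dots> = K / b * exp (w n - \<sigma> n * T / 2)"
    proof -
      have "exp (w n - \<sigma> n * T / 2) = inverse (exp (\<sigma> n * T / 2 - w n))" by (metis exp_minus minus_diff_eq)
      then show ?thesis by (simp only: divide_inverse inverse_mult_distrib mult_ac)
    qed
    finally show ?thesis .
  next
    case False
    have K: "0 \<le> K" using R(1)[of 0] by linarith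
    then show ?thesis using False b by (simp add: c_def)
  qed
  have sw: "summable (\<lambda>n. K / b * exp (w n - \<sigma> n * T / 2))"
    unfolding w_def by (intro summable_mult summable_moment_weights[OF c0 \<delta> T growth])
  have "summable (\<lambda>n. \<bar>c n\<bar>)"
    by (rule summable_comparison_test'[OF sw]) (use cb in simp)
  then have sc: "summable (\<lambda>n. \<bar>c n\<bar> * B)" by (rule summable_mult2)
  note S = C1_bump_suminf[of T "\<lambda>n. \<bar>c n\<bar> * B" "\<lambda>n t. c n * g n t" "\<lambda>n t. c n * g' n t",
      OF C1_bump_scale[OF g] sc]
  have "integral {0..T} (\<lambda>s. exp (\<sigma> m * s) * (\<Sum>n. c n * g n s)) = R m" for m
  proof -
    have "integral {0..T} (\<lambda>s. exp (\<sigma> m * s) * (c n * g n s)) = (if n = r m then R m else 0)" for n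
    proof -
      have "integral {0..T} (\<lambda>s. exp (\<sigma> m * s) * (c n * g n s)) = integral {0..T} (\<lambda>s. c n * (exp (\<sigma> m * s) * g n s))"
        by (simp only: mult_ac)
      also have "\<dots> = c n * Q n m" by (simp add: Q_def)
      also have "\<dots> = (if n = r m then R m else 0)"
      proof (cases "n = r m")
        case True
        have "Q n m = Q n n" unfolding Q_def True r(1) ..
        moreover have "Q n n \<noteq> 0" using Qlow[of n] r(2)[of m] b(1) True
          by (smt (verit) exp_gt_zero mult_pos_pos)
        moreover have "R n = R m" using R(2)[of n m] r(1) True by simp
        ultimately show ?thesis using True r(2) by (simp add: c_def)
      next
        case False
        then have "rep n \<Longrightarrow> \<sigma> m \<noteq> \<sigma> n" using rep_inj[of n "r m"] r[of m] by auto
        then show ?thesis using Q0[of n m] False by (cases "rep n") (simp_all add: c_def)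
      qed
      finally show ?thesis .
    qed
    then have "(\<lambda>n. if n = r m then R m else 0) sums integral {0..T} (\<lambda>s. exp (\<sigma> m * s) * (\<Sum>n. c n * g n s))"
      using S(2)[of "\<sigma> m"] by simp
    moreover have "(\<lambda>n. if n = r m then R m else 0) sums R m" by (rule sums_single)
    ultimately show ?thesis by (rule sums_unique2)
  qed
  then show ?thesis using S(1)
    by (intro exI[of _ "\<lambda>t. \<Sum>n. c n * g n t"] exI[of _ "\<lambda>t. \<Sum>n. c n * g' n t"]
        exI[of _ "\<Sum>n. \<bar>c n\<bar> * B"]) simp
qed

text \<open>Replacing \<open>\<sigma>\<^sub>j\<close> by \<open>\<sigma>\<^sub>j + c > 0\<close> amounts to multiplying the solution by \<open>exp (c t)\<close>, which changes neither the
  gaps nor the class of admissible functions.\<close>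

theorem exponential_moment_problem:
  fixes \<sigma> R :: "nat \<Rightarrow> real"
  assumes T: "T > 0" and c0: "c0 > 0" and \<delta>: "\<delta> > 0"
    and growth: "\<And>j. c0 * (real j + 1) ^ 4 \<le> \<sigma> j + c"
    and gap: "\<And>i j. \<sigma> i \<noteq> \<sigma> j \<Longrightarrow> \<delta> \<le> \<bar>\<sigma> i - \<sigma> j\<bar>"
    and R: "\<And>j. \<bar>R j\<bar> \<le> K" "\<And>i j. \<sigma> i = \<sigma> j \<Longrightarrow> R i = R j"
  shows "\<exists>g g' K'. C1_bump T K' g g' \<and> (\<forall>j. integral {0..T} (\<lambda>s. exp (\<sigma> j * s) * g s) = R j)"
proof -
  have "\<exists>g g' K'. C1_bump T K' g g' \<and> (\<forall>j. integral {0..T} (\<lambda>s. exp ((\<sigma> j + c) * s) * g s) = R j)"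
  proof (rule exponential_moment_problem_pos[OF T c0 \<delta> growth _ R(1)])
    show "\<delta> \<le> \<bar>\<sigma> i + c - (\<sigma> j + c)\<bar>" if "\<sigma> i + c \<noteq> \<sigma> j + c" for i j
      using gap[of i j] that by simp
    show "R i = R j" if "\<sigma> i + c = \<sigma> j + c" for i j using R(2)[of i j] that by simp
  qed
  then obtain g g' K' where g: "C1_bump T K' g g'"
    and R': "\<And>j. integral {0..T} (\<lambda>s. exp ((\<sigma> j + c) * s) * g s) = R j" by blast
  define E where "E = exp (\<bar>c\<bar> * T)"
  have K': "0 \<le> K'" using g unfolding C1_bump_def by (meson abs_ge_zero order_trans)
  have e: "\<bar>exp (c * t) * y\<bar> \<le> E * k" if "\<bar>y\<bar> \<le> k" "t \<notin> {0<..<T} \<Longrightarrow> y = 0" for t y k :: real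
  proof (cases "t \<in> {0<..<T}")
    case True
    have "c * t \<le> \<bar>c\<bar> * T" using True by (intro order.trans[OF _ mult_mono[of "\<bar>c\<bar>" "\<bar>c\<bar>" t T]] mult_right_mono) auto
    then show ?thesis unfolding abs_mult E_def using that(1) by (intro mult_mono) auto
  next
    case False
    then show ?thesis using that by (simp add: E_def)
  qed
  have "C1_bump T (E * (K' + \<bar>c\<bar> * K')) (\<lambda>t. exp (c * t) * g t) (\<lambda>t. exp (c * t) * (g' t + c * g t))"
    unfolding C1_bump_def
  proof (intro conjI allI impI)
    fix t
    have gt: "\<bar>g t\<bar> \<le> K'" "\<bar>g' t\<bar> \<le> K'" "t \<notin> {0<..<T} \<Longrightarrow> g t = 0" "t \<notin> {0<..<T} \<Longrightarrow> g' t = 0"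
      using g unfolding C1_bump_def by auto
    show "((\<lambda>t. exp (c * t) * g t) has_real_derivative exp (c * t) * (g' t + c * g t)) (at t)"
      using g unfolding C1_bump_def by (auto intro!: derivative_eq_intros simp: algebra_simps)
    show "\<bar>exp (c * t) * g t\<bar> \<le> E * (K' + \<bar>c\<bar> * K')"
      using gt K' by (intro e) (auto intro: add_increasing2)
    have "\<bar>c * g t\<bar> \<le> \<bar>c\<bar> * K'" unfolding abs_mult using gt(1) by (intro mult_left_mono) auto
    then show "\<bar>exp (c * t) * (g' t + c * g t)\<bar> \<le> E * (K' + \<bar>c\<bar> * K')"
      using gt by (intro e) auto
    show "exp (c * t) * g t = 0" if "t \<notin> {0<..<T}" using gt that by simp
    show "exp (c * t) * (g' t + c * g t) = 0" if "t \<notin> {0<..<T}" using gt that by simp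
  next
    show "continuous_on UNIV (\<lambda>t. exp (c * t) * (g' t + c * g t))"
      using g C1_bump_continuous[OF g] unfolding C1_bump_def by (intro continuous_intros) auto
  qed
  moreover have "integral {0..T} (\<lambda>s. exp (\<sigma> j * s) * (exp (c * s) * g s)) = R j" for j
    using R'[of j] by (simp add: algebra_simps exp_add)
  ultimately show ?thesis by blast
qed

section \<open>Diagonal semigroups on a Hilbert space\<close>

text \<open>A countable family of mutually orthogonal projections that separates the points of a closed subspace \<open>X\<close> of a Hilbert
  space. The eigenspaces may have any dimension, so no eigenvectors are chosen.\<close>

locale orthogonal_resolution =
  fixes X :: "'a::{real_inner, banach} set" and E :: "nat \<Rightarrow> 'a \<Rightarrow> 'a"
  assumes subspace_X: "subspace X" and closed_X: "closed X"
    and E_linear: "linear (E j)"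
    and E_in_X: "E j u \<in> X"
    and E_selfadjoint: "inner (E j u) v = inner u (E j v)"
    and E_E: "E i (E j u) = (if i = j then E j u else 0)"
    and E_complete: "u \<in> X \<Longrightarrow> (\<And>j. E j u = 0) \<Longrightarrow> u = 0"
begin

lemma inner_E_E: "inner (E i u) (E j v) = (if i = j then inner u (E j v) else 0)"
  by (simp add: E_selfadjoint E_E)

lemma norm_E_sq: "(norm (E j u))\<^sup>2 = inner u (E j u)"
  using inner_E_E[of j u j u] by (simp add: power2_norm_eq_inner)

lemma norm_E_le: "norm (E j u) \<le> norm u"
proof -
  have "(norm (E j u))\<^sup>2 \<le> norm u * norm (E j u)"
    unfolding norm_E_sq by (rule norm_cauchy_schwarz)
  then show ?thesis by (cases "norm (E j u) = 0") (auto simp: power2_eq_square)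
qed

lemma E_bounded_linear: "bounded_linear (E j)"
  using E_linear norm_E_le by (intro bounded_linear_intro[where K = 1]) (auto simp: linear_add linear_scale)

lemma norm_sum_E_sq:
  assumes "finite A"
  shows "(norm (\<Sum>j\<in>A. m j *\<^sub>R E j u))\<^sup>2 = (\<Sum>j\<in>A. (m j)\<^sup>2 * (norm (E j u))\<^sup>2)"
  unfolding norm_E_sq power2_norm_eq_inner inner_sum_left inner_sum_right using assms
  by (simp add: inner_E_E if_distrib power2_eq_square mult.assoc cong: if_cong)

lemma Bessel: assumes "finite A" shows "(\<Sum>j\<in>A. (norm (E j u))\<^sup>2) \<le> (norm u)\<^sup>2"
proof -
  let ?p = "\<Sum>j\<in>A. E j u"
  have 1: "(norm ?p)\<^sup>2 = (\<Sum>j\<in>A. (norm (E j u))\<^sup>2)"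
    using norm_sum_E_sq[OF assms, of "\<lambda>_. 1" u] by simp
  have 2: "inner u ?p = (\<Sum>j\<in>A. (norm (E j u))\<^sup>2)" by (simp add: inner_sum_right norm_E_sq)
  have "0 \<le> (norm (u - ?p))\<^sup>2" by simp
  also have "\<dots> = (norm u)\<^sup>2 - 2 * inner u ?p + (norm ?p)\<^sup>2"
    by (simp add: power2_norm_eq_inner inner_diff_left inner_diff_right inner_commute)
  finally show ?thesis unfolding 1 2 by simp
qed

lemma summable_norm_E_sq: "summable (\<lambda>j. (norm (E j u))\<^sup>2)"
  by (rule summableI_nonneg_bounded[of _ "(norm u)\<^sup>2"]) (auto intro: Bessel)

definition mult :: "(nat \<Rightarrow> real) \<Rightarrow> 'a \<Rightarrow> 'a" where
  "mult m u = (\<Sum>j. m j *\<^sub>R E j u)"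

lemma norm_partial_le:
  assumes "\<And>j. \<bar>m j\<bar> \<le> K" "finite A"
  shows "(norm (\<Sum>j\<in>A. m j *\<^sub>R E j u))\<^sup>2 \<le> K\<^sup>2 * (\<Sum>j\<in>A. (norm (E j u))\<^sup>2)"
  unfolding norm_sum_E_sq[OF assms(2)] sum_distrib_left
proof (intro sum_mono mult_right_mono)
  fix j show "(m j)\<^sup>2 \<le> K\<^sup>2" using power_mono[OF assms(1)[of j], of 2] by simp
qed auto

text \<open>By orthogonality and Bessel's inequality, the Cauchy criterion for \<open>\<Sum> m\<^sub>j E\<^sub>j u\<close> follows from the one for
  \<open>\<Sum> (norm (E\<^sub>j u))\<^sup>2\<close>.\<close>

lemma summable_multiplier:
  assumes "\<And>j. \<bar>m j\<bar> \<le> K" shows "summable (\<lambda>j. m j *\<^sub>R E j u)"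
  unfolding summable_Cauchy
proof (intro allI impI)
  fix e :: real assume e: "e > 0"
  have "summable (\<lambda>j. K\<^sup>2 * (norm (E j u))\<^sup>2)" by (intro summable_mult summable_norm_E_sq)
  then obtain N where N: "\<And>m n. m \<ge> N \<Longrightarrow> norm (\<Sum>j=m..<n. K\<^sup>2 * (norm (E j u))\<^sup>2) < e\<^sup>2"
    unfolding summable_Cauchy using e by (metis zero_less_power)
  have "norm (\<Sum>j=k..<n. m j *\<^sub>R E j u) < e" if "k \<ge> N" for k n
  proof -
    have "(norm (\<Sum>j=k..<n. m j *\<^sub>R E j u))\<^sup>2 \<le> K\<^sup>2 * (\<Sum>j=k..<n. (norm (E j u))\<^sup>2)"
      by (rule norm_partial_le[OF assms]) auto
    also have "\<dots> = (\<Sum>j=k..<n. K\<^sup>2 * (norm (E j u))\<^sup>2)" by (rule sum_distrib_left)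
    also have "\<dots> < e\<^sup>2" using N[OF that, of n] by simp
    finally show ?thesis using e by (intro power2_less_imp_less[of _ e]) auto
  qed
  then show "\<exists>N. \<forall>m'\<ge>N. \<forall>n. norm (\<Sum>j=m'..<n. m j *\<^sub>R E j u) < e" by blast
qed

lemma mult_LIMSEQ:
  assumes "\<And>j. \<bar>m j\<bar> \<le> K" shows "(\<lambda>n. \<Sum>j<n. m j *\<^sub>R E j u) \<longlonglongrightarrow> mult m u"
  unfolding mult_def by (rule summable_LIMSEQ[OF summable_multiplier[OF assms]])

lemma norm_mult_le:
  assumes "\<And>j. \<bar>m j\<bar> \<le> K" shows "norm (mult m u) \<le> K * norm u"
proof (rule LIMSEQ_le_const2[OF tendsto_norm[OF mult_LIMSEQ[OF assms]]])
  have K: "0 \<le> K" using assms[of 0] by linarith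
  have "norm (\<Sum>j<n. m j *\<^sub>R E j u) \<le> K * norm u" for n
  proof -
    have "(norm (\<Sum>j<n. m j *\<^sub>R E j u))\<^sup>2 \<le> K\<^sup>2 * (\<Sum>j<n. (norm (E j u))\<^sup>2)"
      by (rule norm_partial_le[OF assms]) auto
    also have "\<dots> \<le> K\<^sup>2 * (norm u)\<^sup>2" by (intro mult_left_mono Bessel) auto
    also have "\<dots> = (K * norm u)\<^sup>2" by (simp add: power_mult_distrib)
    finally show ?thesis by (rule power2_le_imp_le) (use K in simp)
  qed
  then show "\<exists>N. \<forall>n\<ge>N. norm (\<Sum>j<n. m j *\<^sub>R E j u) \<le> K * norm u" by blast
qed

lemma mult_in_X: assumes "\<And>j. \<bar>m j\<bar> \<le> K" shows "mult m u \<in> X"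
  by (rule closed_sequentially[OF closed_X _ mult_LIMSEQ[OF assms]])
     (intro subspace_sum subspace_scale subspace_X E_in_X)

lemma E_sum: "E i (\<Sum>j<n. c j *\<^sub>R E j u) = (if i < n then c i *\<^sub>R E i u else 0)"
  by (simp add: linear_sum[OF E_linear] linear_scale[OF E_linear] E_E if_distrib cong: if_cong)

lemma E_mult: assumes "\<And>j. \<bar>m j\<bar> \<le> K" shows "E i (mult m u) = m i *\<^sub>R E i u"
proof -
  have "(\<lambda>n. E i (\<Sum>j<n. m j *\<^sub>R E j u)) \<longlonglongrightarrow> E i (mult m u)"
    by (intro bounded_linear.tendsto[OF E_bounded_linear] mult_LIMSEQ[OF assms])
  moreover have "(\<lambda>n. E i (\<Sum>j<n. m j *\<^sub>R E j u)) \<longlonglongrightarrow> m i *\<^sub>R E i u"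
    unfolding E_sum by (rule tendsto_eventually, rule eventually_mono[OF eventually_gt_at_top[of i]]) simp
  ultimately show ?thesis by (rule LIMSEQ_unique)
qed

text \<open>Identities between spectral multipliers reduce to identities between scalars.\<close>

lemma resolution_eqI:
  assumes "u \<in> X" "v \<in> X" "\<And>j. E j u = E j v" shows "u = v"
  using E_complete[of "u - v"] assms by (simp add: subspace_diff[OF subspace_X] linear_diff[OF E_linear])

lemma mult_linear:
  assumes m: "\<And>j. \<bar>m j\<bar> \<le> K"
  shows "mult m (a *\<^sub>R u + b *\<^sub>R v) = a *\<^sub>R mult m u + b *\<^sub>R mult m v"
  by (rule resolution_eqI)
     (auto intro!: mult_in_X[OF m] subspace_add subspace_scale subspace_X
       simp: E_mult[OF m] linear_add[OF E_linear] linear_scale[OF E_linear] scaleR_add_right mult.commute)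

lemma mult_bounded_linear:
  assumes m: "\<And>j. \<bar>m j\<bar> \<le> K" shows "bounded_linear (mult m)"
  using mult_linear[OF m, where a = 1 and b = 1] mult_linear[OF m, where b = 0] norm_mult_le[OF m]
  by (intro bounded_linear_intro[where K = K]) (auto simp: mult.commute)

lemma mult_one: "u \<in> X \<Longrightarrow> mult (\<lambda>_. 1) u = u"
  by (rule resolution_eqI) (auto intro: mult_in_X[of _ 1] simp: E_mult[of _ 1])

text \<open>The dominated convergence theorem for spectral multipliers: the head of the expansion is a finite sum, and the tail is
  small uniformly because of the bound on the multipliers.\<close>

lemma mult_tendsto_0:
  assumes bound: "\<forall>\<^sub>F h in F. \<forall>j. \<bar>m h j\<bar> \<le> K" and lim: "\<And>j. ((\<lambda>h. m h j) \<longlongrightarrow> 0) F" and K: "0 \<le> K"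
  shows "((\<lambda>h. mult (m h) w) \<longlongrightarrow> 0) F"
proof (rule tendstoI)
  fix e :: real assume e: "e > 0"
  let ?w = "mult (\<lambda>_. 1) w"
  have "(\<lambda>n. \<Sum>j<n. E j w) \<longlonglongrightarrow> ?w" using mult_LIMSEQ[of "\<lambda>_. 1" 1 w] by simp
  moreover have "0 < e / (2 * (K + 1))" using e K by simp
  ultimately obtain N where "dist (\<Sum>j<N. E j w) ?w < e / (2 * (K + 1))"
    unfolding lim_sequentially by blast
  then have N: "norm (?w - (\<Sum>j<N. E j w)) < e / (2 * (K + 1))" by (simp add: dist_norm norm_minus_commute)
  have "((\<lambda>h. \<Sum>j<N. \<bar>m h j\<bar> * norm (E j w)) \<longlongrightarrow> (\<Sum>j<N. \<bar>0\<bar> * norm (E j w))) F"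
    by (intro tendsto_intros lim)
  then have "\<forall>\<^sub>F h in F. (\<Sum>j<N. \<bar>m h j\<bar> * norm (E j w)) < e / 2"
    by (rule order_tendstoD) (use e in simp)
  then show "\<forall>\<^sub>F h in F. dist (mult (m h) w) 0 < e"
    using bound
  proof eventually_elim
    case (elim h)
    then have b: "\<bar>m h j\<bar> \<le> K" for j by blast
    let ?r = "?w - (\<Sum>j<N. E j w)"
    have eq: "mult (m h) w = (\<Sum>j<N. m h j *\<^sub>R E j w) + mult (m h) ?r"
    proof (rule resolution_eqI)
      show "E i (mult (m h) w) = E i ((\<Sum>j<N. m h j *\<^sub>R E j w) + mult (m h) ?r)" for i
        using E_sum[where i = i and c = "\<lambda>_. 1" and n = N and u = w]
        by (simp add: linear_add[OF E_linear] linear_diff[OF E_linear] E_mult[OF b] E_sum E_mult[of "\<lambda>_. 1" 1])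
    qed (intro mult_in_X[OF b] subspace_add subspace_sum subspace_scale subspace_X E_in_X)+
    have "norm (mult (m h) w) \<le> norm (\<Sum>j<N. m h j *\<^sub>R E j w) + norm (mult (m h) ?r)"
      by (subst eq) (rule norm_triangle_ineq)
    also have "norm (\<Sum>j<N. m h j *\<^sub>R E j w) \<le> (\<Sum>j<N. \<bar>m h j\<bar> * norm (E j w))"
      by (rule order.trans[OF norm_sum]) simp
    also have "norm (mult (m h) ?r) \<le> K * norm ?r" by (rule norm_mult_le[OF b])
    also have "K * norm ?r \<le> e / 2"
    proof -
      have "K * norm ?r \<le> (K + 1) * (e / (2 * (K + 1)))" using K N by (intro mult_mono) auto
      also have "(K + 1) * (e / (2 * (K + 1))) = e / 2" using K by (simp add: field_simps)
      finally show ?thesis .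
    qed
    finally show ?case using elim by (simp add: dist_norm)
  qed
qed

end

locale spectral_resolution = orthogonal_resolution +
  fixes \<sigma> :: "nat \<Rightarrow> real" and c :: real
  assumes \<sigma>_ge: "- c \<le> \<sigma> j" and c_nonneg: "0 \<le> c"
begin

text \<open>Cutting the time off at zero makes \<open>t \<mapsto> S t u\<close> continuous on the whole line, so that integrands \<open>S (t - s) u\<close>
  are measurable without restricting \<open>s\<close>.\<close>

definition S :: "real \<Rightarrow> 'a \<Rightarrow> 'a" where
  "S t = mult (\<lambda>j. exp (- (\<sigma> j * max 0 t)))"

lemma exp_bound: "0 \<le> s \<Longrightarrow> s \<le> t \<Longrightarrow> exp (- (\<sigma> j * s)) \<le> exp (c * t)"
proof -
  assume s: "0 \<le> s" "s \<le> t"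
  have "- (\<sigma> j * s) \<le> c * s" using mult_right_mono[OF \<sigma>_ge[of j] s(1)] by simp
  also have "\<dots> \<le> c * t" using s c_nonneg by (intro mult_left_mono)
  finally show ?thesis by simp
qed

lemma S_bound: "\<bar>exp (- (\<sigma> j * max 0 t))\<bar> \<le> exp (c * max 0 t)"
  using exp_bound[of "max 0 t" "max 0 t" j] by simp

lemma S_in_X: "S t u \<in> X"
  unfolding S_def by (rule mult_in_X[OF S_bound])

lemma E_S: "E i (S t u) = exp (- (\<sigma> i * max 0 t)) *\<^sub>R E i u"
  unfolding S_def by (rule E_mult[OF S_bound])

lemma S_linear: "S t (a *\<^sub>R u + b *\<^sub>R v) = a *\<^sub>R S t u + b *\<^sub>R S t v"
  unfolding S_def by (rule mult_linear[OF S_bound])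

lemma S_bounded_linear: "bounded_linear (S t)"
  unfolding S_def by (rule mult_bounded_linear[OF S_bound])

lemma norm_S_le: "norm (S t u) \<le> exp (c * max 0 t) * norm u"
  unfolding S_def by (rule norm_mult_le[OF S_bound])

text \<open>The multiplier of \<open>S s - S t\<close> tends to zero for each mode as \<open>s \<longlongrightarrow> t\<close>, and it is bounded uniformly in the modes for
  \<open>s\<close> near \<open>t\<close>.\<close>

lemma S_continuous: "continuous_on UNIV (\<lambda>t. S t u)"
proof (rule continuous_at_imp_continuous_on, rule ballI)
  fix t :: real
  let ?m = "\<lambda>s j. exp (- (\<sigma> j * max 0 s)) - exp (- (\<sigma> j * max 0 t))"
  let ?K = "2 * exp (c * (max 0 t + 1))"
  have b: "\<bar>?m s j\<bar> \<le> ?K" if "dist s t < 1" for s j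
  proof -
    have "exp (- (\<sigma> j * max 0 s)) \<le> exp (c * (max 0 t + 1))"
      using that by (intro exp_bound) (auto simp: dist_real_def)
    moreover have "exp (- (\<sigma> j * max 0 t)) \<le> exp (c * (max 0 t + 1))" by (intro exp_bound) auto
    moreover have "0 < exp (- (\<sigma> j * max 0 s))" "0 < exp (- (\<sigma> j * max 0 t))" by simp_all
    ultimately show ?thesis by (simp only: abs_le_iff) linarith
  qed
  have ev: "\<forall>\<^sub>F s in at t. dist s t < 1" by (rule eventually_at_ball'[of 1 t UNIV, THEN eventually_mono]) (auto simp: dist_commute)
  have "((\<lambda>s. mult (?m s) u) \<longlongrightarrow> 0) (at t)"
  proof (rule mult_tendsto_0[where K = ?K])
    show "\<forall>\<^sub>F s in at t. \<forall>j. \<bar>?m s j\<bar> \<le> ?K" by (rule eventually_mono[OF ev]) (use b in blast)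
    have "((\<lambda>s. ?m s j) \<longlongrightarrow> ?m t j) (at t)" for j by (intro tendsto_intros)
    then show "((\<lambda>s. ?m s j) \<longlongrightarrow> 0) (at t)" for j by simp
  qed simp
  moreover have "\<forall>\<^sub>F s in at t. mult (?m s) u = S s u - S t u"
  proof (rule eventually_mono[OF ev])
    fix s assume s: "dist s t < 1"
    show "mult (?m s) u = S s u - S t u"
      by (rule resolution_eqI)
         (auto intro!: mult_in_X[OF b[OF s]] subspace_diff subspace_X S_in_X
          simp: E_mult[OF b[OF s]] E_S linear_diff[OF E_linear] scaleR_diff_left)
  qed
  ultimately have "((\<lambda>s. S s u - S t u) \<longlongrightarrow> 0) (at t)" by (simp add: tendsto_cong)
  then show "isCont (\<lambda>t. S t u) t" unfolding isCont_def by (simp add: LIM_zero_iff)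
qed

lemma S_zero: "u \<in> X \<Longrightarrow> S 0 u = u" by (simp add: S_def mult_one)

lemma S_add: "0 \<le> s \<Longrightarrow> 0 \<le> t \<Longrightarrow> S (s + t) u = S s (S t u)"
  by (rule resolution_eqI) (auto intro: S_in_X simp: E_S algebra_simps simp flip: exp_add)

lemma C0_semigroup_S: "C0_semigroup X S"
  unfolding C0_semigroup_def
proof (intro conjI allI impI ballI)
  fix u assume u: "u \<in> X"
  have "((\<lambda>t. S t u) \<longlongrightarrow> S 0 u) (at 0)" using S_continuous by (simp add: continuous_on_eq_continuous_at isCont_def)
  then show "((\<lambda>t. S t u) \<longlongrightarrow> u) (at_right 0)"
    unfolding S_zero[OF u] by (rule filterlim_mono[OF _ order_refl]) (simp add: at_le)
qed (auto intro!: S_in_X S_linear S_zero S_add exI norm_S_le)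

lemma exp_minus_1_bound: "\<bar>exp y - 1\<bar> \<le> \<bar>y\<bar> * max 1 (exp (y::real))"
proof (cases "y \<le> 0")
  case True
  then have "exp y \<le> 1" by simp
  moreover have "1 - exp y \<le> - y" using exp_ge_add_one_self[of y] by linarith
  ultimately show ?thesis using True by (simp add: max_absorb1)
next
  case False
  have "1 + (- y) \<le> exp (- y)" by (rule exp_ge_add_one_self)
  then have "(1 - y) * exp y \<le> exp (- y) * exp y" by (intro mult_right_mono) auto
  then have "exp y - 1 \<le> y * exp y" by (simp add: algebra_simps flip: exp_add)
  then show ?thesis using False by (simp add: max_absorb2)
qed

lemma exp_quotient_tendsto: "((\<lambda>h. (exp (- (a * h)) - 1) / h) \<longlongrightarrow> - a) (at_right (0::real))"
proof -
  have "((\<lambda>h. exp (- (a * h))) has_real_derivative - a) (at 0)"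
    by (auto intro!: derivative_eq_intros)
  then have "((\<lambda>h. (exp (- (a * h)) - 1) / h) \<longlongrightarrow> - a) (at 0)" unfolding DERIV_def by simp
  then show ?thesis by (rule filterlim_mono[OF _ order_refl]) (simp add: at_le)
qed

text \<open>The error \<open>(S h u - u)/h - w\<close> is a spectral multiplier applied to \<open>- w\<close>, which has components \<open>\<sigma>\<^sub>j E\<^sub>j u\<close>. Dividing
  by \<open>\<sigma>\<^sub>j\<close> makes the multiplier bounded uniformly in \<open>j\<close>.\<close>

lemma generator_limit:
  assumes u: "u \<in> X" "w \<in> X" and w: "\<And>j. E j w = - \<sigma> j *\<^sub>R E j u"
  shows "((\<lambda>h. (1 / h) *\<^sub>R (S h u - u)) \<longlongrightarrow> w) (at_right 0)"
proof -
  \<comment> \<open>For \<open>\<sigma>\<^sub>j = 0\<close> the component of \<open>w\<close> is zero and any value will do.\<close>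
  let ?g = "\<lambda>h j. if \<sigma> j = 0 then 0 else (exp (- (\<sigma> j * h)) - 1) / h / \<sigma> j + 1"
  let ?K = "1 + max 1 (exp c)"
  have ev: "\<forall>\<^sub>F h in at_right (0::real). 0 < h \<and> h < 1" by (simp add: eventually_at_right_field) (rule exI[of _ 1], simp)
  have b: "\<bar>?g h j\<bar> \<le> ?K" if "0 < h \<and> h < 1" for h j
  proof (cases "\<sigma> j = 0")
    case False
    have "\<bar>exp (- (\<sigma> j * h)) - 1\<bar> \<le> \<bar>\<sigma> j * h\<bar> * max 1 (exp (- (\<sigma> j * h)))"
      using exp_minus_1_bound[of "- (\<sigma> j * h)"] by simp
    also have "\<dots> \<le> \<bar>\<sigma> j * h\<bar> * max 1 (exp c)"
      using exp_bound[of h 1 j] that by (intro mult_left_mono max.mono) auto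
    finally have "\<bar>(exp (- (\<sigma> j * h)) - 1) / h / \<sigma> j\<bar> \<le> max 1 (exp c)"
      using that False by (simp add: abs_divide abs_mult field_simps)
    then have "\<bar>(exp (- (\<sigma> j * h)) - 1) / h / \<sigma> j + 1\<bar> \<le> ?K" by linarith
    then show ?thesis using False by (simp only: if_False)
  qed (simp add: add_nonneg_nonneg)
  have "((\<lambda>h. mult (?g h) (- w)) \<longlongrightarrow> 0) (at_right 0)"
  proof (rule mult_tendsto_0[where K = ?K])
    show "\<forall>\<^sub>F h in at_right 0. \<forall>j. \<bar>?g h j\<bar> \<le> ?K" by (rule eventually_mono[OF ev]) (use b in blast)
    show "((\<lambda>h. ?g h j) \<longlongrightarrow> 0) (at_right 0)" for j
    proof (cases "\<sigma> j = 0")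
      case False
      have "((\<lambda>h. (exp (- (\<sigma> j * h)) - 1) / h / \<sigma> j + 1) \<longlongrightarrow> - \<sigma> j / \<sigma> j + 1) (at_right 0)"
        by (intro tendsto_intros exp_quotient_tendsto) (use False in simp)
      then show ?thesis using False by simp
    qed simp
  qed (simp add: add_nonneg_nonneg)
  moreover have "\<forall>\<^sub>F h in at_right 0. mult (?g h) (- w) = (1 / h) *\<^sub>R (S h u - u) - w"
  proof (rule eventually_mono[OF ev])
    fix h :: real assume h: "0 < h \<and> h < 1"
    show "mult (?g h) (- w) = (1 / h) *\<^sub>R (S h u - u) - w"
    proof (rule resolution_eqI)
      fix j
      have "E j (mult (?g h) (- w)) = (?g h j * \<sigma> j) *\<^sub>R E j u"
        by (simp only: E_mult[OF b[OF h]] linear_neg[OF E_linear] w) simp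
      also have "?g h j * \<sigma> j = (exp (- (\<sigma> j * h)) - 1) / h + \<sigma> j"
        by (cases "\<sigma> j = 0") (simp_all add: distrib_right)
      also have "((exp (- (\<sigma> j * h)) - 1) / h + \<sigma> j) *\<^sub>R E j u = E j ((1 / h) *\<^sub>R (S h u - u) - w)"
        using h by (simp add: linear_diff[OF E_linear] linear_scale[OF E_linear] E_S w
            scaleR_add_left scaleR_diff_left scaleR_diff_right diff_divide_distrib)
      finally show "E j (mult (?g h) (- w)) = E j ((1 / h) *\<^sub>R (S h u - u) - w)" .
    qed (intro mult_in_X[OF b[OF h]] subspace_diff subspace_scale subspace_X S_in_X u)+
  qed
  ultimately have "((\<lambda>h. (1 / h) *\<^sub>R (S h u - u) - w) \<longlongrightarrow> 0) (at_right 0)" by (simp add: tendsto_cong)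
  then show ?thesis by (simp add: LIM_zero_iff)
qed

text \<open>The domain of the generator consists of all \<open>u\<close> with \<open>\<Sum> (\<sigma>\<^sub>j norm (E\<^sub>j u))\<^sup>2 < \<infinity>\<close>. That \<open>D\<close> is no smaller follows from
  surjectivity of \<open>c + 1 - G\<close> on \<open>D\<close>: if \<open>u\<close> is in the domain with derivative \<open>v\<close>, solve \<open>(c + 1) u' - G u' = (c + 1) u - v\<close> in
  \<open>D\<close> and compare components to find \<open>u = u'\<close>.\<close>

theorem generates_S:
  assumes D: "D \<subseteq> X" and G: "\<And>u. u \<in> D \<Longrightarrow> G u \<in> X" "\<And>u j. u \<in> D \<Longrightarrow> E j (G u) = - \<sigma> j *\<^sub>R E j u"
    and onto: "\<And>w. w \<in> X \<Longrightarrow> \<exists>u\<in>D. (c + 1) *\<^sub>R u - G u = w"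
  shows "generates X D G S"
  unfolding generates_def
proof (intro conjI ballI allI iffI C0_semigroup_S D)
  fix u v assume u: "u \<in> X" and lim: "((\<lambda>h. (1 / h) *\<^sub>R (S h u - u)) \<longlongrightarrow> v) (at_right 0)"
  have v: "v \<in> X"
    by (rule Lim_in_closed_set[OF closed_X always_eventually _ lim])
       (auto intro!: subspace_scale subspace_diff subspace_X S_in_X u)
  have Ev: "E j v = - \<sigma> j *\<^sub>R E j u" for j
  proof -
    have "((\<lambda>h. E j ((1 / h) *\<^sub>R (S h u - u))) \<longlongrightarrow> E j v) (at_right 0)"
      by (rule bounded_linear.tendsto[OF E_bounded_linear lim])
    moreover have "\<forall>\<^sub>F h in at_right 0. E j ((1 / h) *\<^sub>R (S h u - u)) = ((exp (- (\<sigma> j * h)) - 1) / h) *\<^sub>R E j u"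
      using eventually_at_right_less[of "0::real"]
      by eventually_elim (simp add: linear_diff[OF E_linear] linear_scale[OF E_linear] E_S
          scaleR_diff_left scaleR_diff_right diff_divide_distrib)
    ultimately have "((\<lambda>h. ((exp (- (\<sigma> j * h)) - 1) / h) *\<^sub>R E j u) \<longlongrightarrow> E j v) (at_right 0)"
      by (simp add: tendsto_cong)
    moreover have "((\<lambda>h. ((exp (- (\<sigma> j * h)) - 1) / h) *\<^sub>R E j u) \<longlongrightarrow> - \<sigma> j *\<^sub>R E j u) (at_right 0)"
      by (intro tendsto_intros exp_quotient_tendsto)
    ultimately show ?thesis by (intro tendsto_unique[of "at_right (0::real)"]) auto
  qed
  define w where "w = (c + 1) *\<^sub>R u - v"
  have "w \<in> X" unfolding w_def by (intro subspace_diff subspace_scale subspace_X u v)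
  from onto[OF this] obtain u' where u': "u' \<in> D" "(c + 1) *\<^sub>R u' - G u' = w" by blast
  have "u = u'"
  proof (rule resolution_eqI)
    fix j
    have "E j w = (c + 1 + \<sigma> j) *\<^sub>R E j u"
      unfolding w_def by (simp add: linear_diff[OF E_linear] linear_scale[OF E_linear] linear_add[OF E_linear] Ev scaleR_add_left)
    moreover have "E j w = (c + 1 + \<sigma> j) *\<^sub>R E j u'"
      unfolding u'(2)[symmetric] by (simp add: linear_diff[OF E_linear] linear_scale[OF E_linear] linear_add[OF E_linear] G(2)[OF u'(1)] scaleR_add_left)
    moreover have "c + 1 + \<sigma> j \<noteq> 0" using \<sigma>_ge[of j] by linarith
    ultimately show "E j u = E j u'" by simp
  qed (use u u' D in auto)
  then show "u \<in> D" "v = G u" using u' unfolding w_def by auto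
next
  fix u v assume "u \<in> X" "u \<in> D \<and> v = G u"
  then show "((\<lambda>h. (1 / h) *\<^sub>R (S h u - u)) \<longlongrightarrow> v) (at_right 0)"
    using generator_limit[of u v] G by auto
qed

end

section \<open>Uniqueness of the semigroup with a given generator\<close>

text \<open>The uniform boundedness principle on a closed subspace, by an argument that avoids the Baire category theorem: choose
  \<open>n k\<close> with norms at least \<open>4\<^sup>k\<close>, and add or subtract \<open>3\<^sup>-\<^sup>k \<xi>\<^sub>k\<close>, where \<open>\<xi>\<^sub>k\<close> almost attains the norm. One of
  the two signs keeps the image large, and the limit \<open>l\<close> differs from the \<open>k\<close>-th step by too little to undo this.\<close>

lemma uniform_boundedness_sequence:
  fixes T :: "nat \<Rightarrow> 'a::banach \<Rightarrow> 'b::real_normed_vector"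
  assumes X: "subspace X" "closed X"
    and lin: "\<And>n u v a b. u \<in> X \<Longrightarrow> v \<in> X \<Longrightarrow> T n (a *\<^sub>R u + b *\<^sub>R v) = a *\<^sub>R T n u + b *\<^sub>R T n v"
    and bdd: "\<And>n. \<exists>K. \<forall>u\<in>X. norm (T n u) \<le> K * norm u"
    and pt: "\<And>u. u \<in> X \<Longrightarrow> \<exists>B. \<forall>n. norm (T n u) \<le> B"
  shows "\<exists>K. \<forall>n. \<forall>u\<in>X. norm (T n u) \<le> K * norm u"
proof (rule ccontr)
  assume "\<nexists>K. \<forall>n. \<forall>u\<in>X. norm (T n u) \<le> K * norm u"
  then have big: "\<And>K. \<exists>n. \<exists>u\<in>X. norm (T n u) > K * norm u" by (meson not_le)
  define U where "U n = (\<lambda>u. norm (T n u)) ` {u \<in> X. norm u \<le> 1}" for n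
  define N where "N n = Sup (U n)" for n
  have bddU: "bdd_above (U n)" for n
  proof -
    obtain K where K: "\<And>u. u \<in> X \<Longrightarrow> norm (T n u) \<le> K * norm u" using bdd[of n] by blast
    have "norm (T n u) \<le> \<bar>K\<bar>" if "u \<in> X" "norm u \<le> 1" for u
    proof -
      have "norm (T n u) \<le> \<bar>K\<bar> * norm u" using K[OF that(1)] by (meson abs_ge_self mult_right_mono norm_ge_zero order_trans)
      also have "\<dots> \<le> \<bar>K\<bar> * 1" using that by (intro mult_left_mono) auto
      finally show ?thesis by simp
    qed
    then show ?thesis unfolding U_def by (auto intro!: bdd_aboveI[of _ "\<bar>K\<bar>"])
  qed
  have lin1: "T n (a *\<^sub>R u) = a *\<^sub>R T n u" if "u \<in> X" for n a u using lin[OF that that, of n a 0] by simp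
  have NT: "norm (T n u) \<le> N n * norm u" if u: "u \<in> X" for n u
  proof (cases "u = 0")
    case True
    then show ?thesis using lin1[OF u, of n 0] by simp
  next
    case False
    have "norm (T n ((1 / norm u) *\<^sub>R u)) \<in> U n"
      unfolding U_def using False u by (intro imageI) (auto intro: subspace_scale[OF X(1)])
    then have "norm (T n ((1 / norm u) *\<^sub>R u)) \<le> N n" unfolding N_def by (rule cSup_upper[OF _ bddU])
    then show ?thesis using False by (simp add: lin1[OF u] field_simps)
  qed
  have "\<exists>n. N n \<ge> 4 ^ k" for k :: nat
  proof -
    obtain n u where nu: "u \<in> X" "norm (T n u) > 4 ^ k * norm u" using big by blast
    have "4 ^ k * norm u < N n * norm u" using NT[OF nu(1), of n] nu(2) by linarith
    then have "4 ^ k < N n" by (simp add: mult_less_cancel_right)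
    then show ?thesis by (intro exI[of _ n]) simp
  qed
  then obtain n where n: "\<And>k. N (n k) \<ge> 4 ^ k" by metis
  have "\<exists>\<xi>\<in>X. norm \<xi> \<le> 1 \<and> norm (T (n k) \<xi>) \<ge> 2/3 * N (n k)" for k
  proof -
    have "0 < (4::real) ^ k" by simp
    then have "2/3 * N (n k) < N (n k)" using n[of k] by linarith
    moreover have "U (n k) \<noteq> {}" unfolding U_def using subspace_0[OF X(1)] by (auto intro!: exI[of _ 0])
    ultimately obtain y where "y \<in> U (n k)" "2/3 * N (n k) < y" unfolding N_def by (metis less_cSupE)
    then show ?thesis unfolding U_def by (auto intro!: bexI simp: less_imp_le)
  qed
  then obtain \<xi> where \<xi>: "\<And>k. \<xi> k \<in> X" "\<And>k. norm (\<xi> k) \<le> 1" "\<And>k. norm (T (n k) (\<xi> k)) \<ge> 2/3 * N (n k)" by metis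
  \<comment> \<open>Choosing the better sign gives at least the mean of the two norms, which dominates the norm of the image of the increment.\<close>
  define step where "step k x = (if norm (T (n k) (x + (1/3) ^ k *\<^sub>R \<xi> k)) \<ge> norm (T (n k) (x - (1/3) ^ k *\<^sub>R \<xi> k))
      then x + (1/3) ^ k *\<^sub>R \<xi> k else x - (1/3) ^ k *\<^sub>R \<xi> k)" for k x
  define x where "x = rec_nat 0 (\<lambda>k y. step k y)"
  have x0: "x 0 = 0" and xS: "x (Suc k) = step k (x k)" for k by (simp_all add: x_def)
  have xX: "x k \<in> X" for k
    by (induction k) (auto simp: x0 xS step_def intro!: subspace_0 subspace_add subspace_diff subspace_scale X(1) \<xi>)
  have xd: "norm (x (Suc k) - x k) \<le> (1/3) ^ k" for k
    using \<xi>(2)[of k] by (auto simp: xS step_def power_one_over divide_simps)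
  have xT: "norm (T (n k) (x (Suc k))) \<ge> (1/3) ^ k * (2/3 * N (n k))" for k
  proof -
    let ?v = "(1/3) ^ k *\<^sub>R \<xi> k"
    have v: "?v \<in> X" by (intro subspace_scale X(1) \<xi>)
    have "2 *\<^sub>R T (n k) ?v = T (n k) (x k + ?v) - T (n k) (x k - ?v)"
      using lin[OF xX[of k] v, of "n k" 1 1] lin[OF xX[of k] v, of "n k" 1 "-1"] by (simp add: scaleR_2)
    then have "2 * norm (T (n k) ?v) \<le> norm (T (n k) (x k + ?v)) + norm (T (n k) (x k - ?v))"
      by (metis norm_scaleR norm_triangle_ineq4 abs_numeral)
    moreover have "norm (T (n k) (x (Suc k))) \<ge> norm (T (n k) (x k + ?v))"
      "norm (T (n k) (x (Suc k))) \<ge> norm (T (n k) (x k - ?v))" by (auto simp: xS step_def)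
    ultimately have "norm (T (n k) (x (Suc k))) \<ge> norm (T (n k) ?v)" by linarith
    moreover have "norm (T (n k) ?v) \<ge> (1/3) ^ k * (2/3 * N (n k))"
      unfolding lin1[OF \<xi>(1)] norm_scaleR using \<xi>(3)[of k] by (simp add: mult_left_mono)
    ultimately show ?thesis by linarith
  qed
  have "summable (\<lambda>k. x (Suc k) - x k)"
    by (rule summable_comparison_test'[OF summable_geometric[of "1/3::real"] xd]) simp
  then have "(\<lambda>m. \<Sum>k<m. x (Suc k) - x k) \<longlonglongrightarrow> (\<Sum>k. x (Suc k) - x k)" by (rule summable_LIMSEQ)
  then have "(\<lambda>m. x m) \<longlonglongrightarrow> (\<Sum>k. x (Suc k) - x k)" by (simp add: sum_lessThan_telescope x0)
  then obtain l where l: "x \<longlonglongrightarrow> l" by blast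
  have lX: "l \<in> X" by (rule closed_sequentially[OF X(2) xX l])
  have ld: "norm (l - x (Suc k)) \<le> (1/3) ^ k / 2" for k
  proof -
    have le: "norm (x (Suc k + m) - x (Suc k)) \<le> (1/3) ^ k / 2 - (1/3) ^ (k + m) / 2" for m
    proof (induction m)
      case (Suc m)
      have "norm (x (Suc k + Suc m) - x (Suc k)) \<le> norm (x (Suc (Suc k + m)) - x (Suc k + m)) + norm (x (Suc k + m) - x (Suc k))"
        by (metis add_Suc_right diff_add_cancel norm_triangle_ineq add_diff_eq diff_diff_eq2 norm_triangle_le order_refl)
      also have "\<dots> \<le> (1/3) ^ (Suc k + m) + ((1/3) ^ k / 2 - (1/3) ^ (k + m) / 2)" by (intro add_mono xd Suc)
      also have "\<dots> = (1/3) ^ k / 2 - (1/3) ^ (k + Suc m) / 2" by simp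
      finally show ?case .
    qed simp
    have le': "norm (x (Suc k + m) - x (Suc k)) \<le> (1/3) ^ k / 2" for m
    proof -
      have "0 \<le> (1/3::real) ^ (k + m) / 2" by simp
      then show ?thesis using le[of m] by linarith
    qed
    have "(\<lambda>m. norm (x (m + Suc k) - x (Suc k))) \<longlonglongrightarrow> norm (l - x (Suc k))"
      by (intro tendsto_intros LIMSEQ_ignore_initial_segment l)
    then show ?thesis by (rule LIMSEQ_le_const2) (use le' in \<open>auto simp: add.commute\<close>)
  qed
  obtain B where B: "\<And>n. norm (T n l) \<le> B" using pt[OF lX] by blast
  have le: "(4/3) ^ k / 6 \<le> B" for k :: nat
  proof -
    have "T (n k) (x (Suc k)) = T (n k) l - T (n k) (l - x (Suc k))"
      using lin[OF lX subspace_diff[OF X(1) lX xX[of "Suc k"]], of "n k" 1 "-1"] by simp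
    then have "norm (T (n k) (x (Suc k))) \<le> norm (T (n k) l) + norm (T (n k) (l - x (Suc k)))"
      by (metis norm_triangle_ineq4)
    also have "\<dots> \<le> B + N (n k) * ((1/3) ^ k / 2)"
    proof (intro add_mono B)
      have "0 < (4::real) ^ k" by simp
      then have N0: "0 \<le> N (n k)" using n[of k] by linarith
      have "norm (T (n k) (l - x (Suc k))) \<le> N (n k) * norm (l - x (Suc k))"
        by (intro NT subspace_diff X(1) lX xX)
      also have "\<dots> \<le> N (n k) * ((1/3) ^ k / 2)" by (intro mult_left_mono ld N0)
      finally show "norm (T (n k) (l - x (Suc k))) \<le> N (n k) * ((1/3) ^ k / 2)" .
    qed
    finally have "(1/3) ^ k * (2/3 * N (n k)) \<le> B + N (n k) * ((1/3) ^ k / 2)" using xT[of k] by linarith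
    then have "(1/3) ^ k * N (n k) / 6 \<le> B" by (simp add: field_simps)
    moreover have "(4/3) ^ k \<le> (1/3) ^ k * N (n k)"
      using mult_left_mono[OF n[of k], of "(1/3) ^ k"] by (simp add: power_divide field_simps)
    ultimately show ?thesis by linarith
  qed
  obtain k :: nat where "6 * B < (4/3) ^ k" using real_arch_pow[of "4/3" "6 * B"] by auto
  then show False using le[of k] by linarith
qed

text \<open>Otherwise there are times \<open>t\<^sub>n \<le> 1/(n+1)\<close> at which the operator norms exceed \<open>n\<close>. Strong continuity at \<open>0\<close> bounds every orbit along
  these times, which contradicts the uniform boundedness principle.\<close>

lemma C0_semigroup_locally_bounded:
  assumes X: "subspace X" "closed (X :: 'a::banach set)" and S: "C0_semigroup X S"
  obtains \<delta> K where "\<delta> > 0" "\<And>t u. 0 \<le> t \<Longrightarrow> t \<le> \<delta> \<Longrightarrow> u \<in> X \<Longrightarrow> norm (S t u) \<le> K * norm u"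
proof -
  have "\<exists>\<delta>>0. \<exists>K. \<forall>t u. 0 \<le> t \<longrightarrow> t \<le> \<delta> \<longrightarrow> u \<in> X \<longrightarrow> norm (S t u) \<le> K * norm u"
  proof (rule ccontr)
    assume neg: "\<not> ?thesis"
    have "\<exists>t u. 0 \<le> t \<and> t \<le> 1 / real (Suc n) \<and> u \<in> X \<and> norm (S t u) > real n * norm u" for n
    proof (rule ccontr)
      assume "\<not> ?thesis"
      then have "\<forall>t u. 0 \<le> t \<longrightarrow> t \<le> 1 / real (Suc n) \<longrightarrow> u \<in> X \<longrightarrow> norm (S t u) \<le> real n * norm u"
        by (meson not_le)
      moreover have "0 < 1 / real (Suc n)" by simp
      ultimately show False using neg by blast
    qed
    then have "\<forall>n. \<exists>p. 0 \<le> fst p \<and> fst p \<le> 1 / real (Suc n) \<and> snd p \<in> X \<and> norm (S (fst p) (snd p)) > real n * norm (snd p)"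
      by auto
    from choice[OF this] obtain p where p: "\<And>n. 0 \<le> fst (p n)" "\<And>n. fst (p n) \<le> 1 / real (Suc n)"
      "\<And>n. snd (p n) \<in> X" "\<And>n. norm (S (fst (p n)) (snd (p n))) > real n * norm (snd (p n))" by blast
    have "\<exists>K. \<forall>n. \<forall>u\<in>X. norm (S (fst (p n)) u) \<le> K * norm u"
    proof (rule uniform_boundedness_sequence[OF X])
      fix u assume u: "u \<in> X"
      have "((\<lambda>t. S t u) \<longlongrightarrow> u) (at_right 0)" "S 0 u = u" using S u by (auto simp: C0_semigroup_def)
      from tendstoD[OF this(1), of 1] obtain d where d: "d > 0" "\<And>t. 0 < t \<Longrightarrow> t < d \<Longrightarrow> dist (S t u) u < 1"
        by (auto simp: eventually_at_right_field)
      have near: "norm (S t u) \<le> norm u + 1" if "0 \<le> t" "t < d" for t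
      proof (cases "t = 0")
        case False
        then have "norm (S t u - u) < 1" using d(2)[of t] that by (simp add: dist_norm)
        then show ?thesis by (smt (verit) norm_triangle_sub)
      qed (simp add: \<open>S 0 u = u\<close>)
      obtain M :: nat where M: "1 / real (Suc M) < d"
        using reals_Archimedean[OF d(1)] by (auto simp: inverse_eq_divide)
      have "norm (S (fst (p n)) u) \<le> norm u + 1 + (\<Sum>i<M. norm (S (fst (p i)) u))" for n
      proof (cases "n < M")
        case True
        then have "norm (S (fst (p n)) u) \<le> (\<Sum>i<M. norm (S (fst (p i)) u))"
          by (intro member_le_sum) auto
        then show ?thesis by (smt (verit) norm_ge_zero)
      next
        case False
        have "1 / real (Suc n) \<le> 1 / real (Suc M)" using False by (intro divide_left_mono) auto
        then have "fst (p n) < d" using p(2)[of n] M by linarith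
        then have "norm (S (fst (p n)) u) \<le> norm u + 1" by (intro near p)
        moreover have "0 \<le> (\<Sum>i<M. norm (S (fst (p i)) u))" by (intro sum_nonneg) auto
        ultimately show ?thesis by linarith
      qed
      then show "\<exists>B. \<forall>n. norm (S (fst (p n)) u) \<le> B" by blast
    qed (use S p(1) in \<open>auto simp: C0_semigroup_def\<close>)
    then obtain K where K: "\<And>n u. u \<in> X \<Longrightarrow> norm (S (fst (p n)) u) \<le> K * norm u" by blast
    obtain n :: nat where n: "K \<le> real n" using real_arch_simple by blast
    have "K * norm (snd (p n)) \<le> real n * norm (snd (p n))" using n by (intro mult_right_mono) auto
    then show False using K[OF p(3)[of n], of n] p(4)[of n] by linarith
  qed
  then show ?thesis using that by blast
qed

lemma C0_semigroup_bounded_on_interval: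
  assumes X: "subspace X" "closed (X :: 'a::banach set)" and S: "C0_semigroup X S"
  obtains K where "K \<ge> 1" "\<And>s u. 0 \<le> s \<Longrightarrow> s \<le> t \<Longrightarrow> u \<in> X \<Longrightarrow> norm (S s u) \<le> K * norm u"
proof -
  obtain \<delta> K where \<delta>: "\<delta> > 0" and K: "\<And>s u. 0 \<le> s \<Longrightarrow> s \<le> \<delta> \<Longrightarrow> u \<in> X \<Longrightarrow> norm (S s u) \<le> K * norm u"
    using C0_semigroup_locally_bounded[OF X S] by metis
  define K' where "K' = max 1 K"
  have K': "norm (S s u) \<le> K' * norm u" if "0 \<le> s" "s \<le> \<delta>" "u \<in> X" for s u
    using K[OF that] mult_right_mono[of K K' "norm u"] by (simp add: K'_def)
  have K1: "1 \<le> K'" by (simp add: K'_def)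
  have pow: "norm (S s u) \<le> K' ^ Suc m * norm u" if "0 \<le> s" "s \<le> real (Suc m) * \<delta>" "u \<in> X" for m s u
    using that
  proof (induction m arbitrary: s u)
    case 0
    then show ?case using K'[of s u] by simp
  next
    case (Suc m)
    show ?case
    proof (cases "s \<le> \<delta>")
      case True
      have "K' * norm u \<le> K' ^ Suc (Suc m) * norm u"
        using K1 power_increasing[of 1 "Suc (Suc m)" K'] by (intro mult_right_mono) auto
      then show ?thesis using K'[of s u] Suc.prems True by linarith
    next
      case False
      have add: "S (r + r') v = S r (S r' v)" if "0 \<le> r" "0 \<le> r'" "v \<in> X" for r r' v
        using S that by (simp add: C0_semigroup_def)
      have 1: "S s u = S (s - \<delta>) (S \<delta> u)" using add[of "s - \<delta>" \<delta> u] Suc.prems False \<delta> by simp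
      have 2: "S \<delta> u \<in> X" using S Suc.prems \<delta> by (simp add: C0_semigroup_def)
      have "norm (S (s - \<delta>) (S \<delta> u)) \<le> K' ^ Suc m * norm (S \<delta> u)"
        using Suc.prems False by (intro Suc.IH 2) (auto simp: algebra_simps)
      also have "\<dots> \<le> K' ^ Suc m * (K' * norm u)"
        using K1 \<delta> Suc.prems by (intro mult_left_mono K') auto
      finally show ?thesis unfolding 1 by (simp add: mult_ac)
    qed
  qed
  obtain m :: nat where "t / \<delta> \<le> real m" using real_arch_simple by blast
  then have m: "t \<le> real (Suc m) * \<delta>" using \<delta> by (simp add: field_simps) 
  show ?thesis
    by (rule that[of "K' ^ Suc m"]) (use K1 pow m in \<open>auto intro: one_le_power order_trans\<close>)
qed

text \<open>The deviation \<open>d h = S h e - exp (- s h) e\<close> is \<open>o(h)\<close>. Over \<open>m\<close> steps of length \<open>t/m\<close> the deviations add up to at most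
  a constant times \<open>m\<close> times the norm of \<open>d (t/m)\<close>, so \<open>d t = 0\<close>. No derivative of an orbit at positive times is needed.\<close>

lemma semigroup_eigenvector:
  assumes X: "subspace X" "closed (X :: 'a::banach set)" and gen: "generates X D G S"
    and e: "e \<in> D" "G e = - s *\<^sub>R e" and t: "0 \<le> t"
  shows "S t e = exp (- (s * t)) *\<^sub>R e"
proof (cases "t = 0")
  case True
  then show ?thesis using gen e unfolding generates_def C0_semigroup_def by auto
next
  case False
  then have t: "t > 0" using assms by simp
  have S: "C0_semigroup X S" and eX: "e \<in> X" using gen e unfolding generates_def by auto
  obtain K where K1: "K \<ge> 1" and K: "\<And>r u. 0 \<le> r \<Longrightarrow> r \<le> t \<Longrightarrow> u \<in> X \<Longrightarrow> norm (S r u) \<le> K * norm u"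
    using C0_semigroup_bounded_on_interval[OF X S] by metis
  define d where "d h = S h e - exp (- (s * h)) *\<^sub>R e" for h
  have dX: "d h \<in> X" if "0 \<le> h" for h
    using S that eX unfolding d_def C0_semigroup_def by (auto intro!: subspace_diff subspace_scale X)
  have lim: "((\<lambda>h. (1 / h) *\<^sub>R d h) \<longlongrightarrow> 0) (at_right 0)"
  proof -
    have A: "((\<lambda>h. (1 / h) *\<^sub>R (S h e - e)) \<longlongrightarrow> - s *\<^sub>R e) (at_right 0)"
      using gen e eX unfolding generates_def by auto
    have B: "((\<lambda>h. (exp (- (s * h)) - 1) / h) \<longlongrightarrow> - s) (at_right 0)"
    proof -
      have "((\<lambda>h. exp (- (s * h))) has_real_derivative - s) (at 0)" by (auto intro!: derivative_eq_intros)
      then have "((\<lambda>h. (exp (- (s * h)) - 1) / h) \<longlongrightarrow> - s) (at 0)" unfolding DERIV_def by simp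
      then show ?thesis by (rule filterlim_mono[OF _ order_refl]) (simp add: at_le)
    qed
    have "((\<lambda>h. (1 / h) *\<^sub>R (S h e - e) - ((exp (- (s * h)) - 1) / h) *\<^sub>R e) \<longlongrightarrow> - s *\<^sub>R e - (- s) *\<^sub>R e) (at_right 0)"
      by (rule tendsto_diff[OF A tendsto_scaleR[OF B tendsto_const]])
    moreover have "(\<lambda>h. (1 / h) *\<^sub>R (S h e - e) - ((exp (- (s * h)) - 1) / h) *\<^sub>R e) = (\<lambda>h. (1 / h) *\<^sub>R d h)"
      by (simp add: d_def fun_eq_iff scaleR_diff_right scaleR_diff_left diff_divide_distrib)
    ultimately show ?thesis by simp
  qed
  have iter: "norm (d (real i * h)) \<le> real i * K * norm (d h) * exp (\<bar>s\<bar> * (real i * h))"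
    if h: "0 < h" and "real i * h \<le> t" for i h
    using that(2)
  proof (induction i)
    case 0
    have "d 0 = 0" using S eX unfolding d_def C0_semigroup_def by simp
    then show ?case by simp
  next
    case (Suc i)
    have le: "real i * h \<le> t" using Suc.prems h by (simp add: algebra_simps)
    have i0: "0 \<le> real i * h" using h by simp
    have Sadd: "S (real i * h + h) e = S (real i * h) (S h e)"
      using S eX h i0 unfolding C0_semigroup_def by auto
    have SX: "S h e \<in> X" using S eX h unfolding C0_semigroup_def by auto
    have "S (real i * h) (d h) = S (real i * h) (S h e) - exp (- (s * h)) *\<^sub>R S (real i * h) e"
    proof -
      have "S (real i * h) (1 *\<^sub>R S h e + (- exp (- (s * h))) *\<^sub>R e)
          = 1 *\<^sub>R S (real i * h) (S h e) + (- exp (- (s * h))) *\<^sub>R S (real i * h) e"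
        using S SX eX i0 unfolding C0_semigroup_def by blast
      then show ?thesis by (simp add: d_def)
    qed
    then have "d (real (Suc i) * h) = S (real i * h) (d h) + exp (- (s * h)) *\<^sub>R d (real i * h)"
      using Sadd by (simp add: d_def algebra_simps scaleR_diff_right exp_add[symmetric])
    then have "norm (d (real (Suc i) * h)) \<le> norm (S (real i * h) (d h)) + exp (- (s * h)) * norm (d (real i * h))"
      by (metis norm_triangle_ineq norm_scaleR abs_exp_cancel)
    also have "\<dots> \<le> K * norm (d h) + exp (\<bar>s\<bar> * h) * (real i * K * norm (d h) * exp (\<bar>s\<bar> * (real i * h)))"
    proof (intro add_mono mult_mono K Suc.IH i0 le dX)
      have "- s * h \<le> \<bar>s\<bar> * h" using h by (intro mult_right_mono) auto
      then show "exp (- (s * h)) \<le> exp (\<bar>s\<bar> * h)" by simp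
    qed (use h in auto)
    also have "\<dots> \<le> K * norm (d h) * exp (\<bar>s\<bar> * (real (Suc i) * h)) + real i * K * norm (d h) * exp (\<bar>s\<bar> * (real (Suc i) * h))"
    proof (intro add_mono)
      have "1 \<le> exp (\<bar>s\<bar> * (real (Suc i) * h))" using h by simp
      then show "K * norm (d h) \<le> K * norm (d h) * exp (\<bar>s\<bar> * (real (Suc i) * h))"
        using K1 mult_left_mono[of 1 _ "K * norm (d h)"] by simp
      show "exp (\<bar>s\<bar> * h) * (real i * K * norm (d h) * exp (\<bar>s\<bar> * (real i * h)))
          \<le> real i * K * norm (d h) * exp (\<bar>s\<bar> * (real (Suc i) * h))"
        by (simp add: algebra_simps exp_add)
    qed
    also have "\<dots> = real (Suc i) * K * norm (d h) * exp (\<bar>s\<bar> * (real (Suc i) * h))"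
      by (simp add: algebra_simps)
    finally show ?case .
  qed
  have bound: "norm (d t) \<le> t * K * exp (\<bar>s\<bar> * t) * norm ((1 / (t / real (Suc m))) *\<^sub>R d (t / real (Suc m)))" for m
  proof -
    define h where "h = t / real (Suc m)"
    have h: "0 < h" "real (Suc m) * h = t" using t by (simp_all add: h_def)
    have "norm (d t) \<le> real (Suc m) * K * norm (d h) * exp (\<bar>s\<bar> * t)"
      using iter[OF h(1), of "Suc m"] unfolding h(2) by simp
    also have "real (Suc m) = t * (1 / h)" using h by (simp add: field_simps)
    also have "t * (1 / h) * K * norm (d h) * exp (\<bar>s\<bar> * t) = t * K * exp (\<bar>s\<bar> * t) * norm ((1 / h) *\<^sub>R d h)"
      using h(1) by simp
    finally show ?thesis unfolding h_def .
  qed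
  have "filterlim (\<lambda>m. t / real (Suc m)) (at_right 0) sequentially"
  proof (rule tendsto_imp_filterlim_at_right)
    have "(\<lambda>m. t * inverse (real (Suc m))) \<longlonglongrightarrow> t * 0" by (intro tendsto_intros LIMSEQ_inverse_real_of_nat)
    then show "(\<lambda>m. t / real (Suc m)) \<longlonglongrightarrow> 0" by (simp add: divide_inverse)
  qed (use t in simp)
  from filterlim_compose[OF lim this]
  have "(\<lambda>m. t * K * exp (\<bar>s\<bar> * t) * norm ((1 / (t / real (Suc m))) *\<^sub>R d (t / real (Suc m)))) \<longlonglongrightarrow> t * K * exp (\<bar>s\<bar> * t) * norm (0::'a)"
    by (intro tendsto_intros)
  then have "norm (d t) \<le> t * K * exp (\<bar>s\<bar> * t) * norm (0::'a)"
    by (rule LIMSEQ_le_const) (use bound in blast)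
  then show ?thesis by (simp add: d_def)
qed

context spectral_resolution
begin

text \<open>Eigenvectors of the generator evolve by exponentials, finite sums of them are dense in \<open>X\<close>, and every
  \<open>S' t\<close> is bounded.\<close>

theorem semigroup_unique:
  assumes gen: "generates X D G S'" and eig: "\<And>j u. E j u \<in> D" "\<And>j u. G (E j u) = - \<sigma> j *\<^sub>R E j u"
    and t: "0 \<le> t" and u: "u \<in> X"
  shows "S' t u = S t u"
proof -
  have S': "C0_semigroup X S'" using gen unfolding generates_def by auto
  have lin: "S' t (a *\<^sub>R v + b *\<^sub>R w) = a *\<^sub>R S' t v + b *\<^sub>R S' t w" if "v \<in> X" "w \<in> X" for a b v w
    using S' t that by (simp add: C0_semigroup_def)
  have "\<exists>K. \<forall>v\<in>X. norm (S' t v) \<le> K * norm v" using S' t by (simp add: C0_semigroup_def)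
  then obtain K where K: "\<And>v. v \<in> X \<Longrightarrow> norm (S' t v) \<le> K * norm v" by blast
  let ?p = "\<lambda>n. \<Sum>j<n. E j u"
  have pX: "?p n \<in> X" for n by (intro subspace_sum subspace_X E_in_X)
  have Sp: "S' t (?p n) = (\<Sum>j<n. exp (- (\<sigma> j * t)) *\<^sub>R E j u)" for n
  proof (induction n)
    case 0
    then show ?case using lin[OF u u, of 0 0] by simp
  next
    case (Suc n)
    then show ?case
      using lin[OF pX E_in_X, of 1 n 1 n u] semigroup_eigenvector[OF subspace_X closed_X gen eig t, of n u] by simp
  qed
  have "(\<lambda>n. ?p n) \<longlonglongrightarrow> u" using mult_LIMSEQ[of "\<lambda>_. 1" 1 u] mult_one[OF u] by simp
  then have "(\<lambda>n. K * norm (?p n - u)) \<longlonglongrightarrow> K * norm (u - u)" by (intro tendsto_intros)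
  moreover have "norm (S' t (?p n) - S' t u) \<le> K * norm (?p n - u)" for n
  proof -
    have "S' t (?p n - u) = S' t (?p n) - S' t u" using lin[OF pX u, of 1 n "-1"] by simp
    then show ?thesis using K[OF subspace_diff[OF subspace_X pX u], of n] by simp
  qed
  ultimately have "(\<lambda>n. S' t (?p n) - S' t u) \<longlonglongrightarrow> 0"
    using Lim_null_comparison[of "\<lambda>n. S' t (?p n) - S' t u" "\<lambda>n. K * norm (?p n - u)" sequentially] by simp
  then have "(\<lambda>n. S' t (?p n)) \<longlonglongrightarrow> S' t u" by (simp add: LIM_zero_iff)
  moreover have "(\<lambda>n. S' t (?p n)) \<longlonglongrightarrow> S t u"
    unfolding Sp S_def using mult_LIMSEQ[of "\<lambda>j. exp (- (\<sigma> j * max 0 t))" "exp (c * max 0 t)" u, OF S_bound] t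
    by (simp add: max_absorb2)
  ultimately show ?thesis by (rule LIMSEQ_unique)
qed

end

section \<open>Weak derivatives on an interval\<close>

lemma borel_measurable_fun_of [measurable]: "fun_of u \<in> borel_measurable borel"
  using sqint_fun_of[of u] by (simp add: sqint_def)

lemma sqint_indicator_mult:
  assumes "sqint f" "A \<in> sets borel" shows "sqint (\<lambda>x. indicator A x * f x)"
  unfolding sqint_def
proof
  show "(\<lambda>x. indicator A x * f x) \<in> borel_measurable lborel" using assms by (auto simp: sqint_def)
  have "integrable lborel (\<lambda>x. indicator A x *\<^sub>R (f x)\<^sup>2)"
    using assms by (intro integrable_mult_indicator) (auto simp: sqint_def)
  moreover have "(\<lambda>x. indicator A x *\<^sub>R (f x)\<^sup>2) = (\<lambda>x. (indicator A x * f x)\<^sup>2)"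
    by (auto simp: indicator_def)
  ultimately show "integrable lborel (\<lambda>x. (indicator A x * f x)\<^sup>2)" by simp
qed

lemma sqint_l2_on:
  assumes "continuous_on {0..L} g" shows "sqint (\<lambda>x. indicator {0<..<L} x * g x)"
proof -
  have 1: "integrable lborel (\<lambda>x. indicator {0..L} x *\<^sub>R g x)"
    using assms by (intro borel_integrable_compact) auto
  have 2: "integrable lborel (\<lambda>x. indicator {0..L} x *\<^sub>R (g x)\<^sup>2)"
    by (rule borel_integrable_compact[OF compact_Icc]) (intro continuous_intros assms)
  have "(\<lambda>x. indicator {0..L} x *\<^sub>R (g x)\<^sup>2) = (\<lambda>x. (indicator {0..L} x * g x)\<^sup>2)"
    by (auto simp: fun_eq_iff indicator_def)
  with 1 2 have "sqint (\<lambda>x. indicator {0..L} x * g x)"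
    unfolding sqint_def by (auto dest: borel_measurable_integrable)
  from sqint_indicator_mult[OF this, of "{0<..<L}"]
  have "sqint (\<lambda>x. indicator {0<..<L} x * (indicator {0..L} x * g x))" by simp
  moreover have "(\<lambda>x. indicator {0<..<L} x * (indicator {0..L} x * g x)) = (\<lambda>x. indicator {0<..<L} x * g x)"
    by (auto simp: fun_eq_iff indicator_def)
  ultimately show ?thesis by simp
qed

text \<open>Vanishing outside the interval is orthogonality to everything supported there; this exhibits \<open>L2_interval\<close> as a
  closed subspace.\<close>

lemma L2_interval_iff_inner:
  "u \<in> L2_interval L \<longleftrightarrow> (\<forall>w. inner u (l2_of (\<lambda>x. indicator (- {0<..<L}) x * fun_of w x)) = 0)"
proof
  assume "u \<in> L2_interval L"
  then have ae: "AE x in lborel. x \<notin> {0<..<L} \<longrightarrow> fun_of u x = 0" by (simp add: L2_interval_def)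
  show "\<forall>w. inner u (l2_of (\<lambda>x. indicator (- {0<..<L}) x * fun_of w x)) = 0"
  proof
    fix w
    have sq: "sqint (\<lambda>x. indicator (- {0<..<L}) x * fun_of w x)" by (rule sqint_indicator_mult) auto
    have "inner u (l2_of (\<lambda>x. indicator (- {0<..<L}) x * fun_of w x))
        = (LINT x|lborel. fun_of u x * (indicator (- {0<..<L}) x * fun_of w x))"
      using inner_l2_of[OF sqint_fun_of[of u] sq] by simp
    also have "\<dots> = (LINT x::real|lborel. 0)"
      by (rule integral_cong_AE) (use ae in \<open>auto simp: indicator_def elim!: AE_mp\<close>)
    finally show "inner u (l2_of (\<lambda>x. indicator (- {0<..<L}) x * fun_of w x)) = 0" by simp
  qed
next
  assume *: "\<forall>w. inner u (l2_of (\<lambda>x. indicator (- {0<..<L}) x * fun_of w x)) = 0"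
  let ?h = "\<lambda>x. indicator (- {0<..<L}) x * fun_of u x"
  have sq: "sqint ?h" by (rule sqint_indicator_mult) auto
  have "inner u (l2_of ?h) = (LINT x|lborel. fun_of u x * ?h x)"
    using inner_l2_of[OF sqint_fun_of[of u] sq] by simp
  also have "\<dots> = (LINT x|lborel. ?h x * ?h x)" by (rule Bochner_Integration.integral_cong) (auto simp: indicator_def)
  also have "\<dots> = inner (l2_of ?h) (l2_of ?h)" by (rule inner_l2_of[OF sq sq, symmetric])
  finally have "l2_of ?h = 0" using * by simp
  also have "0 = l2_of (\<lambda>x. 0)" by (simp add: l2_of_def zero_l2_def)
  finally have "AE x in lborel. ?h x = 0" using l2_of_eq_iff[OF sq sqint_zero] by simp
  then show "u \<in> L2_interval L" unfolding L2_interval_def by (auto simp: indicator_def elim!: AE_mp)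
qed

lemma subspace_L2_interval: "subspace (L2_interval L)"
  by (auto simp: subspace_def L2_interval_iff_inner inner_add_left)

lemma closed_L2_interval: "closed (L2_interval L)"
proof -
  have "L2_interval L = (\<Inter>w. {u. inner u (l2_of (\<lambda>x. indicator (- {0<..<L}) x * fun_of w x)) = 0})"
    unfolding set_eq_iff L2_interval_iff_inner by auto
  also have "closed \<dots>" by (intro closed_INT ballI closed_Collect_eq continuous_intros)
  finally show ?thesis .
qed

lemma l2_of_in_L2_interval: "sqint f \<Longrightarrow> (\<And>x. x \<notin> {0<..<L} \<Longrightarrow> f x = 0) \<Longrightarrow> l2_of f \<in> L2_interval L"
  unfolding L2_interval_def using fun_of_l2_of[of f] by (auto elim!: AE_mp)

lemma l2_on_in_L2_interval: "continuous_on {0..L} g \<Longrightarrow> l2_on L g \<in> L2_interval L"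
  unfolding l2_on_def by (rule l2_of_in_L2_interval[OF sqint_l2_on]) auto

lemma inner_l2_on:
  assumes "continuous_on {0..L} g"
  shows "inner u (l2_on L g) = (LINT x:{0<..<L}|lborel. fun_of u x * g x)"
proof -
  have "inner u (l2_on L g) = (LINT x|lborel. fun_of u x * (indicator {0<..<L} x * g x))"
    unfolding l2_on_def using inner_l2_of[OF sqint_fun_of[of u] sqint_l2_on[OF assms]] by simp
  then show ?thesis by (simp add: set_lebesgue_integral_def mult_ac)
qed

lemma l2_on_add: "continuous_on {0..L} f \<Longrightarrow> continuous_on {0..L} g \<Longrightarrow> l2_on L (\<lambda>x. f x + g x) = l2_on L f + l2_on L g"
  unfolding l2_on_def by (subst l2_of_add) (auto intro: sqint_l2_on simp: distrib_left)

lemma l2_on_scale: "continuous_on {0..L} f \<Longrightarrow> l2_on L (\<lambda>x. c * f x) = c *\<^sub>R l2_on L f"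
  by (simp add: l2_on_def l2_of_scaleR sqint_l2_on mult.left_commute)

lemma l2_on_cong: "(\<And>x. 0 < x \<Longrightarrow> x < L \<Longrightarrow> f x = g x) \<Longrightarrow> l2_on L f = l2_on L g"
  unfolding l2_on_def by (rule arg_cong[of _ _ l2_of]) (auto simp: fun_eq_iff indicator_def)

definition C1_pair :: "(real \<Rightarrow> real) \<Rightarrow> (real \<Rightarrow> real) \<Rightarrow> bool" where
  "C1_pair \<psi> \<psi>' \<longleftrightarrow> (\<forall>x. (\<psi> has_real_derivative \<psi>' x) (at x)) \<and> continuous_on UNIV \<psi>'"

lemma C1_pair_continuous: "C1_pair \<psi> \<psi>' \<Longrightarrow> continuous_on A \<psi>" "C1_pair \<psi> \<psi>' \<Longrightarrow> continuous_on A \<psi>'"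
  unfolding C1_pair_def
  by (meson DERIV_continuous continuous_at_imp_continuous_on) (meson continuous_on_subset top_greatest)

lemma test_functionI:
  assumes "C1_pair \<phi> \<phi>'" "0 < a" "b < L" "\<And>x. x \<notin> {a..b} \<Longrightarrow> \<phi> x = 0"
  shows "test_function L \<phi>" "deriv \<phi> = \<phi>'"
proof -
  have D: "(\<phi> has_real_derivative \<phi>' x) (at x)" for x using assms(1) by (simp add: C1_pair_def)
  then show "deriv \<phi> = \<phi>'" by (auto simp: fun_eq_iff DERIV_imp_deriv)
  have "\<phi> C1_differentiable_on UNIV"
    unfolding C1_differentiable_on_def using assms(1) D
    by (intro exI[of _ \<phi>']) (simp add: C1_pair_def has_real_derivative_iff_has_vector_derivative)
  then show "test_function L \<phi>" unfolding test_function_def using assms(2-4) by blast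
qed

lemma test_functionD:
  assumes "test_function L \<phi>"
  obtains a b where "C1_pair \<phi> (deriv \<phi>)" "0 < a" "b < L" "\<And>x. x \<notin> {a..b} \<Longrightarrow> \<phi> x = 0"
proof -
  obtain a b D where ab: "0 < a" "b < L" "\<And>x. x \<notin> {a..b} \<Longrightarrow> \<phi> x = 0"
    and D: "\<And>x. (\<phi> has_vector_derivative D x) (at x)" "continuous_on UNIV D"
    using assms unfolding test_function_def C1_differentiable_on_def by auto
  have D': "(\<phi> has_real_derivative D x) (at x)" for x
    using D(1) by (simp add: has_real_derivative_iff_has_vector_derivative)
  then have "deriv \<phi> = D" by (auto simp: fun_eq_iff DERIV_imp_deriv)
  then show ?thesis using that[OF _ ab] D' D(2) by (simp add: C1_pair_def)
qed

lemma test_function_continuous: "test_function L \<phi> \<Longrightarrow> continuous_on A \<phi>"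
  "test_function L \<phi> \<Longrightarrow> continuous_on A (deriv \<phi>)"
  by (erule test_functionD, erule C1_pair_continuous)+

lemma has_weak_deriv_iff:
  "has_weak_deriv L u v \<longleftrightarrow> (\<forall>\<phi>. test_function L \<phi> \<longrightarrow> inner u (l2_on L (deriv \<phi>)) = - inner v (l2_on L \<phi>))"
  unfolding has_weak_deriv_def
  by (intro all_cong1 imp_cong refl) (simp add: inner_l2_on test_function_continuous)

text \<open>Orthogonality to test functions is transported to all monomials cut off at \<open>[-n, n]\<close>, whose span is dense. On the part \<open>(0, M)\<close> of
  such an interval inside \<open>(0, L)\<close>, the monomial is the limit of the test functions \<open>\<eta> m\<close>: the monomial times two smooth
  cut-offs that vanish within distance \<open>1/(m+1)\<close> of the ends and tend to one inside.\<close>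

lemma test_functions_dense:
  assumes w: "w \<in> L2_interval L" and L: "0 < L"
    and orth: "\<And>\<phi>. test_function L \<phi> \<Longrightarrow> inner w (l2_on L \<phi>) = 0"
  shows "w = 0"
proof -
  have "{u. inner w u = 0} = UNIV"
  proof (rule closed_subspace_l2_UNIV)
    show "closed {u. inner w u = 0}" by (intro closed_Collect_eq continuous_intros)
    show "subspace {u. inner w u = 0}" by (auto simp: subspace_def inner_add_right)
    fix n j :: nat
    \<comment> \<open>The faster argument \<open>(m+1)((m+1) x - 1)\<close> sends the cut-off to one for every fixed \<open>x\<close> inside, while it is negative for
      \<open>x < 1/(m+1)\<close>.\<close>
    define M where "M = min (real n) L"
    define \<eta> where "\<eta> m x = x ^ j * (flat 0 (real (Suc m) * (real (Suc m) * x - 1))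
        * flat 0 (real (Suc m) * (real (Suc m) * (M - x) - 1)))" for m x
    have flat01: "0 \<le> flat 0 t" "flat 0 t \<le> 1" for t by (auto simp: flat_def)
    have d: "\<exists>D. C1_pair (\<eta> m) D" for m
    proof -
      have 1: "((\<lambda>x. flat 0 (real (Suc m) * (real (Suc m) * x - 1))) has_real_derivative
          flat (Suc 0) (real (Suc m) * (real (Suc m) * x - 1)) * (real (Suc m) * real (Suc m))) (at x)" for x
        by (rule DERIV_chain2[OF flat_deriv]) (auto intro!: derivative_eq_intros)
      have 2: "((\<lambda>x. flat 0 (real (Suc m) * (real (Suc m) * (M - x) - 1))) has_real_derivative
          flat (Suc 0) (real (Suc m) * (real (Suc m) * (M - x) - 1)) * (- (real (Suc m) * real (Suc m)))) (at x)" for x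
        by (rule DERIV_chain2[OF flat_deriv]) (auto intro!: derivative_eq_intros simp: algebra_simps)
      have 3: "((\<lambda>x. x ^ j) has_real_derivative real j * x ^ (j - Suc 0)) (at x)" for x :: real
        by (rule DERIV_pow)
      have cf: "continuous_on A (\<lambda>x. flat n (f x))" if "continuous_on A f" for A n f
        using DERIV_continuous[OF flat_deriv] that
        by (intro continuous_on_compose2[of UNIV "flat n" A f]) (auto intro: continuous_at_imp_continuous_on)
      show ?thesis
        unfolding C1_pair_def \<eta>_def
        by (rule exI, intro conjI allI, rule DERIV_mult[OF 3 DERIV_mult[OF 1 2]]) (intro continuous_intros cf)
    qed
    have supp: "\<eta> m x = 0" if "x \<notin> {1 / real (Suc m)..M - 1 / real (Suc m)}" for m x
    proof -
      have P: "0 < real (Suc m)" by simp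
      have h: "real (Suc m) * x - 1 < 0 \<or> real (Suc m) * (M - x) - 1 < 0"
        using that by (auto simp: field_simps)
      have "real (Suc m) * (real (Suc m) * x - 1) < 0 \<or> real (Suc m) * (real (Suc m) * (M - x) - 1) < 0"
        by (rule disj_forward[OF h]) (erule mult_pos_neg[OF P])+
      then show ?thesis by (auto simp: \<eta>_def flat_def)
    qed
    have \<eta>0: "\<eta> m x = 0" if "\<not> (0 < x \<and> x < M)" for m x
    proof (rule supp)
      have "0 < 1 / real (Suc m)" by simp
      then have "\<not> (1 / real (Suc m) \<le> x \<and> x \<le> M - 1 / real (Suc m))" using that by linarith
      then show "x \<notin> {1 / real (Suc m)..M - 1 / real (Suc m)}" by (simp only: atLeastAtMost_iff not_False_eq_True)
    qed
    have test: "test_function L (\<eta> m)" for m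
    proof -
      obtain D where D: "C1_pair (\<eta> m) D" using d by blast
      have P: "0 < 1 / real (Suc m)" by simp
      moreover have "M \<le> L" by (simp add: M_def)
      ultimately have "M - 1 / real (Suc m) < L" by linarith
      then show ?thesis by (rule test_functionI(1)[OF D P _ supp])
    qed
    let ?f = "\<lambda>x. indicator {0<..<M} x * x ^ j"
    have M: "0 \<le> M" "M \<le> L" using L by (auto simp: M_def)
    have "sqint (\<lambda>x. indicator {0<..<M} x * x ^ j)" by (rule sqint_l2_on) (intro continuous_intros)
    have "(\<lambda>m. l2_of (\<lambda>x. indicator {0<..<L} x * \<eta> m x)) \<longlonglongrightarrow> l2_of ?f"
    proof (rule l2_dominated_convergence[where w = "\<lambda>x. indicator {0<..<L} x * L ^ j"])
      show "sqint ?f" by fact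
      show "sqint (\<lambda>x. indicator {0<..<L} x * \<eta> m x)" for m
        by (rule sqint_l2_on[OF test_function_continuous(1)[OF test]])
      show "sqint (\<lambda>x. indicator {0<..<L} x * L ^ j)" by (rule sqint_l2_on) (intro continuous_intros)
      show "AE x in lborel. (\<lambda>m. indicator {0<..<L} x * \<eta> m x) \<longlonglongrightarrow> ?f x"
      proof (rule AE_I2)
        fix x
        show "(\<lambda>m. indicator {0<..<L} x * \<eta> m x) \<longlonglongrightarrow> ?f x"
        proof (cases "0 < x \<and> x < M")
          case True
          have f1: "(\<lambda>m. flat 0 (real (Suc m) * (real (Suc m) * y - 1))) \<longlonglongrightarrow> 1" if "0 < y" for y
          proof -
            have "filterlim (\<lambda>m. real (Suc m) * (real (Suc m) * y - 1)) at_top sequentially"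
              using that by real_asymp
            moreover have "((\<lambda>t. flat 0 t) \<longlongrightarrow> 1) at_top"
            proof -
              have "((\<lambda>t::real. exp (- (1 / t))) \<longlongrightarrow> 1) at_top" by real_asymp
              moreover have "\<forall>\<^sub>F t in at_top. exp (- (1 / t)) = flat 0 t"
                using eventually_gt_at_top[of 0] by eventually_elim (simp add: flat_def)
              ultimately show ?thesis by (rule Lim_transform_eventually)
            qed
            ultimately show ?thesis by (rule filterlim_compose[rotated])
          qed
          have "(\<lambda>m. \<eta> m x) \<longlonglongrightarrow> x ^ j * (1 * 1)"
            unfolding \<eta>_def using True by (intro tendsto_intros f1) auto
          then show ?thesis using True M by (simp add: indicator_def)
        next
          case False
          have "\<eta> m x = 0" for m by (rule \<eta>0[OF False])
          then show ?thesis using False by (auto simp: indicator_def)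
        qed
      qed
      fix m x
      show "\<bar>indicator {0<..<L} x * \<eta> m x - ?f x\<bar> \<le> indicator {0<..<L} x * L ^ j"
      proof (cases "0 < x \<and> x < M")
        case True
        define q where "q = flat 0 (real (Suc m) * (real (Suc m) * x - 1)) * flat 0 (real (Suc m) * (real (Suc m) * (M - x) - 1))"
        have q: "0 \<le> q" "q \<le> 1" unfolding q_def using flat01 by (auto intro: mult_le_one)
        have "x ^ j * q - x ^ j = - (x ^ j * (1 - q))" by (simp add: algebra_simps)
        then have "\<bar>x ^ j * q - x ^ j\<bar> = x ^ j * (1 - q)" using True q by (simp add: abs_mult)
        also have "\<dots> \<le> L ^ j * 1" using True q M by (intro mult_mono power_mono) auto
        finally show ?thesis using True M by (simp add: indicator_def \<eta>_def q_def)
      next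
        case False
        have "\<eta> m x = 0" by (rule \<eta>0[OF False])
        then show ?thesis using False L by (auto simp: indicator_def)
      qed
    qed
    then have "(\<lambda>m. inner w (l2_on L (\<eta> m))) \<longlonglongrightarrow> inner w (l2_of ?f)"
      unfolding l2_on_def by (intro tendsto_intros)
    then have "inner w (l2_of ?f) = 0" by (simp add: orth[OF test] LIMSEQ_const_iff)
    moreover have "inner w (l2_of (\<lambda>x. indicator {-real n..real n} x * x ^ j)) = inner w (l2_of ?f)"
    proof -
      have sq: "sqint (\<lambda>x. indicator {-real n..real n} x * x ^ j)"
        by (intro sqint_continuous continuous_intros)
      have w0: "AE x in lborel. x \<notin> {0<..<L} \<longrightarrow> fun_of w x = 0" using w by (simp add: L2_interval_def)
      have nM: "AE x in lborel. x \<noteq> M" by (rule AE_lborel_singleton)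
      have "(LINT x|lborel. fun_of w x * (indicator {-real n..real n} x * x ^ j)) = (LINT x|lborel. fun_of w x * ?f x)"
      proof (rule integral_cong_AE)
        show "AE x in lborel. fun_of w x * (indicator {-real n..real n} x * x ^ j) = fun_of w x * ?f x"
          using w0 nM by eventually_elim (auto simp: indicator_def M_def)
      qed auto
      then show ?thesis
        using inner_l2_of[OF sqint_fun_of[of w] sq] inner_l2_of[OF sqint_fun_of[of w] \<open>sqint ?f\<close>] by simp
    qed
    ultimately show "l2_of (\<lambda>x. indicator {-real n..real n} x * x ^ j) \<in> {u. inner w u = 0}" by simp
  qed
  then show "w = 0" by (metis (mono_tags) UNIV_I inner_eq_zero_iff mem_Collect_eq)
qed

lemma set_lint_continuous_eq_integral:
  fixes f :: "real \<Rightarrow> real"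
  assumes "continuous_on {a..b} f"
  shows "(LINT x:{a<..<b}|lborel. f x) = integral {a..b} f"
proof -
  have "set_integrable lborel {a..b} f" by (rule borel_integrable_atLeastAtMost') (rule assms)
  then have "(LINT x:{a..b}|lborel. f x) = integral {a..b} f" by (rule set_borel_integral_eq_integral(2))
  moreover have "(LINT x:{a<..<b}|lborel. f x) = (LINT x:{a..b}|lborel. f x)"
  proof -
    have "(LINT x|lborel. indicator {a<..<b} x *\<^sub>R f x) = (LINT x|lborel. indicator {a..b} x *\<^sub>R f x)"
    proof (rule integral_cong_AE)
      show "AE x in lborel. indicator {a<..<b} x *\<^sub>R f x = indicator {a..b} x *\<^sub>R f x"
        using AE_lborel_singleton[of a] AE_lborel_singleton[of b]
        by eventually_elim (auto simp: indicator_def)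
      have "(\<lambda>x. indicator {a<..<b} x *\<^sub>R f x) = (\<lambda>x. indicator {a<..<b} x *\<^sub>R (indicator {a..b} x *\<^sub>R f x))"
        by (auto simp: indicator_def)
      moreover have m: "(\<lambda>x. indicator {a..b} x *\<^sub>R f x) \<in> borel_measurable borel"
        using assms by (intro borel_measurable_continuous_on_indicator) auto
      ultimately show "(\<lambda>x. indicator {a<..<b} x *\<^sub>R f x) \<in> borel_measurable lborel" by simp
      show "(\<lambda>x. indicator {a..b} x *\<^sub>R f x) \<in> borel_measurable lborel" using m by simp
    qed
    then show ?thesis by (simp add: set_lebesgue_integral_def)
  qed
  ultimately show ?thesis by simp
qed

lemma inner_l2_on_l2_on:
  assumes "continuous_on {0..L} f" "continuous_on {0..L} g"
  shows "inner (l2_on L f) (l2_on L g) = integral {0..L} (\<lambda>x. f x * g x)"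
proof -
  have "inner (l2_on L f) (l2_on L g) = (LINT x|lborel. (indicator {0<..<L} x * f x) * (indicator {0<..<L} x * g x))"
    unfolding l2_on_def by (rule inner_l2_of) (intro sqint_l2_on assms)+
  also have "\<dots> = (LINT x:{0<..<L}|lborel. f x * g x)"
    unfolding set_lebesgue_integral_def by (rule Bochner_Integration.integral_cong) (auto simp: indicator_def)
  also have "\<dots> = integral {0..L} (\<lambda>x. f x * g x)"
    by (rule set_lint_continuous_eq_integral) (intro continuous_intros assms)
  finally show ?thesis .
qed

text \<open>Every test function is a multiple of a fixed one plus a test function of integral zero, and the latter is the derivative of
  a test function.\<close>

lemma weak_deriv_zero_imp_const:
  assumes u: "u \<in> L2_interval L" and L: "0 < L"
    and d: "\<And>\<phi>. test_function L \<phi> \<Longrightarrow> inner u (l2_on L (deriv \<phi>)) = 0"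
  shows "\<exists>c. u = c *\<^sub>R l2_on L (\<lambda>_. 1)"
proof -
  let ?I = "\<lambda>\<eta>. integral {0..L} \<eta>"
  have "\<exists>\<eta>. test_function L \<eta> \<and> inner (l2_on L (\<lambda>_. 1)) (l2_on L \<eta>) \<noteq> 0"
  proof (rule ccontr)
    assume "\<not> ?thesis"
    then have "l2_on L (\<lambda>_. 1) = 0"
      by (intro test_functions_dense[of _ L] L l2_on_in_L2_interval) (auto intro!: continuous_intros)
    then have "inner (l2_on L (\<lambda>_. 1)) (l2_on L (\<lambda>_. 1)) = 0" by simp
    then show False using L by (simp add: inner_l2_on_l2_on)
  qed
  then obtain \<eta>0 where \<eta>0: "test_function L \<eta>0" "?I \<eta>0 \<noteq> 0"
    by (auto simp: inner_l2_on_l2_on test_function_continuous)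
  define c where "c = inner u (l2_on L \<eta>0) / ?I \<eta>0"
  have "u - c *\<^sub>R l2_on L (\<lambda>_. 1) = 0"
  proof (rule test_functions_dense[of _ L])
    show "u - c *\<^sub>R l2_on L (\<lambda>_. 1) \<in> L2_interval L"
      by (intro subspace_diff subspace_scale subspace_L2_interval u l2_on_in_L2_interval continuous_intros)
    fix \<eta> assume \<eta>: "test_function L \<eta>"
    define r where "r = ?I \<eta> / ?I \<eta>0"
    define \<psi> where "\<psi> x = \<eta> x - r * \<eta>0 x" for x
    obtain a1 b1 where 1: "0 < a1" "b1 < L" "\<And>x. x \<notin> {a1..b1} \<Longrightarrow> \<eta> x = 0" using test_functionD[OF \<eta>] by metis
    obtain a0 b0 where 0: "0 < a0" "b0 < L" "\<And>x. x \<notin> {a0..b0} \<Longrightarrow> \<eta>0 x = 0" using test_functionD[OF \<eta>0(1)] by metis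
    define a where "a = min (L/2) (min a0 a1)"
    define b where "b = max (L/2) (max b0 b1)"
    have ab: "0 < a" "a \<le> b" "b < L" using 0 1 L by (auto simp: a_def b_def)
    have \<psi>0: "\<psi> x = 0" if "x \<notin> {a..b}" for x
    proof -
      have "\<eta>0 x = 0" by (rule 0(3)) (use that in \<open>auto simp: a_def b_def\<close>)
      moreover have "\<eta> x = 0" by (rule 1(3)) (use that in \<open>auto simp: a_def b_def\<close>)
      ultimately show ?thesis by (simp add: \<psi>_def)
    qed
    have c\<psi>: "continuous_on A \<psi>" for A
      unfolding \<psi>_def by (intro continuous_intros test_function_continuous(1)[OF \<eta>] test_function_continuous(1)[OF \<eta>0(1)])
    have I\<psi>: "integral {0..L} \<psi> = 0"
    proof -
      have "integral {0..L} \<psi> = ?I \<eta> - r * ?I \<eta>0"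
        unfolding \<psi>_def
        using integrable_continuous_real[OF test_function_continuous(1)[OF \<eta>], of 0 L]
          integrable_continuous_real[OF test_function_continuous(1)[OF \<eta>0(1)], of 0 L]
        by (simp add: integral_diff integrable_on_mult_right)
      then show ?thesis using \<eta>0(2) by (simp add: r_def)
    qed
    define \<phi> where "\<phi> x = integral {0..x} \<psi>" for x
    have big: "integral {0..x} \<psi> = integral {a..b} \<psi>" if "b \<le> x" for x
    proof -
      have "(\<psi> has_integral integral {a..b} \<psi>) {a..b}"
        by (intro integrable_integral integrable_continuous_real c\<psi>)
      then have "(\<psi> has_integral integral {a..b} \<psi>) {0..x}"
        by (rule has_integral_on_superset) (use \<psi>0 ab that in auto)
      then show ?thesis by (rule integral_unique)
    qed
    have \<phi>0: "\<phi> x = 0" if "x \<notin> {a..b}" for x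
    proof (cases "x < a")
      case True
      have "integral {0..x} \<psi> = integral {0..x} (\<lambda>_. 0)"
        by (rule integral_cong) (use \<psi>0 True in auto)
      then show ?thesis by (simp add: \<phi>_def)
    next
      case False
      then show ?thesis using that big[of x] big[of L] I\<psi> ab by (simp add: \<phi>_def)
    qed
    have deriv: "(\<phi> has_real_derivative \<psi> x) (at x)" for x
    proof -
      consider "x < a" | "x > b" | "x \<in> {0<..<L}" using ab by fastforce
      then show ?thesis
      proof cases
        case 1
        have "((\<lambda>x. 0::real) has_real_derivative 0) (at x)" by simp
        then have "(\<phi> has_real_derivative 0) (at x)"
          by (rule has_field_derivative_transform_within_open[of _ _ _ "{..<a}"]) (use 1 \<phi>0 in auto)
        then show ?thesis using 1 \<psi>0[of x] by simp
      next
        case 2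
        have "((\<lambda>x. 0::real) has_real_derivative 0) (at x)" by simp
        then have "(\<phi> has_real_derivative 0) (at x)"
          by (rule has_field_derivative_transform_within_open[of _ _ _ "{b<..}"]) (use 2 \<phi>0 in auto)
        then show ?thesis using 2 \<psi>0[of x] by simp
      next
        case 3
        have "(\<phi> has_real_derivative \<psi> x) (at x within {0..L})"
          unfolding \<phi>_def by (rule integral_has_real_derivative[OF c\<psi>]) (use 3 in auto)
        then have "(\<phi> has_real_derivative \<psi> x) (at x within {0<..<L})"
          by (rule DERIV_subset) auto
        then show ?thesis using 3 at_within_open[of x "{0<..<L}"] by simp
      qed
    qed
    have pair: "C1_pair \<phi> \<psi>" unfolding C1_pair_def using deriv c\<psi> by blast
    have t: "test_function L \<phi>" "deriv \<phi> = \<psi>"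
      using test_functionI[OF pair ab(1) ab(3) \<phi>0] by auto
    have "l2_on L \<psi> = l2_on L \<eta> + (- r) *\<^sub>R l2_on L \<eta>0"
    proof -
      have "l2_on L \<psi> = l2_on L (\<lambda>x. \<eta> x + (- r) * \<eta>0 x)" by (rule l2_on_cong) (simp add: \<psi>_def)
      also have "\<dots> = l2_on L \<eta> + l2_on L (\<lambda>x. (- r) * \<eta>0 x)"
        by (rule l2_on_add) (intro continuous_intros test_function_continuous(1)[OF \<eta>] test_function_continuous(1)[OF \<eta>0(1)])+
      also have "l2_on L (\<lambda>x. (- r) * \<eta>0 x) = (- r) *\<^sub>R l2_on L \<eta>0"
        by (rule l2_on_scale[OF test_function_continuous(1)[OF \<eta>0(1)]])
      finally show ?thesis .
    qed
    then have "inner u (l2_on L \<eta>) = r * inner u (l2_on L \<eta>0)"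
      using d[OF t(1)] t(2) by (simp add: inner_diff_right)
    then show "inner (u - c *\<^sub>R l2_on L (\<lambda>_. 1)) (l2_on L \<eta>) = 0"
      using \<eta>0(2) by (simp add: inner_diff_left inner_l2_on_l2_on test_function_continuous[OF \<eta>] c_def r_def)
  qed (rule L)
  then show ?thesis by (intro exI[of _ c]) simp
qed

text \<open>Written as an inner product, the primitive is visibly linear and Hoelder continuous.\<close>

definition primitive :: "l2 \<Rightarrow> real \<Rightarrow> real" where
  "primitive v x = inner v (l2_of (indicator {0..x}))"

lemma sqint_indicator: "sqint (indicator {a..b})"
proof -
  have "sqint (\<lambda>x. indicator {a..b} x * (indicator {- max \<bar>a\<bar> \<bar>b\<bar>..max \<bar>a\<bar> \<bar>b\<bar>} x * 1))"
    by (intro sqint_indicator_mult sqint_continuous continuous_intros) auto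
  moreover have "(\<lambda>x. indicator {a..b} x * (indicator {- max \<bar>a\<bar> \<bar>b\<bar>..max \<bar>a\<bar> \<bar>b\<bar>} x * 1)) = (indicator {a..b} :: real \<Rightarrow> real)"
    by (auto simp: fun_eq_iff indicator_def)
  ultimately show ?thesis by simp
qed

lemma primitive_continuous: "continuous_on {0..} (primitive v)"
proof -
  have *: "\<bar>primitive v x - primitive v y\<bar> \<le> norm v * sqrt (x - y)" if "0 \<le> y" "y \<le> x" for x y
  proof -
    let ?d = "\<lambda>z. indicator {0..x} z - indicator {0..y} z :: real"
    have sq: "sqint ?d" by (intro sqint_diff sqint_indicator)
    have "primitive v x - primitive v y = inner v (l2_of ?d)"
      unfolding primitive_def l2_of_diff[OF sqint_indicator sqint_indicator, symmetric] by (simp add: inner_diff_right)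
    also have "\<bar>\<dots>\<bar> \<le> norm v * norm (l2_of ?d)" by (rule Cauchy_Schwarz_ineq2)
    also have "norm (l2_of ?d) = sqrt (LINT z|lborel. (?d z)\<^sup>2)" by (rule norm_l2_of[OF sq])
    also have "(\<lambda>z. (?d z)\<^sup>2) = indicator {y<..x}" using that by (auto simp: fun_eq_iff indicator_def)
    also have "(LINT z|lborel. indicator {y<..x} z) = x - y" using that by simp
    finally show ?thesis .
  qed
  have **: "\<bar>primitive v x - primitive v y\<bar> \<le> norm v * sqrt \<bar>x - y\<bar>" if "0 \<le> x" "0 \<le> y" for x y
  proof (cases "x \<le> y")
    case True
    then have "\<bar>x - y\<bar> = y - x" by simp
    then show ?thesis using *[of x y] that True by (simp add: abs_minus_commute)
  next
    case False
    then have "\<bar>x - y\<bar> = x - y" by simp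
    then show ?thesis using *[of y x] that False by simp
  qed
  show ?thesis
    unfolding continuous_on_def
  proof
    fix x :: real assume x: "x \<in> {0..}"
    have "((\<lambda>y. norm v * sqrt \<bar>y - x\<bar>) \<longlongrightarrow> norm v * sqrt \<bar>x - x\<bar>) (at x within {0..})"
      by (intro tendsto_intros)
    moreover have "\<forall>\<^sub>F y in at x within {0..}. norm (primitive v y - primitive v x) \<le> norm v * sqrt \<bar>y - x\<bar>"
      unfolding eventually_at_filter by (rule always_eventually) (use ** x in auto)
    ultimately have "((\<lambda>y. primitive v y - primitive v x) \<longlongrightarrow> 0) (at x within {0..})"
      using Lim_null_comparison[of "\<lambda>y. primitive v y - primitive v x" "\<lambda>y. norm v * sqrt \<bar>y - x\<bar>"] by simp
    then show "(primitive v \<longlongrightarrow> primitive v x) (at x within {0..})" by (simp add: LIM_zero_iff)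
  qed
qed

lemma primitive_eq: "primitive v x = (LINT s|lborel. indicator {0..x} s * fun_of v s)"
  using inner_l2_of[OF sqint_fun_of[of v] sqint_indicator[of 0 x]] by (simp add: primitive_def mult.commute)

text \<open>Write \<open>\<psi> L - \<psi> s\<close> as the integral of \<open>\<psi>'\<close> over \<open>[s, L]\<close> and exchange the integrals over the triangle \<open>s \<le> x \<le> L\<close>.\<close>

lemma primitive_by_parts:
  assumes \<psi>: "C1_pair \<psi> \<psi>'" and L: "0 < L" and v: "v \<in> L2_interval L"
  shows "inner (l2_on L (primitive v)) (l2_on L \<psi>') = primitive v L * \<psi> L - inner v (l2_on L \<psi>)"
proof -
  note c = C1_pair_continuous[OF \<psi>]
  have m\<psi>: "\<psi>' \<in> borel_measurable borel" using c(2)[of UNIV] by (rule borel_measurable_continuous_onI)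
  have m\<psi>1: "\<psi> \<in> borel_measurable borel" using c(1)[of UNIV] by (rule borel_measurable_continuous_onI)
  note [measurable] = m\<psi> m\<psi>1
  define f where "f = (\<lambda>(s, x). indicator {0..L} s * fun_of v s * (if s \<le> x \<and> x \<le> L then \<psi>' x else 0))"
  have fm: "f \<in> borel_measurable (lborel \<Otimes>\<^sub>M lborel)" unfolding f_def by measurable
  obtain C where "\<forall>y\<in>\<psi>' ` {0..L}. norm y \<le> C"
    using compact_imp_bounded[OF compact_continuous_image[OF c(2) compact_Icc[of 0 L]]]
    unfolding bounded_iff by blast
  then have C: "\<And>x. x \<in> {0..L} \<Longrightarrow> \<bar>\<psi>' x\<bar> \<le> C" by auto
  have C0: "0 \<le> C" using C[of 0] L by fastforce
  have int_in: "integrable lborel (\<lambda>x. if s \<le> x \<and> x \<le> L then \<psi>' x else 0)" for s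
  proof -
    have "integrable lborel (\<lambda>x. indicator {s..L} x *\<^sub>R \<psi>' x)"
      by (intro borel_integrable_compact c) auto
    moreover have "(\<lambda>x. indicator {s..L} x *\<^sub>R \<psi>' x) = (\<lambda>x. if s \<le> x \<and> x \<le> L then \<psi>' x else 0)" by auto
    ultimately show ?thesis by simp
  qed
  have ftc: "(LINT x|lborel. (if s \<le> x \<and> x \<le> L then \<psi>' x else 0)) = \<psi> L - \<psi> s" if "s \<le> L" for s
  proof -
    have "(LINT x|lborel. \<psi>' x * indicator {s..L} x) = \<psi> L - \<psi> s"
      using \<psi> that by (intro integral_FTC_Icc_real)
        (auto simp: C1_pair_def continuous_on_eq_continuous_at)
    moreover have "(\<lambda>x. \<psi>' x * indicator {s..L} x) = (\<lambda>x. if s \<le> x \<and> x \<le> L then \<psi>' x else 0)" by auto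
    ultimately show ?thesis by simp
  qed
  have intv: "integrable lborel (\<lambda>s. indicator {0..L} s * fun_of v s)"
    by (rule sqint_mult[OF sqint_indicator sqint_fun_of])
  have intf: "integrable (lborel \<Otimes>\<^sub>M lborel) f"
  proof (rule lborel_pair.Fubini_integrable[OF fm])
    show "AE s in lborel. integrable lborel (\<lambda>x. f (s, x))"
      unfolding f_def using int_in by simp
    show "integrable lborel (\<lambda>s. LINT x|lborel. norm (f (s, x)))"
    proof (rule Bochner_Integration.integrable_bound[of _ "\<lambda>s. C * L * (indicator {0..L} s * fun_of v s)"])
      show "integrable lborel (\<lambda>s. C * L * (indicator {0..L} s * fun_of v s))" using intv by simp
      show "(\<lambda>s. LINT x|lborel. norm (f (s, x))) \<in> borel_measurable lborel"
        using fm by (intro lborel.borel_measurable_lebesgue_integral) simp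
      show "AE s in lborel. norm (LINT x|lborel. norm (f (s, x))) \<le> norm (C * L * (indicator {0..L} s * fun_of v s))"
      proof (rule AE_I2)
        fix s
        have "(LINT x|lborel. norm (f (s, x))) \<le> (LINT x|lborel. indicator {0..L} x *\<^sub>R (C * \<bar>indicator {0..L} s * fun_of v s\<bar>))"
        proof (rule integral_mono)
          show "integrable lborel (\<lambda>x. norm (f (s, x)))" unfolding f_def using int_in[of s] by (intro integrable_norm) simp
          show "integrable lborel (\<lambda>x. indicator {0..L} x *\<^sub>R (C * \<bar>indicator {0..L} s * fun_of v s\<bar>))"
            by (intro borel_integrable_compact continuous_intros) auto
          fix x
          show "norm (f (s, x)) \<le> indicator {0..L} x *\<^sub>R (C * \<bar>indicator {0..L} s * fun_of v s\<bar>)"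
          proof (cases "s \<in> {0..L} \<and> s \<le> x \<and> x \<le> L")
            case True
            then show ?thesis using C[of x] by (auto simp: f_def abs_mult mult.commute intro!: mult_right_mono)
          qed (auto simp: f_def indicator_def C0)
        qed
        also have "\<dots> = L * (C * \<bar>indicator {0..L} s * fun_of v s\<bar>)" using L by simp
        finally have "(LINT x|lborel. norm (f (s, x))) \<le> L * (C * \<bar>indicator {0..L} s * fun_of v s\<bar>)" .
        moreover have "0 \<le> (LINT x|lborel. norm (f (s, x)))" by simp
        ultimately show "norm (LINT x|lborel. norm (f (s, x))) \<le> norm (C * L * (indicator {0..L} s * fun_of v s))"
          using C0 L by (simp add: abs_mult mult_ac)
      qed
    qed
  qed
  have "(LINT x|lborel. LINT s|lborel. f (s, x)) = (LINT s|lborel. LINT x|lborel. f (s, x))"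
    by (rule lborel_pair.Fubini_integral) (use intf in \<open>simp add: case_prod_unfold\<close>)
  moreover have "(LINT s|lborel. f (s, x)) = indicator {0..L} x * (primitive v x * \<psi>' x)" for x
  proof (cases "x \<in> {0..L}")
    case True
    have "(LINT s|lborel. f (s, x)) = (LINT s|lborel. indicator {0..x} s * fun_of v s * \<psi>' x)"
      by (rule Bochner_Integration.integral_cong) (use True in \<open>auto simp: f_def indicator_def\<close>)
    then show ?thesis using True by (simp add: primitive_eq)
  next
    case False
    then have "(LINT s|lborel. f (s, x)) = (LINT s::real|lborel. 0)"
      by (intro Bochner_Integration.integral_cong) (auto simp: f_def indicator_def)
    then show ?thesis using False by simp
  qed
  moreover have "(LINT x|lborel. f (s, x)) = \<psi> L * (indicator {0..L} s * fun_of v s) - indicator {0..L} s * fun_of v s * \<psi> s" for s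
  proof (cases "s \<in> {0..L}")
    case True
    then have "(LINT x|lborel. f (s, x)) = fun_of v s * (\<psi> L - \<psi> s)" using ftc[of s] by (simp add: f_def)
    then show ?thesis using True by (simp add: algebra_simps)
  qed (simp add: f_def)
  moreover have "(LINT s|lborel. \<psi> L * (indicator {0..L} s * fun_of v s) - indicator {0..L} s * fun_of v s * \<psi> s)
      = \<psi> L * primitive v L - inner v (l2_on L \<psi>)"
  proof -
    have int2: "integrable lborel (\<lambda>s. indicator {0..L} s * fun_of v s * \<psi> s)"
      using sqint_mult[OF sqint_fun_of[of v] sqint_indicator_mult[of "\<lambda>x. indicator {-L..L} x * \<psi> x" "{0..L}", OF sqint_continuous[OF c(1)]]]
      by (rule Bochner_Integration.integrable_cong[THEN iffD1, rotated 2]) (auto simp: indicator_def)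
    have "(LINT s|lborel. indicator {0..L} s * fun_of v s * \<psi> s) = (LINT s|lborel. indicator {0<..<L} s *\<^sub>R (fun_of v s * \<psi> s))"
    proof (rule integral_cong_AE)
      show "AE s in lborel. indicator {0..L} s * fun_of v s * \<psi> s = indicator {0<..<L} s *\<^sub>R (fun_of v s * \<psi> s)"
        using AE_lborel_singleton[of 0] AE_lborel_singleton[of L] by eventually_elim (auto simp: indicator_def)
    qed auto
    also have "\<dots> = inner v (l2_on L \<psi>)" by (simp add: inner_l2_on[OF c(1)] set_lebesgue_integral_def)
    finally show ?thesis using int2 intv by (simp add: primitive_eq)
  qed
  moreover have "inner (l2_on L (primitive v)) (l2_on L \<psi>') = (LINT x|lborel. indicator {0..L} x * (primitive v x * \<psi>' x))"
  proof -
    have cp: "continuous_on {0..L} (primitive v)" by (rule continuous_on_subset[OF primitive_continuous]) auto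
    have "inner (l2_on L (primitive v)) (l2_on L \<psi>') = integral {0..L} (\<lambda>x. primitive v x * \<psi>' x)"
      by (rule inner_l2_on_l2_on[OF cp c(2)])
    also have "\<dots> = (LINT x:{0..L}|lborel. primitive v x * \<psi>' x)"
      by (rule set_borel_integral_eq_integral(2)[symmetric])
         (intro borel_integrable_atLeastAtMost' continuous_intros cp c)
    finally show ?thesis by (simp add: set_lebesgue_integral_def)
  qed
  ultimately show ?thesis by (simp add: mult.commute)
qed

lemma AE_eq_continuous_imp_eq:
  fixes f g :: "real \<Rightarrow> real"
  assumes L: "0 < L" and c: "continuous_on {0..L} f" "continuous_on {0..L} g"
    and ae: "AE x in lborel. x \<in> {0<..<L} \<longrightarrow> f x = g x" and p: "p \<in> {0..L}"
  shows "f p = g p"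
proof -
  have "integral {0..L} (\<lambda>x. \<bar>f x - g x\<bar>) = (LINT x:{0<..<L}|lborel. \<bar>f x - g x\<bar>)"
    by (rule set_lint_continuous_eq_integral[symmetric]) (intro continuous_intros c)
  also have "\<dots> = (LINT x::real|lborel. 0)"
    unfolding set_lebesgue_integral_def
    by (rule integral_eq_zero_AE[THEN trans]) (use ae in \<open>auto simp: indicator_def elim!: AE_mp\<close>)
  finally have "integral {0..L} (\<lambda>x. \<bar>f x - g x\<bar>) = 0" by simp
  moreover have cd: "continuous_on {0..L} (\<lambda>x. \<bar>f x - g x\<bar>)" by (intro continuous_intros c)
  ultimately have "((\<lambda>x. \<bar>f x - g x\<bar>) has_integral 0) {0..L}"
    using integrable_integral[OF integrable_continuous_real[OF cd]] by simp
  then have "\<bar>f p - g p\<bar> = 0"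
    using has_integral_0_cbox_imp_0[of 0 L "\<lambda>x. \<bar>f x - g x\<bar>" p] p L cd by auto
  then show ?thesis by simp
qed

lemma pt_value_l2_on:
  assumes L: "0 < L" and g: "continuous_on {0..L} g" and p: "p \<in> {0..L}"
  shows "pt_value L (l2_on L g) p = g p"
  unfolding pt_value_def
proof (rule the_equality)
  have ae: "AE x in lborel. x \<in> {0<..<L} \<longrightarrow> fun_of (l2_on L g) x = g x"
    unfolding l2_on_def using fun_of_l2_of[OF sqint_l2_on[OF g]] by (auto elim!: AE_mp)
  show "\<exists>h. continuous_on {0..L} h \<and> (AE x in lborel. x \<in> {0<..<L} \<longrightarrow> fun_of (l2_on L g) x = h x) \<and> h p = g p"
    using g ae by blast
  fix c assume "\<exists>h. continuous_on {0..L} h \<and> (AE x in lborel. x \<in> {0<..<L} \<longrightarrow> fun_of (l2_on L g) x = h x) \<and> h p = c"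
  then obtain h where h: "continuous_on {0..L} h" "AE x in lborel. x \<in> {0<..<L} \<longrightarrow> fun_of (l2_on L g) x = h x" "h p = c"
    by blast
  have "AE x in lborel. x \<in> {0<..<L} \<longrightarrow> h x = g x" using ae h(2) by eventually_elim auto
  then show "c = g p" using AE_eq_continuous_imp_eq[OF L h(1) g _ p] h(3) by simp
qed

text \<open>Subtracting the primitive of the weak derivative leaves a function with weak derivative zero, hence a constant. Both parts
  satisfy the formula for integration by parts against functions that need not vanish at the ends.\<close>

theorem H1_continuous_representative:
  assumes u: "u \<in> L2_interval L" and v: "v \<in> L2_interval L" and d: "has_weak_deriv L u v" and L: "0 < L"
  obtains g where "continuous_on {0..L} g" "u = l2_on L g"
    "\<And>\<psi> \<psi>'. C1_pair \<psi> \<psi>' \<Longrightarrow> inner v (l2_on L \<psi>) + inner u (l2_on L \<psi>') = g L * \<psi> L - g 0 * \<psi> 0"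
proof -
  have cp: "continuous_on {0..L} (primitive v)" by (rule continuous_on_subset[OF primitive_continuous]) auto
  have "\<exists>c. u - l2_on L (primitive v) = c *\<^sub>R l2_on L (\<lambda>_. 1)"
  proof (rule weak_deriv_zero_imp_const[OF _ L])
    show "u - l2_on L (primitive v) \<in> L2_interval L"
      by (intro subspace_diff subspace_L2_interval u l2_on_in_L2_interval cp)
    fix \<phi> assume \<phi>: "test_function L \<phi>"
    then obtain a b where p: "C1_pair \<phi> (deriv \<phi>)" and "b < L" "\<And>x. x \<notin> {a..b} \<Longrightarrow> \<phi> x = 0"
      using test_functionD by metis
    then have "\<phi> L = 0" by auto
    then show "inner (u - l2_on L (primitive v)) (l2_on L (deriv \<phi>)) = 0"
      using primitive_by_parts[OF p L v] d \<phi> by (simp add: has_weak_deriv_iff inner_diff_left)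
  qed
  then obtain c where c: "u - l2_on L (primitive v) = c *\<^sub>R l2_on L (\<lambda>_. 1)" by blast
  define g where "g x = primitive v x + c * 1" for x
  have cg: "continuous_on {0..L} g" unfolding g_def by (intro continuous_intros cp)
  have u_eq: "u = l2_on L (primitive v) + c *\<^sub>R l2_on L (\<lambda>_. 1)" using c by (simp add: algebra_simps)
  also have "\<dots> = l2_on L g"
    unfolding g_def by (subst l2_on_add) (auto intro!: cp continuous_intros simp: l2_on_scale[of L "\<lambda>_. 1" c, simplified])
  finally have ug: "u = l2_on L g" .
  have p0: "primitive v 0 = 0"
  proof -
    have "(LINT s|lborel. indicator {0..0} s * fun_of v s) = (LINT s::real|lborel. 0)"
    proof (rule integral_cong_AE)
      show "AE s in lborel. indicator {0..0} s * fun_of v s = 0"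
        using AE_lborel_singleton[of 0] by eventually_elim (auto simp: indicator_def)
    qed auto
    then show ?thesis by (simp add: primitive_eq)
  qed
  show ?thesis
  proof (rule that[OF cg ug])
    fix \<psi> \<psi>' assume \<psi>: "C1_pair \<psi> \<psi>'"
    have "inner (l2_on L (\<lambda>_. 1)) (l2_on L \<psi>') = integral {0..L} \<psi>'"
      using C1_pair_continuous[OF \<psi>] by (subst inner_l2_on_l2_on) auto
    also have "\<dots> = \<psi> L - \<psi> 0"
      using L \<psi> by (intro integral_unique fundamental_theorem_of_calculus)
        (auto simp: C1_pair_def has_real_derivative_iff_has_vector_derivative[symmetric] intro: DERIV_subset)
    finally have "inner u (l2_on L \<psi>') = primitive v L * \<psi> L - inner v (l2_on L \<psi>) + c * (\<psi> L - \<psi> 0)"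
      unfolding u_eq using primitive_by_parts[OF \<psi> L v] by (simp add: inner_add_left)
    then show "inner v (l2_on L \<psi>) + inner u (l2_on L \<psi>') = g L * \<psi> L - g 0 * \<psi> 0"
      by (simp add: g_def p0 algebra_simps)
  qed
qed

lemma weak_deriv_eqI:
  assumes "0 < L" "v \<in> L2_interval L" "has_weak_deriv L u v" shows "weak_deriv L u = v"
  unfolding weak_deriv_def
proof (rule the_equality)
  fix w assume w: "w \<in> L2_interval L \<and> has_weak_deriv L u w"
  have "w - v = 0"
    by (rule test_functions_dense[of _ L])
       (use w assms in \<open>auto simp: has_weak_deriv_iff inner_diff_left intro!: subspace_diff subspace_L2_interval\<close>)
  then show "w = v" by simp
qed (use assms in auto)

lemma H1_by_parts:
  assumes "0 < L" "u \<in> L2_interval L" "v \<in> L2_interval L" "has_weak_deriv L u v" "C1_pair \<psi> \<psi>'"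
  shows "inner v (l2_on L \<psi>) + inner u (l2_on L \<psi>') = pt_value L u L * \<psi> L - pt_value L u 0 * \<psi> 0"
proof -
  obtain g where g: "continuous_on {0..L} g" "u = l2_on L g"
    "\<And>\<psi> \<psi>'. C1_pair \<psi> \<psi>' \<Longrightarrow> inner v (l2_on L \<psi>) + inner u (l2_on L \<psi>') = g L * \<psi> L - g 0 * \<psi> 0"
    using H1_continuous_representative[OF assms(2,3,4,1)] by metis
  then show ?thesis using assms(1) g(3)[OF assms(5)] pt_value_l2_on[OF assms(1) g(1)] by auto
qed

lemma H1_pt_value:
  assumes "0 < L" "u \<in> L2_interval L" "v \<in> L2_interval L" "has_weak_deriv L u v"
  shows "continuous_on {0..L} (pt_value L u)" "u = l2_on L (pt_value L u)"
proof -
  obtain g where g: "continuous_on {0..L} g" "u = l2_on L g"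
    using H1_continuous_representative[OF assms(2,3,4,1)] by metis
  have eq: "pt_value L u p = g p" if "p \<in> {0..L}" for p
    unfolding g(2) by (rule pt_value_l2_on[OF assms(1) g(1) that])
  show "continuous_on {0..L} (pt_value L u)" by (rule continuous_on_eq[OF g(1)]) (simp add: eq)
  have "l2_on L g = l2_on L (pt_value L u)" by (rule l2_on_cong) (simp add: eq)
  then show "u = l2_on L (pt_value L u)" using g(2) by simp
qed

lemma has_weak_deriv_l2_on:
  assumes L: "0 < L" and \<psi>: "C1_pair \<psi> \<psi>'" shows "has_weak_deriv L (l2_on L \<psi>) (l2_on L \<psi>')"
  unfolding has_weak_deriv_iff
proof (intro allI impI)
  fix \<phi> assume \<phi>: "test_function L \<phi>"
  then obtain a b where p: "C1_pair \<phi> (deriv \<phi>)" "0 < a" "b < L" "\<And>x. x \<notin> {a..b} \<Longrightarrow> \<phi> x = 0"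
    using test_functionD by metis
  note c = C1_pair_continuous[OF \<psi>] C1_pair_continuous[OF p(1)]
  have "((\<lambda>x. \<psi> x * deriv \<phi> x + \<psi>' x * \<phi> x) has_integral (\<psi> L * \<phi> L - \<psi> 0 * \<phi> 0)) {0..L}"
  proof (rule fundamental_theorem_of_calculus)
    fix x
    have "((\<lambda>x. \<psi> x * \<phi> x) has_real_derivative \<psi> x * deriv \<phi> x + \<psi>' x * \<phi> x) (at x)"
      using \<psi> p(1) unfolding C1_pair_def by (auto intro!: derivative_eq_intros)
    then show "((\<lambda>x. \<psi> x * \<phi> x) has_vector_derivative \<psi> x * deriv \<phi> x + \<psi>' x * \<phi> x) (at x within {0..L})"
      by (simp add: has_real_derivative_iff_has_vector_derivative has_vector_derivative_at_within)
  qed (use L in simp)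
  moreover have "\<phi> L = 0" "\<phi> 0 = 0" using p by auto
  ultimately have "integral {0..L} (\<lambda>x. \<psi> x * deriv \<phi> x + \<psi>' x * \<phi> x) = 0" by (simp add: integral_unique)
  then have "integral {0..L} (\<lambda>x. \<psi> x * deriv \<phi> x) + integral {0..L} (\<lambda>x. \<psi>' x * \<phi> x) = 0"
    by (subst (asm) integral_add) (auto intro!: integrable_continuous_real continuous_intros c)
  then show "inner (l2_on L \<psi>) (l2_on L (deriv \<phi>)) = - inner (l2_on L \<psi>') (l2_on L \<phi>)"
    by (simp add: inner_l2_on_l2_on c)
qed

lemma has_weak_deriv_limit:
  assumes "\<And>n. has_weak_deriv L (u n) (v n)" "u \<longlonglongrightarrow> u'" "v \<longlonglongrightarrow> v'"
  shows "has_weak_deriv L u' v'"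
  unfolding has_weak_deriv_iff
proof (intro allI impI)
  fix \<phi> assume "test_function L \<phi>"
  then have "inner (u n) (l2_on L (deriv \<phi>)) = - inner (v n) (l2_on L \<phi>)" for n
    using assms(1) by (simp add: has_weak_deriv_iff)
  moreover have "(\<lambda>n. inner (u n) (l2_on L (deriv \<phi>))) \<longlonglongrightarrow> inner u' (l2_on L (deriv \<phi>))"
    "(\<lambda>n. - inner (v n) (l2_on L \<phi>)) \<longlonglongrightarrow> - inner v' (l2_on L \<phi>)" by (intro tendsto_intros assms)+
  ultimately show "inner u' (l2_on L (deriv \<phi>)) = - inner v' (l2_on L \<phi>)"
    using LIMSEQ_unique by auto
qed

lemma has_weak_deriv_sum:
  assumes "finite A" "\<And>i. i \<in> A \<Longrightarrow> has_weak_deriv L (u i) (v i)"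
  shows "has_weak_deriv L (\<Sum>i\<in>A. c i *\<^sub>R u i) (\<Sum>i\<in>A. c i *\<^sub>R v i)"
  using assms by (auto simp: has_weak_deriv_iff inner_sum_left sum_negf[symmetric] intro!: sum.cong)

text \<open>Integration by parts against \<open>x\<close> and \<open>x - L\<close> expresses the boundary values by inner products; therefore they
  pass to limits.\<close>

lemma pt_value_endpoints:
  assumes "0 < L" "u \<in> L2_interval L" "v \<in> L2_interval L" "has_weak_deriv L u v"
  shows "pt_value L u L = (inner v (l2_on L (\<lambda>x. x)) + inner u (l2_on L (\<lambda>_. 1))) / L"
    and "pt_value L u 0 = - (inner v (l2_on L (\<lambda>x. x - L)) + inner u (l2_on L (\<lambda>_. 1))) / (- L)"
proof -
  have "C1_pair (\<lambda>x. x) (\<lambda>_. 1)" "C1_pair (\<lambda>x. x - L) (\<lambda>_. 1)"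
    by (auto simp: C1_pair_def intro!: derivative_eq_intros)
  from this[THEN H1_by_parts[OF assms]] assms(1)
  show "pt_value L u L = (inner v (l2_on L (\<lambda>x. x)) + inner u (l2_on L (\<lambda>_. 1))) / L"
    "pt_value L u 0 = - (inner v (l2_on L (\<lambda>x. x - L)) + inner u (l2_on L (\<lambda>_. 1))) / (- L)"
    by (auto simp: field_simps)
qed

section \<open>The cosine and sine modes of one edge\<close>

definition freq :: "real \<Rightarrow> nat \<Rightarrow> real" where "freq L j = pi / (2 * L) * real j"

text \<open>The \<open>i\<close>-th derivative of the mode: \<open>cos (\<omega>\<^sub>j x)\<close> for even \<open>j\<close> and \<open>sin (\<omega>\<^sub>j x) = cos (\<omega>\<^sub>j x - \<pi>/2)\<close> for odd \<open>j\<close>. Each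
  derivative shifts the phase by \<open>\<pi>/2\<close>, so one formula covers all orders and both parities.\<close>

definition mode_deriv :: "real \<Rightarrow> nat \<Rightarrow> nat \<Rightarrow> real \<Rightarrow> real" where
  "mode_deriv L i j x = freq L j ^ i * cos (freq L j * x - (if odd j then pi / 2 else 0) + real i * (pi / 2))"

lemma mode_deriv_C1: "C1_pair (mode_deriv L i j) (mode_deriv L (Suc i) j)"
proof -
  let ?\<theta> = "if odd j then pi / 2 else 0"
  have "(mode_deriv L i j has_real_derivative mode_deriv L (Suc i) j x) (at x)" for x
  proof -
    have "((\<lambda>x. freq L j ^ i * cos (freq L j * x - ?\<theta> + real i * (pi / 2))) has_real_derivative
        freq L j ^ i * (- sin (freq L j * x - ?\<theta> + real i * (pi / 2)) * freq L j)) (at x)"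
      by (auto intro!: derivative_eq_intros)
    moreover have s: "- sin (freq L j * x - ?\<theta> + real i * (pi / 2)) = cos (freq L j * x - ?\<theta> + real (Suc i) * (pi / 2))"
    proof -
      have "freq L j * x - ?\<theta> + real (Suc i) * (pi / 2) = (freq L j * x - ?\<theta> + real i * (pi / 2)) + pi / 2"
        by (simp add: algebra_simps add_divide_distrib)
      then show ?thesis by (simp only: cos_add cos_pi_half sin_pi_half)
    qed
    moreover have "mode_deriv L (Suc i) j x = freq L j ^ i * (- sin (freq L j * x - ?\<theta> + real i * (pi / 2)) * freq L j)"
      unfolding mode_deriv_def s by (simp only: power_Suc mult_ac)
    moreover have "mode_deriv L i j = (\<lambda>x. freq L j ^ i * cos (freq L j * x - ?\<theta> + real i * (pi / 2)))"
      by (simp add: fun_eq_iff mode_deriv_def)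
    ultimately show ?thesis by (simp only:)
  qed
  moreover have "continuous_on UNIV (mode_deriv L (Suc i) j)"
    unfolding mode_deriv_def[abs_def] by (intro continuous_intros)
  ultimately show ?thesis by (simp add: C1_pair_def)
qed

abbreviation "mode L \<equiv> mode_deriv L 0"

lemma mode_deriv_continuous: "continuous_on A (mode_deriv L i j)"
  using C1_pair_continuous(1)[OF mode_deriv_C1] .

lemma mode_even: "even j \<Longrightarrow> mode L j x = cos (freq L j * x)"
  by (simp add: mode_deriv_def)

lemma mode_odd: "odd j \<Longrightarrow> mode L j x = sin (freq L j * x)"
  by (simp add: mode_deriv_def cos_diff)

lemma mode_deriv_add2: "mode_deriv L (Suc (Suc i)) j x = - (freq L j)\<^sup>2 * mode_deriv L i j x"
proof -
  let ?y = "freq L j * x - (if odd j then pi / 2 else 0) + real i * (pi / 2)"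
  have "freq L j * x - (if odd j then pi / 2 else 0) + real (Suc (Suc i)) * (pi / 2) = ?y + pi"
    by (simp add: algebra_simps add_divide_distrib)
  then show ?thesis unfolding mode_deriv_def by (simp only: cos_periodic_pi) (simp add: power2_eq_square)
qed

lemma mode_deriv_bound: "\<bar>mode_deriv L i j x\<bar> \<le> \<bar>freq L j\<bar> ^ i"
  unfolding mode_deriv_def abs_mult power_abs by (rule mult_left_le) auto

lemma freq_L: "0 < L \<Longrightarrow> freq L j * L = real j * (pi / 2)"
  by (simp add: freq_def)

lemma sin_even_half_pi: "even j \<Longrightarrow> sin (real j * (pi / 2)) = 0"
  by (elim evenE) (simp add: sin_npi)

lemma cos_odd_half_pi: "odd j \<Longrightarrow> cos (real j * (pi / 2)) = 0"
proof (elim oddE)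
  fix b assume "j = 2 * b + 1"
  then have "real j * (pi / 2) = real b * pi + pi / 2" by (simp add: algebra_simps add_divide_distrib)
  then show ?thesis by (simp only: cos_add cos_pi_half sin_pi_half sin_npi)
qed

lemma mode_deriv_1_L: "0 < L \<Longrightarrow> mode_deriv L (Suc 0) j L = 0"
proof -
  assume L: "0 < L"
  have "cos (freq L j * L - (if odd j then pi / 2 else 0) + real (Suc 0) * (pi / 2)) = 0"
    unfolding freq_L[OF L]
  proof (cases "odd j")
    case True
    have e: "real j * (pi / 2) - pi / 2 + real (Suc 0) * (pi / 2) = real j * (pi / 2)" by simp
    show "cos (real j * (pi / 2) - (if odd j then pi / 2 else 0) + real (Suc 0) * (pi / 2)) = 0"
      using True by (simp only: if_True not_False_eq_True e cos_odd_half_pi)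
  next
    case False
    then have ev: "even j" by simp
    have e: "real j * (pi / 2) - 0 + real (Suc 0) * (pi / 2) = real j * (pi / 2) + pi / 2" by simp
    show "cos (real j * (pi / 2) - (if odd j then pi / 2 else 0) + real (Suc 0) * (pi / 2)) = 0"
      using False by (simp only: if_False e cos_add cos_pi_half sin_pi_half sin_even_half_pi[OF ev])
  qed
  then show ?thesis by (simp only: mode_deriv_def)
qed

lemma mode_deriv_3_L: "0 < L \<Longrightarrow> mode_deriv L (Suc (Suc (Suc 0))) j L = 0"
  by (simp add: mode_deriv_add2 mode_deriv_1_L)

lemma mode_L_sq: "0 < L \<Longrightarrow> (mode L j L)\<^sup>2 = 1"
proof -
  assume L: "0 < L"
  have "\<bar>mode L j L\<bar> = 1"
  proof (cases "even j")
    case True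
    then have "sin (real j * (pi / 2)) = 0" by (rule sin_even_half_pi)
    then have "(cos (real j * (pi / 2)))\<^sup>2 = 1" using sin_cos_squared_add[of "real j * (pi / 2)"] by simp
    then show ?thesis using True by (simp add: mode_even freq_L[OF L] abs_square_eq_1)
  next
    case False
    then have "cos (real j * (pi / 2)) = 0" by (intro cos_odd_half_pi) simp
    then have "(sin (real j * (pi / 2)))\<^sup>2 = 1" using sin_cos_squared_add[of "real j * (pi / 2)"] by simp
    then show ?thesis using False by (simp add: mode_odd freq_L[OF L] abs_square_eq_1)
  qed
  then show ?thesis by (metis power2_abs power_one)
qed

lemma mode_0_odd: "odd j \<Longrightarrow> mode L j 0 = 0"
  and mode_deriv_1_0_even: "even j \<Longrightarrow> mode_deriv L (Suc 0) j 0 = 0"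
  by (simp_all add: mode_deriv_def)

definition edge_mode :: "real \<Rightarrow> nat \<Rightarrow> l2" where "edge_mode L j = l2_on L (mode L j)"

lemma edge_mode_in: "edge_mode L j \<in> L2_interval L"
  unfolding edge_mode_def by (rule l2_on_in_L2_interval[OF mode_deriv_continuous])

lemma integral_cos_even:
  assumes "0 < L" "even (m::nat)"
  shows "integral {0..L} (\<lambda>x. cos (freq L m * x)) = (if m = 0 then L else 0)"
proof (cases "m = 0")
  case True
  then show ?thesis using assms by (simp add: freq_def)
next
  case False
  then have f: "freq L m \<noteq> 0" using assms by (simp add: freq_def)
  have "((\<lambda>x. cos (freq L m * x)) has_integral (sin (freq L m * L) / freq L m - sin (freq L m * 0) / freq L m)) {0..L}"
  proof (rule fundamental_theorem_of_calculus)
    fix x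
    have "((\<lambda>x. sin (freq L m * x) / freq L m) has_real_derivative cos (freq L m * x)) (at x)"
      using f by (auto intro!: derivative_eq_intros)
    then show "((\<lambda>x. sin (freq L m * x) / freq L m) has_vector_derivative cos (freq L m * x)) (at x within {0..L})"
      by (simp add: has_real_derivative_iff_has_vector_derivative has_vector_derivative_at_within)
  qed (use assms in simp)
  then show ?thesis using False sin_even_half_pi[OF assms(2)] freq_L[OF assms(1)] by (simp add: integral_unique)
qed

lemma mode_product:
  assumes "even i \<longleftrightarrow> even j" "i \<le> j"
  shows "mode L i x * mode L j x
    = (cos (freq L (j - i) * x) + (if even i then 1 else -1) * cos (freq L (i + j) * x)) / 2"
proof -
  have f: "freq L (j - i) * x = freq L j * x - freq L i * x" "freq L (i + j) * x = freq L i * x + freq L j * x"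
  proof -
    have "freq L (j - i) = freq L j - freq L i" "freq L (i + j) = freq L i + freq L j"
      using assms(2) by (simp_all add: freq_def of_nat_diff right_diff_distrib distrib_left)
    then show "freq L (j - i) * x = freq L j * x - freq L i * x" "freq L (i + j) * x = freq L i * x + freq L j * x"
      by (simp_all only: left_diff_distrib distrib_right)
  qed
  show ?thesis
    using assms(1) unfolding f by (cases "even i") (simp_all add: mode_even mode_odd cos_add cos_diff algebra_simps)
qed

lemma inner_edge_mode:
  assumes L: "0 < L" and p: "even i \<longleftrightarrow> even j"
  shows "inner (edge_mode L i) (edge_mode L j) = (if i \<noteq> j then 0 else if i = 0 then L else L / 2)"
proof -
  have *: "inner (edge_mode L i) (edge_mode L j) = (if i \<noteq> j then 0 else if i = 0 then L else L / 2)"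
    if p: "even i \<longleftrightarrow> even j" and "i \<le> j" for i j
  proof -
    have ev: "even (j - i)" "even (i + j)" using that by auto
    have int: "(\<lambda>x. cos (freq L m * x)) integrable_on {0..L}" for m
      by (intro integrable_continuous_real continuous_intros)
    have "inner (edge_mode L i) (edge_mode L j) = integral {0..L} (\<lambda>x. mode L i x * mode L j x)"
      unfolding edge_mode_def by (rule inner_l2_on_l2_on[OF mode_deriv_continuous mode_deriv_continuous])
    also have "\<dots> = integral {0..L} (\<lambda>x. (1/2) * cos (freq L (j - i) * x) + ((if even i then 1 else -1) / 2) * cos (freq L (i + j) * x))"
      unfolding mode_product[OF that] by (simp add: add_divide_distrib)
    also have "\<dots> = (1/2) * integral {0..L} (\<lambda>x. cos (freq L (j - i) * x)) + ((if even i then 1 else -1) / 2) * integral {0..L} (\<lambda>x. cos (freq L (i + j) * x))"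
      using int by (subst integral_add) (auto intro: integrable_on_mult_right)
    also have "\<dots> = (if i \<noteq> j then 0 else if i = 0 then L else L / 2)"
      using that unfolding integral_cos_even[OF L ev(1)] integral_cos_even[OF L ev(2)] by auto
    finally show ?thesis .
  qed
  show ?thesis
  proof (cases "i \<le> j")
    case False
    then show ?thesis using *[of j i] p by (auto simp: inner_commute)
  qed (rule *[OF p])
qed

lemma edge_mode_nonzero: "0 < L \<Longrightarrow> edge_mode L j \<noteq> 0"
  using inner_edge_mode[of L j j] by (auto split: if_splits)

lemma inner_l2_on_uniform_limit:
  assumes L: "0 < L" and c: "\<And>n. continuous_on {0..L} (f n)" "continuous_on {0..L} g"
    and lim: "\<And>e. e > 0 \<Longrightarrow> \<exists>n. \<forall>x\<in>{0..L}. \<bar>g x - f n x\<bar> < e"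
    and orth: "\<And>n. inner w (l2_on L (f n)) = 0"
  shows "inner w (l2_on L g) = 0"
proof (rule ccontr)
  assume neq: "inner w (l2_on L g) \<noteq> 0"
  define e where "e = \<bar>inner w (l2_on L g)\<bar> / ((norm w + 1) * sqrt L)"
  have P: "(norm w + 1) * sqrt L > 0" using L by (intro mult_pos_pos add_nonneg_pos) auto
  then have e: "e > 0" using neq unfolding e_def by (intro divide_pos_pos) auto
  obtain n where n: "\<And>x. x \<in> {0..L} \<Longrightarrow> \<bar>g x - f n x\<bar> < e" using lim[OF e] by blast
  have cd: "continuous_on {0..L} (\<lambda>x. g x - f n x)" by (intro continuous_intros c)
  have eq: "inner w (l2_on L g) = inner w (l2_on L (\<lambda>x. g x - f n x))"
    using orth[of n] l2_on_add[OF cd c(1)[of n]] by (simp add: inner_add_right)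
  have "(norm (l2_on L (\<lambda>x. g x - f n x)))\<^sup>2 = integral {0..L} (\<lambda>x. (g x - f n x) * (g x - f n x))"
    unfolding power2_norm_eq_inner by (rule inner_l2_on_l2_on[OF cd cd])
  also have "\<dots> \<le> integral {0..L} (\<lambda>x. e * e)"
  proof (rule integral_le)
    fix x assume "x \<in> {0..L}"
    then have "\<bar>g x - f n x\<bar> * \<bar>g x - f n x\<bar> \<le> e * e" using n[of x] by (intro mult_mono) auto
    then show "(g x - f n x) * (g x - f n x) \<le> e * e" by (simp add: abs_mult_self_eq)
  qed (auto intro!: integrable_continuous_real continuous_intros c)
  also have "\<dots> = (e * sqrt L)\<^sup>2" using L by (simp add: power_mult_distrib power2_eq_square mult_ac)
  finally have le: "norm (l2_on L (\<lambda>x. g x - f n x)) \<le> e * sqrt L"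
    by (rule power2_le_imp_le) (use e L in simp)
  have "\<bar>inner w (l2_on L g)\<bar> \<le> norm w * (e * sqrt L)"
    unfolding eq by (rule order.trans[OF Cauchy_Schwarz_ineq2 mult_left_mono[OF le norm_ge_zero]])
  also have "\<dots> < (norm w + 1) * (e * sqrt L)" using e L by (intro mult_strict_right_mono) auto
  also have "\<dots> = \<bar>inner w (l2_on L g)\<bar>"
  proof -
    have "(norm w + 1) * (e * sqrt L) = ((norm w + 1) * sqrt L) * e" by (simp only: mult_ac)
    also have "\<dots> = \<bar>inner w (l2_on L g)\<bar>" using P unfolding e_def
      by (metis less_irrefl nonzero_mult_div_cancel_left times_divide_eq_right)
    finally show ?thesis .
  qed
  finally show False by simp
qed

text \<open>Substituting \<open>y = cos (\<pi> x/L)\<close>, a homeomorphism of \<open>[0,L]\<close> onto \<open>[-1,1]\<close>, writes a test function as \<open>s x \<cdot> h y\<close> with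
  continuous \<open>h\<close>, because the test function vanishes near the zeros of \<open>s\<close>. Then \<open>h\<close> is a uniform limit of polynomials. The factor \<open>s\<close> is
  \<open>1\<close> for the cosine system and \<open>sin (\<pi> x/(2L))\<close> for the sine system.\<close>

lemma cos_polynomials_dense:
  assumes L: "0 < L" and w: "w \<in> L2_interval L"
    and orth: "\<And>n. inner w (l2_on L (\<lambda>x. s x * cos (pi / L * x) ^ n)) = 0"
    and s: "continuous_on UNIV s" "\<And>x. 0 < x \<Longrightarrow> x < L \<Longrightarrow> s x \<noteq> 0"
  shows "w = 0"
proof (rule test_functions_dense[OF w L])
  fix \<phi> assume \<phi>: "test_function L \<phi>"
  obtain a b where ab: "0 < a" "b < L" "\<And>x. x \<notin> {a..b} \<Longrightarrow> \<phi> x = 0" using test_functionD[OF \<phi>] by metis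
  define h where "h y = (let x = arccos y * L / pi in \<phi> x / s x)" for y
  have arc: "arccos (cos (pi / L * x)) * L / pi = x" if "x \<in> {0..L}" for x
    using that L by (subst arccos_cos) (auto simp: field_simps)
  have ch: "continuous_on {-1..1} h"
  proof -
    have cq: "continuous_on {0..L} (\<lambda>x. \<phi> x / s x)"
    proof -
      have 1: "continuous_on {a..b} (\<lambda>x. \<phi> x / s x)"
        by (intro continuous_intros test_function_continuous[OF \<phi>] continuous_on_subset[OF s(1)]) (use s(2) ab in auto)
      have 2: "continuous_on ({0..(a/2)} \<union> {(b+L)/2..L}) (\<lambda>x. \<phi> x / s x)"
        by (rule continuous_on_eq[of _ "\<lambda>_. 0"]) (use ab in auto)
      have 3: "continuous_on {a/2..(b+L)/2} (\<lambda>x. \<phi> x / s x)"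
        by (intro continuous_intros test_function_continuous[OF \<phi>] continuous_on_subset[OF s(1)]) (use s(2) ab in auto)
      have "continuous_on (({0..(a/2)} \<union> {(b+L)/2..L}) \<union> {a/2..(b+L)/2}) (\<lambda>x. \<phi> x / s x)"
        by (rule continuous_on_closed_Un[OF _ _ 2 3]) auto
      then show ?thesis by (rule continuous_on_subset) auto
    qed
    have "continuous_on {-1..1} (\<lambda>y. arccos y * L / pi)"
      by (intro continuous_intros continuous_on_arccos') auto
    moreover have "(\<lambda>y. arccos y * L / pi) ` {-1..1} \<subseteq> {0..L}"
      using L by (auto simp: field_simps arccos_lbound arccos_ubound intro!: mult_nonneg_nonneg)
    ultimately show ?thesis
      unfolding h_def Let_def by (intro continuous_on_compose2[OF cq])
  qed
  have "\<exists>p. real_polynomial_function p \<and> (\<forall>y\<in>{-1..1}. \<bar>h y - p y\<bar> < inverse (real (Suc n)))" for n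
    using Stone_Weierstrass_real_polynomial_function[OF compact_Icc ch, of "inverse (real (Suc n))"]
    by (metis inverse_positive_iff_positive of_nat_0_less_iff zero_less_Suc)
  then obtain p where p: "\<And>n. real_polynomial_function (p n)"
    "\<And>n y. y \<in> {-1..1} \<Longrightarrow> \<bar>h y - p n y\<bar> < inverse (real (Suc n))" by metis
  define f where "f n x = s x * p n (cos (pi / L * x))" for n x
  have cs: "continuous_on A s" for A by (rule continuous_on_subset[OF s(1)]) auto
  have f0: "continuous_on {0..L} (f n) \<and> inner w (l2_on L (f n)) = 0" for n
  proof -
    obtain c m where pn: "p n = (\<lambda>y. \<Sum>i\<le>m::nat. c i * y ^ i)"
      using p(1)[of n] unfolding real_polynomial_function_iff_sum by blast
    have "continuous_on {0..L} (\<lambda>x. \<Sum>i\<le>k. c i * (s x * cos (pi / L * x) ^ i)) \<and>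
        inner w (l2_on L (\<lambda>x. \<Sum>i\<le>k. c i * (s x * cos (pi / L * x) ^ i))) = 0" for k
    proof (induction k)
      case 0
      show ?case using orth[of 0] by (auto intro!: continuous_on_mult continuous_on_const cs simp: l2_on_scale[OF cs])
    next
      case (Suc k)
      have c1: "continuous_on {0..L} (\<lambda>x. s x * cos (pi / L * x) ^ Suc k)"
        by (intro continuous_intros cs)
      have c2: "continuous_on {0..L} (\<lambda>x. c (Suc k) * (s x * cos (pi / L * x) ^ Suc k))"
        by (intro continuous_intros cs)
      have "l2_on L (\<lambda>x. \<Sum>i\<le>Suc k. c i * (s x * cos (pi / L * x) ^ i))
          = l2_on L (\<lambda>x. \<Sum>i\<le>k. c i * (s x * cos (pi / L * x) ^ i)) + c (Suc k) *\<^sub>R l2_on L (\<lambda>x. s x * cos (pi / L * x) ^ Suc k)"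
        unfolding sum.atMost_Suc l2_on_scale[OF c1, symmetric] by (rule l2_on_add[OF conjunct1[OF Suc] c2])
      then have "inner w (l2_on L (\<lambda>x. \<Sum>i\<le>Suc k. c i * (s x * cos (pi / L * x) ^ i))) = 0"
        using conjunct2[OF Suc] orth[of "Suc k"] by (simp only: inner_add_right inner_scaleR_right)
      moreover have "continuous_on {0..L} (\<lambda>x. \<Sum>i\<le>Suc k. c i * (s x * cos (pi / L * x) ^ i))"
        by (intro continuous_intros cs)
      ultimately show ?case by blast
    qed
    moreover have "f n = (\<lambda>x. \<Sum>i\<le>m. c i * (s x * cos (pi / L * x) ^ i))"
      unfolding f_def pn by (auto simp: sum_distrib_left mult_ac)
    ultimately show ?thesis by simp
  qed
  obtain C where C: "C > 0" "\<And>x. x \<in> {0..L} \<Longrightarrow> \<bar>s x\<bar> \<le> C"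
    using compact_imp_bounded[OF compact_continuous_image[OF cs compact_Icc[of 0 L]]]
    unfolding bounded_pos by auto
  have hs: "\<phi> x = s x * h (cos (pi / L * x))" if "x \<in> {0..L}" for x
  proof (cases "s x = 0")
    case True
    then have "x = 0 \<or> x = L" using s(2)[of x] that by fastforce
    then have "\<phi> x = 0" using ab by auto
    then show ?thesis using True by simp
  next
    case False
    then show ?thesis
      by (simp only: h_def Let_def arc[OF that] times_divide_eq_right nonzero_mult_div_cancel_left not_False_eq_True)
  qed
  show "inner w (l2_on L \<phi>) = 0"
  proof (rule inner_l2_on_uniform_limit[OF L, of f])
    fix e :: real assume e: "e > 0"
    then have "e / C > 0" using C by simp
    then obtain n where n: "inverse (real (Suc n)) < e / C" using reals_Archimedean by blast
    have "\<bar>\<phi> x - f n x\<bar> < e" if x: "x \<in> {0..L}" for x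
    proof -
      have "\<bar>\<phi> x - f n x\<bar> = \<bar>s x\<bar> * \<bar>h (cos (pi / L * x)) - p n (cos (pi / L * x))\<bar>"
        unfolding hs[OF x] f_def by (simp add: right_diff_distrib[symmetric] abs_mult)
      also have "\<dots> \<le> C * inverse (real (Suc n))"
        using C x p(2)[of "cos (pi / L * x)" n] by (intro mult_mono) (auto simp: less_imp_le)
      also have "\<dots> < e" using n C by (simp add: field_simps)
      finally show ?thesis .
    qed
    then show "\<exists>n. \<forall>x\<in>{0..L}. \<bar>\<phi> x - f n x\<bar> < e" by blast
  qed (use f0 test_function_continuous[OF \<phi>] in auto)
qed

text \<open>The formula \<open>2 cos \<theta> cos (m\<theta>) = cos ((m+1)\<theta>) + cos ((m-1)\<theta>)\<close> trades a power of the cosine for a multiple of the angle.\<close>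

lemma orth_power_cos:
  assumes L: "0 < L" and s: "continuous_on UNIV s"
    and orth: "\<And>m. inner w (l2_on L (\<lambda>x. s x * cos (real m * (pi / L * x)))) = 0"
  shows "inner w (l2_on L (\<lambda>x. s x * (cos (pi / L * x) ^ n * cos (real m * (pi / L * x))))) = 0"
proof (induction n arbitrary: m)
  case 0
  show ?case using orth[of m] by simp
next
  case (Suc n)
  have cs: "continuous_on A s" for A by (rule continuous_on_subset[OF s]) auto
  let ?t = "\<lambda>x. pi / L * x" and ?f = "\<lambda>m x. s x * (cos (pi / L * x) ^ n * cos (real m * (pi / L * x)))"
  have c: "continuous_on {0..L} (?f m)" for m by (intro continuous_intros cs)
  show ?case
  proof (cases m)
    case 0
    then have "(\<lambda>x. s x * (cos (?t x) ^ Suc n * cos (real m * ?t x))) = ?f 1" by (auto simp: mult_ac)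
    then show ?thesis using Suc[of 1] by simp
  next
    case (Suc k)
    have "s x * (cos (?t x) ^ Suc n * cos (real m * ?t x)) = (1/2) * (?f (Suc m) x + ?f k x)" for x
    proof -
      have e: "real (Suc m) * ?t x = real m * ?t x + ?t x" "real k * ?t x = real m * ?t x - ?t x"
        using Suc by (simp_all add: algebra_simps add_divide_distrib)
      show ?thesis unfolding e by (simp add: cos_add cos_diff algebra_simps)
    qed
    then have "l2_on L (\<lambda>x. s x * (cos (?t x) ^ Suc n * cos (real m * ?t x))) = (1/2) *\<^sub>R (l2_on L (?f (Suc m)) + l2_on L (?f k))"
      by (simp only: l2_on_add[OF c c, symmetric] l2_on_scale[OF continuous_on_add[OF c c], symmetric])
    then show ?thesis using Suc.IH[of "Suc m"] Suc.IH[of k] by (simp add: inner_add_right)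
  qed
qed

lemma cosine_system_complete:
  assumes L: "0 < L" and w: "w \<in> L2_interval L" and orth: "\<And>j. even j \<Longrightarrow> inner w (edge_mode L j) = 0"
  shows "w = 0"
proof (rule cos_polynomials_dense[OF L w, of "\<lambda>_. 1"])
  fix n
  have "inner w (l2_on L (\<lambda>x. 1 * (cos (pi / L * x) ^ n * cos (real 0 * (pi / L * x))))) = 0"
  proof (rule orth_power_cos[OF L])
    fix m
    have "l2_on L (\<lambda>x. 1 * cos (real m * (pi / L * x))) = edge_mode L (2 * m)"
      unfolding edge_mode_def by (rule l2_on_cong) (simp add: mode_even freq_def field_simps)
    then show "inner w (l2_on L (\<lambda>x. 1 * cos (real m * (pi / L * x)))) = 0" using orth[of "2 * m"] by simp
  qed simp
  then show "inner w (l2_on L (\<lambda>x. 1 * cos (pi / L * x) ^ n)) = 0" by simp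
qed auto

text \<open>The product \<open>sin (\<pi> x/(2L)) cos (m \<pi> x/L)\<close> is half the difference of two neighbouring odd modes.\<close>

lemma sine_system_complete:
  assumes L: "0 < L" and w: "w \<in> L2_interval L" and orth: "\<And>j. odd j \<Longrightarrow> inner w (edge_mode L j) = 0"
  shows "w = 0"
proof (rule cos_polynomials_dense[OF L w, of "\<lambda>x. sin (pi / (2 * L) * x)"])
  let ?s = "\<lambda>x. sin (pi / (2 * L) * x)"
  show cs: "continuous_on UNIV ?s" by (intro continuous_intros)
  show "?s x \<noteq> 0" if "0 < x" "x < L" for x
  proof -
    have "0 < pi / (2 * L) * x" using that by simp
    moreover have "pi / (2 * L) * x < pi" using that L by (simp add: field_simps)
    ultimately show ?thesis using sin_gt_zero[of "pi / (2 * L) * x"] by simp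
  qed
  fix n
  have "inner w (l2_on L (\<lambda>x. ?s x * (cos (pi / L * x) ^ n * cos (real 0 * (pi / L * x))))) = 0"
  proof (rule orth_power_cos[OF L cs])
    fix m
    show "inner w (l2_on L (\<lambda>x. ?s x * cos (real m * (pi / L * x)))) = 0"
    proof (cases m)
      case 0
      have "l2_on L (\<lambda>x. ?s x * cos (real m * (pi / L * x))) = edge_mode L 1"
        unfolding edge_mode_def by (rule l2_on_cong) (simp add: 0 mode_odd freq_def)
      then show ?thesis using orth[of 1] by simp
    next
      case (Suc k)
      have "?s x * cos (real m * (pi / L * x)) = (1/2) * (mode L (2 * m + 1) x + (-1) * mode L (2 * k + 1) x)" for x
      proof -
        let ?a = "pi / (2 * L) * x" and ?b = "real m * (pi / L * x)"
        have e: "freq L (2 * m + 1) * x = ?b + ?a" "freq L (2 * k + 1) * x = ?b - ?a"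
          using L Suc by (simp_all add: freq_def field_simps)
        have "mode L (2 * m + 1) x = sin (?b + ?a)" "mode L (2 * k + 1) x = sin (?b - ?a)"
          by (simp_all only: mode_odd e[symmetric] odd_two_times_div_two_succ even_plus_one_iff even_mult_iff) (simp_all add: mode_odd)
        then show ?thesis by (simp add: sin_add sin_diff)
      qed
      then have "l2_on L (\<lambda>x. ?s x * cos (real m * (pi / L * x))) = (1/2) *\<^sub>R (edge_mode L (2 * m + 1) + (-1) *\<^sub>R edge_mode L (2 * k + 1))"
        unfolding edge_mode_def
        by (simp only: l2_on_scale[OF mode_deriv_continuous, symmetric]
            l2_on_add[OF mode_deriv_continuous continuous_on_mult_left[OF mode_deriv_continuous], symmetric]
            l2_on_scale[OF continuous_on_add[OF mode_deriv_continuous continuous_on_mult_left[OF mode_deriv_continuous]], symmetric])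
      then show ?thesis using orth[of "2 * m + 1"] orth[of "2 * k + 1"] by (simp add: inner_diff_right)
    qed
  qed
  then show "inner w (l2_on L (\<lambda>x. ?s x * cos (pi / L * x) ^ n)) = 0" by simp
qed

section \<open>The spectral resolution of the tree\<close>

definition unit_mode :: "real \<Rightarrow> nat \<Rightarrow> l2" where "unit_mode L j = sgn (edge_mode L j)"

text \<open>On edge \<open>k\<close> the projection onto the \<open>j\<close>-th eigenspace of the tree is \<open>mode_coeff L j u k\<close> times the unit mode: for even \<open>j\<close> the
  edge coefficients are replaced by their mean, for odd \<open>j\<close> their mean is subtracted.\<close>

definition mode_coeff :: "real \<Rightarrow> nat \<Rightarrow> l2 ^ 'n \<Rightarrow> 'n::finite \<Rightarrow> real" where
  "mode_coeff L j u k = (if even j then (\<Sum>i\<in>UNIV. inner (u $ i) (unit_mode L j)) / CARD('n)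
     else inner (u $ k) (unit_mode L j) - (\<Sum>i\<in>UNIV. inner (u $ i) (unit_mode L j)) / CARD('n))"

definition tree_proj :: "real \<Rightarrow> nat \<Rightarrow> l2 ^ 'n \<Rightarrow> (l2 ^ 'n::finite)" where
  "tree_proj L j u = (\<chi> k. mode_coeff L j u k *\<^sub>R unit_mode L j)"

definition eigval :: "real \<Rightarrow> real \<Rightarrow> nat \<Rightarrow> real" where
  "eigval lam L j = freq L j ^ 4 - lam * (freq L j)\<^sup>2"

lemma unit_mode_in: "unit_mode L j \<in> L2_interval L"
  unfolding unit_mode_def sgn_div_norm by (rule subspace_scale[OF subspace_L2_interval edge_mode_in])

lemma unit_mode_eq: "unit_mode L j = (1 / norm (edge_mode L j)) *\<^sub>R edge_mode L j"
  by (simp add: unit_mode_def sgn_div_norm inverse_eq_divide)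

lemma norm_unit_mode: "0 < L \<Longrightarrow> norm (unit_mode L j) = 1"
  by (simp add: unit_mode_def norm_sgn edge_mode_nonzero)

lemma inner_unit_mode: "0 < L \<Longrightarrow> even i \<longleftrightarrow> even j \<Longrightarrow> inner (unit_mode L i) (unit_mode L j) = (if i = j then 1 else 0)"
proof (cases "i = j")
  case True
  assume "0 < L"
  then show ?thesis using True norm_unit_mode[of L j] by (simp flip: power2_norm_eq_inner)
next
  case False
  assume "0 < L" "even i \<longleftrightarrow> even j"
  then show ?thesis using False inner_edge_mode[of L i j] by (simp add: unit_mode_eq)
qed

lemma mode_coeff_add: "mode_coeff L j (u + v) k = mode_coeff L j u k + mode_coeff L j v k"
  by (simp add: mode_coeff_def inner_add_left sum.distrib add_divide_distrib)

lemma mode_coeff_scale: "mode_coeff L j (c *\<^sub>R u) k = c * mode_coeff L j u k"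
  by (simp add: mode_coeff_def sum_distrib_left[symmetric] right_diff_distrib)

lemma mode_coeff_even: "even j \<Longrightarrow> mode_coeff L j u k = mode_coeff L j u k'"
  by (simp add: mode_coeff_def)

lemma sum_mode_coeff_odd: "odd j \<Longrightarrow> (\<Sum>k\<in>UNIV. mode_coeff L j (u :: l2 ^ 'n::finite) k) = 0"
  by (simp add: mode_coeff_def sum_subtractf)

lemma inner_tree_proj: "inner (tree_proj L j u) v = (\<Sum>k\<in>UNIV. mode_coeff L j u k * inner (v $ k) (unit_mode L j))"
  by (simp add: inner_vec_def tree_proj_def inner_commute)

lemma inner_tree_proj_symmetric:
  fixes u v :: "l2 ^ 'n::finite"
  shows "inner (tree_proj L j u) v =
    (if even j then 0 else (\<Sum>k\<in>UNIV. inner (u $ k) (unit_mode L j) * inner (v $ k) (unit_mode L j)))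
    + (if even j then 1 else -1) * ((\<Sum>k\<in>UNIV. inner (u $ k) (unit_mode L j)) * (\<Sum>k\<in>UNIV. inner (v $ k) (unit_mode L j))) / CARD('n)"
  unfolding inner_tree_proj mode_coeff_def
  by (simp add: left_diff_distrib sum_subtractf flip: sum_distrib_left sum_divide_distrib)

lemma mode_coeff_tree_proj:
  assumes "0 < L"
  shows "mode_coeff L i (tree_proj L j u) k = (if i = j then mode_coeff L j u k else 0)"
proof (cases "even i \<longleftrightarrow> even j")
  case True
  have a: "inner (tree_proj L j u $ k) (unit_mode L i) = (if i = j then mode_coeff L j u k else 0)" for k
    using inner_unit_mode[OF assms, of j i] True by (auto simp: tree_proj_def)
  show ?thesis
  proof (cases "even j")
    case ev: True
    define A where "A = mode_coeff L j u k"
    have "mode_coeff L j u k' = A" for k' unfolding A_def using ev by (rule mode_coeff_even)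
    then show ?thesis using True ev unfolding mode_coeff_def[of L i "tree_proj L j u"] a
      by (cases "i = j") simp_all
  next
    case False
    then show ?thesis using True sum_mode_coeff_odd[OF False, of L u] unfolding mode_coeff_def[of L i "tree_proj L j u"] a
      by (cases "i = j") simp_all
  qed
next
  case False
  then have "i \<noteq> j" by auto
  have a: "inner (tree_proj L j u $ k) (unit_mode L i) = mode_coeff L j u k * inner (unit_mode L j) (unit_mode L i)" for k
    by (simp add: tree_proj_def)
  show ?thesis
  proof (cases "even j")
    case True
    define A where "A = mode_coeff L j u k"
    have "mode_coeff L j u k' = A" for k' unfolding A_def using True by (rule mode_coeff_even)
    then show ?thesis using True False \<open>i \<noteq> j\<close> by (simp add: mode_coeff_def[of L i] a)
  next
    case odd: False
    then show ?thesis using False \<open>i \<noteq> j\<close> sum_mode_coeff_odd[OF odd, of L u]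
      by (simp add: mode_coeff_def[of L i] a sum_distrib_right[symmetric])
  qed
qed

lemma subspace_L2_tree: "subspace (L2_tree L :: (l2 ^ 'n::finite) set)"
  using subspace_L2_interval[of L] by (auto simp: subspace_def L2_tree_def)

lemma closed_L2_tree: "closed (L2_tree L :: (l2 ^ 'n::finite) set)"
proof -
  have "L2_tree L = (\<Inter>k. (\<lambda>u::l2^'n. u $ k) -` L2_interval L)" by (auto simp: L2_tree_def)
  also have "closed \<dots>" by (intro closed_INT ballI closed_vimage closed_L2_interval continuous_intros)
  finally show ?thesis .
qed

text \<open>Completeness: if all projections of \<open>u\<close> vanish, the sum of the edge functions is orthogonal to all cosine modes and hence
  zero. The means in the odd coefficients are therefore zero, so every edge function is orthogonal to all sine modes.\<close>

lemma tree_resolution: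
  assumes L: "0 < L"
  shows "orthogonal_resolution (L2_tree L :: (l2 ^ 'n::finite) set) (tree_proj L)"
proof (rule orthogonal_resolution.intro)
  fix i j and u v :: "l2 ^ 'n"
  show "linear (tree_proj L j :: l2 ^ 'n \<Rightarrow> _)"
    by (intro linearI) (auto simp: tree_proj_def vec_eq_iff mode_coeff_add mode_coeff_scale scaleR_add_left)
  show "tree_proj L j u \<in> L2_tree L"
    by (auto simp: tree_proj_def L2_tree_def intro: subspace_scale[OF subspace_L2_interval unit_mode_in])
  show "inner (tree_proj L j u) v = inner u (tree_proj L j v)"
    unfolding inner_commute[of u] inner_tree_proj_symmetric by (simp add: mult.commute)
  show "tree_proj L i (tree_proj L j u) = (if i = j then tree_proj L j u else 0)"
    by (auto simp: tree_proj_def[of L i "tree_proj L j u"] mode_coeff_tree_proj[OF L] vec_eq_iff)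
       (simp add: tree_proj_def)
  assume u: "u \<in> L2_tree L" and 0: "\<And>j. tree_proj L j u = 0"
  have c0: "mode_coeff L j u k = 0" for j k
  proof -
    have "mode_coeff L j u k *\<^sub>R unit_mode L j = 0" 
      using arg_cong[OF 0[of j], of "\<lambda>w. w $ k"] by (simp only: tree_proj_def vec_lambda_beta zero_index)
    then show ?thesis using norm_unit_mode[OF L, of j] by auto
  qed
  have in_k: "u $ k \<in> L2_interval L" for k using u by (simp add: L2_tree_def)
  have z: "inner w (edge_mode L j) = 0" if "inner w (unit_mode L j) = 0" for w j
    using that edge_mode_nonzero[OF L, of j] by (simp add: unit_mode_eq)
  have "(\<Sum>k\<in>UNIV. u $ k) = 0"
  proof (rule cosine_system_complete[OF L])
    show "(\<Sum>k\<in>UNIV. u $ k) \<in> L2_interval L" by (intro subspace_sum subspace_L2_interval in_k)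
    fix j :: nat assume "even j"
    then have "inner (\<Sum>k\<in>UNIV. u $ k) (unit_mode L j) = 0"
      using c0[of j undefined] by (simp add: mode_coeff_def inner_sum_left)
    then show "inner (\<Sum>k\<in>UNIV. u $ k) (edge_mode L j) = 0" by (rule z)
  qed
  then have s0: "(\<Sum>k\<in>UNIV. inner (u $ k) (unit_mode L j)) = 0" for j by (simp flip: inner_sum_left)
  have "u $ k = 0" for k
  proof (rule sine_system_complete[OF L in_k])
    fix j :: nat assume "odd j"
    then have "inner (u $ k) (unit_mode L j) = 0" using c0[of j k] s0[of j] by (simp add: mode_coeff_def)
    then show "inner (u $ k) (edge_mode L j) = 0" by (rule z)
  qed
  then show "u = 0" by (simp add: vec_eq_iff)
qed (intro subspace_L2_tree closed_L2_tree)+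

text \<open>Completing the square; besides the lower bound for the spectrum this gives growth of order \<open>j\<^sup>4\<close>.\<close>

lemma eigval_shift: "freq L j ^ 4 / 2 \<le> eigval lam L j + lam\<^sup>2"
proof -
  define x where "x = (freq L j)\<^sup>2"
  have x: "freq L j ^ 4 = x\<^sup>2" by (simp add: x_def)
  have "(x - lam)\<^sup>2 = x\<^sup>2 - 2 * (lam * x) + lam\<^sup>2" by (simp add: power2_eq_square algebra_simps)
  moreover have "0 \<le> (x - lam)\<^sup>2" "0 \<le> lam\<^sup>2" by simp_all
  ultimately show ?thesis unfolding eigval_def x x_def[symmetric] by linarith
qed

locale star_tree =
  fixes L lam :: real and edges :: "'n::finite itself"
  assumes L: "0 < L"
begin

sublocale spectral_resolution "L2_tree L :: (l2 ^ 'n) set" "tree_proj L" "eigval lam L" "lam\<^sup>2"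
proof -
  interpret orthogonal_resolution "L2_tree L :: (l2 ^ 'n) set" "tree_proj L" by (rule tree_resolution[OF L])
  show "spectral_resolution (L2_tree L :: (l2 ^ 'n) set) (tree_proj L) (eigval lam L) (lam\<^sup>2)"
  proof
    fix j
    have "0 \<le> freq L j ^ 4 / 2" by simp
    then show "- lam\<^sup>2 \<le> eigval lam L j" using eigval_shift[of L j lam] by linarith
  qed simp
qed

end

lemma sobolev_Suc_weak_deriv:
  assumes "0 < L" "u \<in> sobolev (Suc m) L"
  shows "u \<in> L2_interval L" "has_weak_deriv L u (weak_deriv L u)" "weak_deriv L u \<in> sobolev m L"
proof -
  obtain v where v: "v \<in> sobolev m L" "has_weak_deriv L u v" and u: "u \<in> L2_interval L" using assms(2) by auto
  have "v \<in> L2_interval L" using v(1) by (cases m) auto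
  then have "weak_deriv L u = v" by (intro weak_deriv_eqI assms v)
  then show "u \<in> L2_interval L" "has_weak_deriv L u (weak_deriv L u)" "weak_deriv L u \<in> sobolev m L"
    using u v by auto
qed

lemma sobolev_funpow: "0 < L \<Longrightarrow> u \<in> sobolev (i + m) L \<Longrightarrow> (weak_deriv L ^^ i) u \<in> sobolev m L"
proof (induction i arbitrary: u)
  case (Suc i)
  have "weak_deriv L u \<in> sobolev (i + m) L" using sobolev_Suc_weak_deriv(3)[of L u "i + m"] Suc.prems by simp
  then show ?case using Suc.IH Suc.prems(1) by (simp add: funpow_swap1)
qed simp

lemma sobolev_in_L2: "u \<in> sobolev m L \<Longrightarrow> u \<in> L2_interval L"
  by (cases m) auto

lemma sobolev4_chain:
  assumes "0 < L" "u \<in> sobolev 4 L"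
  shows "i \<le> 4 \<Longrightarrow> (weak_deriv L ^^ i) u \<in> L2_interval L"
    "i < 4 \<Longrightarrow> has_weak_deriv L ((weak_deriv L ^^ i) u) ((weak_deriv L ^^ Suc i) u)"
proof -
  have s: "(weak_deriv L ^^ i) u \<in> sobolev (4 - i) L" if "i \<le> 4" for i
    using sobolev_funpow[of L u i "4 - i"] assms that by simp
  show "i \<le> 4 \<Longrightarrow> (weak_deriv L ^^ i) u \<in> L2_interval L" using s sobolev_in_L2 by blast
  assume "i < 4"
  then obtain m where "4 - i = Suc m" by (metis Suc_diff_Suc)
  then show "has_weak_deriv L ((weak_deriv L ^^ i) u) ((weak_deriv L ^^ Suc i) u)"
    using sobolev_Suc_weak_deriv(2)[OF assms(1), of "(weak_deriv L ^^ i) u" m] s[of i] \<open>i < 4\<close> by simp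
qed

lemma sobolev_weak_deriv_chainI:
  assumes L: "0 < L" and U: "\<And>i. i \<le> m \<Longrightarrow> U i \<in> L2_interval L"
    "\<And>i. i < m \<Longrightarrow> has_weak_deriv L (U i) (U (Suc i))"
  shows "U 0 \<in> sobolev m L" "i \<le> m \<Longrightarrow> (weak_deriv L ^^ i) (U 0) = U i"
proof -
  show "U 0 \<in> sobolev m L" using U
  proof (induction m arbitrary: U)
    case (Suc m)
    have "U (Suc 0) \<in> sobolev m L" by (rule Suc.IH[of "\<lambda>i. U (Suc i)"]) (use Suc.prems in auto)
    then show ?case using Suc.prems(1)[of 0] Suc.prems(2)[of 0] by auto
  qed simp
  show "i \<le> m \<Longrightarrow> (weak_deriv L ^^ i) (U 0) = U i"
  proof (induction i)
    case (Suc i)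
    then show ?case using U weak_deriv_eqI[OF L, of "U (Suc i)" "U i"] by simp
  qed simp
qed

lemma l2_on_mode_deriv2: "l2_on L (mode_deriv L (Suc (Suc i)) j) = - (freq L j)\<^sup>2 *\<^sub>R l2_on L (mode_deriv L i j)"
  by (simp only: l2_on_scale[OF mode_deriv_continuous, symmetric] mode_deriv_add2[abs_def])

text \<open>The boundary terms at \<open>L\<close> contain only the first and third derivatives of \<open>U 0\<close>, because the odd derivatives of each mode vanish
  at \<open>L\<close>: these are the controlled quantities. Since \<open>\<phi>'' = - \<omega>\<^sup>2 \<phi>\<close>, the terms of second and fourth order combine with the factor
  \<open>\<lambda> - \<omega>\<^sup>2\<close>.\<close>

lemma mode_Green_formula:
  fixes lam :: real
  assumes L: "0 < L" and U: "\<And>i. i \<le> 4 \<Longrightarrow> U i \<in> L2_interval L"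
    "\<And>i. i < 4 \<Longrightarrow> has_weak_deriv L (U i) (U (Suc i))"
  shows "inner (lam *\<^sub>R U 2 + U 4) (edge_mode L j) = eigval lam L j * inner (U 0) (edge_mode L j)
    + mode L j L * (pt_value L (U 3) L + (lam - (freq L j)\<^sup>2) * pt_value L (U 1) L)
    - mode L j 0 * (pt_value L (U 3) 0 + (lam - (freq L j)\<^sup>2) * pt_value L (U 1) 0)
    + mode_deriv L (Suc 0) j 0 * (pt_value L (U 2) 0 + (lam - (freq L j)\<^sup>2) * pt_value L (U 0) 0)"
proof -
  let ?D = "\<lambda>i. l2_on L (mode_deriv L i j)"
  have bp: "inner (U (Suc i)) (?D l) = pt_value L (U i) L * mode_deriv L l j L
      - pt_value L (U i) 0 * mode_deriv L l j 0 - inner (U i) (?D (Suc l))" if "i < 4" for i l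
    using H1_by_parts[OF L U(1) U(1) U(2) mode_deriv_C1[of L l j], of i] that by simp
  have n: "2 = Suc (Suc 0)" "3 = Suc (Suc (Suc 0))" "4 = Suc (Suc (Suc (Suc 0)))" "(1::nat) = Suc 0" by simp_all
  have u4: "inner (U 4) (?D 0) = pt_value L (U 3) L * mode L j L - pt_value L (U 3) 0 * mode L j 0
      + pt_value L (U 2) 0 * mode_deriv L (Suc 0) j 0 - (freq L j)\<^sup>2 * inner (U 2) (?D 0)"
    using bp[of 3 0] bp[of 2 "Suc 0"] unfolding n by (simp add: l2_on_mode_deriv2 mode_deriv_1_L[OF L] power2_eq_square)
  have u2: "inner (U 2) (?D 0) = pt_value L (U 1) L * mode L j L - pt_value L (U 1) 0 * mode L j 0
      + pt_value L (U 0) 0 * mode_deriv L (Suc 0) j 0 - (freq L j)\<^sup>2 * inner (U 0) (?D 0)"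
    using bp[of 1 0] bp[of 0 "Suc 0"] unfolding n by (simp add: l2_on_mode_deriv2 mode_deriv_1_L[OF L] power2_eq_square)
  show ?thesis
    unfolding edge_mode_def inner_add_left inner_scaleR_left u4 u2 eigval_def
    by (simp add: algebra_simps power2_eq_square power4_eq_xxxx)
qed

context star_tree
begin

lemma KS_op_in:
  assumes "u \<in> KS_dom L" shows "KS_op lam L (u :: l2 ^ 'n) \<in> L2_tree L"
proof -
  have "u $ k \<in> sobolev 4 L" for k using assms by (simp add: KS_dom_def sobolev_tree_def)
  then show ?thesis unfolding L2_tree_def KS_op_def
    using sobolev4_chain(1)[OF L] by (auto intro!: subspace_add subspace_scale subspace_L2_interval)
qed

text \<open>The vertex conditions match the two kinds of modes. For even \<open>j\<close> the boundary terms at \<open>0\<close> contain odd derivatives, whose sum over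
  the edges is zero; for odd \<open>j\<close> they contain even derivatives, which agree on all edges and are removed by subtracting the mean.\<close>

lemma tree_proj_KS_op:
  assumes u: "u \<in> KS_dom L"
  shows "tree_proj L j (KS_op lam L (u :: l2 ^ 'n)) = eigval lam L j *\<^sub>R tree_proj L j u"
proof -
  define p where "p i k x = pt_value L ((weak_deriv L ^^ i) (u $ k)) x" for i k x
  have s: "u $ k \<in> sobolev 4 L" for k using u by (simp add: KS_dom_def sobolev_tree_def)
  have n: "(weak_deriv L ^^ 1) = weak_deriv L" "(weak_deriv L ^^ 0) v = v" for v by (simp_all add: fun_eq_iff)
  have bc: "p 1 k L = 0" "p 3 k L = 0" "p 0 i 0 = p 0 k 0" "p 2 i 0 = p 2 k 0"
    "(\<Sum>k\<in>UNIV. p 1 k 0) = 0" "(\<Sum>k\<in>UNIV. p 3 k 0) = 0" for i k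
    using u unfolding p_def n by (simp_all add: KS_dom_def)
  define \<mu> where "\<mu> = lam - (freq L j)\<^sup>2"
  let ?n = "norm (edge_mode L j)"
  have G0: "inner (KS_op lam L u $ k) (edge_mode L j) = eigval lam L j * inner (u $ k) (edge_mode L j)
    + (mode_deriv L (Suc 0) j 0 * (p 2 k 0 + \<mu> * p 0 k 0) - mode L j 0 * (p 3 k 0 + \<mu> * p 1 k 0))" for k
    using mode_Green_formula[where U = "\<lambda>i. (weak_deriv L ^^ i) (u $ k)" and lam = lam and j = j, OF L sobolev4_chain[OF L s]] bc(1,2)[of k]
    by (simp add: KS_op_def p_def \<mu>_def algebra_simps del: funpow.simps)
  have G: "inner (KS_op lam L u $ k) (unit_mode L j) = eigval lam L j * inner (u $ k) (unit_mode L j)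
    + (1 / ?n) * (mode_deriv L (Suc 0) j 0 * (p 2 k 0 + \<mu> * p 0 k 0) - mode L j 0 * (p 3 k 0 + \<mu> * p 1 k 0))" for k
    unfolding unit_mode_eq inner_scaleR_right G0 by (simp only: distrib_left mult.left_commute)
  have "mode_coeff L j (KS_op lam L u) k = eigval lam L j * mode_coeff L j u k" for k
  proof (cases "even j")
    case True
    have "(\<Sum>k\<in>UNIV. p 3 k 0 + \<mu> * p 1 k 0) = 0"
      using bc(5,6) by (simp add: sum.distrib sum_distrib_left[symmetric])
    moreover have "(\<Sum>k\<in>UNIV. inner (KS_op lam L u $ k) (unit_mode L j))
        = (\<Sum>k\<in>UNIV. eigval lam L j * inner (u $ k) (unit_mode L j) - (mode L j 0 / ?n) * (p 3 k 0 + \<mu> * p 1 k 0))"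
      unfolding G using mode_deriv_1_0_even[OF True, of L] by simp
    moreover have "\<dots> = eigval lam L j * (\<Sum>k\<in>UNIV. inner (u $ k) (unit_mode L j))
        - (mode L j 0 / ?n) * (\<Sum>k\<in>UNIV. p 3 k 0 + \<mu> * p 1 k 0)"
      by (simp only: sum_subtractf sum_distrib_left)
    ultimately have "(\<Sum>k\<in>UNIV. inner (KS_op lam L u $ k) (unit_mode L j)) = eigval lam L j * (\<Sum>k\<in>UNIV. inner (u $ k) (unit_mode L j))"
      by (simp only: mult_zero_right diff_zero)
    then show ?thesis using True by (simp add: mode_coeff_def)
  next
    case False
    define C where "C = (1 / ?n) * (mode_deriv L (Suc 0) j 0 * (p 2 undefined 0 + \<mu> * p 0 undefined 0))"
    have "inner (KS_op lam L u $ k) (unit_mode L j) = eigval lam L j * inner (u $ k) (unit_mode L j) + C" for k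
      unfolding G C_def using mode_0_odd[OF False, of L] bc(3)[of k undefined] bc(4)[of k undefined] by simp
    then show ?thesis using False
      by (simp add: mode_coeff_def sum.distrib sum_distrib_left[symmetric] add_divide_distrib right_diff_distrib)
  qed
  then show ?thesis by (simp add: tree_proj_def vec_eq_iff)
qed

end

section \<open>The generator on the tree\<close>

lemma l2_on_sum:
  assumes "\<And>i. i \<in> A \<Longrightarrow> continuous_on {0..L} (f i)" "finite A"
  shows "l2_on L (\<lambda>x. \<Sum>i\<in>A. c i * f i x) = (\<Sum>i\<in>A. c i *\<^sub>R l2_on L (f i))"
  using assms(2,1)
proof (induction A rule: finite_induct)
  case empty
  show ?case by (simp add: l2_on_def l2_of_def zero_l2_def)
next
  case (insert i A)
  have 1: "continuous_on {0..L} (\<lambda>x. c i * f i x)" using insert by (intro continuous_intros) auto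
  have 2: "continuous_on {0..L} (\<lambda>x. \<Sum>i\<in>A. c i * f i x)" using insert by (intro continuous_intros) auto
  have "l2_on L (\<lambda>x. \<Sum>i\<in>insert i A. c i * f i x) = l2_on L (\<lambda>x. c i * f i x + (\<Sum>i\<in>A. c i * f i x))"
    using insert by simp
  also have "\<dots> = l2_on L (\<lambda>x. c i * f i x) + l2_on L (\<lambda>x. \<Sum>i\<in>A. c i * f i x)" by (rule l2_on_add[OF 1 2])
  finally show ?case using insert by (simp add: l2_on_scale)
qed

lemma norm_l2_on_le:
  assumes "0 < L" "continuous_on {0..L} f" "\<And>x. x \<in> {0..L} \<Longrightarrow> \<bar>f x\<bar> \<le> B" "0 \<le> B"
  shows "norm (l2_on L f) \<le> B * sqrt L"
proof -
  have "(norm (l2_on L f))\<^sup>2 = integral {0..L} (\<lambda>x. f x * f x)"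
    unfolding power2_norm_eq_inner by (rule inner_l2_on_l2_on[OF assms(2,2)])
  also have "\<dots> \<le> integral {0..L} (\<lambda>x. B * B)"
  proof (rule integral_le)
    fix x assume "x \<in> {0..L}"
    then have "\<bar>f x\<bar> * \<bar>f x\<bar> \<le> B * B" using assms(3)[of x] assms(4) by (intro mult_mono) auto
    then show "f x * f x \<le> B * B" by (simp add: abs_mult_self_eq)
  qed (auto intro!: integrable_continuous_real continuous_intros assms)
  also have "\<dots> = (B * sqrt L)\<^sup>2" using assms(1) by (simp add: power_mult_distrib power2_eq_square mult_ac)
  finally show ?thesis by (rule power2_le_imp_le) (use assms in simp)
qed

lemma norm_edge_mode_ge: "0 < L \<Longrightarrow> sqrt (L / 2) \<le> norm (edge_mode L j)"
  using inner_edge_mode[of L j j] by (auto simp: norm_eq_sqrt_inner split: if_splits)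

lemma power_le_2_plus_4: "0 \<le> x \<Longrightarrow> i \<le> 4 \<Longrightarrow> x ^ i \<le> 2 + (x::real) ^ 4"
proof (cases "x \<le> 1")
  case True
  assume "0 \<le> x"
  then have "x ^ i \<le> 1" using True by (intro power_le_one)
  moreover have "0 \<le> x ^ 4" using \<open>0 \<le> x\<close> by simp
  ultimately show ?thesis by linarith
next
  case False
  assume "i \<le> 4"
  then have "x ^ i \<le> x ^ 4" using False by (intro power_increasing) auto
  then show ?thesis by simp
qed

context star_tree
begin

text \<open>The spectral multiplier of \<open>(\<lambda>\<^sup>2 + 1 + A)\<^sup>-\<^sup>1\<close>; the shift makes all denominators positive.\<close>

definition resolvent_mult :: "nat \<Rightarrow> real" where
  "resolvent_mult j = 1 / (lam\<^sup>2 + 1 + eigval lam L j)"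

lemma freq_nonneg: "0 \<le> freq L j"
  using L by (simp add: freq_def)

lemma resolvent_denominator: "(2 + freq L j ^ 4) / 2 \<le> lam\<^sup>2 + 1 + eigval lam L j"
  using eigval_shift[of L j lam] by simp

lemma resolvent_mult_nonneg: "0 \<le> resolvent_mult j"
proof -
  have "0 \<le> (2 + freq L j ^ 4) / 2" by simp
  then have "0 \<le> lam\<^sup>2 + 1 + eigval lam L j" using resolvent_denominator[of j] by linarith
  then show ?thesis by (simp add: resolvent_mult_def)
qed

lemma resolvent_mult_bound:
  assumes "i \<le> 4" shows "resolvent_mult j * freq L j ^ i \<le> 2"
proof -
  have pos: "0 < (2 + freq L j ^ 4) / 2" by (simp add: add_pos_nonneg)
  then have "resolvent_mult j \<le> 1 / ((2 + freq L j ^ 4) / 2)"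
    unfolding resolvent_mult_def using resolvent_denominator[of j] by (intro divide_left_mono) auto
  then have "resolvent_mult j * freq L j ^ i \<le> 1 / ((2 + freq L j ^ 4) / 2) * (2 + freq L j ^ 4)"
    using power_le_2_plus_4[OF freq_nonneg assms] freq_nonneg by (intro mult_mono) auto
  also have "\<dots> = 2" using pos by (simp add: field_simps)
  finally show ?thesis .
qed

lemma resolvent_mult_decay:
  assumes "i \<le> 3" shows "resolvent_mult j * freq L j ^ i \<le> (2 + 4 * L / pi) / (real j + 1)"
proof -
  define B where "B = real j * (resolvent_mult j * freq L j ^ i)"
  have "resolvent_mult j * freq L j ^ Suc i = pi / (2 * L) * B"
    by (simp add: freq_def B_def)
  moreover have "resolvent_mult j * freq L j ^ Suc i \<le> 2" using assms by (intro resolvent_mult_bound) simp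
  ultimately have "2 * L / pi * (pi / (2 * L) * B) \<le> 2 * L / pi * 2" using L by (intro mult_left_mono) auto
  then have "B \<le> 4 * L / pi" using L by simp
  moreover have "resolvent_mult j * freq L j ^ i \<le> 2" using assms by (intro resolvent_mult_bound) simp
  ultimately have "(resolvent_mult j * freq L j ^ i) * (real j + 1) \<le> 2 + 4 * L / pi"
    by (simp add: algebra_simps B_def)
  then show ?thesis by (subst pos_le_divide_eq) auto
qed

lemma abs_mode_coeff_le: "\<bar>mode_coeff L j w k\<bar> \<le> norm (tree_proj L j (w :: l2 ^ 'n))"
proof -
  have "norm (tree_proj L j w $ k) \<le> norm (tree_proj L j w)" by (rule Finite_Cartesian_Product.norm_nth_le)
  then show ?thesis by (simp add: tree_proj_def norm_unit_mode[OF L])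
qed

lemma summable_mode_coeff: "summable (\<lambda>j. \<bar>mode_coeff L j (w :: l2 ^ 'n) k\<bar> / (real j + 1))"
proof -
  have "summable (\<lambda>j. 1 / (real j + 1)\<^sup>2)"
    by (rule summableI_nonneg_bounded[of _ 2]) (auto intro: sum_inverse_squares_le)
  then have "summable (\<lambda>j. (norm (tree_proj L j w))\<^sup>2 + 1 / (real j + 1)\<^sup>2)"
    by (intro summable_add summable_norm_E_sq)
  then show ?thesis
  proof (rule summable_comparison_test')
    fix j :: nat
    let ?a = "\<bar>mode_coeff L j w k\<bar>" and ?b = "1 / (real j + 1)"
    have "2 * (?a * ?b) \<le> ?a\<^sup>2 + ?b\<^sup>2" using sum_squares_bound[of ?a ?b] by (simp add: mult.assoc)
    moreover have "0 \<le> ?a * ?b" by simp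
    moreover have "?a\<^sup>2 \<le> (norm (tree_proj L j w))\<^sup>2" by (intro power_mono abs_mode_coeff_le) auto
    ultimately have "?a * ?b \<le> (norm (tree_proj L j w))\<^sup>2 + ?b\<^sup>2" by linarith
    then show "norm (\<bar>mode_coeff L j w k\<bar> / (real j + 1)) \<le> (norm (tree_proj L j w))\<^sup>2 + 1 / (real j + 1)\<^sup>2"
      by (simp add: power_divide)
  qed
qed

text \<open>The mode expansion of the resolvent may be differentiated termwise. The multiplier times \<open>\<omega>\<^sub>j\<^sup>i\<close> is \<open>O(1/j)\<close> for \<open>i \<le> 3\<close>, and the
  coefficients are square summable, so these derivatives converge absolutely; for \<open>i = 4\<close> it is only bounded, but four derivatives of a mode give a multiple of the
  mode, and convergence follows from orthogonality. The boundary conditions pass to the limit because boundary values are continuous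
  in the \<open>H\<^sup>1\<close> norm.\<close>

lemma resolvent_in_KS_dom:
  fixes w :: "l2 ^ 'n"
  shows "mult resolvent_mult w \<in> KS_dom L"
proof -
  define \<gamma> where "\<gamma> j k = resolvent_mult j * (mode_coeff L j w k / norm (edge_mode L j))" for j and k :: 'n
  define s where "s i k n = (\<Sum>j<n. \<gamma> j k *\<^sub>R l2_on L (mode_deriv L i j))" for i k n
  have rb: "\<bar>resolvent_mult j * freq L j ^ i\<bar> \<le> 2" if "i \<le> 4" for i j
    using resolvent_mult_bound[OF that, of j] resolvent_mult_nonneg[of j] freq_nonneg[of j] by simp
  have comp: "(m j *\<^sub>R tree_proj L j w) $ k = (m j * (mode_coeff L j w k / norm (edge_mode L j))) *\<^sub>R l2_on L (mode L j)" for m :: "nat \<Rightarrow> real" and j k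
    by (simp add: tree_proj_def unit_mode_eq edge_mode_def)
  have mult_conv: "(\<lambda>n. \<Sum>j<n. (m j * (mode_coeff L j w k / norm (edge_mode L j))) *\<^sub>R l2_on L (mode L j)) \<longlonglongrightarrow> mult m w $ k"
    if "\<And>j. \<bar>m j\<bar> \<le> K" for m K k
    using tendsto_vec_nth[OF mult_LIMSEQ[where m = m and u = w, OF that], where i = k] by (simp only: sum_component comp)
  have conv: "convergent (s i k)" if i: "i \<le> 4" for i k
  proof (cases "i = 4")
    case True
    have "mode_deriv L 4 j = (\<lambda>x. freq L j ^ 4 * mode L j x)" for j
      using mode_deriv_add2[of L 2 j] mode_deriv_add2[of L 0 j]
      by (auto simp: fun_eq_iff eval_nat_numeral power2_eq_square)
    then have D4: "l2_on L (mode_deriv L 4 j) = freq L j ^ 4 *\<^sub>R l2_on L (mode L j)" for j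
      by (simp add: l2_on_scale[OF mode_deriv_continuous])
    have "(\<lambda>n. \<Sum>j<n. ((resolvent_mult j * freq L j ^ 4) * (mode_coeff L j w k / norm (edge_mode L j))) *\<^sub>R l2_on L (mode L j))
        \<longlonglongrightarrow> mult (\<lambda>j. resolvent_mult j * freq L j ^ 4) w $ k"
      by (rule mult_conv[OF rb]) simp
    moreover have "s i k = (\<lambda>n. \<Sum>j<n. ((resolvent_mult j * freq L j ^ 4) * (mode_coeff L j w k / norm (edge_mode L j))) *\<^sub>R l2_on L (mode L j))"
      unfolding s_def True D4 \<gamma>_def by (simp add: fun_eq_iff mult_ac)
    ultimately show ?thesis by (auto simp: convergent_def)
  next
    case False
    then have i3: "i \<le> 3" using i by simp
    define C where "C = (2 + 4 * L / pi) * sqrt L / sqrt (L / 2)"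
    have "summable (\<lambda>j. \<gamma> j k *\<^sub>R l2_on L (mode_deriv L i j))"
    proof (rule summable_comparison_test')
      show "summable (\<lambda>j. C * (\<bar>mode_coeff L j w k\<bar> / (real j + 1)))" by (intro summable_mult summable_mode_coeff)
      fix j
      have nD: "norm (l2_on L (mode_deriv L i j)) \<le> freq L j ^ i * sqrt L"
        using mode_deriv_bound[of L i j] freq_nonneg[of j]
        by (intro norm_l2_on_le[OF L mode_deriv_continuous]) auto
      have ne: "0 < sqrt (L / 2)" "sqrt (L / 2) \<le> norm (edge_mode L j)" using L norm_edge_mode_ge[OF L] by auto
      have "norm (\<gamma> j k *\<^sub>R l2_on L (mode_deriv L i j))
          = resolvent_mult j * (\<bar>mode_coeff L j w k\<bar> / norm (edge_mode L j)) * norm (l2_on L (mode_deriv L i j))"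
        by (simp add: \<gamma>_def abs_mult resolvent_mult_nonneg)
      also have "\<dots> \<le> resolvent_mult j * (\<bar>mode_coeff L j w k\<bar> / sqrt (L / 2)) * (freq L j ^ i * sqrt L)"
        using ne resolvent_mult_nonneg by (intro mult_mono nD mult_left_mono divide_left_mono mult_pos_pos) (auto intro: mult_nonneg_nonneg)
      also have "\<dots> = (resolvent_mult j * freq L j ^ i) * (\<bar>mode_coeff L j w k\<bar> * (sqrt L / sqrt (L / 2)))"
        by simp
      also have "\<dots> \<le> ((2 + 4 * L / pi) / (real j + 1)) * (\<bar>mode_coeff L j w k\<bar> * (sqrt L / sqrt (L / 2)))"
        using resolvent_mult_decay[OF i3, of j] L by (intro mult_right_mono) auto
      also have "\<dots> = C * (\<bar>mode_coeff L j w k\<bar> / (real j + 1))" by (simp add: C_def mult_ac)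
      finally show "norm (\<gamma> j k *\<^sub>R l2_on L (mode_deriv L i j)) \<le> C * (\<bar>mode_coeff L j w k\<bar> / (real j + 1))" .
    qed
    then show ?thesis unfolding s_def by (simp add: summable_iff_convergent)
  qed
  define U where "U k i = lim (s i k)" for k i
  have sU: "s i k \<longlonglongrightarrow> U k i" if "i \<le> 4" for i k
    using conv[OF that] by (simp add: U_def convergent_LIMSEQ_iff)
  have s_in: "s i k n \<in> L2_interval L" for i k n
    unfolding s_def by (intro subspace_sum subspace_scale subspace_L2_interval l2_on_in_L2_interval mode_deriv_continuous)
  have s_deriv: "has_weak_deriv L (s i k n) (s (Suc i) k n)" for i k n
    unfolding s_def by (rule has_weak_deriv_sum) (auto intro: has_weak_deriv_l2_on[OF L mode_deriv_C1])
  have U_in: "U k i \<in> L2_interval L" if "i \<le> 4" for k i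
    by (rule closed_sequentially[OF closed_L2_interval s_in sU[OF that]])
  have U_deriv: "has_weak_deriv L (U k i) (U k (Suc i))" if "i < 4" for k i
    by (rule has_weak_deriv_limit[OF s_deriv[of i k] sU sU]) (use that in auto)
  have U0: "U k 0 = mult resolvent_mult w $ k" for k
  proof -
    have "(\<lambda>n. \<Sum>j<n. (resolvent_mult j * (mode_coeff L j w k / norm (edge_mode L j))) *\<^sub>R l2_on L (mode L j)) \<longlonglongrightarrow> mult resolvent_mult w $ k"
      by (rule mult_conv[of _ 2]) (use rb[of 0] in simp)
    then have "s 0 k \<longlonglongrightarrow> mult resolvent_mult w $ k" unfolding s_def \<gamma>_def by simp
    then show ?thesis using sU[of 0 k] LIMSEQ_unique by blast
  qed
  have chain: "mult resolvent_mult w $ k \<in> sobolev 4 L" "i \<le> 4 \<Longrightarrow> (weak_deriv L ^^ i) (mult resolvent_mult w $ k) = U k i" for k i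
    using sobolev_weak_deriv_chainI[OF L, of 4 "U k"] U_in U_deriv unfolding U0 by auto
  have pt_s: "pt_value L (s i k n) p = (\<Sum>j<n. \<gamma> j k * mode_deriv L i j p)" if "p \<in> {0..L}" for i k n p
  proof -
    have "s i k n = l2_on L (\<lambda>x. \<Sum>j<n. \<gamma> j k * mode_deriv L i j x)"
      unfolding s_def by (rule l2_on_sum[symmetric]) (auto intro: mode_deriv_continuous)
    then show ?thesis using that
      by (simp add: pt_value_l2_on[OF L] continuous_on_sum continuous_on_mult_left mode_deriv_continuous)
  qed
  have pt_lim: "(\<lambda>n. pt_value L (s i k n) p) \<longlonglongrightarrow> pt_value L (U k i) p" if "i < 4" "p = 0 \<or> p = L" for i k p
  proof -
    note e = pt_value_endpoints[OF L s_in s_in s_deriv] and eU = pt_value_endpoints[OF L U_in U_in U_deriv]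
    have s: "s i k \<longlonglongrightarrow> U k i" "s (Suc i) k \<longlonglongrightarrow> U k (Suc i)" using that by (auto intro: sU)
    from that(2) show ?thesis
    proof
      assume "p = L"
      then show ?thesis using that(1) L by (simp add: e(1) eU(1)) (intro tendsto_intros s, simp)
    next
      assume "p = 0"
      then show ?thesis using that(1) L by (simp add: e(2) eU(2)) (intro tendsto_intros s, simp)
    qed
  qed
  have n: "(1::nat) = Suc 0" "(2::nat) = Suc (Suc 0)" "(3::nat) = Suc (Suc (Suc 0))" by simp_all
  have bcL: "pt_value L (U k i) L = 0" if "i = 1 \<or> i = 3" for k i
  proof -
    have "pt_value L (s i k m) L = 0" for m
      using that L by (auto simp: pt_s n mode_deriv_1_L mode_deriv_3_L)
    then show ?thesis using pt_lim[of i L k] that by (auto simp: LIMSEQ_const_iff)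
  qed
  have bc0: "pt_value L (U k i) 0 = pt_value L (U k' i) 0" if "i = 0 \<or> i = 2" for k k' i
  proof -
    have eq: "\<gamma> j k * mode_deriv L i j 0 = \<gamma> j k' * mode_deriv L i j 0" for j
    proof (cases "even j")
      case True
      then show ?thesis using mode_coeff_even[of j L w k k'] by (simp add: \<gamma>_def)
    next
      case False
      then have "mode_deriv L i j 0 = 0" using that mode_0_odd[of j L] by (auto simp: n mode_deriv_add2)
      then show ?thesis by simp
    qed
    have z: "0 \<in> {0..L}" using L by simp
    have "(\<lambda>m. pt_value L (s i k m) 0) = (\<lambda>m. pt_value L (s i k' m) 0)"
      unfolding pt_s[OF z] by (intro ext sum.cong refl eq)
    moreover have "i < 4" using that by auto
    ultimately show ?thesis using pt_lim[of i 0 k] pt_lim[of i 0 k'] LIMSEQ_unique by (metis (no_types, lifting))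
  qed
  have bcs: "(\<Sum>k\<in>UNIV. pt_value L (U k i) 0) = 0" if "i = 1 \<or> i = 3" for i
  proof -
    have i4: "i < 4" using that by auto
    have z: "0 \<in> {0..L}" using L by simp
    have zero: "(\<Sum>k\<in>UNIV. \<gamma> j k * mode_deriv L i j 0) = 0" for j
    proof (cases "even j")
      case True
      then have "mode_deriv L i j 0 = 0" using that mode_deriv_1_0_even[of j L] by (auto simp: n mode_deriv_add2)
      then show ?thesis by simp
    next
      case False
      have "(\<Sum>k\<in>UNIV. \<gamma> j k * mode_deriv L i j 0)
          = resolvent_mult j / norm (edge_mode L j) * mode_deriv L i j 0 * (\<Sum>k\<in>UNIV. mode_coeff L j w k)"
        by (simp add: \<gamma>_def sum_distrib_left sum_divide_distrib mult_ac)
      then show ?thesis using sum_mode_coeff_odd[OF False, of L w] by simp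
    qed
    have "(\<Sum>k\<in>UNIV. pt_value L (s i k m) 0) = 0" for m
      unfolding pt_s[OF z] by (subst sum.swap) (simp only: zero sum.neutral_const)
    moreover have "(\<lambda>m. \<Sum>k\<in>UNIV. pt_value L (s i k m) 0) \<longlonglongrightarrow> (\<Sum>k\<in>UNIV. pt_value L (U k i) 0)"
      by (intro tendsto_sum pt_lim i4) simp
    ultimately show ?thesis by (simp add: LIMSEQ_const_iff)
  qed
  have w1: "weak_deriv L (mult resolvent_mult w $ k) = U k 1" for k using chain(2)[of 1 k] by simp
  have w2: "(weak_deriv L ^^ 2) (mult resolvent_mult w $ k) = U k 2" for k by (rule chain(2)) simp
  have w3: "(weak_deriv L ^^ 3) (mult resolvent_mult w $ k) = U k 3" for k by (rule chain(2)) simp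
  show ?thesis
    unfolding KS_dom_def sobolev_tree_def
    using chain(1) bcL[of 1] bcL[of 3] bc0[of 0, unfolded U0] bc0[of 2] bcs[of 1] bcs[of 3]
    by (simp add: w1 w2 w3)
qed

theorem KS_generates: "generates (L2_tree L) (KS_dom L) (\<lambda>\<phi>. - KS_op lam L \<phi>) (S :: real \<Rightarrow> l2 ^ 'n \<Rightarrow> _)"
proof (rule generates_S)
  show "KS_dom L \<subseteq> (L2_tree L :: (l2 ^ 'n) set)"
    using sobolev_in_L2 by (auto simp: KS_dom_def sobolev_tree_def L2_tree_def)
  fix u :: "l2 ^ 'n" assume u: "u \<in> KS_dom L"
  show "- KS_op lam L u \<in> L2_tree L" using KS_op_in[OF u] by (rule subspace_neg[OF subspace_X])
  show "tree_proj L j (- KS_op lam L u) = - eigval lam L j *\<^sub>R tree_proj L j u" for j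
    using tree_proj_KS_op[OF u] by (simp add: linear_neg[OF E_linear])
next
  fix w :: "l2 ^ 'n" assume w: "w \<in> L2_tree L"
  let ?u = "mult resolvent_mult w"
  have rb: "\<bar>resolvent_mult j\<bar> \<le> 2" for j
    using resolvent_mult_bound[of 0 j] resolvent_mult_nonneg[of j] by simp
  have "(lam\<^sup>2 + 1) *\<^sub>R ?u - (- KS_op lam L ?u) = w"
  proof (rule resolution_eqI[OF _ w])
    show "(lam\<^sup>2 + 1) *\<^sub>R ?u - (- KS_op lam L ?u) \<in> L2_tree L"
      using KS_op_in[OF resolvent_in_KS_dom] by (auto intro!: subspace_add subspace_scale subspace_X mult_in_X[OF rb])
    fix j
    have "0 < (2 + freq L j ^ 4) / 2" by (simp add: add_pos_nonneg)
    then have pos: "lam\<^sup>2 + 1 + eigval lam L j \<noteq> 0" using resolvent_denominator[of j] by linarith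
    have "tree_proj L j ((lam\<^sup>2 + 1) *\<^sub>R ?u - (- KS_op lam L ?u)) = ((lam\<^sup>2 + 1 + eigval lam L j) * resolvent_mult j) *\<^sub>R tree_proj L j w"
      by (simp add: linear_add[OF E_linear] linear_scale[OF E_linear] E_mult[OF rb] tree_proj_KS_op[OF resolvent_in_KS_dom]
          scaleR_add_left distrib_right)
    also have "(lam\<^sup>2 + 1 + eigval lam L j) * resolvent_mult j = 1" using pos by (simp add: resolvent_mult_def)
    finally show "tree_proj L j ((lam\<^sup>2 + 1) *\<^sub>R ?u - (- KS_op lam L ?u)) = tree_proj L j w" by simp
  qed
  then show "\<exists>u\<in>KS_dom L. (lam\<^sup>2 + 1) *\<^sub>R u - - KS_op lam L u = w" using resolvent_in_KS_dom by blast
qed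

lemma tree_proj_in_KS_dom: "tree_proj L j (u :: l2 ^ 'n) \<in> KS_dom L"
proof -
  have rb: "\<bar>resolvent_mult j\<bar> \<le> 2" for j
    using resolvent_mult_bound[of 0 j] resolvent_mult_nonneg[of j] by simp
  have "0 < (2 + freq L j ^ 4) / 2" by (simp add: add_pos_nonneg)
  then have pos: "lam\<^sup>2 + 1 + eigval lam L j \<noteq> 0" using resolvent_denominator[of j] by linarith
  have "mult resolvent_mult ((lam\<^sup>2 + 1 + eigval lam L j) *\<^sub>R tree_proj L j u) = tree_proj L j u"
    by (rule resolution_eqI)
       (auto intro: mult_in_X[OF rb] E_in_X simp: E_mult[OF rb] linear_scale[OF E_linear] E_E resolvent_mult_def pos)
  then show ?thesis using resolvent_in_KS_dom by metis
qed

theorem KS_semigroup_unique: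
  assumes "generates (L2_tree L) (KS_dom L) (\<lambda>\<phi>. - KS_op lam L \<phi>) S'" "0 \<le> t" "u \<in> L2_tree L"
  shows "S' t u = S t (u :: l2 ^ 'n)"
proof (rule semigroup_unique[OF assms(1) tree_proj_in_KS_dom _ assms(2,3)])
  fix j and u :: "l2 ^ 'n"
  have "KS_op lam L (tree_proj L j u) = eigval lam L j *\<^sub>R tree_proj L j u"
    by (rule resolution_eqI)
       (auto intro: KS_op_in tree_proj_in_KS_dom subspace_scale[OF subspace_X] E_in_X
         simp: tree_proj_KS_op[OF tree_proj_in_KS_dom] E_E linear_scale[OF E_linear])
  then show "- KS_op lam L (tree_proj L j u) = - eigval lam L j *\<^sub>R tree_proj L j u" by simp
qed

end

section \<open>Solutions of the boundary control problem\<close>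

lemma lifting_polys_exist: assumes "0 < L" shows "\<exists>P1 P2. lifting_polys L P1 P2"
proof -
  \<comment> \<open>Polynomials \<open>\<alpha> x\<^sup>4 + \<beta> x\<^sup>5\<close> vanish to fourth order at \<open>0\<close>; the conditions at \<open>L\<close> are two linear equations for \<open>\<alpha>, \<beta>\<close>.\<close>
  let ?P = "\<lambda>\<alpha> \<beta>. [:0, 0, 0, 0, \<alpha>, \<beta>:] :: real poly"
  have j: "poly ((pderiv ^^ j) (?P \<alpha> \<beta>)) 0 = 0" if "j \<le> 3" for j \<alpha> \<beta>
  proof -
    have "j = 0 \<or> j = Suc 0 \<or> j = Suc (Suc 0) \<or> j = Suc (Suc (Suc 0))" using that by linarith
    then show ?thesis by (auto simp: pderiv_pCons)
  qed
  have v: "poly (pderiv (?P \<alpha> \<beta>)) L = 4 * \<alpha> * L ^ 3 + 5 * \<beta> * L ^ 4"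
    "poly ((pderiv ^^ 3) (?P \<alpha> \<beta>)) L = 24 * \<alpha> * L + 60 * \<beta> * L\<^sup>2" for \<alpha> \<beta>
    by (simp_all add: pderiv_pCons numeral_3_eq_3 power2_eq_square power4_eq_xxxx algebra_simps)
  have "lifting_polys L (?P (1 / (2 * L ^ 3)) (- 1 / (5 * L ^ 4))) (?P (- 1 / (24 * L)) (1 / (30 * L\<^sup>2)))"
    unfolding lifting_polys_def v using assms j
    by (simp add: power2_eq_square power3_eq_cube power4_eq_xxxx)
  then show ?thesis by blast
qed

lemma set_integrable_continuous: "continuous_on {0..T} f \<Longrightarrow> set_integrable lborel {0..T} (f :: real \<Rightarrow> real)"
  by (rule borel_integrable_atLeastAtMost')

lemma set_integrable_fun_of: "set_integrable lborel {0..T} (fun_of u)"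
  unfolding set_integrable_def using sqint_mult[OF sqint_indicator[of 0 T] sqint_fun_of[of u]] by simp

lemma set_lint_closed_open:
  "(LINT x:{0..T}|lborel. f x :: real) = (LINT x:{0<..<T}|lborel. f x)"
  if [measurable]: "f \<in> borel_measurable borel" for T :: real
  unfolding set_lebesgue_integral_def
proof (rule integral_cong_AE)
  show "AE x in lborel. indicator {0..T} x *\<^sub>R f x = indicator {0<..<T} x *\<^sub>R f x"
    using AE_lborel_singleton[of 0] AE_lborel_singleton[of T] by eventually_elim (auto simp: indicator_def)
qed simp_all

definition exp_moment :: "real \<Rightarrow> real \<Rightarrow> l2 \<Rightarrow> real" where
  "exp_moment T s u = (LINT t:{0..T}|lborel. exp (s * t) * pt_value T u t)"

lemma sobolev_1D:
  assumes "0 < T" "u \<in> sobolev 1 T"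
  shows "u \<in> L2_interval T" "has_weak_deriv T u (weak_deriv T u)" "weak_deriv T u \<in> L2_interval T"
    "continuous_on {0..T} (pt_value T u)" "u = l2_on T (pt_value T u)"
proof -
  show *: "u \<in> L2_interval T" "has_weak_deriv T u (weak_deriv T u)" "weak_deriv T u \<in> L2_interval T"
    using sobolev_Suc_weak_deriv[of T u 0] assms by auto
  show "continuous_on {0..T} (pt_value T u)" "u = l2_on T (pt_value T u)"
    using H1_pt_value[OF assms(1) *(1) *(3) *(2)] by auto
qed

lemma exp_C1: "C1_pair (\<lambda>t. exp (s * t)) (\<lambda>t. s * exp (s * t))"
  unfolding C1_pair_def by (auto intro!: derivative_eq_intros continuous_intros)

lemma exp_moment_weak_deriv:
  assumes T: "0 < T" and u: "u \<in> sobolev 1 T"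
  shows "(LINT t:{0..T}|lborel. exp (s * t) * fun_of (weak_deriv T u) t)
    = exp (s * T) * pt_value T u T - pt_value T u 0 - s * exp_moment T s u"
proof -
  note u' = sobolev_1D[OF T u]
  note c = C1_pair_continuous[OF exp_C1[of s]]
  have "inner (weak_deriv T u) (l2_on T (\<lambda>t. exp (s * t))) + inner u (l2_on T (\<lambda>t. s * exp (s * t)))
      = pt_value T u T * exp (s * T) - pt_value T u 0 * exp (s * 0)"
    by (rule H1_by_parts[OF T u'(1,3,2) exp_C1])
  moreover have "inner (weak_deriv T u) (l2_on T (\<lambda>t. exp (s * t))) = (LINT t:{0..T}|lborel. exp (s * t) * fun_of (weak_deriv T u) t)"
    unfolding inner_l2_on[OF c(1)] by (subst set_lint_closed_open) (simp_all add: mult.commute)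
  moreover have "inner u (l2_on T (\<lambda>t. s * exp (s * t))) = s * exp_moment T s u"
  proof -
    have "inner u (l2_on T (\<lambda>t. exp (s * t))) = inner (l2_on T (pt_value T u)) (l2_on T (\<lambda>t. exp (s * t)))"
      using u'(5) by simp
    also have "\<dots> = integral {0..T} (\<lambda>t. pt_value T u t * exp (s * t))"
      by (rule inner_l2_on_l2_on[OF u'(4) c(1)])
    also have "\<dots> = (LINT t:{0..T}|lborel. pt_value T u t * exp (s * t))"
      by (rule set_borel_integral_eq_integral(2)[symmetric, OF set_integrable_continuous]) (intro continuous_intros u'(4))
    finally have "inner u (l2_on T (\<lambda>t. exp (s * t))) = exp_moment T s u" by (simp add: exp_moment_def mult.commute)
    then show ?thesis by (simp add: l2_on_scale[OF c(1)])
  qed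
  ultimately show ?thesis by (simp add: mult.commute)
qed

lemma poly_C1: "C1_pair (poly P) (poly (pderiv P))"
  unfolding C1_pair_def by (auto intro: poly_DERIV continuous_intros)

lemma poly_l2_chain:
  assumes "0 < L"
  shows "l2_on L (poly ((pderiv ^^ i) P)) \<in> L2_interval L"
    "has_weak_deriv L (l2_on L (poly ((pderiv ^^ i) P))) (l2_on L (poly ((pderiv ^^ Suc i) P)))"
    "p \<in> {0..L} \<Longrightarrow> pt_value L (l2_on L (poly ((pderiv ^^ i) P))) p = poly ((pderiv ^^ i) P) p"
  using has_weak_deriv_l2_on[OF assms poly_C1[of "(pderiv ^^ i) P"]]
  by (auto intro!: l2_on_in_L2_interval pt_value_l2_on assms continuous_intros)

lemma mode_Green_poly:
  assumes L: "0 < L" and "\<And>j. j \<le> 3 \<Longrightarrow> poly ((pderiv ^^ j) P) 0 = 0"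
  shows "inner (l2_on L (\<lambda>x. lam * poly ((pderiv ^^ 2) P) x + poly ((pderiv ^^ 4) P) x)) (edge_mode L j)
    = eigval lam L j * inner (l2_on L (poly P)) (edge_mode L j)
      + mode L j L * (poly ((pderiv ^^ 3) P) L + (lam - (freq L j)\<^sup>2) * poly (pderiv P) L)"
proof -
  let ?U = "\<lambda>i. l2_on L (poly ((pderiv ^^ i) P))"
  have "l2_on L (\<lambda>x. lam * poly ((pderiv ^^ 2) P) x + poly ((pderiv ^^ 4) P) x) = lam *\<^sub>R ?U 2 + ?U 4"
    by (subst l2_on_add) (auto intro!: continuous_intros simp: l2_on_scale continuous_on_poly)
  moreover have p0: "pt_value L (?U i) 0 = 0" if "i \<le> 3" for i
    using poly_l2_chain(3)[OF L, of 0 i P] assms(2)[OF that] L by simp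
  moreover have "pt_value L (?U 3) L = poly ((pderiv ^^ 3) P) L" "pt_value L (?U 1) L = poly (pderiv P) L"
    using poly_l2_chain(3)[OF L, of L 3 P] poly_l2_chain(3)[OF L, of L 1 P] L by simp_all
  ultimately show ?thesis
    using mode_Green_formula[where U = ?U and lam = lam and j = j, OF L poly_l2_chain(1)[OF L] poly_l2_chain(2)[OF L]]
      p0[of 0] p0[of 1] p0[of 2] p0[of 3]
    by simp
qed

context star_tree
begin

text \<open>The sources are finite sums of scalar functions times fixed vectors. For one such term, continuity in \<open>t\<close> follows by dominated
  convergence, where the indicator of \<open>[0, t]\<close> is continuous in \<open>t\<close> at every \<open>s \<noteq> t\<close>.\<close>

lemma Duhamel_term:
  fixes W :: "l2 ^ 'n" and c :: "real \<Rightarrow> real"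
  assumes T: "0 \<le> T" and c: "set_integrable lborel {0..T} c"
  shows "t \<in> {0..T} \<Longrightarrow> set_integrable lborel {0..t} (\<lambda>s. c s *\<^sub>R S (t - s) W)"
    and "continuous_on {0..T} (\<lambda>t. LINT s:{0..t}|lborel. c s *\<^sub>R S (t - s) W)"
proof -
  define M where "M = exp (lam\<^sup>2 * T) * norm W"
  have M0: "0 \<le> M" by (simp add: M_def)
  have "continuous_on UNIV (\<lambda>s. S (t - s) W)" for t
    by (rule continuous_on_compose2[OF S_continuous]) (auto intro!: continuous_intros)
  then have [measurable]: "(\<lambda>s. S (t - s) W) \<in> borel_measurable borel" for t
    by (rule borel_measurable_continuous_onI)
  have [measurable]: "(\<lambda>s. indicator {0..T} s * c s) \<in> borel_measurable borel"
    using borel_measurable_integrable[OF c[unfolded set_integrable_def]] by simp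
  have eq: "indicator {0..t} s *\<^sub>R (c s *\<^sub>R S (t - s) W) = indicator {0..t} s *\<^sub>R ((indicator {0..T} s * c s) *\<^sub>R S (t - s) W)"
    if "t \<in> {0..T}" for t s
    using that by (auto simp: indicator_def)
  have meas: "(\<lambda>s. indicator {0..t} s *\<^sub>R (c s *\<^sub>R S (t - s) W)) \<in> borel_measurable lborel" if "t \<in> {0..T}" for t
    unfolding eq[OF that] by measurable
  have bound: "norm (indicator {0..t} s *\<^sub>R (c s *\<^sub>R S (t - s) W)) \<le> M * \<bar>indicator {0..T} s * c s\<bar>" if t: "t \<in> {0..T}" for t s
  proof (cases "s \<in> {0..t}")
    case True
    have "norm (S (t - s) W) \<le> exp (lam\<^sup>2 * max 0 (t - s)) * norm W" by (rule norm_S_le)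
    also have "\<dots> \<le> M" unfolding M_def using True t by (intro mult_right_mono) (auto intro!: mult_left_mono)
    finally have "norm (S (t - s) W) \<le> M" .
    then have "\<bar>c s\<bar> * norm (S (t - s) W) \<le> \<bar>c s\<bar> * M" by (intro mult_left_mono) auto
    then show ?thesis using True t by (simp add: mult.commute)
  qed (simp add: M_def)
  have dom: "integrable lborel (\<lambda>s. M * \<bar>indicator {0..T} s * c s\<bar>)"
    using c unfolding set_integrable_def by (intro integrable_mult_right integrable_abs) simp
  show "set_integrable lborel {0..t} (\<lambda>s. c s *\<^sub>R S (t - s) W)" if "t \<in> {0..T}"
    unfolding set_integrable_def
    by (rule Bochner_Integration.integrable_bound[OF dom meas[OF that]])
       (rule AE_I2, use bound[OF that] M0 in \<open>simp add: abs_mult\<close>)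
  show "continuous_on {0..T} (\<lambda>t. LINT s:{0..t}|lborel. c s *\<^sub>R S (t - s) W)"
    unfolding continuous_on_sequentially
  proof (intro ballI allI impI)
    fix r t assume t: "t \<in> {0..T}" and r: "(\<forall>n. r n \<in> {0..T}) \<and> r \<longlonglongrightarrow> t"
    show "((\<lambda>t. LINT s:{0..t}|lborel. c s *\<^sub>R S (t - s) W) \<circ> r) \<longlonglongrightarrow> (LINT s:{0..t}|lborel. c s *\<^sub>R S (t - s) W)"
      unfolding o_def set_lebesgue_integral_def
    proof (rule integral_dominated_convergence[OF meas[OF t] _ dom])
      show "(\<lambda>s. indicator {0..r n} s *\<^sub>R (c s *\<^sub>R S (r n - s) W)) \<in> borel_measurable lborel" for n
        using meas[of "r n"] r by blast
      show "AE s in lborel. norm (indicator {0..r n} s *\<^sub>R (c s *\<^sub>R S (r n - s) W)) \<le> M * \<bar>indicator {0..T} s * c s\<bar>" for n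
        using bound[of "r n"] r by (intro AE_I2) blast
      show "AE s in lborel. (\<lambda>n. indicator {0..r n} s *\<^sub>R (c s *\<^sub>R S (r n - s) W)) \<longlonglongrightarrow> indicator {0..t} s *\<^sub>R (c s *\<^sub>R S (t - s) W)"
        using AE_lborel_singleton[of t]
      proof eventually_elim
        case (elim s)
        have i: "(\<lambda>n. indicator {0..r n} s :: real) \<longlonglongrightarrow> indicator {0..t} s"
        proof (rule tendsto_eventually)
          show "\<forall>\<^sub>F n in sequentially. indicator {0..r n} s = (indicator {0..t} s :: real)"
          proof (cases "s < t")
            case True
            have "\<forall>\<^sub>F n in sequentially. s < r n" using r True by (auto intro: order_tendstoD)
            then show ?thesis by eventually_elim (use True in \<open>auto simp: indicator_def\<close>)
          next
            case False
            then have "t < s" using elim by simp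
            then have "\<forall>\<^sub>F n in sequentially. r n < s" using r by (auto intro: order_tendstoD)
            then show ?thesis by eventually_elim (use False elim in \<open>auto simp: indicator_def\<close>)
          qed
        qed
        have "(\<lambda>n. S (r n - s) W) \<longlonglongrightarrow> S (t - s) W"
          by (rule continuous_on_tendsto_compose[OF S_continuous]) (use r in \<open>auto intro!: tendsto_intros\<close>)
        then show ?case by (intro tendsto_scaleR i tendsto_const)
      qed
    qed
  qed
qed

lemma Duhamel_sum:
  fixes W :: "'i \<Rightarrow> l2 ^ 'n" and c :: "'i \<Rightarrow> real \<Rightarrow> real"
  assumes T: "0 \<le> T" and I: "finite I" and c: "\<And>i. i \<in> I \<Longrightarrow> set_integrable lborel {0..T} (c i)"
    and F: "\<And>s. F s = (\<Sum>i\<in>I. c i s *\<^sub>R W i)"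
  shows "t \<in> {0..T} \<Longrightarrow> set_integrable lborel {0..t} (\<lambda>s. S (t - s) (F s))"
    and "continuous_on {0..T} (\<lambda>t. LINT s:{0..t}|lborel. S (t - s) (F s))"
proof -
  have SF: "S r (F s) = (\<Sum>i\<in>I. c i s *\<^sub>R S r (W i))" for r s
    unfolding F by (simp add: linear_sum[OF bounded_linear.linear[OF S_bounded_linear]]
        linear_scale[OF bounded_linear.linear[OF S_bounded_linear]])
  have int: "integrable lborel (\<lambda>s. indicator {0..t} s *\<^sub>R c i s *\<^sub>R S (t - s) (W i))" if "i \<in> I" "t \<in> {0..T}" for i t
    using Duhamel_term(1)[OF T c[OF that(1)] that(2)] unfolding set_integrable_def .
  show "set_integrable lborel {0..t} (\<lambda>s. S (t - s) (F s))" if "t \<in> {0..T}"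
    unfolding SF set_integrable_def scaleR_sum_right
    by (rule Bochner_Integration.integrable_sum) (rule int[OF _ that])
  have eq: "(LINT s:{0..t}|lborel. S (t - s) (F s)) = (\<Sum>i\<in>I. LINT s:{0..t}|lborel. c i s *\<^sub>R S (t - s) (W i))"
    if "t \<in> {0..T}" for t
    unfolding SF set_lebesgue_integral_def scaleR_sum_right
    by (rule Bochner_Integration.integral_sum) (rule int[OF _ that])
  have "continuous_on {0..T} (\<lambda>t. \<Sum>i\<in>I. LINT s:{0..t}|lborel. c i s *\<^sub>R S (t - s) (W i))"
    by (intro continuous_on_sum Duhamel_term(2)[OF T] c)
  then show "continuous_on {0..T} (\<lambda>t. LINT s:{0..t}|lborel. S (t - s) (F s))"
    by (rule continuous_on_eq) (simp only: eq)
qed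

text \<open>The source \<open>F\<close> has four terms on each edge; \<open>control_weight\<close> collects their time-dependent factors and \<open>source_profile\<close> their profiles in \<open>x\<close>.\<close>

definition control_weight :: "real poly \<Rightarrow> real poly \<Rightarrow> real \<Rightarrow> l2 ^ 'n \<Rightarrow> l2 ^ 'n \<Rightarrow> 'n \<times> nat \<Rightarrow> real \<Rightarrow> real" where
  "control_weight P1 P2 T a b i s = (case i of (k, m) \<Rightarrow>
     - [fun_of (weak_deriv T (a $ k)) s, fun_of (weak_deriv T (b $ k)) s, pt_value T (a $ k) s, pt_value T (b $ k) s] ! m)"

definition source_profile :: "real poly \<Rightarrow> real poly \<Rightarrow> nat \<Rightarrow> real \<Rightarrow> real" where
  "source_profile P1 P2 m x = [poly P1 x, poly P2 x,
     lam * poly ((pderiv ^^ 2) P1) x + poly ((pderiv ^^ 4) P1) x,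
     lam * poly ((pderiv ^^ 2) P2) x + poly ((pderiv ^^ 4) P2) x] ! m"

lemma source_profile_continuous: "m < 4 \<Longrightarrow> continuous_on A (source_profile P1 P2 m)"
proof -
  assume "m < 4"
  then have "m = 0 \<or> m = 1 \<or> m = 2 \<or> m = 3" by linarith
  then show ?thesis unfolding source_profile_def[abs_def]
    by (elim disjE) (simp_all add: numeral_2_eq_2 numeral_3_eq_3 del: funpow.simps, (intro continuous_intros)+)
qed

lemma sum_4: "(\<Sum>m<(4::nat). f m) = f 0 + f 1 + f 2 + (f 3 :: 'b::comm_monoid_add)"
  by (simp add: eval_nat_numeral)

lemma lift_source_component:
  "lift_source lam L T P1 P2 a b s $ k = (\<Sum>m<4. control_weight P1 P2 T a b (k, m) s *\<^sub>R l2_on L (source_profile P1 P2 m))"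
proof -
  have "lift_source lam L T P1 P2 a b s $ k = l2_on L (\<lambda>x. \<Sum>m<4. control_weight P1 P2 T a b (k, m) s * source_profile P1 P2 m x)"
    unfolding lift_source_def vec_lambda_beta
    by (rule l2_on_cong) (simp add: sum_4 control_weight_def source_profile_def eval_nat_numeral algebra_simps del: funpow.simps)
  then show ?thesis
    using l2_on_sum[where A = "{..<4}" and L = L and f = "source_profile P1 P2" and c = "\<lambda>m. control_weight P1 P2 T a b (k, m) s"]
    by (simp add: source_profile_continuous)
qed

lemma lift_source_sum:
  "lift_source lam L T P1 P2 a b s
    = (\<Sum>i\<in>UNIV \<times> {..<4}. control_weight P1 P2 T a b i s *\<^sub>R axis (fst i) (l2_on L (source_profile P1 P2 (snd i))))"
proof -
  have "(\<Sum>i\<in>UNIV \<times> {..<4}. control_weight P1 P2 T a b i s *\<^sub>R axis (fst i) (l2_on L (source_profile P1 P2 (snd i)))) $ k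
      = (\<Sum>k'\<in>UNIV. \<Sum>m<4. control_weight P1 P2 T a b (k', m) s *\<^sub>R (axis k' (l2_on L (source_profile P1 P2 m)) $ k))" for k
    by (simp add: sum.cartesian_product sum_component case_prod_unfold)
  also have "\<dots> k = (\<Sum>k'\<in>UNIV. if k' = k then lift_source lam L T P1 P2 a b s $ k else 0)" for k
    by (rule sum.cong) (auto simp: axis_def lift_source_component)
  finally show ?thesis by (simp add: vec_eq_iff)
qed

lemma control_weight_integrable:
  assumes "0 < T" "a \<in> sobolev_tree 1 T" "b \<in> sobolev_tree 1 T" "i \<in> UNIV \<times> {..<4}"
  shows "set_integrable lborel {0..T} (control_weight P1 P2 T a b i)"
proof -
  obtain k m where i: "i = (k, m)" "m < 4" using assms(4) by auto
  have s: "a $ k \<in> sobolev 1 T" "b $ k \<in> sobolev 1 T" using assms unfolding sobolev_tree_def by auto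
  have "set_integrable lborel {0..T} (\<lambda>s. - f s)" if "set_integrable lborel {0..T} f" for f :: "real \<Rightarrow> real"
    using that unfolding set_integrable_def by simp
  moreover have "m = 0 \<or> m = 1 \<or> m = 2 \<or> m = 3" using i(2) by linarith
  ultimately show ?thesis
    unfolding i(1) control_weight_def[abs_def]
    by (elim disjE) (simp_all add: eval_nat_numeral set_integrable_fun_of set_integrable_continuous
        sobolev_1D(4)[OF assms(1) s(1)] sobolev_1D(4)[OF assms(1) s(2)])
qed

lemma lift_state_component:
  "lift_state L T P1 P2 a b t $ k = pt_value T (a $ k) t *\<^sub>R l2_on L (poly P1) + pt_value T (b $ k) t *\<^sub>R l2_on L (poly P2)"
  unfolding lift_state_def vec_lambda_beta
  by (subst l2_on_add) (auto intro!: continuous_intros simp: mult.commute[of "poly _ _"] l2_on_scale continuous_on_poly)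

lemma lift_state_in: "lift_state L T P1 P2 a b t \<in> (L2_tree L :: (l2 ^ 'n) set)"
  unfolding L2_tree_def mem_Collect_eq lift_state_component
  by (intro allI subspace_add subspace_scale subspace_L2_interval l2_on_in_L2_interval continuous_intros)

lemma lift_source_in: "lift_source lam L T P1 P2 a b t \<in> (L2_tree L :: (l2 ^ 'n) set)"
  unfolding L2_tree_def mem_Collect_eq lift_source_component
  by (intro allI subspace_sum subspace_scale subspace_L2_interval l2_on_in_L2_interval source_profile_continuous) simp

lemma lift_state_continuous:
  assumes "0 < T" "a \<in> sobolev_tree 1 T" "b \<in> sobolev_tree 1 T"
  shows "continuous_on {0..T} (lift_state L T P1 P2 a (b :: l2 ^ 'n))"
proof -
  have s: "a $ k \<in> sobolev 1 T" "b $ k \<in> sobolev 1 T" for k using assms unfolding sobolev_tree_def by auto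
  have "continuous_on {0..T} (\<lambda>t. lift_state L T P1 P2 a b t $ k)" for k
    unfolding lift_state_component
    by (intro continuous_intros sobolev_1D(4)[OF assms(1) s(1)] sobolev_1D(4)[OF assms(1) s(2)])
  then have "continuous_on {0..T} (\<lambda>t. \<chi> k. lift_state L T P1 P2 a b t $ k)"
    by (rule continuous_on_vec_lambda)
  then show ?thesis by simp
qed

theorem KS_solution_exists:
  assumes T: "0 < T" and a: "a \<in> sobolev_tree 1 T" and b: "b \<in> sobolev_tree 1 T"
  shows "\<exists>y. KS_solution lam L T (y0 :: l2 ^ 'n) a b y"
proof -
  obtain P1 P2 where P: "lifting_polys L P1 P2" using lifting_polys_exist[OF L] by blast
  let ?F = "lift_source lam L T P1 P2 a b" and ?z0 = "y0 - lift_state L T P1 P2 a b 0"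
  define z where "z t = S t ?z0 + (LINT s:{0..t}|lborel. S (t - s) (?F s))" for t
  note D = Duhamel_sum[OF less_imp_le[OF T] _ control_weight_integrable[OF T a b] lift_source_sum[of T P1 P2 a b], simplified]
  have mild: "mild_solution S T ?z0 ?F z" unfolding mild_solution_def z_def using D(1) by auto
  have cz: "continuous_on {0..T} z" unfolding z_def
    by (intro continuous_on_add D(2) continuous_on_subset[OF S_continuous]) auto
  have "KS_solution lam L T y0 a b (\<lambda>t. z t + lift_state L T P1 P2 a b t)"
    unfolding KS_solution_def
    using P KS_generates mild cz lift_state_continuous[OF T a b, of P1 P2] by (auto intro: continuous_on_add)
  then show ?thesis by blast
qed

definition eigvec :: "nat \<Rightarrow> ('n \<Rightarrow> real) \<Rightarrow> l2 ^ 'n" where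
  "eigvec j v = (\<chi> k. v k *\<^sub>R edge_mode L j)"

text \<open>The edge weights for which the mode satisfies the conditions at the vertex.\<close>

definition admissible :: "nat \<Rightarrow> ('n \<Rightarrow> real) \<Rightarrow> bool" where
  "admissible j v \<longleftrightarrow> (if even j then (\<forall>k k'. v k = v k') else (\<Sum>k\<in>UNIV. v k) = 0)"

lemma inner_eigvec: "inner u (eigvec j v) = (\<Sum>k\<in>UNIV. v k * inner (u $ k) (edge_mode L j))"
  by (simp add: inner_vec_def eigvec_def)

lemma tree_proj_eigvec:
  assumes "admissible j v" shows "tree_proj L j (eigvec j v) = eigvec j v"
proof -
  have i: "inner (eigvec j v $ k) (unit_mode L j) = v k * norm (edge_mode L j)" for k
    by (simp add: eigvec_def unit_mode_eq flip: power2_norm_eq_inner) (simp add: power2_eq_square)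
  have "mode_coeff L j (eigvec j v) k = v k * norm (edge_mode L j)" for k
  proof (cases "even j")
    case True
    define A where "A = v k"
    have "v k' = A" for k' using assms True by (simp add: admissible_def A_def)
    then show ?thesis using True by (simp add: mode_coeff_def i)
  next
    case False
    then show ?thesis using assms by (simp add: mode_coeff_def i admissible_def sum_distrib_right[symmetric])
  qed
  then show ?thesis using edge_mode_nonzero[OF L, of j] by (simp add: tree_proj_def vec_eq_iff unit_mode_eq eigvec_def)
qed

lemma inner_S_eigvec:
  assumes "admissible j v" "0 \<le> t"
  shows "inner (S t u) (eigvec j v) = exp (- (eigval lam L j * t)) * inner u (eigvec j v)"
proof -
  have "inner (S t u) (eigvec j v) = inner (tree_proj L j (S t u)) (eigvec j v)"
    unfolding E_selfadjoint tree_proj_eigvec[OF assms(1)] ..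
  also have "\<dots> = exp (- (eigval lam L j * t)) * inner (tree_proj L j u) (eigvec j v)"
    using assms(2) by (simp add: E_S max_absorb2)
  also have "inner (tree_proj L j u) (eigvec j v) = inner u (eigvec j v)"
    unfolding E_selfadjoint tree_proj_eigvec[OF assms(1)] ..
  finally show ?thesis .
qed

end

context star_tree
begin

text \<open>In Duhamel's formula the derivatives \<open>a\<^sub>t, b\<^sub>t\<close> are integrated by parts in time, and the profiles of the source are integrated by
  parts in space by \<open>mode_Green_poly\<close>. The contributions of the polynomials \<open>P\<^sub>1, P\<^sub>2\<close> cancel against the lifted initial and final
  states, and only the boundary terms at \<open>x = L\<close> remain.\<close>

lemma KS_solution_final_mode:
  assumes T: "0 < T" and a: "a \<in> sobolev_tree 1 T" and b: "b \<in> sobolev_tree 1 T"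
    and y0: "y0 \<in> (L2_tree L :: (l2 ^ 'n) set)" and y: "KS_solution lam L T y0 a b y"
  shows "y T \<in> L2_tree L"
    and "admissible j v \<Longrightarrow> inner (y T) (eigvec j v) = exp (- (eigval lam L j * T)) * (inner y0 (eigvec j v)
      - mode L j L * (\<Sum>k\<in>UNIV. v k * (exp_moment T (eigval lam L j) (b $ k)
          + (lam - (freq L j)\<^sup>2) * exp_moment T (eigval lam L j) (a $ k))))"
proof -
  obtain P1 P2 S' z where P: "lifting_polys L P1 P2"
    and gen: "generates (L2_tree L) (KS_dom L) (\<lambda>\<phi>. - KS_op lam L \<phi>) S'"
    and mild: "mild_solution S' T (y0 - lift_state L T P1 P2 a b 0) (lift_source lam L T P1 P2 a b) z"
    and yz: "\<And>t. t \<in> {0..T} \<Longrightarrow> y t = z t + lift_state L T P1 P2 a b t"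
    using y unfolding KS_solution_def by blast
  let ?F = "lift_source lam L T P1 P2 a b" and ?g = "lift_state L T P1 P2 a b"
  have z0: "y0 - ?g 0 \<in> L2_tree L" by (intro subspace_diff subspace_X y0 lift_state_in)
  note D = Duhamel_sum[OF less_imp_le[OF T] _ control_weight_integrable[OF T a b] lift_source_sum[of T P1 P2 a b], simplified]
  have TT: "T \<in> {0..T}" using T by simp
  have int: "set_integrable lborel {0..T} (\<lambda>s. S (T - s) (?F s))" by (rule D(1)[OF TT[unfolded atLeastAtMost_iff]])
  have eqS: "indicator {0..T} s *\<^sub>R S' (T - s) (?F s) = indicator {0..T} s *\<^sub>R S (T - s) (?F s)" for s
    using KS_semigroup_unique[OF gen _ lift_source_in, of "T - s"] by (cases "s \<in> {0..T}") auto
  have zT: "z T = S T (y0 - ?g 0) + (LINT s:{0..T}|lborel. S (T - s) (?F s))"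
  proof -
    have "z T = S' T (y0 - ?g 0) + (LINT s:{0..T}|lborel. S' (T - s) (?F s))"
      using mild TT unfolding mild_solution_def by blast
    then show ?thesis unfolding set_lebesgue_integral_def eqS
      using KS_semigroup_unique[OF gen less_imp_le[OF T] z0] by simp
  qed
  have "(LINT s:{0..T}|lborel. S (T - s) (?F s)) \<in> L2_tree L"
  proof -
    \<comment> \<open>The multiplier \<open>1\<close> is the orthogonal projection onto the tree space; it commutes with the integral.\<close>
    have one: "\<bar>(\<lambda>_. 1) j\<bar> \<le> (1::real)" for j :: nat by simp
    let ?P = "mult (\<lambda>_. 1)"
    have "(LINT s|lborel. indicator {0..T} s *\<^sub>R S (T - s) (?F s)) = (LINT s|lborel. ?P (indicator {0..T} s *\<^sub>R S (T - s) (?F s)))"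
      by (rule Bochner_Integration.integral_cong[OF refl]) (simp add: mult_one subspace_scale[OF subspace_X S_in_X])
    also have "\<dots> = ?P (LINT s|lborel. indicator {0..T} s *\<^sub>R S (T - s) (?F s))"
      using int unfolding set_integrable_def by (rule integral_bounded_linear[OF mult_bounded_linear[OF one]])
    finally have e: "(LINT s|lborel. indicator {0..T} s *\<^sub>R S (T - s) (?F s)) = ?P (LINT s|lborel. indicator {0..T} s *\<^sub>R S (T - s) (?F s))" .
    show ?thesis unfolding set_lebesgue_integral_def by (subst e) (rule mult_in_X[where m = "\<lambda>_. 1" and K = 1], simp)
  qed
  then show "y T \<in> L2_tree L"
    unfolding yz[OF TT] zT by (intro subspace_add subspace_X S_in_X lift_state_in)
  assume v: "admissible j v"
  define \<sigma> where "\<sigma> = eigval lam L j"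
  define \<mu> where "\<mu> = lam - (freq L j)\<^sup>2"
  define m where "m = mode L j L"
  let ?V = "eigvec j v"
  define p where "p i = inner (l2_on L (poly i)) (edge_mode L j)" for i
  define q where "q P = inner (l2_on L (\<lambda>x. lam * poly ((pderiv ^^ 2) P) x + poly ((pderiv ^^ 4) P) x)) (edge_mode L j)" for P
  have q1: "q P1 = \<sigma> * p P1 + m * \<mu>" and q2: "q P2 = \<sigma> * p P2 + m"
    using P mode_Green_poly[OF L, of P1 lam j] mode_Green_poly[OF L, of P2 lam j]
    unfolding q_def p_def \<sigma>_def \<mu>_def m_def lifting_polys_def by simp_all
  define A where "A k = (LINT t:{0..T}|lborel. exp (\<sigma> * t) * fun_of (weak_deriv T (a $ k)) t)" for k
  define B where "B k = (LINT t:{0..T}|lborel. exp (\<sigma> * t) * fun_of (weak_deriv T (b $ k)) t)" for k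
  define a0 where "a0 k = exp_moment T \<sigma> (a $ k)" for k
  define b0 where "b0 k = exp_moment T \<sigma> (b $ k)" for k
  have s: "a $ k \<in> sobolev 1 T" "b $ k \<in> sobolev 1 T" for k using a b unfolding sobolev_tree_def by auto
  have A: "A k = exp (\<sigma> * T) * pt_value T (a $ k) T - pt_value T (a $ k) 0 - \<sigma> * a0 k"
    and B: "B k = exp (\<sigma> * T) * pt_value T (b $ k) T - pt_value T (b $ k) 0 - \<sigma> * b0 k" for k
    unfolding A_def B_def a0_def b0_def by (rule exp_moment_weak_deriv[OF T s(1)], rule exp_moment_weak_deriv[OF T s(2)])
  have F: "inner (?F t) ?V = (\<Sum>k\<in>UNIV. v k * (- (fun_of (weak_deriv T (a $ k)) t * p P1) - fun_of (weak_deriv T (b $ k)) t * p P2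
      - pt_value T (a $ k) t * q P1 - pt_value T (b $ k) t * q P2))" for t
    unfolding inner_eigvec lift_source_component inner_sum_left
    by (rule sum.cong) (simp_all add: sum_4 control_weight_def source_profile_def[abs_def] p_def q_def eval_nat_numeral del: funpow.simps)
  have ce: "continuous_on {0..T} (\<lambda>t. exp (\<sigma> * t))" by (intro continuous_intros)
  have i1: "set_integrable lborel {0..T} (\<lambda>t. exp (\<sigma> * t) * fun_of u t)" for u
  proof -
    have "integrable lborel (\<lambda>t. (indicator {-T..T} t * exp (\<sigma> * t)) * (indicator {0..T} t * fun_of u t))"
      by (intro sqint_mult sqint_continuous sqint_indicator_mult continuous_intros sqint_fun_of) auto
    moreover have "(\<lambda>t. (indicator {-T..T} t * exp (\<sigma> * t)) * (indicator {0..T} t * fun_of u t))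
        = (\<lambda>t. indicator {0..T} t *\<^sub>R (exp (\<sigma> * t) * fun_of u t))" using T by (auto simp: fun_eq_iff indicator_def)
    ultimately show ?thesis unfolding set_integrable_def by simp
  qed
  have i2: "set_integrable lborel {0..T} (\<lambda>t. exp (\<sigma> * t) * pt_value T u t)" if "u \<in> sobolev 1 T" for u
    by (intro set_integrable_continuous continuous_on_mult ce sobolev_1D(4)[OF T that])
  have "inner (LINT s:{0..T}|lborel. S (T - s) (?F s)) ?V = (LINT s:{0..T}|lborel. inner (S (T - s) (?F s)) ?V)"
    unfolding set_lebesgue_integral_def
    using int[unfolded set_integrable_def] by (subst integral_inner_left[symmetric]) (auto simp: inner_scaleR_left)
  also have "\<dots> = (LINT s:{0..T}|lborel. exp (- (\<sigma> * T)) * (exp (\<sigma> * s) * inner (?F s) ?V))"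
  proof (rule set_lebesgue_integral_cong)
    show "\<forall>s. s \<in> {0..T} \<longrightarrow> inner (S (T - s) (?F s)) ?V = exp (- (\<sigma> * T)) * (exp (\<sigma> * s) * inner (?F s) ?V)"
    proof (intro allI impI)
      fix s assume "s \<in> {0..T}"
      then have "inner (S (T - s) (?F s)) ?V = exp (- (\<sigma> * (T - s))) * inner (?F s) ?V"
        using inner_S_eigvec[OF v, of "T - s"] by (simp add: \<sigma>_def)
      also have "exp (- (\<sigma> * (T - s))) = exp (- (\<sigma> * T)) * exp (\<sigma> * s)" by (simp add: exp_add[symmetric] algebra_simps)
      finally show "inner (S (T - s) (?F s)) ?V = exp (- (\<sigma> * T)) * (exp (\<sigma> * s) * inner (?F s) ?V)" by simp
    qed
  qed simp
  also have "\<dots> = exp (- (\<sigma> * T)) * (LINT s:{0..T}|lborel. exp (\<sigma> * s) * inner (?F s) ?V)" by simp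
  also have "(LINT s:{0..T}|lborel. exp (\<sigma> * s) * inner (?F s) ?V)
      = (\<Sum>k\<in>UNIV. v k * (- (A k * p P1) - B k * p P2 - a0 k * q P1 - b0 k * q P2))"
  proof -
    let ?G = "\<lambda>k t. v k * (- ((exp (\<sigma> * t) * fun_of (weak_deriv T (a $ k)) t) * p P1) - (exp (\<sigma> * t) * fun_of (weak_deriv T (b $ k)) t) * p P2
      - (exp (\<sigma> * t) * pt_value T (a $ k) t) * q P1 - (exp (\<sigma> * t) * pt_value T (b $ k) t) * q P2)"
    have G: "set_integrable lborel {0..T} (?G k)"
      "(LINT t:{0..T}|lborel. ?G k t) = v k * (- (A k * p P1) - B k * p P2 - a0 k * q P1 - b0 k * q P2)" for k
    proof -
      note I = i1[of "weak_deriv T (a $ k)"] i1[of "weak_deriv T (b $ k)"] i2[OF s(1)[of k]] i2[OF s(2)[of k]]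
      have 1: "set_integrable lborel {0..T} (\<lambda>t. - ((exp (\<sigma> * t) * fun_of (weak_deriv T (a $ k)) t) * p P1))"
        using set_integrable_mult_left[of "- p P1", OF I(1)] by simp
      note I' = 1 set_integrable_mult_left[of "p P2", OF I(2)] set_integrable_mult_left[of "q P1", OF I(3)] set_integrable_mult_left[of "q P2", OF I(4)]
      note J = set_integral_diff(1)[OF set_integral_diff(1)[OF set_integral_diff(1)[OF I'(1,2)] I'(3)] I'(4)]
      show "set_integrable lborel {0..T} (?G k)" by (rule set_integrable_mult_right) (rule J)
      have "(LINT t:{0..T}|lborel. ?G k t) = v k * (LINT t:{0..T}|lborel. - ((exp (\<sigma> * t) * fun_of (weak_deriv T (a $ k)) t) * p P1) - (exp (\<sigma> * t) * fun_of (weak_deriv T (b $ k)) t) * p P2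
          - (exp (\<sigma> * t) * pt_value T (a $ k) t) * q P1 - (exp (\<sigma> * t) * pt_value T (b $ k) t) * q P2)" by simp
      also have "\<dots> = v k * (- (A k * p P1) - B k * p P2 - a0 k * q P1 - b0 k * q P2)"
      proof -
        have e1: "(LINT t:{0..T}|lborel. - ((exp (\<sigma> * t) * fun_of (weak_deriv T (a $ k)) t) * p P1)) = - (A k * p P1)"
          by (simp only: minus_mult_right set_integral_mult_left A_def)
        show ?thesis unfolding set_integral_diff(2)[OF set_integral_diff(1)[OF set_integral_diff(1)[OF I'(1,2)] I'(3)] I'(4)]
          set_integral_diff(2)[OF set_integral_diff(1)[OF I'(1,2)] I'(3)] set_integral_diff(2)[OF I'(1,2)] e1
          by (simp add: B_def a0_def b0_def exp_moment_def)
      qed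
      finally show "(LINT t:{0..T}|lborel. ?G k t) = v k * (- (A k * p P1) - B k * p P2 - a0 k * q P1 - b0 k * q P2)" .
    qed
    have "(LINT s:{0..T}|lborel. exp (\<sigma> * s) * inner (?F s) ?V) = (LINT s:{0..T}|lborel. \<Sum>k\<in>UNIV. ?G k s)"
      unfolding F sum_distrib_left by (rule set_lebesgue_integral_cong) (auto simp: algebra_simps)
    also have "\<dots> = (\<Sum>k\<in>UNIV. LINT s:{0..T}|lborel. ?G k s)"
      using G(1) unfolding set_lebesgue_integral_def set_integrable_def scaleR_sum_right
      by (intro Bochner_Integration.integral_sum) auto
    finally show ?thesis by (simp only: G(2))
  qed
  finally have I: "inner (LINT s:{0..T}|lborel. S (T - s) (?F s)) ?V
    = exp (- (\<sigma> * T)) * (\<Sum>k\<in>UNIV. v k * (- (A k * p P1) - B k * p P2 - a0 k * q P1 - b0 k * q P2))" .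
  have g: "inner (?g t) ?V = (\<Sum>k\<in>UNIV. v k * (pt_value T (a $ k) t * p P1 + pt_value T (b $ k) t * p P2))" for t
    unfolding inner_eigvec lift_state_component by (simp add: p_def inner_add_left)
  have "inner (S T (y0 - ?g 0)) ?V = exp (- (\<sigma> * T)) * (inner y0 ?V - inner (?g 0) ?V)"
    using inner_S_eigvec[OF v, of T "y0 - ?g 0"] T by (simp add: \<sigma>_def inner_diff_left)
  then have "inner (y T) ?V = exp (- (\<sigma> * T)) * (inner y0 ?V - inner (?g 0) ?V
      + (\<Sum>k\<in>UNIV. v k * (- (A k * p P1) - B k * p P2 - a0 k * q P1 - b0 k * q P2)) + exp (\<sigma> * T) * inner (?g T) ?V)"
    unfolding yz[OF TT] zT inner_add_left I by (simp add: distrib_left exp_minus mult.assoc[symmetric])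
  also have "- inner (?g 0) ?V + (\<Sum>k\<in>UNIV. v k * (- (A k * p P1) - B k * p P2 - a0 k * q P1 - b0 k * q P2)) + exp (\<sigma> * T) * inner (?g T) ?V
      = - m * (\<Sum>k\<in>UNIV. v k * (b0 k + \<mu> * a0 k))"
    unfolding g A B q1 q2 sum_distrib_left sum_negf[symmetric] sum.distrib[symmetric]
    by (rule sum.cong) (simp_all add: algebra_simps)
  then have "inner y0 ?V - inner (?g 0) ?V
      + (\<Sum>k\<in>UNIV. v k * (- (A k * p P1) - B k * p P2 - a0 k * q P1 - b0 k * q P2)) + exp (\<sigma> * T) * inner (?g T) ?V
      = inner y0 ?V - m * (\<Sum>k\<in>UNIV. v k * (b0 k + \<mu> * a0 k))" by linarith
  finally show "inner (y T) ?V = exp (- (eigval lam L j * T)) * (inner y0 ?V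
      - mode L j L * (\<Sum>k\<in>UNIV. v k * (exp_moment T (eigval lam L j) (b $ k)
          + (lam - (freq L j)\<^sup>2) * exp_moment T (eigval lam L j) (a $ k))))"
    unfolding \<sigma>_def \<mu>_def m_def a0_def b0_def .
qed

text \<open>For odd modes it suffices to test with the differences of an edge \<open>k\<close> and the fixed edge \<open>i\<close>, since these span all weights of sum
  zero.\<close>

lemma eq_0_if_eigvec_orthogonal:
  assumes u: "u \<in> (L2_tree L :: (l2 ^ 'n) set)"
    and ev: "\<And>j. even j \<Longrightarrow> inner u (eigvec j (\<lambda>_. 1)) = 0"
    and od: "\<And>j k. odd j \<Longrightarrow> k \<noteq> i \<Longrightarrow> inner u (eigvec j (\<lambda>k'. (if k' = k then 1 else 0) - (if k' = i then 1 else 0))) = 0"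
  shows "u = 0"
proof (rule E_complete[OF u])
  fix j
  have n: "inner w (unit_mode L j) = (1 / norm (edge_mode L j)) * inner w (edge_mode L j)" for w by (simp add: unit_mode_eq)
  have "mode_coeff L j u k = 0" for k
  proof (cases "even j")
    case True
    then have "(\<Sum>k\<in>UNIV. inner (u $ k) (edge_mode L j)) = 0" using ev[of j] by (simp add: inner_eigvec)
    then show ?thesis using True unfolding mode_coeff_def n by (simp flip: sum_distrib_left sum_divide_distrib)
  next
    case False
    have eq: "inner (u $ k') (edge_mode L j) = inner (u $ i) (edge_mode L j)" for k'
    proof (cases "k' = i")
      case neq: False
      have "(\<Sum>k\<in>UNIV. ((if k = k' then 1 else 0) - (if k = i then 1 else 0)) * inner (u $ k) (edge_mode L j))
          = inner (u $ k') (edge_mode L j) - inner (u $ i) (edge_mode L j)"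
        by (simp add: left_diff_distrib sum_subtractf if_distrib[of "\<lambda>x. x * _"] cong: if_cong)
      then show ?thesis using od[OF False neq] by (simp add: inner_eigvec)
    qed simp
    define A where "A = inner (u $ i) (edge_mode L j)"
    have "inner (u $ k') (edge_mode L j) = A" for k' unfolding A_def by (rule eq)
    then show ?thesis using False unfolding mode_coeff_def n by simp
  qed
  then show "tree_proj L j u = 0" by (simp add: tree_proj_def vec_eq_iff)
qed

lemma admissible_one: "even j \<Longrightarrow> admissible j (\<lambda>_. 1)" by (simp add: admissible_def)

lemma admissible_difference: "odd j \<Longrightarrow> admissible j (\<lambda>k'. (if k' = k then c else 0) - (if k' = i then c else 0))"
  by (simp add: admissible_def sum_subtractf)

end

section \<open>Choice of the controls\<close>

lemma C1_bump_control:
  assumes T: "0 < T" and g: "C1_bump T K g g'"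
  shows "l2_on T g \<in> sobolev 1 T" "t \<in> {0..T} \<Longrightarrow> pt_value T (l2_on T g) t = g t"
    "exp_moment T s (l2_on T g) = integral {0..T} (\<lambda>t. exp (s * t) * g t)"
proof -
  have p: "C1_pair g g'" using g by (simp add: C1_bump_def C1_pair_def)
  note c = C1_pair_continuous[OF p]
  show "l2_on T g \<in> sobolev 1 T"
    using has_weak_deriv_l2_on[OF T p] l2_on_in_L2_interval[OF c(1)] l2_on_in_L2_interval[OF c(2)] by auto
  show pt: "t \<in> {0..T} \<Longrightarrow> pt_value T (l2_on T g) t = g t" for t by (rule pt_value_l2_on[OF T c(1)])
  have "exp_moment T s (l2_on T g) = (LINT t:{0..T}|lborel. exp (s * t) * g t)"
    unfolding exp_moment_def by (rule set_lebesgue_integral_cong) (auto simp: pt)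
  also have "\<dots> = integral {0..T} (\<lambda>t. exp (s * t) * g t)"
    by (rule set_borel_integral_eq_integral(2)[OF set_integrable_continuous]) (intro continuous_intros c)
  finally show "exp_moment T s (l2_on T g) = integral {0..T} (\<lambda>t. exp (s * t) * g t)" .
qed

lemma zero_control:
  assumes T: "0 < T"
  shows "0 \<in> sobolev 1 T" "t \<in> {0..T} \<Longrightarrow> pt_value T 0 t = 0" "exp_moment T s 0 = 0"
proof -
  have z: "0 = l2_on T (\<lambda>_. 0)" by (simp add: l2_on_def l2_of_def zero_l2_def)
  have "C1_bump T 0 (\<lambda>_. 0) (\<lambda>_. 0)" by (simp add: C1_bump_def)
  from C1_bump_control[OF T this, folded z]
  show "0 \<in> sobolev 1 T" "t \<in> {0..T} \<Longrightarrow> pt_value T 0 t = 0" "exp_moment T s 0 = 0" by auto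
qed

lemma exp_moment_eq_0:
  assumes T: "0 < T" and u: "u \<in> sobolev 1 T" and 0: "\<And>t. t \<in> {0<..<T} \<Longrightarrow> pt_value T u t = 0"
  shows "exp_moment T s u = 0"
proof -
  have "pt_value T u t = 0" if "t \<in> {0..T}" for t
    using AE_eq_continuous_imp_eq[OF T sobolev_1D(4)[OF T u] continuous_on_const _ that, of 0] 0 by auto
  then have "exp_moment T s u = (LINT t:{0..T}|lborel. 0)"
    unfolding exp_moment_def by (intro set_lebesgue_integral_cong) auto
  then show ?thesis by simp
qed

context star_tree
begin

lemma freq_sq: "(freq L j)\<^sup>2 = (pi / (2 * L))\<^sup>2 * real (j\<^sup>2)"
  by (simp only: freq_def power_mult_distrib of_nat_power)

lemma freq_sq_eq_iff: "(freq L i)\<^sup>2 = (freq L j)\<^sup>2 \<longleftrightarrow> i = j"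
  using L by (auto simp: freq_sq)

lemma eigval_diff: "eigval lam L i - eigval lam L j = ((freq L i)\<^sup>2 - (freq L j)\<^sup>2) * ((freq L i)\<^sup>2 + (freq L j)\<^sup>2 - lam)"
  by (simp add: eigval_def power2_eq_square power4_eq_xxxx algebra_simps)

text \<open>The difference of two eigenvalues factors, which shows that resonances are governed by sums of two squares.\<close>

lemma eigval_eq_iff: "eigval lam L i = eigval lam L j \<longleftrightarrow> i = j \<or> (freq L i)\<^sup>2 + (freq L j)\<^sup>2 = lam"
  using eigval_diff[of i j] freq_sq_eq_iff[of i j] by auto

text \<open>In the factorisation of \<open>\<sigma>\<^sub>i - \<sigma>\<^sub>j\<close>, the squares \<open>\<omega>\<^sub>i\<^sup>2\<close> and the sums \<open>\<omega>\<^sub>i\<^sup>2 + \<omega>\<^sub>j\<^sup>2\<close> are integer multiples of \<open>\<kappa> = (\<pi>/(2L))\<^sup>2\<close>. So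
  a nonzero first factor is at least \<open>\<kappa>\<close>, and the second factor comes near \<open>0\<close> only for the finitely many multiples up to \<open>\<lambda> + 1\<close>.\<close>

lemma eigval_gap: "\<exists>\<delta>>0. \<forall>i j. eigval lam L i \<noteq> eigval lam L j \<longrightarrow> \<delta> \<le> \<bar>eigval lam L i - eigval lam L j\<bar>"
proof -
  define \<kappa> where "\<kappa> = (pi / (2 * L))\<^sup>2"
  have \<kappa>: "\<kappa> > 0" using L by (simp add: \<kappa>_def)
  define M where "M = {m :: nat. \<kappa> * real m \<le> lam + 1}"
  have "M \<subseteq> {..nat \<lceil>(lam + 1) / \<kappa>\<rceil>}"
  proof
    fix m assume "m \<in> M"
    then have "real m \<le> (lam + 1) / \<kappa>" using \<kappa> by (simp add: M_def field_simps)
    then show "m \<in> {..nat \<lceil>(lam + 1) / \<kappa>\<rceil>}" by (simp add: le_nat_iff) linarith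
  qed
  then have fin: "finite M" by (rule finite_subset) simp
  define D where "D = insert 1 ((\<lambda>m. \<bar>\<kappa> * real m - lam\<bar>) ` {m \<in> M. \<kappa> * real m \<noteq> lam})"
  have finD: "finite D" "D \<noteq> {}" using fin by (auto simp: D_def)
  define d where "d = Min D"
  have d: "d > 0" unfolding d_def using finD by (subst Min_gr_iff) (auto simp: D_def)
  have dm: "d \<le> \<bar>\<kappa> * real m - lam\<bar>" if "\<kappa> * real m \<noteq> lam" for m
  proof (cases "m \<in> M")
    case True
    then show ?thesis unfolding d_def using that finD by (intro Min_le) (auto simp: D_def)
  next
    case False
    have "d \<le> 1" unfolding d_def using finD by (intro Min_le) (auto simp: D_def)
    then show ?thesis using False by (simp add: M_def)
  qed
  have "\<kappa> * d \<le> \<bar>eigval lam L i - eigval lam L j\<bar>" if ne: "eigval lam L i \<noteq> eigval lam L j" for i j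
  proof -
    have ij: "i \<noteq> j" "(freq L i)\<^sup>2 + (freq L j)\<^sup>2 \<noteq> lam" using ne by (auto simp: eigval_eq_iff)
    have f: "(freq L i)\<^sup>2 = \<kappa> * real (i\<^sup>2)" for i by (simp only: freq_sq \<kappa>_def)
    have e: "(freq L i)\<^sup>2 + (freq L j)\<^sup>2 = \<kappa> * real (i\<^sup>2 + j\<^sup>2)" by (simp only: f of_nat_add distrib_left)
    have "i\<^sup>2 \<noteq> j\<^sup>2" using ij(1) by simp
    then have "1 \<le> \<bar>real (i\<^sup>2) - real (j\<^sup>2)\<bar>" by linarith
    then have "\<kappa> * 1 \<le> \<kappa> * \<bar>real (i\<^sup>2) - real (j\<^sup>2)\<bar>" using \<kappa> by (intro mult_left_mono) auto
    also have "\<dots> = \<bar>(freq L i)\<^sup>2 - (freq L j)\<^sup>2\<bar>" using \<kappa> unfolding f by (simp add: abs_mult right_diff_distrib[symmetric] del: of_nat_power)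
    finally have 1: "\<kappa> \<le> \<bar>(freq L i)\<^sup>2 - (freq L j)\<^sup>2\<bar>" by simp
    have 2: "d \<le> \<bar>(freq L i)\<^sup>2 + (freq L j)\<^sup>2 - lam\<bar>" using dm[of "i\<^sup>2 + j\<^sup>2"] ij(2) unfolding e by blast
    show ?thesis unfolding eigval_diff abs_mult using 1 2 d \<kappa> by (intro mult_mono) auto
  qed
  then show ?thesis using d \<kappa> by (intro exI[of _ "\<kappa> * d"]) auto
qed

lemma eigval_growth: "\<exists>c0>0. \<exists>c. \<forall>j. c0 * (real j + 1) ^ 4 \<le> eigval lam L j + c"
proof -
  define \<kappa> where "\<kappa> = pi / (2 * L)"
  have \<kappa>: "\<kappa> > 0" using L by (simp add: \<kappa>_def)
  have "(\<kappa> ^ 4 / 16) * (real j + 1) ^ 4 \<le> eigval lam L j + (lam\<^sup>2 + \<kappa> ^ 4 / 2)" for j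
  proof -
    have sq: "(x + 1)\<^sup>2 \<le> 2 * (x\<^sup>2 + 1)" for x :: real
      using zero_le_power2[of "x - 1"] by (simp add: power2_eq_square algebra_simps)
    have "(real j + 1) ^ 4 = ((real j + 1)\<^sup>2)\<^sup>2" by (simp flip: power_mult)
    also have "\<dots> \<le> (2 * ((real j)\<^sup>2 + 1))\<^sup>2" by (intro power_mono sq) auto
    also have "\<dots> = 4 * ((real j)\<^sup>2 + 1)\<^sup>2" by (simp only: power_mult_distrib) simp
    also have "\<dots> \<le> 4 * (2 * (((real j)\<^sup>2)\<^sup>2 + 1))" using sq[of "(real j)\<^sup>2"] by simp
    also have "\<dots> = 8 * (real j ^ 4 + 1)" by (simp flip: power_mult)
    finally have "(\<kappa> ^ 4 / 16) * (real j + 1) ^ 4 \<le> (\<kappa> ^ 4 / 16) * (8 * (real j ^ 4 + 1))"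
      by (intro mult_left_mono) auto
    also have "\<dots> = freq L j ^ 4 / 2 + \<kappa> ^ 4 / 2"
    proof -
      have "freq L j ^ 4 = \<kappa> ^ 4 * real j ^ 4" by (simp only: freq_def \<kappa>_def power_mult_distrib)
      then show ?thesis by (simp add: distrib_left)
    qed
    finally show ?thesis using eigval_shift[of L j lam] by linarith
  qed
  then show ?thesis using \<kappa> by (intro exI[of _ "\<kappa> ^ 4 / 16"] conjI exI[of _ "lam\<^sup>2 + \<kappa> ^ 4 / 2"]) auto
qed

lemma scalar_control:
  assumes T: "0 < T" and R: "\<And>j. \<bar>R j\<bar> \<le> K" "\<And>i j. eigval lam L i = eigval lam L j \<Longrightarrow> R i = R j"
  shows "\<exists>u \<in> sobolev 1 T. \<forall>j. exp_moment T (eigval lam L j) u = R j"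
proof -
  obtain \<delta> where \<delta>: "\<delta> > 0" "\<And>i j. eigval lam L i \<noteq> eigval lam L j \<Longrightarrow> \<delta> \<le> \<bar>eigval lam L i - eigval lam L j\<bar>"
    using eigval_gap by blast
  obtain c0 c where c0: "c0 > 0" "\<And>j. c0 * (real j + 1) ^ 4 \<le> eigval lam L j + c"
    using eigval_growth by blast
  obtain g g' K' where g: "C1_bump T K' g g'" "\<And>j. integral {0..T} (\<lambda>s. exp (eigval lam L j * s) * g s) = R j"
    using exponential_moment_problem[of T c0 \<delta> "eigval lam L" c R K, OF T c0(1) \<delta>(1) c0(2) \<delta>(2) R] by blast
  show ?thesis
    by (rule bexI[of _ "l2_on T g"]) (use C1_bump_control[OF T g(1)] g(2) in auto)
qed

text \<open>Seek moments \<open>A\<^sub>j\<close> of \<open>a\<close> and \<open>B\<^sub>j = R\<^sub>j - (\<lambda> - \<omega>\<^sub>j\<^sup>2) A\<^sub>j\<close> of \<open>b\<close> that respect coincidences. For a coincidence of \<open>i\<close> with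
  \<open>j\<close>, where \<open>\<lambda> - \<omega>\<^sub>i\<^sup>2 = \<omega>\<^sub>j\<^sup>2\<close>, the requirement \<open>B\<^sub>i = B\<^sub>j\<close> with \<open>A\<^sub>i = A\<^sub>j\<close> is one linear equation with solution
  \<open>(R\<^sub>i - R\<^sub>j)/(\<omega>\<^sub>j\<^sup>2 - \<omega>\<^sub>i\<^sup>2)\<close>. An index has at most one such partner, because \<open>\<omega>\<^sub>i\<^sup>2 = \<lambda> - \<omega>\<^sub>j\<^sup>2\<close> determines \<open>i\<close>; without partner, \<open>A\<^sub>j = 0\<close>.\<close>

lemma pair_control:
  assumes T: "0 < T" and R: "\<And>j. \<bar>R j\<bar> \<le> K"
  shows "\<exists>a \<in> sobolev 1 T. \<exists>b \<in> sobolev 1 T. \<forall>j. exp_moment T (eigval lam L j) b + (lam - (freq L j)\<^sup>2) * exp_moment T (eigval lam L j) a = R j"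
proof -
  let ?f = "\<lambda>j. (freq L j)\<^sup>2"
  define A where "A j = (if \<exists>i. i \<noteq> j \<and> ?f i + ?f j = lam
      then let i = SOME i. i \<noteq> j \<and> ?f i + ?f j = lam in (R i - R j) / (?f j - ?f i) else 0)" for j
  have A: "A j = (R i - R j) / (?f j - ?f i)" if "i \<noteq> j" "?f i + ?f j = lam" for i j
  proof -
    have "(SOME i. i \<noteq> j \<and> ?f i + ?f j = lam) = i"
    proof (rule some_equality)
      fix i' assume "i' \<noteq> j \<and> ?f i' + ?f j = lam"
      then have "?f i' = ?f i" using that by linarith
      then show "i' = i" by (simp only: freq_sq_eq_iff)
    qed (use that in blast)
    then show ?thesis using that unfolding A_def Let_def by auto
  qed
  define B where "B j = R j - (lam - ?f j) * A j" for j
  have cons: "A i = A j \<and> B i = B j" if eq: "eigval lam L i = eigval lam L j" for i j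
  proof (cases "i = j")
    case False
    then have s: "?f i + ?f j = lam" using eq by (simp add: eigval_eq_iff)
    have ne: "?f j - ?f i \<noteq> 0" using False freq_sq_eq_iff[of j i] by auto
    have Aj: "A j = (R i - R j) / (?f j - ?f i)" by (rule A[OF False s])
    have Ai: "A i = (R j - R i) / (?f i - ?f j)" by (rule A) (use False s in \<open>auto simp: add.commute\<close>)
    have "A i = A j" unfolding Ai Aj by (metis minus_diff_eq minus_divide_divide)
    moreover have "R i - R j = (?f j - ?f i) * A j" unfolding Aj using ne by simp
    moreover have "lam - ?f i = ?f j" "lam - ?f j = ?f i" using s by auto
    ultimately show ?thesis unfolding B_def by (simp add: algebra_simps)
  qed simp
  \<comment> \<open>Indices with a partner lie in the finite set \<open>J\<close>, hence the modified targets are still bounded.\<close>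
  define J where "J = {j. ?f j \<le> lam}"
  have "J \<subseteq> {..nat \<lceil>lam / (pi / (2 * L))\<^sup>2\<rceil>}"
  proof
    fix j assume "j \<in> J"
    then have "real (j\<^sup>2) \<le> lam / (pi / (2 * L))\<^sup>2" using L by (simp add: J_def freq_sq field_simps)
    moreover have "j \<le> j\<^sup>2" by (simp add: power2_eq_square)
    ultimately have "real j \<le> lam / (pi / (2 * L))\<^sup>2" by (meson of_nat_le_iff order_trans)
    then show "j \<in> {..nat \<lceil>lam / (pi / (2 * L))\<^sup>2\<rceil>}" by (simp only: atMost_iff) linarith
  qed
  then have finJ: "finite J" by (rule finite_subset) simp
  have AJ: "A j = 0" if "j \<notin> J" for j
  proof -
    have "\<not> (\<exists>i. i \<noteq> j \<and> ?f i + ?f j = lam)"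
    proof
      assume "\<exists>i. i \<noteq> j \<and> ?f i + ?f j = lam"
      then obtain i where "?f i + ?f j = lam" by blast
      moreover have "0 \<le> ?f i" by simp
      ultimately show False using that unfolding J_def mem_Collect_eq by linarith
    qed
    then show ?thesis unfolding A_def by auto
  qed
  define KA where "KA = (\<Sum>j\<in>J. \<bar>A j\<bar>)"
  have bA: "\<bar>A j\<bar> \<le> KA" for j
    using AJ[of j] member_le_sum[of j J "\<lambda>j. \<bar>A j\<bar>"] finJ by (cases "j \<in> J") (auto simp: KA_def intro: sum_nonneg)
  have bB: "\<bar>B j\<bar> \<le> K + \<bar>lam\<bar> * KA" for j
  proof (cases "j \<in> J")
    case True
    then have "0 \<le> lam - ?f j" by (simp add: J_def)
    moreover have "lam - ?f j \<le> \<bar>lam\<bar>" using zero_le_power2[of "freq L j"] by linarith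
    ultimately have "\<bar>(lam - ?f j) * A j\<bar> \<le> \<bar>lam\<bar> * KA"
      unfolding abs_mult using bA[of j] by (intro mult_mono) auto
    then show ?thesis using R[of j] unfolding B_def by linarith
  next
    case False
    have "0 \<le> \<bar>lam\<bar> * KA" using bA[of j] by (intro mult_nonneg_nonneg) auto
    then show ?thesis using R[of j] AJ[OF False] unfolding B_def by simp
  qed
  have consA: "A i = A j" and consB: "B i = B j" if "eigval lam L i = eigval lam L j" for i j
    using cons[OF that] by simp_all
  obtain a where a: "a \<in> sobolev 1 T" "\<And>j. exp_moment T (eigval lam L j) a = A j"
    using scalar_control[where R = A and K = KA, OF T bA consA] by blast
  obtain b where b: "b \<in> sobolev 1 T" "\<And>j. exp_moment T (eigval lam L j) b = B j"
    using scalar_control[where R = B, OF T bB consB] by blast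
  show ?thesis using a b unfolding B_def by (intro bexI[of _ a] bexI[of _ b]) auto
qed

text \<open>The moments \<open>\<integral> exp (\<sigma>\<^sub>j t) (b\<^sup>k + (\<lambda> - \<omega>\<^sub>j\<^sup>2) a\<^sup>k) dt\<close> that steer to rest when edge \<open>i\<close> is left alone and edge \<open>k0\<close> takes
  over the even modes. The factor \<open>mode L j L = \<plusminus>1\<close> is its own inverse.\<close>

definition edge_target :: "l2 ^ 'n \<Rightarrow> 'n \<Rightarrow> 'n \<Rightarrow> 'n \<Rightarrow> nat \<Rightarrow> real" where
  "edge_target y0 i k0 k j = mode L j L *
     (if odd j then inner (y0 $ k) (edge_mode L j) - inner (y0 $ i) (edge_mode L j)
      else if k = k0 then (\<Sum>k\<in>UNIV. inner (y0 $ k) (edge_mode L j)) else 0)"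

lemma abs_mode_L: "\<bar>mode L j L\<bar> = 1"
  using mode_L_sq[OF L, of j] by (simp add: power2_eq_1_iff abs_if) auto

lemma norm_edge_mode_le: "norm (edge_mode L j) \<le> sqrt L"
  unfolding edge_mode_def
  using norm_l2_on_le[where f = "mode_deriv L 0 j" and B = 1, OF L mode_deriv_continuous] mode_deriv_bound[of L 0 j] by simp

lemma edge_target_bounded: "\<bar>edge_target y0 i k0 k j\<bar> \<le> (2 * (\<Sum>k\<in>UNIV. norm (y0 $ k))) * sqrt L"
proof -
  let ?N = "\<Sum>k\<in>UNIV. norm (y0 $ k)"
  have N: "0 \<le> ?N" by (intro sum_nonneg) auto
  have b: "\<bar>inner (y0 $ k) (edge_mode L j)\<bar> \<le> norm (y0 $ k) * sqrt L" for k
    by (rule order.trans[OF Cauchy_Schwarz_ineq2]) (intro mult_left_mono norm_edge_mode_le norm_ge_zero)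
  have b1: "\<bar>inner (y0 $ k) (edge_mode L j)\<bar> \<le> ?N * sqrt L" for k
  proof -
    have "norm (y0 $ k) \<le> ?N" by (rule member_le_sum) auto
    then show ?thesis using b[of k] L by (meson mult_right_mono order_trans real_sqrt_ge_zero less_imp_le)
  qed
  have bs: "\<bar>\<Sum>k\<in>UNIV. inner (y0 $ k) (edge_mode L j)\<bar> \<le> ?N * sqrt L"
    unfolding sum_distrib_right by (rule order.trans[OF sum_abs]) (intro sum_mono b)
  have N2: "0 \<le> ?N * sqrt L" using N L by simp
  show ?thesis
    unfolding edge_target_def abs_mult abs_mode_L using b1[of k] b1[of i] bs N2
    by (auto simp: algebra_simps)
qed

text \<open>In an even mode only the target of \<open>k0\<close> contributes to the sum over the edges; in an odd mode with the weights \<open>+1\<close> on \<open>k\<close> and \<open>-1\<close>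
  on \<open>i\<close>, only the one of \<open>k\<close>.\<close>

lemma null_controlled:
  assumes T: "0 < T" and a: "a \<in> sobolev_tree 1 T" and b: "b \<in> sobolev_tree 1 T"
    and y0: "y0 \<in> (L2_tree L :: (l2 ^ 'n) set)" and ik: "i \<noteq> k0"
    and mom: "\<And>k j. exp_moment T (eigval lam L j) (b $ k) + (lam - (freq L j)\<^sup>2) * exp_moment T (eigval lam L j) (a $ k)
        = (if k = i then 0 else edge_target y0 i k0 k j)"
    and y: "KS_solution lam L T y0 a b y"
  shows "y T = 0"
proof -
  note W = KS_solution_final_mode[OF T a b y0 y]
  have m: "mode L j L * (mode L j L * x) = x" for j x
    using mode_L_sq[OF L, of j] by (simp add: power2_eq_square flip: mult.assoc)
  show ?thesis
  proof (rule eq_0_if_eigvec_orthogonal[OF W(1), of i])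
    fix j :: nat assume ev: "even j"
    have "(\<Sum>k\<in>UNIV. 1 * (if k = i then 0 else edge_target y0 i k0 k j)) = mode L j L * (\<Sum>k\<in>UNIV. inner (y0 $ k) (edge_mode L j))"
    proof -
      have "(\<Sum>k\<in>UNIV. 1 * (if k = i then 0 else edge_target y0 i k0 k j))
          = (\<Sum>k\<in>UNIV. if k = k0 then mode L j L * (\<Sum>k\<in>UNIV. inner (y0 $ k) (edge_mode L j)) else 0)"
        by (rule sum.cong) (use ev ik in \<open>auto simp: edge_target_def\<close>)
      then show ?thesis by simp
    qed
    then show "inner (y T) (eigvec j (\<lambda>_. 1)) = 0"
      unfolding W(2)[OF admissible_one[OF ev]] mom by (simp only: m) (simp add: inner_eigvec)
  next
    fix j :: nat and k assume od: "odd j" and k: "k \<noteq> i"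
    let ?v = "\<lambda>k'. (if k' = k then 1 else 0) - (if k' = i then 1 else 0) :: real"
    have s: "(\<Sum>k'\<in>UNIV. ?v k' * h k') = h k - h i" for h :: "'n \<Rightarrow> real"
      by (simp add: left_diff_distrib sum_subtractf if_distrib[of "\<lambda>x. x * _"] cong: if_cong)
    show "inner (y T) (eigvec j ?v) = 0"
      unfolding W(2)[OF admissible_difference[OF od, of k 1 i]] mom
      unfolding inner_eigvec s using k od by (simp add: edge_target_def m)
  qed
qed

lemma null_controllable_one_passive_edge:
  assumes T: "0 < T" and N: "CARD('n) \<ge> 2" and y0: "y0 \<in> (L2_tree L :: (l2 ^ 'n) set)"
  shows "\<exists>a b. a \<in> sobolev_tree 1 T \<and> b \<in> sobolev_tree 1 T \<and>
    (\<forall>t\<in>{0<..<T}. pt_value T (a $ i) t = 0 \<and> pt_value T (b $ i) t = 0) \<and>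
    (\<exists>y. KS_solution lam L T y0 a b y) \<and> (\<forall>y. KS_solution lam L T y0 a b y \<longrightarrow> (\<forall>k. y T $ k = 0))"
proof -
  have "\<exists>k0. k0 \<noteq> i"
  proof (rule ccontr)
    assume "\<not> ?thesis"
    then have "(UNIV :: 'n set) = {i}" by blast
    then have "CARD('n) = card {i}" by (rule arg_cong)
    then show False using N by simp
  qed
  then obtain k0 where "k0 \<noteq> i" by (rule exE)
  then have k0: "i \<noteq> k0" by (rule not_sym)
  have "\<forall>k. \<exists>ab. fst ab \<in> sobolev 1 T \<and> snd ab \<in> sobolev 1 T \<and> (\<forall>j. exp_moment T (eigval lam L j) (snd ab)
      + (lam - (freq L j)\<^sup>2) * exp_moment T (eigval lam L j) (fst ab) = edge_target y0 i k0 k j)"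
  proof
    fix k
    obtain a b where "a \<in> sobolev 1 T" "b \<in> sobolev 1 T" "\<And>j. exp_moment T (eigval lam L j) b
        + (lam - (freq L j)\<^sup>2) * exp_moment T (eigval lam L j) a = edge_target y0 i k0 k j"
      using pair_control[where R = "edge_target y0 i k0 k", OF T edge_target_bounded] by blast
    then show "\<exists>ab. fst ab \<in> sobolev 1 T \<and> snd ab \<in> sobolev 1 T \<and> (\<forall>j. exp_moment T (eigval lam L j) (snd ab)
        + (lam - (freq L j)\<^sup>2) * exp_moment T (eigval lam L j) (fst ab) = edge_target y0 i k0 k j)"
      by (intro exI[of _ "(a, b)"]) simp
  qed
  from choice[OF this] obtain h where h: "\<And>k. fst (h k) \<in> sobolev 1 T" "\<And>k. snd (h k) \<in> sobolev 1 T"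
    "\<And>k j. exp_moment T (eigval lam L j) (snd (h k)) + (lam - (freq L j)\<^sup>2) * exp_moment T (eigval lam L j) (fst (h k)) = edge_target y0 i k0 k j"
    by blast
  define a where "a = (\<chi> k. if k = i then 0 else fst (h k))"
  define b where "b = (\<chi> k. if k = i then 0 else snd (h k))"
  note z = zero_control[OF T]
  have a: "a \<in> sobolev_tree 1 T" and b: "b \<in> sobolev_tree 1 T"
    unfolding a_def b_def sobolev_tree_def using h z(1) by auto
  have mom: "exp_moment T (eigval lam L j) (b $ k) + (lam - (freq L j)\<^sup>2) * exp_moment T (eigval lam L j) (a $ k)
        = (if k = i then 0 else edge_target y0 i k0 k j)" for k j
    unfolding a_def b_def by (simp add: z(3) h(3))
  have "y T $ k = 0" if "KS_solution lam L T y0 a b y" for y k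
    using null_controlled[OF T a b y0 k0 mom that] by simp
  moreover have "pt_value T (a $ i) t = 0 \<and> pt_value T (b $ i) t = 0" if "t \<in> {0<..<T}" for t
    using z(2)[of t] that by (simp add: a_def b_def)
  ultimately show ?thesis using a b KS_solution_exists[OF T a b, of y0] by blast
qed

lemma Nodd_coincidence:
  assumes "odd i" "odd j" "i \<noteq> j" "(freq L i)\<^sup>2 + (freq L j)\<^sup>2 = lam" shows "lam \<in> Nodd L"
proof -
  have *: "lam \<in> Nodd L" if ij: "odd i" "odd j" "i < j" "(freq L i)\<^sup>2 + (freq L j)\<^sup>2 = lam" for i j
  proof -
    obtain m n where mn: "i = 2 * m + 1" "j = 2 * n + 1" using ij by (auto elim!: oddE)
    have "lam = pi\<^sup>2 / (4 * L\<^sup>2) * ((2 * real m + 1)\<^sup>2 + (2 * real n + 1)\<^sup>2)"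
      using ij(4)[symmetric] unfolding freq_sq mn by (simp add: power_divide power_mult_distrib distrib_left add.commute)
    then show ?thesis unfolding Nodd_def using ij(3) mn by auto
  qed
  show ?thesis using assms *[of i j] *[of j i] by (cases "i < j") (auto simp: add.commute)
qed

lemma Nmixt_coincidence:
  assumes "even i" "odd j" "(freq L i)\<^sup>2 + (freq L j)\<^sup>2 = lam" shows "lam \<in> Nmixt L"
proof -
  obtain m n where mn: "i = 2 * m" "j = 2 * n + 1" using assms by (auto elim!: oddE evenE)
  have "lam = pi\<^sup>2 / (4 * L\<^sup>2) * ((2 * real m)\<^sup>2 + (2 * real n + 1)\<^sup>2)"
    using assms(3)[symmetric] unfolding freq_sq mn by (simp add: power_divide power_mult_distrib distrib_left add.commute)
  then show ?thesis unfolding Nmixt_def N3_def N4_def by (cases "m = 0") (auto intro: exI[of _ n])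
qed

text \<open>On edge \<open>j0\<close> only \<open>b\<close> acts, so its target must agree at coincidences. Outside \<open>\<N>\<^sub>m\<^sub>i\<^sub>x\<^sub>t \<union> \<N>\<^sub>o\<^sub>d\<^sub>d\<close> these only join two even modes, for which the target on \<open>j0\<close> is
  zero, as long as \<open>k0\<close> is a third edge.\<close>

lemma null_controllable_three_passive_controls:
  assumes T: "0 < T" and N: "CARD('n) \<ge> 3" and y0: "y0 \<in> (L2_tree L :: (l2 ^ 'n) set)"
    and nodd: "lam \<notin> Nodd L" and nmixt: "lam \<notin> Nmixt L"
  shows "\<exists>a b. a \<in> sobolev_tree 1 T \<and> b \<in> sobolev_tree 1 T \<and>
    (\<forall>t\<in>{0<..<T}. pt_value T (a $ i0) t = 0 \<and> pt_value T (a $ j0) t = 0 \<and> pt_value T (b $ i0) t = 0) \<and>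
    (\<exists>y. KS_solution lam L T y0 a b y) \<and> (\<forall>y. KS_solution lam L T y0 a b y \<longrightarrow> (\<forall>k. y T $ k = 0))"
proof -
  have "\<exists>k0. k0 \<notin> {i0, j0}"
  proof (rule ccontr)
    assume "\<not> ?thesis"
    then have "(UNIV :: 'n set) = {i0, j0}" by blast
    then have "CARD('n) = card {i0, j0}" by (rule arg_cong)
    also have "\<dots> \<le> 2" by (simp add: card_insert_if)
    finally show False using N by simp
  qed
  then obtain k0 where "k0 \<notin> {i0, j0}" by (rule exE)
  then have k0: "i0 \<noteq> k0" "j0 \<noteq> k0" by auto
  have "\<forall>k. \<exists>ab. fst ab \<in> sobolev 1 T \<and> snd ab \<in> sobolev 1 T \<and> (\<forall>j. exp_moment T (eigval lam L j) (snd ab)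
      + (lam - (freq L j)\<^sup>2) * exp_moment T (eigval lam L j) (fst ab) = edge_target y0 i0 k0 k j)"
  proof
    fix k
    obtain a b where "a \<in> sobolev 1 T" "b \<in> sobolev 1 T" "\<And>j. exp_moment T (eigval lam L j) b
        + (lam - (freq L j)\<^sup>2) * exp_moment T (eigval lam L j) a = edge_target y0 i0 k0 k j"
      using pair_control[where R = "edge_target y0 i0 k0 k", OF T edge_target_bounded] by blast
    then show "\<exists>ab. fst ab \<in> sobolev 1 T \<and> snd ab \<in> sobolev 1 T \<and> (\<forall>j. exp_moment T (eigval lam L j) (snd ab)
        + (lam - (freq L j)\<^sup>2) * exp_moment T (eigval lam L j) (fst ab) = edge_target y0 i0 k0 k j)"
      by (intro exI[of _ "(a, b)"]) simp
  qed
  from choice[OF this] obtain h where h: "\<And>k. fst (h k) \<in> sobolev 1 T" "\<And>k. snd (h k) \<in> sobolev 1 T"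
    "\<And>k j. exp_moment T (eigval lam L j) (snd (h k)) + (lam - (freq L j)\<^sup>2) * exp_moment T (eigval lam L j) (fst (h k)) = edge_target y0 i0 k0 k j"
    by blast
  have cons: "edge_target y0 i0 k0 j0 i = edge_target y0 i0 k0 j0 j" if eq: "eigval lam L i = eigval lam L j" for i j
  proof (cases "i = j")
    case False
    then have s: "(freq L i)\<^sup>2 + (freq L j)\<^sup>2 = lam" using eq by (simp add: eigval_eq_iff)
    have "even i \<and> even j"
      using Nodd_coincidence[OF _ _ False s] Nmixt_coincidence[OF _ _ s] Nmixt_coincidence[of j i] s nodd nmixt
      by (auto simp: add.commute)
    then show ?thesis using k0 by (simp add: edge_target_def)
  qed simp
  obtain u where u: "u \<in> sobolev 1 T" "\<And>j. exp_moment T (eigval lam L j) u = edge_target y0 i0 k0 j0 j"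
    using scalar_control[where R = "edge_target y0 i0 k0 j0", OF T edge_target_bounded cons] by blast
  define a where "a = (\<chi> k. if k = i0 \<or> k = j0 then 0 else fst (h k))"
  define b where "b = (\<chi> k. if k = i0 then 0 else if k = j0 then u else snd (h k))"
  note z = zero_control[OF T]
  have a: "a \<in> sobolev_tree 1 T" and b: "b \<in> sobolev_tree 1 T"
    unfolding a_def b_def sobolev_tree_def using h z(1) u(1) by auto
  have mom: "exp_moment T (eigval lam L j) (b $ k) + (lam - (freq L j)\<^sup>2) * exp_moment T (eigval lam L j) (a $ k)
        = (if k = i0 then 0 else edge_target y0 i0 k0 k j)" for k j
    unfolding a_def b_def by (simp add: z(3) h(3) u(2))
  have "y T $ k = 0" if "KS_solution lam L T y0 a b y" for y k
    using null_controlled[OF T a b y0 k0(1) mom that] by simp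
  moreover have "pt_value T (a $ i0) t = 0 \<and> pt_value T (a $ j0) t = 0 \<and> pt_value T (b $ i0) t = 0" if "t \<in> {0<..<T}" for t
    using z(2)[of t] that by (simp add: a_def b_def)
  ultimately show ?thesis using a b KS_solution_exists[OF T a b, of y0] by blast
qed

text \<open>Let \<open>i \<noteq> j\<close> be the two resonant odd modes. With weights \<open>1\<close> on \<open>i0\<close> and \<open>-1\<close> on \<open>j0\<close>, both conditions involve the same moments. When a
  single one of the four controls on these edges is left, the condition of mode \<open>j\<close> makes its moment zero, so it cannot cancel the initial
  state, which is the mode \<open>i\<close>.\<close>

lemma odd_resonance_not_controllable:
  assumes T: "0 < T" and lam: "lam \<in> Nodd L" and ij: "i0 \<noteq> j0"
  shows "\<exists>y0 :: l2 ^ 'n. y0 \<in> L2_tree L \<and> (\<forall>a b. a \<in> sobolev_tree 1 T \<longrightarrow> b \<in> sobolev_tree 1 T \<longrightarrow>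
    (\<forall>t\<in>{0<..<T}. pt_value T (a $ i0) t = 0 \<and> pt_value T (a $ j0) t = 0 \<and> pt_value T (b $ i0) t = 0) \<or>
    (\<forall>t\<in>{0<..<T}. pt_value T (b $ i0) t = 0 \<and> pt_value T (b $ j0) t = 0 \<and> pt_value T (a $ i0) t = 0) \<longrightarrow>
    (\<exists>y. KS_solution lam L T y0 a b y) \<and> (\<forall>y. KS_solution lam L T y0 a b y \<longrightarrow> (\<exists>k. y T $ k \<noteq> 0)))"
proof -
  obtain m n where mn: "m < n" "lam = pi\<^sup>2 / (4 * L\<^sup>2) * ((2 * real m + 1)\<^sup>2 + (2 * real n + 1)\<^sup>2)"
    using lam unfolding Nodd_def by blast
  define i where "i = 2 * m + 1"
  define j where "j = 2 * n + 1"
  have o: "odd i" "odd j" "i \<noteq> j" using mn(1) by (auto simp: i_def j_def)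
  have s: "(freq L i)\<^sup>2 + (freq L j)\<^sup>2 = lam"
    unfolding mn(2) freq_sq i_def j_def by (simp add: power_divide power_mult_distrib distrib_left add.commute)
  have \<sigma>: "eigval lam L j = eigval lam L i" using s by (simp add: eigval_eq_iff add.commute)
  have fi: "(freq L i)\<^sup>2 \<noteq> 0" using freq_sq_eq_iff[of i 0] o(1) by (auto simp: freq_def)
  let ?v = "\<lambda>k'. (if k' = i0 then 1 else 0) - (if k' = j0 then 1 else 0) :: real"
  have sum: "(\<Sum>k'\<in>UNIV. ?v k' * h k') = h i0 - h j0" for h :: "'n \<Rightarrow> real"
    by (simp add: left_diff_distrib sum_subtractf if_distrib[of "\<lambda>x. x * _"] cong: if_cong)
  define y0 where "y0 = eigvec i ?v"
  have y0: "y0 \<in> L2_tree L" unfolding y0_def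
    using E_in_X[of i "eigvec i ?v"] tree_proj_eigvec[OF admissible_difference[OF o(1)]] by simp
  have y0k: "y0 $ k = ?v k *\<^sub>R edge_mode L i" for k by (simp add: y0_def eigvec_def)
  have in_i: "inner y0 (eigvec i ?v) = 2 * inner (edge_mode L i) (edge_mode L i)"
    and in_j: "inner y0 (eigvec j ?v) = 0"
    using ij inner_edge_mode[OF L, of i j] o unfolding inner_eigvec sum y0k by auto
  have pos: "inner (edge_mode L i) (edge_mode L i) \<noteq> 0" using edge_mode_nonzero[OF L] by simp
  have ml: "mode L k L \<noteq> 0" for k using mode_L_sq[OF L, of k] by auto
  have "\<exists>k. y T $ k \<noteq> 0" if a: "a \<in> sobolev_tree 1 T" and b: "b \<in> sobolev_tree 1 T" and y: "KS_solution lam L T y0 a b y"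
    and c: "(\<forall>t\<in>{0<..<T}. pt_value T (a $ i0) t = 0 \<and> pt_value T (a $ j0) t = 0 \<and> pt_value T (b $ i0) t = 0) \<or>
      (\<forall>t\<in>{0<..<T}. pt_value T (b $ i0) t = 0 \<and> pt_value T (b $ j0) t = 0 \<and> pt_value T (a $ i0) t = 0)" for a b y
  proof (rule ccontr)
    assume "\<nexists>k. y T $ k \<noteq> 0"
    then have yT: "y T = 0" by (simp add: vec_eq_iff)
    define A where "A k = exp_moment T (eigval lam L i) (a $ k)" for k
    define B where "B k = exp_moment T (eigval lam L i) (b $ k)" for k
    have sob: "a $ k \<in> sobolev 1 T" "b $ k \<in> sobolev 1 T" for k using a b unfolding sobolev_tree_def by auto
    note W = KS_solution_final_mode(2)[OF T a b y0 y, unfolded yT inner_zero_left]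
    have l: "lam - (freq L i)\<^sup>2 = (freq L j)\<^sup>2" "lam - (freq L j)\<^sup>2 = (freq L i)\<^sup>2" using s by auto
    have 1: "2 * inner (edge_mode L i) (edge_mode L i) = mode L i L * ((B i0 + (freq L j)\<^sup>2 * A i0) - (B j0 + (freq L j)\<^sup>2 * A j0))"
      using W[OF admissible_difference[OF o(1), of i0 1 j0]] unfolding sum in_i l by (simp add: A_def B_def)
    have 2: "(B i0 + (freq L i)\<^sup>2 * A i0) - (B j0 + (freq L i)\<^sup>2 * A j0) = 0"
      using W[OF admissible_difference[OF o(2), of i0 1 j0]] ml[of j] unfolding sum in_j l \<sigma> by (simp add: A_def B_def)
    from c show False
    proof
      assume "\<forall>t\<in>{0<..<T}. pt_value T (a $ i0) t = 0 \<and> pt_value T (a $ j0) t = 0 \<and> pt_value T (b $ i0) t = 0"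
      then have "A i0 = 0" "A j0 = 0" "B i0 = 0"
        unfolding A_def B_def by (auto intro!: exp_moment_eq_0[OF T] sob)
      then show False using 1 2 pos by simp
    next
      assume "\<forall>t\<in>{0<..<T}. pt_value T (b $ i0) t = 0 \<and> pt_value T (b $ j0) t = 0 \<and> pt_value T (a $ i0) t = 0"
      then have "B i0 = 0" "B j0 = 0" "A i0 = 0"
        unfolding A_def B_def by (auto intro!: exp_moment_eq_0[OF T] sob)
      then show False using 1 2 pos fi by simp
    qed
  qed
  then show ?thesis using y0 KS_solution_exists[OF T] by (intro exI[of _ y0]) blast
qed

end

theorem theorem1p2:
  fixes T L lam :: real
  assumes "T > 0" and "L > 0" and "CARD('n::finite) \<ge> 2"
    and "lam > 0" and "lam \<notin> Nmixt L"
  shows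
    "(\<forall>(i::'n) (y0::l2 ^ 'n). y0 \<in> L2_tree L \<longrightarrow>
       (\<exists>a b. a \<in> sobolev_tree 1 T \<and> b \<in> sobolev_tree 1 T \<and>
          (\<forall>t\<in>{0<..<T}. pt_value T (a $ i) t = 0 \<and> pt_value T (b $ i) t = 0) \<and>
          (\<exists>y. KS_solution lam L T y0 a b y) \<and>
          (\<forall>y. KS_solution lam L T y0 a b y \<longrightarrow> (\<forall>k. y T $ k = 0)))) \<and>
     (lam \<in> Nodd L \<longrightarrow>
       (\<forall>i0 j0 :: 'n. i0 \<noteq> j0 \<longrightarrow>
         (\<exists>y0::l2 ^ 'n. y0 \<in> L2_tree L \<and>
           (\<forall>a b. a \<in> sobolev_tree 1 T \<longrightarrow> b \<in> sobolev_tree 1 T \<longrightarrow>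
              (\<forall>t\<in>{0<..<T}. pt_value T (a $ i0) t = 0 \<and> pt_value T (a $ j0) t = 0 \<and>
                             pt_value T (b $ i0) t = 0) \<or>
              (\<forall>t\<in>{0<..<T}. pt_value T (b $ i0) t = 0 \<and> pt_value T (b $ j0) t = 0 \<and>
                             pt_value T (a $ i0) t = 0) \<longrightarrow>
              (\<exists>y. KS_solution lam L T y0 a b y) \<and>
              (\<forall>y. KS_solution lam L T y0 a b y \<longrightarrow> (\<exists>k0. y T $ k0 \<noteq> 0)))))) \<and>
     (lam \<notin> Nodd L \<and> CARD('n) \<ge> 3 \<longrightarrow>
       (\<forall>(i0::'n) (j0::'n) (y0::l2 ^ 'n). i0 \<noteq> j0 \<longrightarrow> y0 \<in> L2_tree L \<longrightarrow>
         (\<exists>a b. a \<in> sobolev_tree 1 T \<and> b \<in> sobolev_tree 1 T \<and>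
            ((\<forall>t\<in>{0<..<T}. pt_value T (a $ i0) t = 0 \<and> pt_value T (a $ j0) t = 0 \<and>
                            pt_value T (b $ i0) t = 0) \<or>
             (\<forall>t\<in>{0<..<T}. pt_value T (b $ i0) t = 0 \<and> pt_value T (b $ j0) t = 0 \<and>
                            pt_value T (a $ i0) t = 0)) \<and>
            (\<exists>y. KS_solution lam L T y0 a b y) \<and>
            (\<forall>y. KS_solution lam L T y0 a b y \<longrightarrow> (\<forall>k. y T $ k = 0)))))"
proof -
  interpret star_tree L lam "TYPE('n)" by unfold_locales (rule \<open>L > 0\<close>)
  show ?thesis
  proof (intro conjI allI impI)
    fix i :: 'n and y0 :: "l2 ^ 'n" assume "y0 \<in> L2_tree L"
    then show "\<exists>a b. a \<in> sobolev_tree 1 T \<and> b \<in> sobolev_tree 1 T \<and>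
        (\<forall>t\<in>{0<..<T}. pt_value T (a $ i) t = 0 \<and> pt_value T (b $ i) t = 0) \<and>
        (\<exists>y. KS_solution lam L T y0 a b y) \<and>
        (\<forall>y. KS_solution lam L T y0 a b y \<longrightarrow> (\<forall>k. y T $ k = 0))"
      by (rule null_controllable_one_passive_edge[OF \<open>T > 0\<close> \<open>CARD('n) \<ge> 2\<close>])
  next
    fix i0 j0 :: 'n assume "lam \<in> Nodd L" "i0 \<noteq> j0"
    then show "\<exists>y0::l2 ^ 'n. y0 \<in> L2_tree L \<and>
        (\<forall>a b. a \<in> sobolev_tree 1 T \<longrightarrow> b \<in> sobolev_tree 1 T \<longrightarrow>
          (\<forall>t\<in>{0<..<T}. pt_value T (a $ i0) t = 0 \<and> pt_value T (a $ j0) t = 0 \<and> pt_value T (b $ i0) t = 0) \<or>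
          (\<forall>t\<in>{0<..<T}. pt_value T (b $ i0) t = 0 \<and> pt_value T (b $ j0) t = 0 \<and> pt_value T (a $ i0) t = 0) \<longrightarrow>
          (\<exists>y. KS_solution lam L T y0 a b y) \<and>
          (\<forall>y. KS_solution lam L T y0 a b y \<longrightarrow> (\<exists>k0. y T $ k0 \<noteq> 0)))"
      by (rule odd_resonance_not_controllable[OF \<open>T > 0\<close>])
  next
    fix i0 j0 :: 'n and y0 :: "l2 ^ 'n"
    assume "lam \<notin> Nodd L \<and> 3 \<le> CARD('n)" "i0 \<noteq> j0" "y0 \<in> L2_tree L"
    then show "\<exists>a b. a \<in> sobolev_tree 1 T \<and> b \<in> sobolev_tree 1 T \<and>
        ((\<forall>t\<in>{0<..<T}. pt_value T (a $ i0) t = 0 \<and> pt_value T (a $ j0) t = 0 \<and> pt_value T (b $ i0) t = 0) \<or>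
         (\<forall>t\<in>{0<..<T}. pt_value T (b $ i0) t = 0 \<and> pt_value T (b $ j0) t = 0 \<and> pt_value T (a $ i0) t = 0)) \<and>
        (\<exists>y. KS_solution lam L T y0 a b y) \<and>
        (\<forall>y. KS_solution lam L T y0 a b y \<longrightarrow> (\<forall>k. y T $ k = 0))"
      using null_controllable_three_passive_controls[OF \<open>T > 0\<close> _ _ _ \<open>lam \<notin> Nmixt L\<close>, of y0 i0 j0] by blast
  qed
qed

end
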